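(* Let $k>0$ be fixed, $d_u>0$, $d_v\ge0$, and let $(u^k,v^k)$ be the solution of problem $(P_2^k)$ (on $(0,\infty)\times(0,T)$ for every $T>0$) with initial data $u_0^k,v_0^k\in C^2(\mathbb{R}^+)$ with $0\le u_0^k,v_0^k\le M$ such that $$\|u_0^k\|_{L^1(\mathbb{R}^+)}<\infty,\qquad \|v_0^k-V_0\|_{L^1(\mathbb{R}^+)}<\infty,$$ and $u_0^k(x)\to 0$ and $v_0^k(x)\to V_0$ as $x\to\infty$. Then for each $J>0$ there exists a sequence $t_n\to\infty$ such that, as $t_n\to\infty$, $$\frac1{\sqrt{t_n}}\int_{0}^{J\sqrt{t_n}}\left|u^k(y,t_n)-f^+\left(\frac{y}{\sqrt{t_n}}\right)\right|^2dy\to0 \quad\text{and}\quad \frac1{\sqrt{t_n}}\int_{0}^{J\sqrt{t_n}}\left|v^k(y,t_n)+f^-\left(\frac{y}{\sqrt{t_n}}\right)\right|^2dy\to0,$$ where $f^+=\max\{f,0\}$, $f^-=\min\{f,0\}$, and $f:\mathbb{R}^+\to\mathbb{R}$ is the following self-similar profile. For $\eta\le a$, $$f(\eta)=U_0\left(1-\frac{\int_{0}^{\eta}e^{-s^2/(4d_u)}\,ds}{\int_{0}^{a}e^{-s^2/(4d_u)}\,ds}\right).$$ If $d_v>0$, then $f(\eta)=-V_0\left(1-\frac{\int_{\eta}^{\infty}e^{-s^2/(4d_v)}ds}{\int_{a}^{\infty}e^{-s^2/(4d_v)}ds}\right)$ for $\eta>a$, and $a>0$ is the unique root of $d_uU_0\int_a^\infty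 e^{\frac{a^2-s^2}{4d_v}}ds=d_vV_0\int_{0}^a e^{\frac{a^2-s^2}{4d_u}}ds$. If $d_v=0$, then $f(\eta)=-V_0$ for $\eta>a$, and $a>0$ is the unique root of $U_0=\frac{V_0a}{2d_u}\int_{0}^a e^{\frac{a^2-s^2}{4d_u}}ds$.
   Context: $\mathbb{R}^+=[0,\infty)$, $S_T=(0,\infty)\times(0,T)$; $U_0,V_0>0$, $M\ge\max\{U_0,V_0\}$. $F:\mathbb{R}^+\times\mathbb{R}^+\to\mathbb{R}^+$ satisfies (i) $F\in C^{0,\alpha}(\mathbb{R}^+\times\mathbb{R}^+)$ for some $\alpha>0$; (ii) $F(u,0)=F(0,v)=0$ for all $u,v\in\mathbb{R}^+$ and $F(u,v)>0$ for $u,v>0$; (iii) $F(\cdot,v)$ and $F(u,\cdot)$ are non-decreasing for all $u,v\in\mathbb{R}^+$. Problem $(P_2^k)$: $u_t=d_uu_{xx}-kF(u,v)$, $v_t=d_vv_{xx}-kF(u,v)$ in $S_T$; $u(0,t)=U_0$, $d_vv_x(0,t)=0$ for $t\in(0,T)$; $u(\cdot,0)=u_0^k$, $v(\cdot,0)=v_0^k$ on $\mathbb{R}^+$ (terms multiplied by $d_v$ are absent when $d_v=0$). Solutions satisfy $0\le u^k,v^k\le M$. If $d_v>0$ they are classical, with $u^k,v^k\in C^{2,1}(\mathbb{R}^+\times[\delta,T])\cap C^0(\mathbb{R}^+\times[0,T])\cap W^{2,1}_p((0,J)\times(0,T))$ for all $\delta,J>0$, $p\ge1$. If $d_v=0$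 they are weak, with $u^k\in W^{2,1}_p((0,J)\times(0,T))$, $v^k\in W^{1,\infty}(0,T;L^\infty((0,J)))$ for all $J>0$, $p\ge1$, and for all $\psi\in C^{2,1}(\overline{S_T})$ with $\psi(\cdot,T)=0$, $\psi(0,t)=0$ for $t\in(0,T)$ and $\operatorname{supp}\psi\subset[0,J]\times[0,T]$ for some $J>0$: $\iint_{S_T}u^k\psi_t+\iint_{S_T}\{d_uu^k\psi_{xx}-kF(u^k,v^k)\psi\}=-\int_0^\infty u_0^k\psi(\cdot,0)-d_uU_0\int_0^T\psi_x(0,t)\,dt$ and $\iint_{S_T}v^k\psi_t-\iint_{S_T}kF(u^k,v^k)\psi=-\int_0^\infty v_0^k\psi(\cdot,0)$. *)

theory Defs
  imports "HOL-Analysis.Analysis" "HOL-Probability.Essential_Supremum"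
begin

section \<open>Function spaces\<close>

text \<open>Functions of space and time are curried, \<open>w x t\<close>, and total; only their values on the
  closed quadrant \<open>x \<ge> 0\<close>, \<open>t \<ge> 0\<close> are ever used.\<close>

definition C2_on :: "real set \<Rightarrow> (real \<Rightarrow> real) \<Rightarrow> bool" where
  "C2_on X g \<longleftrightarrow> (\<exists>g' g''.
     (\<forall>x\<in>X. (g has_real_derivative g' x) (at x within X) \<and>
             (g' has_real_derivative g'' x) (at x within X)) \<and>
     continuous_on X g'')"

text \<open>\<open>w\<close> is of class \<open>C\<^sup>2\<^sup>,\<^sup>1\<close> on \<open>X \<times> I\<close>, up to those parts of the boundary that belong to
  \<open>X \<times> I\<close> (where derivatives are one-sided), with partial derivatives \<open>wx\<close>, \<open>wxx\<close>, \<open>wt\<close>.\<close>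

definition C21_partials ::
  "real set \<Rightarrow> real set \<Rightarrow> (real \<Rightarrow> real \<Rightarrow> real) \<Rightarrow> (real \<Rightarrow> real \<Rightarrow> real) \<Rightarrow>
   (real \<Rightarrow> real \<Rightarrow> real) \<Rightarrow> (real \<Rightarrow> real \<Rightarrow> real) \<Rightarrow> bool" where
  "C21_partials X I w wx wxx wt \<longleftrightarrow>
     (\<forall>x\<in>X. \<forall>t\<in>I.
        ((\<lambda>y. w y t) has_real_derivative wx x t) (at x within X) \<and>
        ((\<lambda>y. wx y t) has_real_derivative wxx x t) (at x within X) \<and>
        ((\<lambda>s. w x s) has_real_derivative wt x t) (at t within I)) \<and>
     continuous_on (X \<times> I) (\<lambda>(x, t). w x t) \<and>
     continuous_on (X \<times> I) (\<lambda>(x, t). wx x t) \<and>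
     continuous_on (X \<times> I) (\<lambda>(x, t). wxx x t) \<and>
     continuous_on (X \<times> I) (\<lambda>(x, t). wt x t)"

definition C21_on :: "real set \<Rightarrow> real set \<Rightarrow> (real \<Rightarrow> real \<Rightarrow> real) \<Rightarrow> bool" where
  "C21_on X I w \<longleftrightarrow> (\<exists>wx wxx wt. C21_partials X I w wx wxx wt)"

text \<open>\<open>D i j\<close> is the partial derivative of order \<open>i\<close> in \<open>x\<close> and \<open>j\<close> in \<open>t\<close> of the
  smooth function \<open>D 0 0\<close> on the plane, whose support is a compact subset of \<open>Q\<close>.\<close>

definition test_function_partials ::
  "(real \<times> real) set \<Rightarrow> (nat \<Rightarrow> nat \<Rightarrow> real \<Rightarrow> real \<Rightarrow> real) \<Rightarrow> bool" where
  "test_function_partials Q D \<longleftrightarrow>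
     (\<forall>i j. continuous_on UNIV (\<lambda>(x, t). D i j x t) \<and>
        (\<forall>x t. ((\<lambda>y. D i j y t) has_real_derivative D (Suc i) j x t) (at x) \<and>
               ((\<lambda>s. D i j x s) has_real_derivative D i (Suc j) x t) (at t))) \<and>
     (\<exists>K. compact K \<and> K \<subseteq> Q \<and> (\<forall>x t. (x, t) \<notin> K \<longrightarrow> D 0 0 x t = 0))"

definition weak_partial ::
  "(real \<times> real) set \<Rightarrow> nat \<Rightarrow> nat \<Rightarrow> (real \<Rightarrow> real \<Rightarrow> real) \<Rightarrow> (real \<Rightarrow> real \<Rightarrow> real) \<Rightarrow> bool" where
  "weak_partial Q i j w g \<longleftrightarrow>
     (\<forall>D. test_function_partials Q D \<longrightarrow>
        (LINT (x, t):Q|lebesgue. w x t * D i j x t) =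
        (- 1) ^ (i + j) * (LINT (x, t):Q|lebesgue. g x t * D 0 0 x t))"

definition in_Lp :: "real \<Rightarrow> (real \<times> real) set \<Rightarrow> (real \<Rightarrow> real \<Rightarrow> real) \<Rightarrow> bool" where
  "in_Lp p Q w \<longleftrightarrow> (\<lambda>(x, t). w x t) \<in> borel_measurable (lebesgue_on Q) \<and>
     integrable (lebesgue_on Q) (\<lambda>(x, t). \<bar>w x t\<bar> powr p)"

definition in_W21p :: "real \<Rightarrow> (real \<times> real) set \<Rightarrow> (real \<Rightarrow> real \<Rightarrow> real) \<Rightarrow> bool" where
  "in_W21p p Q w \<longleftrightarrow> in_Lp p Q w \<and> (\<exists>wx wxx wt.
     weak_partial Q 1 0 w wx \<and> in_Lp p Q wx \<and>
     weak_partial Q 2 0 w wxx \<and> in_Lp p Q wxx \<and>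
     weak_partial Q 0 1 w wt \<and> in_Lp p Q wt)"

text \<open>The value is \<open>\<infinity>\<close> if \<open>g\<close> is not Lebesgue measurable on \<open>A\<close>.\<close>

definition Linf_norm :: "real set \<Rightarrow> (real \<Rightarrow> real) \<Rightarrow> ereal" where
  "Linf_norm A g = esssup (lebesgue_on A) (\<lambda>x. ereal \<bar>g x\<bar>)"

definition in_Linf :: "real set \<Rightarrow> (real \<Rightarrow> real) \<Rightarrow> bool" where
  "in_Linf A g \<longleftrightarrow> g \<in> borel_measurable (lebesgue_on A) \<and> Linf_norm A g < \<infinity>"

text \<open>The Bochner space \<open>L\<^sup>\<infinity>(0,T;L\<^sup>\<infinity>(A))\<close>: \<open>t \<mapsto> w \<cdot> t\<close> is almost everywhere the limit in
  \<open>L\<^sup>\<infinity>(A)\<close> of simple functions, and essentially bounded. The function \<open>w\<close> of two variables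
  representing an element is required to be jointly measurable.\<close>

definition in_Linf_Linf :: "real \<Rightarrow> real set \<Rightarrow> (real \<Rightarrow> real \<Rightarrow> real) \<Rightarrow> bool" where
  "in_Linf_Linf T A w \<longleftrightarrow>
     (\<lambda>(x, t). w x t) \<in> borel_measurable (lebesgue_on (A \<times> {0<..<T})) \<and>
     (\<exists>s :: nat \<Rightarrow> real \<Rightarrow> real \<Rightarrow> real.
        (\<forall>n. finite (s n ` {0<..<T}) \<and>
             (\<forall>h \<in> s n ` {0<..<T}. in_Linf A h \<and> {t\<in>{0<..<T}. s n t = h} \<in> sets lebesgue)) \<and>
        (AE t in lebesgue_on {0<..<T}.
           (\<lambda>n. Linf_norm A (\<lambda>x. s n t x - w x t)) \<longlonglongrightarrow> 0)) \<and>
     (\<exists>C::real. AE t in lebesgue_on {0<..<T}. Linf_norm A (\<lambda>x. w x t) \<le> ereal C)"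

text \<open>The space \<open>W\<^sup>1\<^sup>,\<^sup>\<infinity>(0,T;L\<^sup>\<infinity>(A))\<close>. The two integrals below are Bochner integrals in
  \<open>L\<^sup>\<infinity>(A)\<close>, evaluated at almost every \<open>x\<close>.\<close>

definition in_W1inf_Linf :: "real \<Rightarrow> real set \<Rightarrow> (real \<Rightarrow> real \<Rightarrow> real) \<Rightarrow> bool" where
  "in_W1inf_Linf T A w \<longleftrightarrow> in_Linf_Linf T A w \<and>
     (\<exists>wt. in_Linf_Linf T A wt \<and>
        (\<forall>\<phi> :: real \<Rightarrow> real.
           (\<forall>n t. (deriv ^^ n) \<phi> differentiable (at t)) \<and>
           (\<exists>K. compact K \<and> K \<subseteq> {0<..<T} \<and> (\<forall>t. t \<notin> K \<longrightarrow> \<phi> t = 0)) \<longrightarrow>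
           (AE x in lebesgue_on A.
              (LINT t:{0<..<T}|lebesgue. w x t * deriv \<phi> t) =
              - (LINT t:{0<..<T}|lebesgue. wt x t * \<phi> t))))"


section \<open>The reaction-diffusion problem\<close>

text \<open>Hoelder continuity is required with a constant that may depend on the bounded part
  \<open>[0,R]\<^sup>2\<close> of the quadrant (the exponent may not).\<close>

definition reaction_function :: "(real \<Rightarrow> real \<Rightarrow> real) \<Rightarrow> bool" where
  "reaction_function F \<longleftrightarrow>
     (\<forall>u\<ge>0. \<forall>v\<ge>0. F u v \<ge> 0) \<and>
     (\<exists>\<alpha>>0. \<forall>R>0. \<exists>C. \<forall>u\<in>{0..R}. \<forall>v\<in>{0..R}. \<forall>u'\<in>{0..R}. \<forall>v'\<in>{0..R}.
        \<bar>F u v - F u' v'\<bar> \<le> C * dist (u, v) (u', v') powr \<alpha>) \<and>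
     (\<forall>u\<ge>0. F u 0 = 0) \<and> (\<forall>v\<ge>0. F 0 v = 0) \<and> (\<forall>u>0. \<forall>v>0. F u v > 0) \<and>
     (\<forall>v\<ge>0. mono_on {0..} (\<lambda>u. F u v)) \<and> (\<forall>u\<ge>0. mono_on {0..} (\<lambda>v. F u v))"

definition classical_solution ::
  "real \<Rightarrow> real \<Rightarrow> real \<Rightarrow> (real \<Rightarrow> real \<Rightarrow> real) \<Rightarrow> real \<Rightarrow> real \<Rightarrow>
   (real \<Rightarrow> real) \<Rightarrow> (real \<Rightarrow> real) \<Rightarrow> real \<Rightarrow>
   (real \<Rightarrow> real \<Rightarrow> real) \<Rightarrow> (real \<Rightarrow> real \<Rightarrow> real) \<Rightarrow> bool" where
  "classical_solution du dv k F U0 M u0 v0 T u v \<longleftrightarrow>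
     (\<forall>x\<ge>0. \<forall>t\<in>{0..T}. 0 \<le> u x t \<and> u x t \<le> M \<and> 0 \<le> v x t \<and> v x t \<le> M) \<and>
     (\<forall>\<delta>\<in>{0<..<T}. C21_on {0..} {\<delta>..T} u \<and> C21_on {0..} {\<delta>..T} v) \<and>
     continuous_on ({0..} \<times> {0..T}) (\<lambda>(x, t). u x t) \<and>
     continuous_on ({0..} \<times> {0..T}) (\<lambda>(x, t). v x t) \<and>
     (\<forall>J>0. \<forall>p\<ge>1. in_W21p p ({0<..<J} \<times> {0<..<T}) u \<and> in_W21p p ({0<..<J} \<times> {0<..<T}) v) \<and>
     (\<forall>x>0. \<forall>t\<in>{0<..<T}.
        deriv (\<lambda>s. u x s) t = du * deriv (deriv (\<lambda>y. u y t)) x - k * F (u x t) (v x t) \<and>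
        deriv (\<lambda>s. v x s) t = dv * deriv (deriv (\<lambda>y. v y t)) x - k * F (u x t) (v x t)) \<and>
     (\<forall>t\<in>{0<..<T}. u 0 t = U0 \<and>
        (\<exists>vx. ((\<lambda>y. v y t) has_real_derivative vx) (at 0 within {0..}) \<and> dv * vx = 0)) \<and>
     (\<forall>x\<ge>0. u x 0 = u0 x \<and> v x 0 = v0 x)"

text \<open>Weak solutions for \<open>d\<^sub>v = 0\<close>. So that their values at a fixed time make sense, they are given
  by the usual representatives: \<open>u\<close> is continuous, as all elements of \<open>W\<^sup>2\<^sup>,\<^sup>1\<^sub>p\<close> are for large
  \<open>p\<close>, and \<open>t \<mapsto> v \<cdot> t\<close> is continuous with values in \<open>L\<^sup>\<infinity>(0,J)\<close>, as all elements of
  \<open>W\<^sup>1\<^sup>,\<^sup>\<infinity>(0,T;L\<^sup>\<infinity>(0,J))\<close> are.\<close>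

definition weak_solution ::
  "real \<Rightarrow> real \<Rightarrow> (real \<Rightarrow> real \<Rightarrow> real) \<Rightarrow> real \<Rightarrow> real \<Rightarrow>
   (real \<Rightarrow> real) \<Rightarrow> (real \<Rightarrow> real) \<Rightarrow> real \<Rightarrow>
   (real \<Rightarrow> real \<Rightarrow> real) \<Rightarrow> (real \<Rightarrow> real \<Rightarrow> real) \<Rightarrow> bool" where
  "weak_solution du k F U0 M u0 v0 T u v \<longleftrightarrow>
     (\<forall>x\<ge>0. \<forall>t\<in>{0..T}. 0 \<le> u x t \<and> u x t \<le> M) \<and>
     (\<forall>t\<in>{0..T}. AE x in lebesgue_on {0..}. 0 \<le> v x t \<and> v x t \<le> M) \<and>
     continuous_on ({0..} \<times> {0..T}) (\<lambda>(x, t). u x t) \<and>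
     (\<forall>J>0. \<forall>t\<^sub>0\<in>{0..T}. in_Linf {0<..<J} (\<lambda>x. v x t\<^sub>0) \<and>
        ((\<lambda>t. Linf_norm {0<..<J} (\<lambda>x. v x t - v x t\<^sub>0)) \<longlongrightarrow> 0) (at t\<^sub>0 within {0..T})) \<and>
     (\<forall>J>0. \<forall>p\<ge>1. in_W21p p ({0<..<J} \<times> {0<..<T}) u) \<and>
     (\<forall>J>0. in_W1inf_Linf T {0<..<J} v) \<and>
     (\<forall>\<psi> \<psi>x \<psi>xx \<psi>t.
        C21_partials {0..} {0..T} \<psi> \<psi>x \<psi>xx \<psi>t \<and>
        (\<forall>x\<ge>0. \<psi> x T = 0) \<and> (\<forall>t\<in>{0<..<T}. \<psi> 0 t = 0) \<and>
        (\<exists>J>0. \<forall>x>J. \<forall>t\<in>{0..T}. \<psi> x t = 0) \<longrightarrow>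
        (LINT (x, t):{0<..} \<times> {0<..<T}|lebesgue. u x t * \<psi>t x t) +
        (LINT (x, t):{0<..} \<times> {0<..<T}|lebesgue.
           du * u x t * \<psi>xx x t - k * F (u x t) (v x t) * \<psi> x t) =
        - (LINT x:{0<..}|lebesgue. u0 x * \<psi> x 0) - du * U0 * (LINT t:{0<..<T}|lebesgue. \<psi>x 0 t) \<and>
        (LINT (x, t):{0<..} \<times> {0<..<T}|lebesgue. v x t * \<psi>t x t) -
        (LINT (x, t):{0<..} \<times> {0<..<T}|lebesgue. k * F (u x t) (v x t) * \<psi> x t) =
        - (LINT x:{0<..}|lebesgue. v0 x * \<psi> x 0))"

definition is_solution ::
  "real \<Rightarrow> real \<Rightarrow> real \<Rightarrow> (real \<Rightarrow> real \<Rightarrow> real) \<Rightarrow> real \<Rightarrow> real \<Rightarrow>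
   (real \<Rightarrow> real) \<Rightarrow> (real \<Rightarrow> real) \<Rightarrow> real \<Rightarrow>
   (real \<Rightarrow> real \<Rightarrow> real) \<Rightarrow> (real \<Rightarrow> real \<Rightarrow> real) \<Rightarrow> bool" where
  "is_solution du dv k F U0 M u0 v0 T u v \<longleftrightarrow>
     (if dv > 0 then classical_solution du dv k F U0 M u0 v0 T u v
      else weak_solution du k F U0 M u0 v0 T u v)"


section \<open>The self-similar profile\<close>

definition is_interface :: "real \<Rightarrow> real \<Rightarrow> real \<Rightarrow> real \<Rightarrow> real \<Rightarrow> bool" where
  "is_interface du dv U0 V0 a \<longleftrightarrow> a > 0 \<and>
     (if dv > 0 then
        du * U0 * (LINT s:{a..}|lebesgue. exp ((a\<^sup>2 - s\<^sup>2) / (4 * dv))) =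
        dv * V0 * (LINT s:{0..a}|lebesgue. exp ((a\<^sup>2 - s\<^sup>2) / (4 * du)))
      else
        U0 = V0 * a / (2 * du) * (LINT s:{0..a}|lebesgue. exp ((a\<^sup>2 - s\<^sup>2) / (4 * du))))"

definition interface :: "real \<Rightarrow> real \<Rightarrow> real \<Rightarrow> real \<Rightarrow> real" where
  "interface du dv U0 V0 = (THE a. is_interface du dv U0 V0 a)"

definition profile :: "real \<Rightarrow> real \<Rightarrow> real \<Rightarrow> real \<Rightarrow> real \<Rightarrow> real" where
  "profile du dv U0 V0 \<eta> = (let a = interface du dv U0 V0 in
     if \<eta> \<le> a then
       U0 * (1 - (LINT s:{0..\<eta>}|lebesgue. exp (- s\<^sup>2 / (4 * du))) /
                 (LINT s:{0..a}|lebesgue. exp (- s\<^sup>2 / (4 * du))))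
     else if dv > 0 then
       - V0 * (1 - (LINT s:{\<eta>..}|lebesgue. exp (- s\<^sup>2 / (4 * dv))) /
                   (LINT s:{a..}|lebesgue. exp (- s\<^sup>2 / (4 * dv))))
     else - V0)"

end

theory Submission
  imports Defs "HOL-Probability.Distributions" "HOL-Real_Asymp.Real_Asymp"
begin

text \<open>Put \<open>w(x,t) = f(x/\<surd>t)\<close>, \<open>B = d\<^sub>u u - d\<^sub>v v\<close> and let \<open>A\<close> be the difference of \<open>B\<close> and its
  counterpart \<open>d\<^sub>u w\<^sup>+ + d\<^sub>v w\<^sup>-\<close>. The reaction cancels in \<open>u - v\<close>, so the time integral \<open>q\<close> of \<open>A\<close>
  satisfies \<open>q\<^sub>t = A\<close> and \<open>q\<^sub>x\<^sub>x = Z - Z\<^sub>0\<close> with \<open>Z = u - v - w\<close> and \<open>Z\<^sub>0\<close> integrable; no regularity of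
  \<open>u\<close> and \<open>v\<close> beyond this is needed. With \<open>p = q\<^sub>x\<close> and a cutoff \<open>\<rho>\<close> of width comparable to \<open>\<surd>t\<close>, the
  energy \<open>\<integral> p\<^sup>2 \<rho> / 2\<close> is dissipated at the rate \<open>\<integral> A Z \<rho>\<close>, and \<open>A Z\<close> controls \<open>(u - w\<^sup>+)\<^sup>2\<close> and
  \<open>d\<^sub>v (v + w\<^sup>-)\<^sup>2\<close> up to a multiple of \<open>u v\<close>. In a box of size \<open>L \<times> L\<^sup>2\<close> the total reaction is \<open>O(L)\<close>,
  which is negligible against the volume \<open>L\<^sup>3\<close>; hence so is the integral of \<open>u v\<close>, because \<open>F\<close> is
  bounded below where \<open>u\<close> and \<open>v\<close> are. Averaging over \<open>t \<in> [1,L\<^sup>2]\<close> gives suitable times. If \<open>d\<^sub>v = 0\<close>,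
  the convergence of \<open>v\<close> comes instead from \<open>v \<le> v\<^sub>0\<close> and from the smallness of the
  potential.\<close>

section \<open>Bounded measurable functions\<close>

text \<open>Formally \<open>Z_t = A_xx\<close>, and if \<open>u v\<close> were 0 then
  \<open>A\<close> would have the sign of \<open>Z\<close>, as for two solutions of a Stefan
  problem. The fitting energy is therefore a negative norm of \<open>Z - Z0\<close>, the square of
  its primitive \<open>p\<close>, and only \<open>q\<close> has to be differentiated in time. By
  parabolic scaling \<open>p = O(\<surd>t)\<close>. In a box of size \<open>N L\<close> by
  \<open>L^2\<close> every error is then \<open>o(L^3)\<close>, with one exception: the slope of the
  cutoff costs a constant times \<open>L^3 / N\<close>. Hence \<open>N\<close> is fixed before
  \<open>L\<close> tends to infinity. The second obstacle is the boundary term \<open>p A\<close> at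
  \<open>x = 0\<close>, where \<open>A = - dv v\<close>. It is small on average because
  \<open>u v\<close> is small next to a boundary on which \<open>u = U0 > 0\<close>. Time starts at
  1, where the energy is still \<open>O(L)\<close>, since classical derivatives are available only
  away from \<open>t = 0\<close>. The bound \<open>O(L)\<close> for the reaction comes from weights
  or test functions that vanish at the far end of the box, so no slope has to be known
  there.\<close>

definition bm :: "real set \<Rightarrow> (real \<Rightarrow> real) \<Rightarrow> bool" where
  "bm S z \<longleftrightarrow> z \<in> borel_measurable (lebesgue_on S) \<and> (\<exists>C. \<forall>x\<in>S. \<bar>z x\<bar> \<le> C)"

lemma bmI: "z \<in> borel_measurable (lebesgue_on S) \<Longrightarrow> (\<And>x. x \<in> S \<Longrightarrow> \<bar>z x\<bar> \<le> C) \<Longrightarrow> bm S z"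
  by (auto simp: bm_def)

lemma bm_bound: assumes "bm S z" obtains C where "C > 0" "\<And>x. x \<in> S \<Longrightarrow> \<bar>z x\<bar> \<le> C"
proof -
  obtain C where C: "\<forall>x\<in>S. \<bar>z x\<bar> \<le> C" using assms by (auto simp: bm_def)
  show ?thesis by (rule that[of "max C 1"]) (use C in \<open>auto simp: le_max_iff_disj\<close>)
qed

lemma bm_cont: assumes "continuous_on {a..b} z" shows "bm {a..b} z"
proof -
  have "bounded (z ` {a..b})"
    by (intro compact_imp_bounded compact_continuous_image assms) auto
  then obtain C where "\<And>x. x \<in> {a..b} \<Longrightarrow> \<bar>z x\<bar> \<le> C"
    unfolding bounded_iff by (metis image_eqI real_norm_def)
  then show ?thesis
    by (intro bmI[of _ _ C] continuous_imp_measurable_on_sets_lebesgue assms) auto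
qed

lemma bm_const: "bm S (\<lambda>x. c)" by (rule bmI[of _ _ "\<bar>c\<bar>"]) auto

lemma bm_add: assumes "bm S y" "bm S z" shows "bm S (\<lambda>x. y x + z x)"
proof -
  obtain C where "\<And>x. x \<in> S \<Longrightarrow> \<bar>y x\<bar> \<le> C" using bm_bound[OF assms(1)] by metis
  moreover obtain D where "\<And>x. x \<in> S \<Longrightarrow> \<bar>z x\<bar> \<le> D" using bm_bound[OF assms(2)] by metis
  ultimately show ?thesis
    using assms by (intro bmI[of _ _ "C+D"] borel_measurable_add) (fastforce simp: bm_def)+
qed

lemma bm_mult: assumes "bm S y" "bm S z" shows "bm S (\<lambda>x. y x * z x)"
proof -
  obtain C where "\<And>x. x \<in> S \<Longrightarrow> \<bar>y x\<bar> \<le> C" "C > 0" using bm_bound[OF assms(1)] by metis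
  moreover obtain D where "\<And>x. x \<in> S \<Longrightarrow> \<bar>z x\<bar> \<le> D" using bm_bound[OF assms(2)] by metis
  ultimately show ?thesis
    using assms by (intro bmI[of _ _ "C*D"] borel_measurable_times)
      (simp_all add: bm_def abs_mult mult_mono)
qed

lemma bm_uminus: "bm S z \<Longrightarrow> bm S (\<lambda>x. - z x)"
  using bm_mult[OF bm_const[of S "-1"]] by auto

lemma bm_diff: "bm S y \<Longrightarrow> bm S z \<Longrightarrow> bm S (\<lambda>x. y x - z x)"
  using bm_add[OF _ bm_uminus] by force

lemma bm_abs: "bm S z \<Longrightarrow> bm S (\<lambda>x. \<bar>z x\<bar>)"
  by (auto simp: bm_def)

lemma bm_max: "bm S y \<Longrightarrow> bm S z \<Longrightarrow> bm S (\<lambda>x. max (y x) (z x))"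

proof -
  assume a: "bm S y" "bm S z"
  have "(\<lambda>x. max (y x) (z x)) = (\<lambda>x. (1/2) * ((y x + z x) + \<bar>y x - z x\<bar>))" by (auto simp: fun_eq_iff max_def)
  then show ?thesis using a by (simp only:) (intro bm_mult bm_add bm_abs bm_diff bm_const; simp)
qed

lemma bm_min: "bm S y \<Longrightarrow> bm S z \<Longrightarrow> bm S (\<lambda>x. min (y x) (z x))"
proof -
  assume a: "bm S y" "bm S z"
  have "(\<lambda>x. min (y x) (z x)) = (\<lambda>x. (1/2) * ((y x + z x) - \<bar>y x - z x\<bar>))" by (auto simp: fun_eq_iff min_def)
  then show ?thesis using a by (simp only:) (intro bm_mult bm_add bm_abs bm_diff bm_const; simp)
qed

lemma bm_power2: "bm S z \<Longrightarrow> bm S (\<lambda>x. (z x)\<^sup>2)"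
  by (simp add: power2_eq_square bm_mult)

lemma bm_divide: "bm S z \<Longrightarrow> bm S (\<lambda>x. z x / c)"
  using bm_mult[OF _ bm_const[of S "1/c"]] by force

lemmas bm_intros = bm_const bm_add bm_diff bm_mult bm_uminus bm_abs bm_max bm_min bm_power2 bm_divide

lemma bm_subset: assumes "bm {a..b} z" "{c..d} \<subseteq> {a..b}" shows "bm {c..d} z"
proof -
  have "z \<in> borel_measurable (lebesgue_on {c..d})"
    by (rule measurable_on_imp_borel_measurable_lebesgue measurable_restrict_mono[OF _ assms(2)])
      (use assms in \<open>auto simp: bm_def\<close>)
  with assms show ?thesis unfolding bm_def by blast
qed

text \<open>The bridge between two integrals: calculations use the gauge integral, while the
  definitions and the final statement use the Lebesgue integral. For this class of integrands both
  exist and agree.\<close>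

lemma bm_absint: assumes "bm {a..b} z" shows "z absolutely_integrable_on {a..b}"
proof -
  obtain C where "\<And>x. x \<in> {a..b} \<Longrightarrow> \<bar>z x\<bar> \<le> C" using bm_bound[OF assms] by metis
  then show ?thesis
    by (intro measurable_bounded_by_integrable_imp_absolutely_integrable[where g="\<lambda>x. C"])
      (use assms in \<open>auto simp: bm_def\<close>)
qed

lemma bm_int: "bm {a..b} z \<Longrightarrow> z integrable_on {a..b}"
  using bm_absint set_lebesgue_integral_eq_integral(1) by blast

lemma bm_int_sub: "bm {a..b} z \<Longrightarrow> {c..d} \<subseteq> {a..b} \<Longrightarrow> z integrable_on {c..d}"
  using bm_int bm_subset by blast

lemma bm_lint: "bm {a..b} z \<Longrightarrow> (LINT x:{a..b}|lebesgue. z x) = integral {a..b} z"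
  using bm_absint set_lebesgue_integral_eq_integral(2) by blast

section \<open>Integral bounds, integration by parts and second primitives\<close>

lemma abs_integral_le: fixes z :: "real \<Rightarrow> real"
  assumes "z integrable_on {a..b}" "\<And>x. x \<in> {a..b} \<Longrightarrow> \<bar>z x\<bar> \<le> C" "a \<le> b"
  shows "\<bar>integral {a..b} z\<bar> \<le> C * (b - a)"
proof -
  have "norm (integral {a..b} z) \<le> integral {a..b} (\<lambda>x. C)"
    by (rule integral_norm_bound_integral) (use assms in auto)
  then show ?thesis using assms by (simp add: mult.commute)
qed

lemma abs_integral_le_integral: fixes z :: "real \<Rightarrow> real"
  assumes "z integrable_on {a..b}" "w integrable_on {a..b}" "\<And>x. x \<in> {a..b} \<Longrightarrow> \<bar>z x\<bar> \<le> w x"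
  shows "\<bar>integral {a..b} z\<bar> \<le> integral {a..b} w"
  using integral_norm_bound_integral[of z "{a..b}" w] assms by auto

text \<open>All difference quotients are at most \<open>K\<close> times the increment, so
  \<open>D\<close> has derivative 0 everywhere. A bound on increments can be checked even where the
  separate terms of \<open>D\<close> fail to be differentiable.\<close>

lemma quadratic_increment_const:
  fixes D :: "real \<Rightarrow> real"
  assumes "\<And>x y. a \<le> x \<Longrightarrow> x < y \<Longrightarrow> y \<le> b \<Longrightarrow> \<bar>D y - D x\<bar> \<le> K * (y - x)\<^sup>2" "a \<le> b"
  shows "D b = D a"
proof -
  have K: "\<bar>D y - D x\<bar> \<le> K * (y - x)\<^sup>2" if "x \<in> {a..b}" "y \<in> {a..b}" for x y
    using assms(1)[of x y] assms(1)[of y x] that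
    by (cases x y rule: linorder_cases) (simp_all add: abs_minus_commute power2_commute)
  have "(D has_field_derivative 0) (at x within {a..b})" if x: "x \<in> {a..b}" for x
    unfolding has_field_derivative_iff
  proof (rule Lim_null_comparison)
    show "\<forall>\<^sub>F y in at x within {a..b}. norm ((D y - D x) / (y - x)) \<le> \<bar>K\<bar> * \<bar>y - x\<bar>"
      unfolding eventually_at_filter
    proof (rule always_eventually, intro allI impI)
      fix y assume y: "y \<noteq> x" "y \<in> {a..b}"
      have "\<bar>D y - D x\<bar> \<le> \<bar>K\<bar> * (y - x)\<^sup>2" using K[OF x y(2)]
        by (meson abs_ge_self mult_right_mono order_trans zero_le_power2)
      also have "\<dots> = \<bar>K\<bar> * \<bar>y - x\<bar> * \<bar>y - x\<bar>" by (metis mult.assoc power2_abs power2_eq_square)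
      finally show "norm ((D y - D x) / (y - x)) \<le> \<bar>K\<bar> * \<bar>y - x\<bar>" using y
        by (simp add: divide_le_eq)
    qed
    have "((\<lambda>y. \<bar>K\<bar> * \<bar>y - x\<bar>) \<longlongrightarrow> \<bar>K\<bar> * \<bar>x - x\<bar>) (at x within {a..b})"
      by (intro tendsto_intros)
    then show "((\<lambda>y. \<bar>K\<bar> * \<bar>y - x\<bar>) \<longlongrightarrow> 0) (at x within {a..b})" by simp
  qed
  then obtain c where "\<And>x. x \<in> {a..b} \<Longrightarrow> D x = c"
    using has_field_derivative_zero_constant[of "{a..b}" D] by auto
  then show ?thesis using assms(2) by auto
qed

text \<open>The defect in the product rule has quadratically small increments, hence it is constant;
  this avoids the almost-everywhere differentiability of \<open>P\<close>.\<close>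

lemma integral_by_parts_indefinite:
  fixes z P h h' :: "real \<Rightarrow> real"
  assumes z: "bm {a..b} z" and ab: "a \<le> b"
    and P: "\<And>x. x \<in> {a..b} \<Longrightarrow> P x = P a + integral {a..x} z"
    and h: "\<And>x. x \<in> {a..b} \<Longrightarrow> (h has_real_derivative h' x) (at x within {a..b})"
    and h': "continuous_on {a..b} h'"
  shows "integral {a..b} (\<lambda>x. P x * h' x) = P b * h b - P a * h a - integral {a..b} (\<lambda>x. z x * h x)"
proof -
  obtain Cz where Cz: "\<And>x. x \<in> {a..b} \<Longrightarrow> \<bar>z x\<bar> \<le> Cz" "Cz > 0" using bm_bound[OF z] by metis
  obtain Ch where Ch: "\<And>x. x \<in> {a..b} \<Longrightarrow> \<bar>h' x\<bar> \<le> Ch" "Ch > 0" using bm_bound[OF bm_cont[OF h']] by metis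
  have conth: "continuous_on {a..b} h" by (rule DERIV_continuous_on[OF h])
  have "continuous_on {a..b} (\<lambda>x. P a + integral {a..x} z)"
    by (intro continuous_intros indefinite_integral_continuous_1 bm_int z)
  then have contP: "continuous_on {a..b} P"
    by (rule continuous_on_eq) (rule P[symmetric])
  note bmh = bm_cont[OF conth] and bmh' = bm_cont[OF h'] and bmP = bm_cont[OF contP]
  have Pd: "P y - P x = integral {x..y} z" if "a \<le> x" "x \<le> y" "y \<le> b" for x y
    using Henstock_Kurzweil_Integration.integral_combine[of a x y z] P[of x] P[of y] that bm_int_sub[OF z, of a y] by auto
  have hd: "h y - h x = integral {x..y} h'" if "a \<le> x" "x \<le> y" "y \<le> b" for x y
  proof -
    have "(h' has_integral h y - h x) {x..y}"
      by (rule fundamental_theorem_of_calculus[OF that(2)])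
        (use that in \<open>auto simp flip: has_real_derivative_iff_has_vector_derivative intro!: DERIV_subset[OF h]\<close>)
    then show ?thesis by (simp add: integral_unique)
  qed
  define w where "w = (\<lambda>x. z x * h x + P x * h' x)"
  have bmw: "bm {a..b} w" unfolding w_def by (intro bm_intros z bmh bmh' bmP)
  define D where "D = (\<lambda>x. P x * h x - integral {a..x} w)"
  have "D b = D a"
  proof (rule quadratic_increment_const[OF _ ab])
    fix x y assume xy: "a \<le> x" "x < y" "y \<le> b"
    have sub: "{x..y} \<subseteq> {a..b}" using xy by auto
    note S = bm_subset[OF _ sub]
    have "integral {a..y} w = integral {a..x} w + integral {x..y} w"
      using Henstock_Kurzweil_Integration.integral_combine[of a x y w] xy bm_int_sub[OF bmw, of a y] by auto
    then have "D y - D x = (P y - P x) * h y + P x * (h y - h x) - integral {x..y} w"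
      unfolding D_def by (simp add: algebra_simps)
    also have "\<dots> = integral {x..y} (\<lambda>s. z s * h y + P x * h' s) - integral {x..y} w"
      using xy bm_int[OF S[OF z]] bm_int[OF S[OF bmh']]
      by (simp add: Pd hd Henstock_Kurzweil_Integration.integral_add integrable_on_mult_right integrable_on_mult_left)
    also have "\<dots> = integral {x..y} (\<lambda>s. z s * h y + P x * h' s - w s)"
      by (rule Henstock_Kurzweil_Integration.integral_diff[symmetric]) (intro bm_int bm_intros S z bmh' bmw)+
    finally have e: "D y - D x = integral {x..y} (\<lambda>s. z s * h y + P x * h' s - w s)" .
    \<comment> \<open>The integrand has \<open>h y\<close> and \<open>P x\<close> in place of
      \<open>h s\<close> and \<open>P s\<close>. Each replacement costs a Lipschitz constant times
      \<open>y - x\<close>, which gives the two equal contributions to the constant.\<close>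
    have "\<bar>integral {x..y} (\<lambda>s. z s * h y + P x * h' s - w s)\<bar> \<le> (2 * (Cz * Ch) * (y - x)) * (y - x)"
    proof (rule abs_integral_le)
      show "(\<lambda>s. z s * h y + P x * h' s - w s) integrable_on {x..y}"
        by (intro bm_int bm_intros S z bmh' bmw)
      fix s assume s: "s \<in> {x..y}"
      have "\<bar>h y - h s\<bar> \<le> Ch * (y - s)"
        using s xy by (subst hd) (auto intro!: abs_integral_le Ch bm_int bm_subset[OF bmh'])
      also have "\<dots> \<le> Ch * (y - x)" using s Ch by auto
      finally have 1: "\<bar>z s\<bar> * \<bar>h y - h s\<bar> \<le> Cz * (Ch * (y - x))"
        using Cz s xy by (intro mult_mono) auto
      have "\<bar>P s - P x\<bar> \<le> Cz * (s - x)"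
        using s xy by (subst Pd) (auto intro!: abs_integral_le Cz bm_int bm_subset[OF z])
      also have "\<dots> \<le> Cz * (y - x)" using s Cz by auto
      finally have 2: "\<bar>P s - P x\<bar> * \<bar>h' s\<bar> \<le> (Cz * (y - x)) * Ch"
        using Ch Cz s xy by (intro mult_mono) auto
      have "z s * h y + P x * h' s - w s = z s * (h y - h s) - (P s - P x) * h' s"
        unfolding w_def by (simp add: algebra_simps)
      also have "\<bar>\<dots>\<bar> \<le> \<bar>z s\<bar> * \<bar>h y - h s\<bar> + \<bar>P s - P x\<bar> * \<bar>h' s\<bar>"
        by (metis abs_mult abs_triangle_ineq4)
      finally show "\<bar>z s * h y + P x * h' s - w s\<bar> \<le> 2 * (Cz * Ch) * (y - x)" using 1 2
        by (simp add: algebra_simps)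
    qed (use xy in auto)
    then show "\<bar>D y - D x\<bar> \<le> 2 * (Cz * Ch) * (y - x)\<^sup>2" using e by (simp add: power2_eq_square algebra_simps)
  qed
  then have "P b * h b - P a * h a = integral {a..b} w" by (simp add: D_def)
  also have "\<dots> = integral {a..b} (\<lambda>x. z x * h x) + integral {a..b} (\<lambda>x. P x * h' x)"
    unfolding w_def by (intro Henstock_Kurzweil_Integration.integral_add bm_int bm_intros z bmh bmh' bmP)
  finally show ?thesis by simp
qed

text \<open>Cauchy's formula for repeated integration: integrate by parts against
  \<open>x - y\<close>. The boundary terms vanish because the weight is 0 at \<open>x\<close> and
  the primitive is 0 at 0.\<close>

lemma integral_iterated_indefinite:
  assumes z: "bm {0..x} z" and x: "0 \<le> (x::real)"
  shows "integral {0..x} (\<lambda>y. (x - y) * z y) = integral {0..x} (\<lambda>y. integral {0..y} z)"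
proof -
  have "integral {0..x} (\<lambda>y. integral {0..y} z * (-1)) =
      integral {0..x} z * (x - x) - integral {0..0} z * (x - 0) - integral {0..x} (\<lambda>y. z y * (x - y))"
    by (rule integral_by_parts_indefinite[OF z x, where P="\<lambda>y. integral {0..y} z"])
      (auto intro!: derivative_eq_intros)
  then show ?thesis by (simp add: mult.commute)
qed

text \<open>The first primitive of a bounded measurable \<open>z\<close> is continuous even where
  \<open>z\<close> is not, so the second primitive is differentiable at every point, one-sidedly at
  0.\<close>

lemma has_derivative_second_primitive:
  assumes z: "\<And>X. bm {0..X} z"
    and q: "\<And>x. 0 \<le> x \<Longrightarrow> q x = q0 + c * x + integral {0..x} (\<lambda>y. (x - y) * z y)"
    and x: "0 \<le> (x::real)"
  shows "(q has_real_derivative c + integral {0..x} z) (at x within {0..})"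
proof -
  have qx: "q y = q0 + c * y + integral {0..y} (\<lambda>y. integral {0..y} z)" if "0 \<le> y" for y
    using q[OF that] integral_iterated_indefinite[OF z that] by simp
  have ct: "continuous_on {0..x+1} (\<lambda>y. integral {0..y} z)"
    by (intro indefinite_integral_continuous_1 bm_int z)
  have "((\<lambda>y. q0 + c * y + integral {0..y} (\<lambda>y. integral {0..y} z)) has_real_derivative c + integral {0..x} z) (at x within {0..x+1})"
  proof -
    have "((\<lambda>y. integral {0..y} (\<lambda>y. integral {0..y} z)) has_real_derivative integral {0..x} z) (at x within {0..x+1})"
      by (rule integral_has_real_derivative[OF ct]) (use x in auto)
    moreover have "((\<lambda>y. q0 + c * y) has_real_derivative c) (at x within {0..x+1})"
      by (auto intro!: derivative_eq_intros)
    ultimately show ?thesis by (rule DERIV_add[rotated])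
  qed
  then have "(q has_real_derivative c + integral {0..x} z) (at x within {0..x+1})"
    by (rule has_field_derivative_transform_within[where d=1]) (use qx x in auto)
  moreover have "at x within {0..x+1} = at x within {0..}"
    by (rule at_within_nhd[of _ "{..<x+1}"]) auto
  ultimately show ?thesis by simp
qed

text \<open>Landau's inequality. By the mean value theorem some point within distance
  \<open>s\<close> has slope at most \<open>2 * Q / s\<close>, and the Lipschitz bound on
  \<open>p\<close> carries this back to \<open>x\<close>. The free step \<open>s\<close> is adapted
  to the scale at hand.\<close>

lemma landau_derivative_bound:
  fixes q p :: "real \<Rightarrow> real"
  assumes q: "\<And>x. 0 \<le> x \<Longrightarrow> (q has_real_derivative p x) (at x within {0..})"
    and Q: "\<And>x. 0 \<le> x \<Longrightarrow> \<bar>q x\<bar> \<le> Q"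
    and p: "\<And>x y. 0 \<le> x \<Longrightarrow> x \<le> y \<Longrightarrow> \<bar>p y - p x\<bar> \<le> K * (y - x)"
    and s: "s > 0" and x: "0 \<le> x"
  shows "\<bar>p x\<bar> \<le> 2 * Q / s + K * s"
proof -
  have "\<exists>\<xi>>x. \<xi> < x+s \<and> q (x+s) - q x = (x + s - x) * p \<xi>"
  proof -
    have d: "(q has_real_derivative p y) (at y)" if "x < y" for y
      using q[of y] at_within_interior[of y "{0..}"] that x by (simp add: interior_real_atLeast)
    have "continuous_on {x..x+s} q"
      by (rule DERIV_continuous_on, rule DERIV_subset[OF q]) (use x in auto)
    then obtain l z where lz: "x < z" "z < x+s" "(q has_real_derivative l) (at z)" "q (x+s) - q x = (x + s - x) * l"
      using MVT[of x "x+s" q] s d by (auto simp: real_differentiable_def)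
    then show ?thesis using DERIV_unique[OF d[OF lz(1)] lz(3)] by blast
  qed
  then obtain y where y: "x < y" "y < x + s" "q (x+s) - q x = s * p y" by auto
  have "s * \<bar>p y\<bar> = \<bar>q (x+s) - q x\<bar>" using y(3) s by (simp add: abs_mult)
  also have "\<dots> \<le> 2 * Q" using Q[of "x+s"] Q[of x] x s by auto
  finally have "\<bar>p y\<bar> \<le> 2 * Q / s" using s by (simp add: field_simps)
  moreover have "\<bar>p y - p x\<bar> \<le> K * s"
  proof -
    have *: "\<bar>p y - p x\<bar> \<le> K * (y - x)" using p[of x y] x y by auto
    then have "0 \<le> K" using y by (smt (verit) mult_neg_pos)
    then have "K * (y - x) \<le> K * s" using y by (intro mult_left_mono) auto
    with * show ?thesis by simp
  qed
  ultimately show ?thesis by linarith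
qed

section \<open>Energy of a potential\<close>

definition L1lim :: "real \<Rightarrow> real filter \<Rightarrow> (real \<Rightarrow> real \<Rightarrow> real) \<Rightarrow> (real \<Rightarrow> real) \<Rightarrow> bool" where
  "L1lim X F a a0 \<longleftrightarrow> bm {0..X} a0 \<and>
     (\<exists>C. \<forall>\<^sub>F s in F. bm {0..X} (a s) \<and> (\<forall>x\<in>{0..X}. \<bar>a s x\<bar> \<le> C)) \<and>
     ((\<lambda>s. integral {0..X} (\<lambda>x. \<bar>a s x - a0 x\<bar>)) \<longlongrightarrow> 0) F"

lemma L1lim_bm: "L1lim X F a a0 \<Longrightarrow> bm {0..X} a0" by (simp add: L1lim_def)

lemma L1lim_ev: "L1lim X F a a0 \<Longrightarrow> \<forall>\<^sub>F s in F. bm {0..X} (a s)"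
  unfolding L1lim_def by (auto elim: eventually_mono)

lemma L1limI:
  assumes "bm {0..X} a0" "\<forall>\<^sub>F s in F. bm {0..X} (a s)" "\<forall>\<^sub>F s in F. \<forall>x\<in>{0..X}. \<bar>a s x\<bar> \<le> C"
    "((\<lambda>s. integral {0..X} (\<lambda>x. \<bar>a s x - a0 x\<bar>)) \<longlongrightarrow> 0) F"
  shows "L1lim X F a a0"
  unfolding L1lim_def using assms eventually_conj[OF assms(2,3)] by blast

lemma L1lim_const: assumes "bm {0..X} a0" shows "L1lim X F (\<lambda>s. a0) a0"
proof -
  obtain C where "\<And>x. x \<in> {0..X} \<Longrightarrow> \<bar>a0 x\<bar> \<le> C" using bm_bound[OF assms] by metis
  then show ?thesis using assms by (intro L1limI[where C=C]) auto
qed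

lemma L1lim_squeeze:
  assumes "bm {0..X} a0" "\<forall>\<^sub>F s in F. bm {0..X} (a s)" "\<forall>\<^sub>F s in F. \<forall>x\<in>{0..X}. \<bar>a s x\<bar> \<le> C"
    and bd: "\<forall>\<^sub>F s in F. bm {0..X} (w s) \<and> (\<forall>x\<in>{0..X}. \<bar>a s x - a0 x\<bar> \<le> w s x)"
    and w: "((\<lambda>s. integral {0..X} (w s)) \<longlongrightarrow> 0) F"
  shows "L1lim X F a a0"
proof (rule L1limI[OF assms(1-3)])
  show "((\<lambda>s. integral {0..X} (\<lambda>x. \<bar>a s x - a0 x\<bar>)) \<longlongrightarrow> 0) F"
  proof (rule Lim_null_comparison[OF _ w])
    show "\<forall>\<^sub>F s in F. norm (integral {0..X} (\<lambda>x. \<bar>a s x - a0 x\<bar>)) \<le> integral {0..X} (w s)"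
      using eventually_conj[OF bd assms(2)]
    proof (rule eventually_mono)
      fix s assume "(bm {0..X} (w s) \<and> (\<forall>x\<in>{0..X}. \<bar>a s x - a0 x\<bar> \<le> w s x)) \<and> bm {0..X} (a s)"
      then show "norm (integral {0..X} (\<lambda>x. \<bar>a s x - a0 x\<bar>)) \<le> integral {0..X} (w s)"
        unfolding real_norm_def
        by (intro abs_integral_le_integral bm_int bm_intros assms(1)) auto
    qed
  qed
qed

lemma L1lim_add:
  assumes "L1lim X F a a0" "L1lim X F b b0"
  shows "L1lim X F (\<lambda>s x. a s x + b s x) (\<lambda>x. a0 x + b0 x)"
proof -
  obtain C where C: "\<forall>\<^sub>F s in F. bm {0..X} (a s) \<and> (\<forall>x\<in>{0..X}. \<bar>a s x\<bar> \<le> C)"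
    using assms(1) unfolding L1lim_def by blast
  obtain D where D: "\<forall>\<^sub>F s in F. bm {0..X} (b s) \<and> (\<forall>x\<in>{0..X}. \<bar>b s x\<bar> \<le> D)"
    using assms(2) unfolding L1lim_def by blast
  note CD = eventually_conj[OF C D] and b0 = L1lim_bm[OF assms(1)] L1lim_bm[OF assms(2)]
  show ?thesis
  proof (rule L1lim_squeeze[where w="\<lambda>s x. \<bar>a s x - a0 x\<bar> + \<bar>b s x - b0 x\<bar>" and C="C+D"])
    show "\<forall>\<^sub>F s in F. \<forall>x\<in>{0..X}. \<bar>a s x + b s x\<bar> \<le> C + D"
      using CD by (rule eventually_mono) fastforce
    have "((\<lambda>s. integral {0..X} (\<lambda>x. \<bar>a s x - a0 x\<bar>) + integral {0..X} (\<lambda>x. \<bar>b s x - b0 x\<bar>)) \<longlongrightarrow> 0 + 0) F"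
      using assms unfolding L1lim_def by (intro tendsto_add) auto
    moreover have "\<forall>\<^sub>F s in F. integral {0..X} (\<lambda>x. \<bar>a s x - a0 x\<bar>) + integral {0..X} (\<lambda>x. \<bar>b s x - b0 x\<bar>)
        = integral {0..X} (\<lambda>x. \<bar>a s x - a0 x\<bar> + \<bar>b s x - b0 x\<bar>)"
      using CD by (rule eventually_mono)
        (intro Henstock_Kurzweil_Integration.integral_add[symmetric] bm_int bm_intros b0, auto)
    ultimately show "((\<lambda>s. integral {0..X} (\<lambda>x. \<bar>a s x - a0 x\<bar> + \<bar>b s x - b0 x\<bar>)) \<longlongrightarrow> 0) F"
      using Lim_transform_eventually by fastforce
    show "\<forall>\<^sub>F s in F. bm {0..X} (\<lambda>x. a s x + b s x)"
      using CD by (rule eventually_mono) (auto intro: bm_intros)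
    show "\<forall>\<^sub>F s in F. bm {0..X} (\<lambda>x. \<bar>a s x - a0 x\<bar> + \<bar>b s x - b0 x\<bar>) \<and>
        (\<forall>x\<in>{0..X}. \<bar>a s x + b s x - (a0 x + b0 x)\<bar> \<le> \<bar>a s x - a0 x\<bar> + \<bar>b s x - b0 x\<bar>)"
      using CD by (rule eventually_mono) (auto intro!: bm_intros b0)
  qed (use b0 in \<open>auto intro: bm_intros\<close>)
qed

text \<open>Convergence in \<open>L^1\<close> alone is not stable under products; the eventual
  common bound in \<open>L1lim\<close> is there for this purpose.\<close>

lemma L1lim_mult:
  assumes "L1lim X F a a0" "L1lim X F b b0"
  shows "L1lim X F (\<lambda>s x. a s x * b s x) (\<lambda>x. a0 x * b0 x)"
proof -
  obtain C' where C': "\<forall>\<^sub>F s in F. bm {0..X} (a s) \<and> (\<forall>x\<in>{0..X}. \<bar>a s x\<bar> \<le> C')"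
    using assms(1) unfolding L1lim_def by blast
  obtain D' where D': "\<forall>\<^sub>F s in F. bm {0..X} (b s) \<and> (\<forall>x\<in>{0..X}. \<bar>b s x\<bar> \<le> D')"
    using assms(2) unfolding L1lim_def by blast
  note b0 = L1lim_bm[OF assms(1)] L1lim_bm[OF assms(2)]
  obtain E where E: "\<And>x. x \<in> {0..X} \<Longrightarrow> \<bar>a0 x\<bar> \<le> E" "E > 0" using bm_bound[OF b0(1)] by metis
  \<comment> \<open>On an empty interval the given bounds may be negative. Truncation at 0 makes
    them usable as factors.\<close>
  define C where "C = max C' 0" define D where "D = max D' 0"
  have C: "\<forall>\<^sub>F s in F. bm {0..X} (a s) \<and> (\<forall>x\<in>{0..X}. \<bar>a s x\<bar> \<le> C)"
    using C' by (rule eventually_mono) (auto simp: C_def le_max_iff_disj)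
  have D: "\<forall>\<^sub>F s in F. bm {0..X} (b s) \<and> (\<forall>x\<in>{0..X}. \<bar>b s x\<bar> \<le> D)"
    using D' by (rule eventually_mono) (auto simp: D_def le_max_iff_disj)
  note CD = eventually_conj[OF C D]
  have C0: "C \<ge> 0" "D \<ge> 0" by (auto simp: C_def D_def)
  show ?thesis
  proof (rule L1lim_squeeze[where w="\<lambda>s x. D * \<bar>a s x - a0 x\<bar> + E * \<bar>b s x - b0 x\<bar>" and C="C*D"])
    show "\<forall>\<^sub>F s in F. \<forall>x\<in>{0..X}. \<bar>a s x * b s x\<bar> \<le> C * D"
      using CD by (rule eventually_mono) (use C0 in \<open>simp add: abs_mult mult_mono\<close>)
    have "((\<lambda>s. D * integral {0..X} (\<lambda>x. \<bar>a s x - a0 x\<bar>) + E * integral {0..X} (\<lambda>x. \<bar>b s x - b0 x\<bar>)) \<longlongrightarrow> D * 0 + E * 0) F"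
      using assms unfolding L1lim_def by (intro tendsto_add tendsto_mult tendsto_const) auto
    moreover have "\<forall>\<^sub>F s in F. D * integral {0..X} (\<lambda>x. \<bar>a s x - a0 x\<bar>) + E * integral {0..X} (\<lambda>x. \<bar>b s x - b0 x\<bar>)
        = integral {0..X} (\<lambda>x. D * \<bar>a s x - a0 x\<bar> + E * \<bar>b s x - b0 x\<bar>)"
      using CD
    proof (rule eventually_mono)
      fix s assume "(bm {0..X} (a s) \<and> (\<forall>x\<in>{0..X}. \<bar>a s x\<bar> \<le> C)) \<and> bm {0..X} (b s) \<and> (\<forall>x\<in>{0..X}. \<bar>b s x\<bar> \<le> D)"
      then have i: "bm {0..X} (\<lambda>x. \<bar>a s x - a0 x\<bar>)" "bm {0..X} (\<lambda>x. \<bar>b s x - b0 x\<bar>)" by (auto intro!: bm_intros b0)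
      show "D * integral {0..X} (\<lambda>x. \<bar>a s x - a0 x\<bar>) + E * integral {0..X} (\<lambda>x. \<bar>b s x - b0 x\<bar>)
        = integral {0..X} (\<lambda>x. D * \<bar>a s x - a0 x\<bar> + E * \<bar>b s x - b0 x\<bar>)"
        by (subst Henstock_Kurzweil_Integration.integral_add) (auto intro!: bm_int bm_mult bm_const i)
    qed
    ultimately show "((\<lambda>s. integral {0..X} (\<lambda>x. D * \<bar>a s x - a0 x\<bar> + E * \<bar>b s x - b0 x\<bar>)) \<longlongrightarrow> 0) F"
      using Lim_transform_eventually by fastforce
    show "\<forall>\<^sub>F s in F. bm {0..X} (\<lambda>x. a s x * b s x)"
      using CD by (rule eventually_mono) (auto intro: bm_intros)
    show "\<forall>\<^sub>F s in F. bm {0..X} (\<lambda>x. D * \<bar>a s x - a0 x\<bar> + E * \<bar>b s x - b0 x\<bar>) \<and>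
        (\<forall>x\<in>{0..X}. \<bar>a s x * b s x - (a0 x * b0 x)\<bar> \<le> D * \<bar>a s x - a0 x\<bar> + E * \<bar>b s x - b0 x\<bar>)"
      using CD
    proof (rule eventually_mono, intro conjI ballI)
      fix s x assume h: "(bm {0..X} (a s) \<and> (\<forall>x\<in>{0..X}. \<bar>a s x\<bar> \<le> C)) \<and> bm {0..X} (b s) \<and> (\<forall>x\<in>{0..X}. \<bar>b s x\<bar> \<le> D)"
        and x: "x \<in> {0..X}"
      have "a s x * b s x - a0 x * b0 x = b s x * (a s x - a0 x) + a0 x * (b s x - b0 x)" by (simp add: algebra_simps)
      also have "\<bar>\<dots>\<bar> \<le> \<bar>b s x\<bar> * \<bar>a s x - a0 x\<bar> + \<bar>a0 x\<bar> * \<bar>b s x - b0 x\<bar>" by (metis abs_mult abs_triangle_ineq)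
      also have "\<dots> \<le> D * \<bar>a s x - a0 x\<bar> + E * \<bar>b s x - b0 x\<bar>"
        using h x E by (intro add_mono mult_right_mono) auto
      finally show "\<bar>a s x * b s x - (a0 x * b0 x)\<bar> \<le> D * \<bar>a s x - a0 x\<bar> + E * \<bar>b s x - b0 x\<bar>" .
    next
      fix s assume "(bm {0..X} (a s) \<and> (\<forall>x\<in>{0..X}. \<bar>a s x\<bar> \<le> C)) \<and> bm {0..X} (b s) \<and> (\<forall>x\<in>{0..X}. \<bar>b s x\<bar> \<le> D)"
      then show "bm {0..X} (\<lambda>x. D * \<bar>a s x - a0 x\<bar> + E * \<bar>b s x - b0 x\<bar>)" by (auto intro!: bm_intros b0)
    qed
  qed (use b0 in \<open>auto intro: bm_intros\<close>)
qed

lemma L1lim_cmult: "L1lim X F a a0 \<Longrightarrow> L1lim X F (\<lambda>s x. c * a s x) (\<lambda>x. c * a0 x)"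
  by (rule L1lim_mult[OF L1lim_const[OF bm_const]])

lemma L1lim_diff: "L1lim X F a a0 \<Longrightarrow> L1lim X F b b0 \<Longrightarrow> L1lim X F (\<lambda>s x. a s x - b s x) (\<lambda>x. a0 x - b0 x)"
  using L1lim_add[OF _ L1lim_cmult[where c="-1"]] by force

lemma L1lim_lipschitz:
  assumes "L1lim X F a a0" "\<And>x y. \<bar>g x - g y\<bar> \<le> \<bar>x - y\<bar>" and bm: "\<And>z. bm {0..X} z \<Longrightarrow> bm {0..X} (\<lambda>x. g (z x))"
  shows "L1lim X F (\<lambda>s x. g (a s x)) (\<lambda>x. g (a0 x))"
proof -
  obtain C where C: "\<forall>\<^sub>F s in F. bm {0..X} (a s) \<and> (\<forall>x\<in>{0..X}. \<bar>a s x\<bar> \<le> C)"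
    using assms(1) unfolding L1lim_def by blast
  note b0 = L1lim_bm[OF assms(1)]
  show ?thesis
  proof (rule L1lim_squeeze[where w="\<lambda>s x. \<bar>a s x - a0 x\<bar>" and C="C + \<bar>g 0\<bar>"])
    show "\<forall>\<^sub>F s in F. \<forall>x\<in>{0..X}. \<bar>g (a s x)\<bar> \<le> C + \<bar>g 0\<bar>"
      using C
    proof (rule eventually_mono, intro ballI)
      fix s x assume "bm {0..X} (a s) \<and> (\<forall>x\<in>{0..X}. \<bar>a s x\<bar> \<le> C)" "x \<in> {0..X}"
      then show "\<bar>g (a s x)\<bar> \<le> C + \<bar>g 0\<bar>" using assms(2)[of "a s x" 0] by force
    qed
  qed (use assms b0 C in \<open>auto simp: L1lim_def intro!: bm_intros elim!: eventually_mono\<close>)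
qed

lemma L1lim_max0: "L1lim X F a a0 \<Longrightarrow> L1lim X F (\<lambda>s x. max (a s x) 0) (\<lambda>x. max (a0 x) 0)"
  by (rule L1lim_lipschitz[where g="\<lambda>x. max x 0"]) (auto intro: bm_intros)

lemma L1lim_min0: "L1lim X F a a0 \<Longrightarrow> L1lim X F (\<lambda>s x. min (a s x) 0) (\<lambda>x. min (a0 x) 0)"
  by (rule L1lim_lipschitz[where g="\<lambda>x. min x 0"]) (auto intro: bm_intros)

lemma L1lim_power2: "L1lim X F a a0 \<Longrightarrow> L1lim X F (\<lambda>s x. (a s x)\<^sup>2) (\<lambda>x. (a0 x)\<^sup>2)"
  unfolding power2_eq_square by (rule L1lim_mult)

lemma L1lim_integral:
  assumes "L1lim X F a a0" shows "((\<lambda>s. integral {0..X} (a s)) \<longlongrightarrow> integral {0..X} a0) F"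
proof (rule LIM_zero_cancel, rule Lim_null_comparison)
  show "((\<lambda>s. integral {0..X} (\<lambda>x. \<bar>a s x - a0 x\<bar>)) \<longlongrightarrow> 0) F" using assms by (simp add: L1lim_def)
  show "\<forall>\<^sub>F s in F. norm (integral {0..X} (a s) - integral {0..X} a0) \<le> integral {0..X} (\<lambda>x. \<bar>a s x - a0 x\<bar>)"
    using L1lim_ev[OF assms]
  proof (rule eventually_mono)
    fix s assume s: "bm {0..X} (a s)"
    note b0 = L1lim_bm[OF assms]
    show "norm (integral {0..X} (a s) - integral {0..X} a0) \<le> integral {0..X} (\<lambda>x. \<bar>a s x - a0 x\<bar>)"
      unfolding real_norm_def
      by (subst Henstock_Kurzweil_Integration.integral_diff[symmetric])
        (auto intro!: bm_int bm_intros s b0 abs_integral_le_integral)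
  qed
qed

lemma L1lim_uniform:
  assumes "bm {0..X} a0" "\<forall>\<^sub>F s in F. bm {0..X} (a s)"
    and u: "\<And>e. e > 0 \<Longrightarrow> \<forall>\<^sub>F s in F. \<forall>x\<in>{0..X}. \<bar>a s x - a0 x\<bar> \<le> e"
  shows "L1lim X F a a0"
proof -
  obtain C where C: "\<And>x. x \<in> {0..X} \<Longrightarrow> \<bar>a0 x\<bar> \<le> C" using bm_bound[OF assms(1)] by metis
  show ?thesis
  proof (rule L1limI[OF assms(1,2), where C="C+1"])
  show "\<forall>\<^sub>F s in F. \<forall>x\<in>{0..X}. \<bar>a s x\<bar> \<le> C + 1"
    using u[OF zero_less_one] by (rule eventually_mono) (use C in fastforce)
  show "((\<lambda>s. integral {0..X} (\<lambda>x. \<bar>a s x - a0 x\<bar>)) \<longlongrightarrow> 0) F"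
    unfolding tendsto_iff
  proof (intro allI impI)
    fix e :: real assume e: "e > 0"
    define e' where "e' = e / (2 * (\<bar>X\<bar> + 1))"
    have "e' > 0" using e by (simp add: e'_def)
    from u[OF this] assms(2) show "\<forall>\<^sub>F s in F. dist (integral {0..X} (\<lambda>x. \<bar>a s x - a0 x\<bar>)) 0 < e"
    proof eventually_elim
      case (elim s)
      show ?case
      proof (cases "X \<ge> 0")
        case True
        have "\<bar>integral {0..X} (\<lambda>x. \<bar>a s x - a0 x\<bar>)\<bar> \<le> e' * (X - 0)"
          by (rule abs_integral_le) (use elim assms True in \<open>auto intro!: bm_int bm_intros\<close>)
        also have "\<dots> \<le> e / 2" unfolding e'_def using e True by (simp add: field_simps)
        finally show ?thesis using e by simp
      qed (use e in simp)
    qed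
  qed
qed
qed

lemma continuous_on_uniform_at:
  fixes g :: "real \<Rightarrow> real \<Rightarrow> real"
  assumes c: "continuous_on ({0..X} \<times> {0<..}) (\<lambda>(x, t). g x t)" and t: "t > 0" and e: "e > 0"
  shows "\<exists>d>0. d < t \<and> (\<forall>s x. \<bar>s - t\<bar> < d \<longrightarrow> x \<in> {0..X} \<longrightarrow> \<bar>g x s - g x t\<bar> \<le> e)"
proof -
  have "uniformly_continuous_on ({0..X} \<times> {t/2..2*t}) (\<lambda>(x, t). g x t)"
    by (rule compact_uniformly_continuous) (use t in \<open>auto intro!: compact_Times continuous_on_subset[OF c]\<close>)
  then obtain d where d: "d > 0" "\<And>z w. z \<in> {0..X} \<times> {t/2..2*t} \<Longrightarrow> w \<in> {0..X} \<times> {t/2..2*t} \<Longrightarrow> dist w z < d \<Longrightarrow>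
      dist ((\<lambda>(x, t). g x t) w) ((\<lambda>(x, t). g x t) z) < e"
    unfolding uniformly_continuous_on_def using e by metis
  show ?thesis
  proof (intro exI[of _ "min d (t/2)"] conjI allI impI)
    fix s x assume s: "\<bar>s - t\<bar> < min d (t/2)" and x: "x \<in> {0..X}"
    have "s \<in> {t/2..2*t}" using s by (auto simp: abs_if split: if_splits)
    moreover have "dist (x, s) (x, t) < d" using s by (simp add: dist_Pair_Pair dist_real_def)
    ultimately show "\<bar>g x s - g x t\<bar> \<le> e" using d(2)[of "(x,t)" "(x,s)"] x t by (auto simp: dist_real_def)
  qed (use d t in auto)
qed

lemma L1lim_cont:
  assumes c: "continuous_on ({0..X} \<times> {0<..}) (\<lambda>(x, t). g x t)" and t: "t > 0"
  shows "L1lim X (at t) (\<lambda>s x. g x s) (\<lambda>x. g x t)"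
proof (rule L1lim_uniform)
  have *: "bm {0..X} (\<lambda>x. g x s)" if "s > 0" for s
    by (rule bm_cont, rule continuous_on_compose2[OF c, of _ "\<lambda>x. (x, s)", simplified])
       (use that in \<open>auto intro!: continuous_intros\<close>)
  then show "bm {0..X} (\<lambda>x. g x t)" using t .
  have "\<forall>\<^sub>F s in at t. s > 0" using t
    by (metis eventually_at_topological greaterThan_iff open_greaterThan)
  then show "\<forall>\<^sub>F s in at t. bm {0..X} (\<lambda>x. g x s)" by (rule eventually_mono) (rule *)
  show "\<forall>\<^sub>F s in at t. \<forall>x\<in>{0..X}. \<bar>g x s - g x t\<bar> \<le> e" if "e > 0" for e
    using continuous_on_uniform_at[OF c t that] unfolding eventually_at dist_real_def by blast
qed

text \<open>Dominated convergence, transferred from sequences to the filter at \<open>t\<close>. The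
  exceptional null set serves the profile, which has a jump at the interface if
  \<open>dv = 0\<close>.\<close>

lemma L1lim_pointwise:
  assumes bm: "\<And>s. s > 0 \<Longrightarrow> bm {0..X} (a s)" and t: "t > (0::real)"
    and C: "\<And>s x. s > 0 \<Longrightarrow> x \<in> {0..X} \<Longrightarrow> \<bar>a s x\<bar> \<le> C"
    and N: "negligible N"
    and p: "\<And>x. x \<in> {0..X} - N \<Longrightarrow> ((\<lambda>s. a s x) \<longlongrightarrow> a t x) (at t)"
  shows "L1lim X (at t) a (a t)"
proof (rule L1limI)
  have ev: "\<forall>\<^sub>F s in at t. s > 0" using t
    by (metis eventually_at_topological greaterThan_iff open_greaterThan)
  show "bm {0..X} (a t)" using bm t .
  show "\<forall>\<^sub>F s in at t. bm {0..X} (a s)" using ev by (rule eventually_mono) (rule bm)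
  show "\<forall>\<^sub>F s in at t. \<forall>x\<in>{0..X}. \<bar>a s x\<bar> \<le> C" using ev by (rule eventually_mono) (auto intro: C)
  show "((\<lambda>s. integral {0..X} (\<lambda>x. \<bar>a s x - a t x\<bar>)) \<longlongrightarrow> 0) (at t)"
    unfolding tendsto_at_iff_sequentially comp_def
  proof (intro allI impI)
    fix S assume S: "\<forall>i. S i \<in> UNIV - {t}" "S \<longlonglongrightarrow> t"
    have "\<forall>\<^sub>F i in sequentially. S i > 0" using order_tendstoD(1)[OF S(2) t] .
    \<comment> \<open>The bounds hold at positive times only, so the sequence is shifted until all
      its terms are positive.\<close>
    then obtain n where n: "\<And>i. i \<ge> n \<Longrightarrow> S i > 0" unfolding eventually_sequentially by blast
    have St: "filterlim (\<lambda>i. S (i + n)) (at t) sequentially"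
      unfolding filterlim_at using S LIMSEQ_ignore_initial_segment[OF S(2), of n] by auto
    have "(\<lambda>i. integral ({0..X} - N) (\<lambda>x. \<bar>a (S (i + n)) x - a t x\<bar>)) \<longlonglongrightarrow> integral ({0..X} - N) (\<lambda>x. 0)"
    proof (rule dominated_convergence(2)[where h="\<lambda>x. 2 * C"])
      fix i
      have "(\<lambda>x. \<bar>a (S (i + n)) x - a t x\<bar>) integrable_on {0..X}" by (intro bm_int bm_intros bm n t) auto
      moreover have "negligible (sym_diff {0..X} ({0..X} - N))" by (rule negligible_subset[OF N]) auto
      ultimately show "(\<lambda>x. \<bar>a (S (i + n)) x - a t x\<bar>) integrable_on {0..X} - N"
        using integrable_spike_set_eq by blast
    next
      have "negligible (sym_diff {0..X} ({0..X} - N))" by (rule negligible_subset[OF N]) auto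
      then show "(\<lambda>x. 2 * C) integrable_on {0..X} - N"
        using integrable_spike_set_eq[of "{0..X}" "{0..X} - N" "\<lambda>x. 2 * C"] by (auto simp: integrable_const_ivl)
    next
      fix i x assume "x \<in> {0..X} - N"
      then show "norm \<bar>a (S (i + n)) x - a t x\<bar> \<le> 2 * C"
        using C[of "S (i+n)" x] C[OF t, of x] n[of "i + n"] by auto
    next
      show "(\<lambda>i. \<bar>a (S (i + n)) x - a t x\<bar>) \<longlonglongrightarrow> 0" if "x \<in> {0..X} - N" for x
        by (rule tendsto_rabs_zero, rule LIM_zero) (rule filterlim_compose[OF p[OF that] St])
    qed
    moreover have "integral ({0..X} - N) g = integral {0..X} g" for g :: "real \<Rightarrow> real"
      by (rule integral_spike_set) (rule negligible_subset[OF N]; auto)+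
    ultimately have "(\<lambda>i. integral {0..X} (\<lambda>x. \<bar>a (S (i + n)) x - a t x\<bar>)) \<longlonglongrightarrow> 0" by simp
    then show "(\<lambda>i. integral {0..X} (\<lambda>x. \<bar>a (S i) x - a t x\<bar>)) \<longlonglongrightarrow> 0"
      by (rule LIMSEQ_offset)
  qed
qed


text \<open>The abstract setting of the energy method: \<open>q_t = A\<close>,
  \<open>q_x = p\<close>, and \<open>p\<close> is a primitive of \<open>Z - Z0\<close>. Regularity
  in time is asked of \<open>A\<close> pointwise but of \<open>Z\<close> only in the mean, which is
  what a discontinuous profile and a weak solution can provide. The bound \<open>K * t\<close> says
  that the time integral starts from 0.\<close>

locale potential =
  fixes q p Z A :: "real \<Rightarrow> real \<Rightarrow> real" and Z0 :: "real \<Rightarrow> real" and K K1 :: real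
  assumes Zbm: "t > 0 \<Longrightarrow> bm {0..X} (\<lambda>x. Z x t)" and Z0bm: "bm {0..X} Z0"
    and Zb: "t > 0 \<Longrightarrow> x \<ge> 0 \<Longrightarrow> \<bar>Z x t\<bar> \<le> K1" and Z0b: "x \<ge> 0 \<Longrightarrow> \<bar>Z0 x\<bar> \<le> K1"
    and Acont: "continuous_on ({0..} \<times> {0<..}) (\<lambda>(x, t). A x t)"
    and Ab: "t > 0 \<Longrightarrow> x \<ge> 0 \<Longrightarrow> \<bar>A x t\<bar> \<le> K"
    and ZL1: "t > 0 \<Longrightarrow> L1lim X (at t) (\<lambda>s x. Z x s) (\<lambda>x. Z x t)"
    and qx: "t > 0 \<Longrightarrow> x \<ge> 0 \<Longrightarrow> ((\<lambda>x. q x t) has_real_derivative p x t) (at x within {0..})"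
    and px: "t > 0 \<Longrightarrow> x \<ge> 0 \<Longrightarrow> p x t = p 0 t + integral {0..x} (\<lambda>y. Z y t - Z0 y)"
    and qt: "t > 0 \<Longrightarrow> x \<ge> 0 \<Longrightarrow> ((\<lambda>s. q x s) has_real_derivative A x t) (at t)"
    and qb: "t > 0 \<Longrightarrow> x \<ge> 0 \<Longrightarrow> \<bar>q x t\<bar> \<le> K * t"
begin

section \<open>Size and continuity of the potential and of its slope\<close>

lemma Z_diff_bm: "t > 0 \<Longrightarrow> bm {a..b} (\<lambda>x. Z x t - Z0 x)" if "a \<ge> 0"
  by (rule bm_subset[of 0 b]) (use that in \<open>auto intro!: bm_diff Zbm Z0bm\<close>)

lemma p_increment: "t > 0 \<Longrightarrow> 0 \<le> x \<Longrightarrow> x \<le> y \<Longrightarrow> p y t - p x t = integral {x..y} (\<lambda>y. Z y t - Z0 y)"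
  using Henstock_Kurzweil_Integration.integral_combine[of 0 x y "\<lambda>y. Z y t - Z0 y"]
    px[of t x] px[of t y] bm_int[OF Z_diff_bm[of 0 t y]] by auto

lemma p_lipschitz: "t > 0 \<Longrightarrow> 0 \<le> x \<Longrightarrow> x \<le> y \<Longrightarrow> \<bar>p y t - p x t\<bar> \<le> (2 * K1) * (y - x)"
  unfolding p_increment
proof (rule abs_integral_le)
  assume a: "t > 0" "0 \<le> x" "x \<le> y"
  show "(\<lambda>y. Z y t - Z0 y) integrable_on {x..y}" using a by (intro bm_int Z_diff_bm) auto
  show "\<bar>Z y' t - Z0 y'\<bar> \<le> 2 * K1" if "y' \<in> {x..y}" for y'
    using Zb[OF a(1), of y'] Z0b[of y'] a that by auto
qed

lemma p_cont: "t > 0 \<Longrightarrow> continuous_on {0..X} (\<lambda>x. p x t)"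
proof -
  assume t: "t > 0"
  have "continuous_on {0..X} (\<lambda>x. p 0 t + integral {0..x} (\<lambda>y. Z y t - Z0 y))"
    by (intro continuous_intros indefinite_integral_continuous_1 bm_int Z_diff_bm t) auto
  then show ?thesis by (rule continuous_on_eq) (rule px[OF t, symmetric], simp)
qed

text \<open>Landau's inequality with step \<open>sqrt t\<close> balances the size
  \<open>K * t\<close> of \<open>q\<close> against the Lipschitz constant \<open>2 * K1\<close> of
  \<open>p\<close>. The result has the order dictated by parabolic scaling, and it includes
  \<open>x = 0\<close>, where \<open>p\<close> is not given by any boundary condition.\<close>

lemma p_bound: assumes "t > 0" "x \<ge> 0" shows "\<bar>p x t\<bar> \<le> (2 * K + 2 * K1) * sqrt t"
proof -
  have "\<bar>p x t\<bar> \<le> 2 * (K * t) / sqrt t + (2 * K1) * sqrt t"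
    by (rule landau_derivative_bound[where q="\<lambda>x. q x t"])
      (use assms qx qb p_lipschitz in auto)
  also have "2 * (K * t) / sqrt t = 2 * K * sqrt t"
    using assms by (simp add: real_div_sqrt field_simps)
  finally show ?thesis by (simp add: algebra_simps)
qed

lemma q_mean: assumes "t > 0" "s > 0" "x \<ge> 0" "s \<noteq> t"
  shows "\<exists>r. \<bar>r - t\<bar> < \<bar>s - t\<bar> \<and> r > 0 \<and> q x s - q x t = (s - t) * A x r"
proof (cases "s > t")
  case True
  have "\<exists>z>t. z < s \<and> q x s - q x t = (s - t) * A x z"
    by (rule MVT2) (use assms True in \<open>auto intro!: qt\<close>)
  then obtain z where z: "z > t" "z < s" "q x s - q x t = (s - t) * A x z" by blast
  then show ?thesis using assms by (intro exI[of _ z]) (auto simp: algebra_simps)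
next
  case False
  have "\<exists>z>s. z < t \<and> q x t - q x s = (t - s) * A x z"
    by (rule MVT2) (use assms False in \<open>auto intro!: qt\<close>)
  then obtain z where z: "z > s" "z < t" "q x t - q x s = (t - s) * A x z" by blast
  then show ?thesis using assms by (intro exI[of _ z]) (auto simp: algebra_simps)
qed

lemma q_lipschitz: assumes "t > 0" "s > 0" "x \<ge> 0" shows "\<bar>q x s - q x t\<bar> \<le> K * \<bar>s - t\<bar>"
proof (cases "s = t")
  case False
  then obtain r where r: "r > 0" "q x s - q x t = (s - t) * A x r" using q_mean[OF assms] by blast
  have "\<bar>q x s - q x t\<bar> = \<bar>A x r\<bar> * \<bar>s - t\<bar>" by (simp add: r abs_mult)
  also have "\<dots> \<le> K * \<bar>s - t\<bar>" using Ab[OF r(1) assms(3)] by (intro mult_right_mono) auto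
  finally show ?thesis .
qed simp

text \<open>The same interpolation, applied to the increment of \<open>q\<close> in time with step
  \<open>sqrt \<bar>s - t\<bar>\<close>. It makes \<open>p\<close> Hoelder continuous in time with
  exponent 1/2, uniformly in \<open>x\<close>.\<close>

lemma p_increment_time: assumes "t > 0" "s > 0" "x \<ge> 0"
  shows "\<bar>p x s - p x t\<bar> \<le> (2 * K + 4 * K1) * sqrt \<bar>s - t\<bar>"
proof (cases "s = t")
  case False
  have "\<bar>p x s - p x t\<bar> \<le> 2 * (K * \<bar>s - t\<bar>) / sqrt \<bar>s - t\<bar> + (4 * K1) * sqrt \<bar>s - t\<bar>"
  proof (rule landau_derivative_bound[where q="\<lambda>x. q x s - q x t" and p="\<lambda>x. p x s - p x t"])
    show "((\<lambda>x. q x s - q x t) has_real_derivative p x s - p x t) (at x within {0..})" if "0 \<le> x" for x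
      by (intro DERIV_diff qx assms that)
    show "\<bar>q x s - q x t\<bar> \<le> K * \<bar>s - t\<bar>" if "0 \<le> x" for x by (rule q_lipschitz) (use assms that in auto)
    show "\<bar>p y s - p y t - (p x s - p x t)\<bar> \<le> 4 * K1 * (y - x)" if "0 \<le> x" "x \<le> y" for x y
      using p_lipschitz[OF assms(1) that] p_lipschitz[OF assms(2) that] by linarith
  qed (use assms False in auto)
  also have "2 * (K * \<bar>s - t\<bar>) / sqrt \<bar>s - t\<bar> = 2 * K * sqrt \<bar>s - t\<bar>"
    using False by (simp add: real_div_sqrt flip: times_divide_eq_right)
  finally show ?thesis by (simp add: algebra_simps)
qed simp

section \<open>Cutoff energy and its time derivative\<close>

context
  fixes X :: real
  assumes X: "X > 0"
begin

text \<open>Squaring the linear cutoff makes the square of \<open>rho'\<close> equal to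
  \<open>(4 / X^2) * rho\<close>. The error caused by the cutoff can thus be absorbed by a
  dissipation that carries the weight \<open>rho\<close>. Only the values on {0..X} matter.\<close>

definition rho where "rho x = (1 - x / X)\<^sup>2"
definition rho' where "rho' x = - (2 / X) * (1 - x / X)"
definition energy where "energy t = (1/2) * integral {0..X} (\<lambda>x. (p x t)\<^sup>2 * rho x)"

lemma rho_simps: "rho 0 = 1" "rho X = 0" "0 \<le> rho x" using X by (auto simp: rho_def)

lemma rho_le: "x \<in> {0..X} \<Longrightarrow> rho x \<le> 1"
  unfolding rho_def using X by (intro power_le_one) (auto simp: field_simps)

lemma rho_deriv: "(rho has_real_derivative rho' x) (at x within S)"
  unfolding rho_def rho'_def using X
  by (auto intro!: derivative_eq_intros simp: field_simps power2_eq_square)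

lemma rho_bm: "bm {0..X} rho" "bm {0..X} rho'"
  unfolding rho_def rho'_def using X by (auto intro!: bm_cont continuous_intros)

text \<open>Half the difference of the squares of \<open>p\<close> is the mean of the two slopes
  times the difference of the two slopes. The latter is the \<open>x\<close>-derivative of
  \<open>q x s - q x t\<close>, and integration by parts removes this derivative. Working with
  increments avoids any time derivative of \<open>p\<close>.\<close>

lemma energy_increment:
  assumes t: "t > 0" and s: "s > 0"
  shows "energy s - energy t = - ((p 0 s + p 0 t) / 2) * (q 0 s - q 0 t)
    - integral {0..X} (\<lambda>x. (((Z x s - Z0 x) + (Z x t - Z0 x)) / 2) * (rho x * (q x s - q x t)))
    - integral {0..X} (\<lambda>x. (p x s + p x t) / 2 * (rho' x * (q x s - q x t)))"
proof -
  define P where "P = (\<lambda>x. (p x s + p x t) / 2)"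
  define z where "z = (\<lambda>x. ((Z x s - Z0 x) + (Z x t - Z0 x)) / 2)"
  define h where "h = (\<lambda>x. q x s - q x t)"
  have hd: "(h has_real_derivative p x s - p x t) (at x within {0..X})" if "x \<in> {0..X}" for x
    unfolding h_def by (rule DERIV_subset[of _ _ _ "{0..}"]) (use that s t in \<open>auto intro!: DERIV_diff qx\<close>)
  have hc: "continuous_on {0..X} h" by (rule DERIV_continuous_on[OF hd])
  have rc: "continuous_on {0..X} rho" "continuous_on {0..X} rho'"
    unfolding rho_def rho'_def using X by (auto intro!: continuous_intros)
  have zbm: "bm {0..X} z" unfolding z_def by (intro bm_intros Zbm Z0bm s t)
  have "integral {0..X} (\<lambda>x. P x * (rho' x * h x + (p x s - p x t) * rho x)) =
      P X * (rho X * h X) - P 0 * (rho 0 * h 0) - integral {0..X} (\<lambda>x. z x * (rho x * h x))"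
  proof (rule integral_by_parts_indefinite[OF zbm])
    fix x assume x: "x \<in> {0..X}"
    have "integral {0..x} z = (integral {0..x} (\<lambda>x. Z x s - Z0 x) + integral {0..x} (\<lambda>x. Z x t - Z0 x)) / 2"
      unfolding z_def integral_divide
      by (subst Henstock_Kurzweil_Integration.integral_add) (use Z_diff_bm[of 0 s x] Z_diff_bm[of 0 t x] s t in \<open>auto intro: bm_int\<close>)
    then show "P x = P 0 + integral {0..x} z"
      using px[OF s, of x] px[OF t, of x] x by (simp add: P_def field_simps)
    show "((\<lambda>x. rho x * h x) has_real_derivative rho' x * h x + (p x s - p x t) * rho x) (at x within {0..X})"
      by (rule DERIV_mult[OF rho_deriv hd[OF x]])
  qed (use X in \<open>auto intro!: continuous_intros rc hc p_cont s t\<close>)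
  moreover have "integral {0..X} (\<lambda>x. P x * (rho' x * h x + (p x s - p x t) * rho x)) =
      integral {0..X} (\<lambda>x. P x * (rho' x * h x)) + integral {0..X} (\<lambda>x. (1/2) * ((p x s)\<^sup>2 * rho x - (p x t)\<^sup>2 * rho x))"
  proof -
    have e: "P x * (rho' x * h x + (p x s - p x t) * rho x) =
        P x * (rho' x * h x) + (1/2) * ((p x s)\<^sup>2 * rho x - (p x t)\<^sup>2 * rho x)" for x
      by (simp add: P_def field_simps power2_eq_square)
    have "bm {0..X} (\<lambda>x. P x * (rho' x * h x))" "bm {0..X} (\<lambda>x. (1/2) * ((p x s)\<^sup>2 * rho x - (p x t)\<^sup>2 * rho x))"
      unfolding P_def by (intro bm_intros rho_bm bm_cont[OF hc] bm_cont[OF p_cont] s t)+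
    then show ?thesis unfolding e by (intro Henstock_Kurzweil_Integration.integral_add bm_int)
  qed
  moreover have "integral {0..X} (\<lambda>x. (1/2) * ((p x s)\<^sup>2 * rho x - (p x t)\<^sup>2 * rho x)) = energy s - energy t"
  proof -
    have "integral {0..X} (\<lambda>x. (p x s)\<^sup>2 * rho x - (p x t)\<^sup>2 * rho x) =
      integral {0..X} (\<lambda>x. (p x s)\<^sup>2 * rho x) - integral {0..X} (\<lambda>x. (p x t)\<^sup>2 * rho x)"
      by (intro Henstock_Kurzweil_Integration.integral_diff bm_int bm_intros bm_cont p_cont s t rc)
    then show ?thesis by (simp add: energy_def)
  qed
  ultimately show ?thesis
    by (simp add: rho_simps P_def z_def h_def)
qed

lemma L1lim_quotient: assumes t: "t > 0"
  shows "L1lim X (at t) (\<lambda>s x. (q x s - q x t) / (s - t)) (\<lambda>x. A x t)"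
proof (rule L1lim_uniform)
  have Ac: "continuous_on ({0..X} \<times> {0<..}) (\<lambda>(x, t). A x t)"
    by (rule continuous_on_subset[OF Acont]) auto
  show "bm {0..X} (\<lambda>x. A x t)" by (rule L1lim_bm[OF L1lim_cont[OF Ac t]])
  have ev: "\<forall>\<^sub>F s in at t. s > 0" using t
    by (metis eventually_at_topological greaterThan_iff open_greaterThan)
  have qc: "continuous_on {0..X} (\<lambda>x. q x s)" if "s > 0" for s
    by (rule DERIV_continuous_on, rule DERIV_subset[OF qx]) (use that in auto)
  show "\<forall>\<^sub>F s in at t. bm {0..X} (\<lambda>x. (q x s - q x t) / (s - t))"
    using ev by (rule eventually_mono) (intro bm_intros bm_cont qc t)
  fix e :: real assume "e > 0"
  from continuous_on_uniform_at[OF Ac t this] obtain d where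
    d: "d > 0" "d < t" "\<And>s x. \<bar>s - t\<bar> < d \<Longrightarrow> x \<in> {0..X} \<Longrightarrow> \<bar>A x s - A x t\<bar> \<le> e" by blast
  show "\<forall>\<^sub>F s in at t. \<forall>x\<in>{0..X}. \<bar>(q x s - q x t) / (s - t) - A x t\<bar> \<le> e"
    unfolding eventually_at
  proof (intro exI[of _ d] conjI d ballI impI)
    fix s x assume s: "s \<noteq> t \<and> dist s t < d" and x: "x \<in> {0..X}"
    then have s0: "s > 0" "\<bar>s - t\<bar> < d" "s \<noteq> t" using d by (auto simp: dist_real_def)
    obtain r where r: "\<bar>r - t\<bar> < \<bar>s - t\<bar>" "q x s - q x t = (s - t) * A x r"
      using q_mean[OF t s0(1) _ s0(3), of x] x by auto
    then show "\<bar>(q x s - q x t) / (s - t) - A x t\<bar> \<le> e" using d(3)[of r x] s0 x by auto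
  qed
qed

lemma L1lim_p: assumes t: "t > 0" shows "L1lim X (at t) (\<lambda>s x. p x s) (\<lambda>x. p x t)"
proof (rule L1lim_uniform)
  show "bm {0..X} (\<lambda>x. p x t)" by (intro bm_cont p_cont t)
  have ev: "\<forall>\<^sub>F s in at t. s > 0" using t
    by (metis eventually_at_topological greaterThan_iff open_greaterThan)
  show "\<forall>\<^sub>F s in at t. bm {0..X} (\<lambda>x. p x s)"
    using ev by (rule eventually_mono) (intro bm_cont p_cont)
  fix e :: real assume e: "e > 0"
  have "((\<lambda>s. (2 * K + 4 * K1) * sqrt \<bar>s - t\<bar>) \<longlongrightarrow> (2 * K + 4 * K1) * sqrt \<bar>t - t\<bar>) (at t)"
    by (intro tendsto_intros)
  then have "\<forall>\<^sub>F s in at t. (2 * K + 4 * K1) * sqrt \<bar>s - t\<bar> < e"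
    by (rule order_tendstoD) (use e in simp)
  with ev show "\<forall>\<^sub>F s in at t. \<forall>x\<in>{0..X}. \<bar>p x s - p x t\<bar> \<le> e"
    by eventually_elim (use p_increment_time[OF t] in fastforce)
qed

lemma p0_tendsto: assumes t: "t > 0" shows "((\<lambda>s. p 0 s) \<longlongrightarrow> p 0 t) (at t)"
proof (rule LIM_zero_cancel, rule Lim_null_comparison)
  have ev: "\<forall>\<^sub>F s in at t. s > 0" using t
    by (metis eventually_at_topological greaterThan_iff open_greaterThan)
  show "\<forall>\<^sub>F s in at t. norm (p 0 s - p 0 t) \<le> (2 * K + 4 * K1) * sqrt \<bar>s - t\<bar>"
    using ev by eventually_elim (use p_increment_time[OF t] in fastforce)
  have "((\<lambda>s. (2 * K + 4 * K1) * sqrt \<bar>s - t\<bar>) \<longlongrightarrow> (2 * K + 4 * K1) * sqrt \<bar>t - t\<bar>) (at t)"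
    by (intro tendsto_intros)
  then show "((\<lambda>s. (2 * K + 4 * K1) * sqrt \<bar>s - t\<bar>) \<longlongrightarrow> 0) (at t)" by simp
qed

text \<open>Divide \<open>energy_increment\<close> by \<open>s - t\<close>. The difference quotient
  of \<open>q\<close> converges uniformly to \<open>A\<close>, while \<open>Z\<close> and
  \<open>p\<close> converge in the mean with a common bound, so all products pass to the
  limit.\<close>

lemma energy_deriv:
  assumes t: "t > 0"
  shows "(energy has_real_derivative - p 0 t * A 0 t
    - integral {0..X} (\<lambda>x. (Z x t - Z0 x) * (rho x * A x t))
    - integral {0..X} (\<lambda>x. p x t * (rho' x * A x t))) (at t)"
  unfolding has_field_derivative_iff
proof (rule Lim_transform_eventually)
  let ?k = "\<lambda>s x. (q x s - q x t) / (s - t)"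
  note c = L1lim_const[OF rho_bm(1), where F="at t"] L1lim_const[OF rho_bm(2), where F="at t"] L1lim_const[OF Z0bm[of X], where F="at t"]
    L1lim_const[OF p_cont[OF t, THEN bm_cont], where F="at t"] L1lim_const[OF Zbm[OF t, of X], where F="at t"]
  have z: "L1lim X (at t) (\<lambda>s x. (1/2) * ((Z x s - Z0 x) + (Z x t - Z0 x))) (\<lambda>x. (1/2) * ((Z x t - Z0 x) + (Z x t - Z0 x)))"
    by (intro L1lim_cmult L1lim_add L1lim_diff ZL1 c t)
  have 1: "((\<lambda>s. integral {0..X} (\<lambda>x. (1/2) * ((Z x s - Z0 x) + (Z x t - Z0 x)) * (rho x * ?k s x))) \<longlongrightarrow>
      integral {0..X} (\<lambda>x. (1/2) * ((Z x t - Z0 x) + (Z x t - Z0 x)) * (rho x * A x t))) (at t)"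
    by (rule L1lim_integral) (intro L1lim_mult[OF z] L1lim_mult[OF c(1)] L1lim_quotient t)
  have P: "L1lim X (at t) (\<lambda>s x. (1/2) * (p x s + p x t)) (\<lambda>x. (1/2) * (p x t + p x t))"
    by (intro L1lim_cmult L1lim_add L1lim_p c t)
  have 2: "((\<lambda>s. integral {0..X} (\<lambda>x. (1/2) * (p x s + p x t) * (rho' x * ?k s x))) \<longlongrightarrow>
      integral {0..X} (\<lambda>x. (1/2) * (p x t + p x t) * (rho' x * A x t))) (at t)"
    by (rule L1lim_integral) (intro L1lim_mult[OF P] L1lim_mult[OF c(2)] L1lim_quotient t)
  have 3: "((\<lambda>s. - ((p 0 s + p 0 t) / 2) * ?k s 0) \<longlongrightarrow> - ((p 0 t + p 0 t) / 2) * A 0 t) (at t)"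
    using qt[OF t, of 0] unfolding has_field_derivative_iff
    by (intro tendsto_intros p0_tendsto t) auto
  show "((\<lambda>s. - ((p 0 s + p 0 t) / 2) * ?k s 0
     - integral {0..X} (\<lambda>x. (1/2) * ((Z x s - Z0 x) + (Z x t - Z0 x)) * (rho x * ?k s x))
     - integral {0..X} (\<lambda>x. (1/2) * (p x s + p x t) * (rho' x * ?k s x))) \<longlongrightarrow>
     - p 0 t * A 0 t - integral {0..X} (\<lambda>x. (Z x t - Z0 x) * (rho x * A x t))
    - integral {0..X} (\<lambda>x. p x t * (rho' x * A x t))) (at t)"
  proof -
    have e: "(1/2) * ((Z x t - Z0 x) + (Z x t - Z0 x)) = Z x t - Z0 x" "(1/2) * (p x t + p x t) = p x t"
      "(p 0 t + p 0 t) / 2 = p 0 t" for x by (simp_all add: field_simps)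
    show ?thesis using tendsto_diff[OF tendsto_diff[OF 3 1] 2] unfolding e .
  qed
  have ev: "\<forall>\<^sub>F s in at t. s > 0 \<and> s \<noteq> t" using t
    by (intro eventually_conj eventually_neq_at_within) (metis eventually_at_topological greaterThan_iff open_greaterThan)
  then show "\<forall>\<^sub>F s in at t. - ((p 0 s + p 0 t) / 2) * ?k s 0
     - integral {0..X} (\<lambda>x. (1/2) * ((Z x s - Z0 x) + (Z x t - Z0 x)) * (rho x * ?k s x))
     - integral {0..X} (\<lambda>x. (1/2) * (p x s + p x t) * (rho' x * ?k s x)) = (energy s - energy t) / (s - t)"
  proof eventually_elim
    case (elim s)
    have a: "(1/2) * ((Z x s - Z0 x) + (Z x t - Z0 x)) * (rho x * ?k s x) =
        ((Z x s - Z0 x + (Z x t - Z0 x)) / 2 * (rho x * (q x s - q x t))) / (s - t)" for x by simp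
    have b: "(1/2) * (p x s + p x t) * (rho' x * ?k s x) = ((p x s + p x t) / 2 * (rho' x * (q x s - q x t))) / (s - t)" for x by simp
    have c: "- ((p 0 s + p 0 t) / 2) * ?k s 0 = (- ((p 0 s + p 0 t) / 2) * (q 0 s - q 0 t)) / (s - t)" by simp
    show ?case unfolding a b c energy_increment[OF t conjunct1[OF elim]]
      by (simp add: diff_divide_distrib)
  qed
qed

end

end

section \<open>The self-similar profile\<close>

definition gauss :: "real \<Rightarrow> real \<Rightarrow> real" where "gauss d s = exp (- s\<^sup>2 / (4 * d))"
definition gaussl :: "real \<Rightarrow> real \<Rightarrow> real" where "gaussl d x = integral {0..x} (gauss d)"
definition gaussr :: "real \<Rightarrow> real \<Rightarrow> real" where "gaussr d x = (LINT s:{x..}|lebesgue. gauss d s)"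

section \<open>Gaussian integrals on bounded and unbounded intervals\<close>

lemma gauss_pos: "gauss d s > 0" by (simp add: gauss_def)

lemma gauss_cont: "continuous_on S (gauss d)"
proof (cases "d = 0")
  case False then show ?thesis unfolding gauss_def by (intro continuous_intros) auto
qed (simp add: gauss_def)

lemma gauss_deriv: "d \<noteq> 0 \<Longrightarrow> (gauss d has_real_derivative - (x / (2 * d)) * gauss d x) (at x within S)"
  unfolding gauss_def by (auto intro!: derivative_eq_intros simp: field_simps)

lemma gauss_integrable: assumes "d > 0" shows "integrable lborel (gauss d)"
proof -
  have "gauss d x = sqrt (2 * pi * (sqrt (2 * d))\<^sup>2) * normal_density 0 (sqrt (2 * d)) x" for x
    using assms by (simp add: gauss_def normal_density_def)
  then have "gauss d = (\<lambda>x. sqrt (2 * pi * (sqrt (2 * d))\<^sup>2) * normal_density 0 (sqrt (2 * d)) x)" by blast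
  moreover have "integrable lborel (\<lambda>x. sqrt (2 * pi * (sqrt (2 * d))\<^sup>2) * normal_density 0 (sqrt (2 * d)) x)"
    using assms by (intro integrable_mult_right) simp
  ultimately show ?thesis by simp
qed

lemma gauss_set_integrable: assumes "d > 0" "S \<in> sets lebesgue" shows "set_integrable lebesgue S (gauss d)"
proof -
  have "integrable lebesgue (gauss d)" using gauss_integrable[OF assms(1)] integrable_completion by blast
  then have "set_integrable lebesgue UNIV (gauss d)" by (simp add: set_integrable_def)
  then show ?thesis by (rule set_integrable_subset) (use assms in auto)
qed

lemma gaussl_deriv: "x \<ge> 0 \<Longrightarrow> (gaussl d has_real_derivative gauss d x) (at x within {0..})"
proof -
  assume x: "x \<ge> 0"
  have "(gaussl d has_real_derivative gauss d x) (at x within {0..x+1})"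
    unfolding gaussl_def[abs_def] by (rule integral_has_real_derivative[OF gauss_cont]) (use x in auto)
  moreover have "at x within {0..x+1} = at x within {0..}"
    by (rule at_within_nhd[of _ "{..<x+1}"]) auto
  ultimately show ?thesis by simp
qed

lemma gaussl_cont: "continuous_on {0..} (gaussl d)"
  by (rule DERIV_continuous_on[OF gaussl_deriv]) auto

lemma gaussl_strict_mono: assumes "0 \<le> x" "x < y" shows "gaussl d x < gaussl d y"
proof -
  have "\<exists>z>x. z < y \<and> gaussl d y - gaussl d x = (y - x) * gauss d z"
  proof -
    have d: "(gaussl d has_real_derivative gauss d z) (at z)" if "z > x" for z
      using gaussl_deriv[of z d] at_within_interior[of z "{0..}"] that assms by (simp add: interior_real_atLeast)
    have "continuous_on {x..y} (gaussl d)"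
      by (rule continuous_on_subset[OF gaussl_cont]) (use assms in auto)
    then obtain l z where lz: "x < z" "z < y" "(gaussl d has_real_derivative l) (at z)" "gaussl d y - gaussl d x = (y - x) * l"
      using MVT[of x y "gaussl d"] assms d by (auto simp: real_differentiable_def)
    then show ?thesis using DERIV_unique[OF d[OF lz(1)] lz(3)] by blast
  qed
  then obtain z where "gaussl d y - gaussl d x = (y - x) * gauss d z" by blast
  moreover have "(y - x) * gauss d z > 0" using assms gauss_pos by simp
  ultimately show ?thesis by linarith
qed

lemma gaussl_0: "gaussl d 0 = 0" by (simp add: gaussl_def)

lemma gaussl_pos: "0 < x \<Longrightarrow> gaussl d x > 0"
  using gaussl_strict_mono[of 0 x d] by (simp add: gaussl_0)

lemma gaussl_mono: "0 \<le> x \<Longrightarrow> x \<le> y \<Longrightarrow> gaussl d x \<le> gaussl d y"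
  using gaussl_strict_mono[of x y d] by (cases "x = y") auto

lemma lint_gaussl: "(LINT s:{0..x}|lebesgue. gauss d s) = gaussl d x"
  unfolding gaussl_def by (rule bm_lint[OF bm_cont[OF gauss_cont]])

lemma gaussr_eq: assumes d: "d > 0" and x: "x \<ge> 0" shows "gaussr d x = gaussr d 0 - gaussl d x"
proof -
  have "(LINT s:{0..<x} \<union> {x..}|lebesgue. gauss d s) = (LINT s:{0..<x}|lebesgue. gauss d s) + (LINT s:{x..}|lebesgue. gauss d s)"
    by (rule set_integral_Un) (use d in \<open>auto intro!: gauss_set_integrable\<close>)
  moreover have "{0..<x} \<union> {x..} = {0..}" using x by auto
  moreover have "(LINT s:{0..<x}|lebesgue. gauss d s) = integral {0..<x} (gauss d)"
    by (rule set_lebesgue_integral_eq_integral(2)) (use d in \<open>auto intro!: gauss_set_integrable\<close>)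
  moreover have "integral {0..<x} (gauss d) = integral {0..x} (gauss d)"
    by (rule integral_spike_set) (auto intro: negligible_subset[of "{x}"])
  ultimately show ?thesis by (simp add: gaussr_def gaussl_def)
qed

lemma gaussl_le_gaussr: assumes d: "d > 0" and x: "x \<ge> 0" shows "gaussl d x \<le> gaussr d 0"
proof -
  have "0 \<le> gaussr d x" unfolding gaussr_def
    unfolding set_lebesgue_integral_def by (rule integral_nonneg_AE) (auto simp: indicator_def intro!: less_imp_le gauss_pos)
  then show ?thesis using gaussr_eq[OF assms] by linarith
qed

lemma gaussr_pos: assumes d: "d > 0" and x: "x \<ge> 0" shows "gaussr d x > 0"
  using gaussr_eq[OF assms] gaussl_le_gaussr[OF d, of "x+1"] gaussl_strict_mono[of x "x+1" d] x by linarith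

lemma gaussr_mono: "d > 0 \<Longrightarrow> 0 \<le> x \<Longrightarrow> x \<le> y \<Longrightarrow> gaussr d y \<le> gaussr d x"
  using gaussr_eq[of d x] gaussr_eq[of d y] gaussl_mono[of x y d] by linarith

lemma gaussr_cont: assumes "d > 0" shows "continuous_on {0..} (gaussr d)"
  by (rule continuous_on_eq[of _ "\<lambda>x. gaussr d 0 - gaussl d x"])
    (use gaussr_eq[OF assms, symmetric] in \<open>auto intro!: continuous_intros gaussl_cont\<close>)

lemma gaussr_deriv: assumes "d > 0" "x > 0" shows "(gaussr d has_real_derivative - gauss d x) (at x)"
proof -
  have "(gaussl d has_real_derivative gauss d x) (at x)"
    using gaussl_deriv[of x d] at_within_interior[of x "{0..}"] assms by (simp add: interior_real_atLeast)
  then have "((\<lambda>x. gaussr d 0 - gaussl d x) has_real_derivative - gauss d x) (at x)"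
    by (auto intro!: derivative_eq_intros)
  then show ?thesis
    by (rule has_field_derivative_transform_within_open[of _ _ _ "{0<..}"])
      (use gaussr_eq[OF assms(1), symmetric] assms in auto)
qed

lemma gaussr_tendsto_0: assumes "d > 0" shows "(gaussr d \<longlongrightarrow> 0) at_top"
proof -
  have "((\<lambda>y. LINT s:{0..y}|lebesgue. gauss d s) \<longlongrightarrow> (LINT s:{0..}|lebesgue. gauss d s)) at_top"
    by (rule tendsto_set_lebesgue_integral_at_top) (use assms in \<open>auto intro!: gauss_set_integrable\<close>)
  then have "(gaussl d \<longlongrightarrow> gaussr d 0) at_top"
    by (simp add: lint_gaussl gaussr_def)
  then have "((\<lambda>x. gaussr d 0 - gaussl d x) \<longlongrightarrow> gaussr d 0 - gaussr d 0) at_top"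
    by (intro tendsto_intros)
  moreover have "\<forall>\<^sub>F x in at_top. gaussr d 0 - gaussl d x = gaussr d x"
    using eventually_ge_at_top[of 0] by eventually_elim (rule gaussr_eq[OF assms, symmetric])
  ultimately show ?thesis using Lim_transform_eventually by fastforce
qed

lemma gauss_quot: "exp ((a\<^sup>2 - s\<^sup>2) / (4 * d)) = gauss d s / gauss d a" 
  by (simp add: gauss_def exp_diff[symmetric] diff_divide_distrib)

text \<open>Monotonicity of the Mills ratio. After translation by \<open>c\<close> the integrand is
  \<open>exp (- (2 * c * s + s^2) / (4 * d))\<close>, which decreases in \<open>c\<close> for every
  \<open>s \<ge> 0\<close>.\<close>

lemma gaussr_quot_mono:
  assumes d: "d > 0" and ab: "0 \<le> a" "a \<le> b"
  shows "gaussr d b / gauss d b \<le> gaussr d a / gauss d a"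
proof -
  have int: "integrable lborel (\<lambda>s. indicator {c..} s *\<^sub>R (gauss d s / gauss d c))" for c
    using gauss_integrable[OF d]
    by (intro integrable_mult_indicator integrable_divide) auto
  have e: "gaussr d c / gauss d c = (LINT s|lborel. indicator {0..} s *\<^sub>R (gauss d (c + s) / gauss d c))" 
    and i: "integrable lborel (\<lambda>s. indicator {0..} s *\<^sub>R (gauss d (c + s) / gauss d c))" for c
  proof -
    have ind: "indicator {c..} (c + 1 * s) = (indicator {0..} s :: real)" for s by (auto simp: indicator_def)
    have "gaussr d c / gauss d c = (LINT s|lebesgue. indicator {c..} s *\<^sub>R (gauss d s / gauss d c))"
      by (simp add: gaussr_def set_lebesgue_integral_def flip: integral_divide_zero)
    also have "\<dots> = (LINT s|lborel. indicator {c..} s *\<^sub>R (gauss d s / gauss d c))"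
      by (rule integral_completion) (use int[of c] in auto)
    also have "\<dots> = (LINT s|lborel. indicator {0..} s *\<^sub>R (gauss d (c + s) / gauss d c))"
      by (subst lborel_integral_real_affine[where c=1 and t=c]) (simp_all add: ind[simplified])
    finally show "gaussr d c / gauss d c = (LINT s|lborel. indicator {0..} s *\<^sub>R (gauss d (c + s) / gauss d c))" .
    show "integrable lborel (\<lambda>s. indicator {0..} s *\<^sub>R (gauss d (c + s) / gauss d c))"
      using lborel_integrable_real_affine[OF int[of c], of 1 c] by (simp add: ind[simplified])
  qed
  show ?thesis unfolding e
  proof (rule integral_mono[OF i i])
    fix s
    have "gauss d (b + s) / gauss d b \<le> gauss d (a + s) / gauss d a" if "s \<ge> 0"
    proof -
      have "b\<^sup>2 - (b+s)\<^sup>2 \<le> a\<^sup>2 - (a+s)\<^sup>2" using that ab by (simp add: power2_eq_square algebra_simps mult_right_mono)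
      then have "(b\<^sup>2 - (b+s)\<^sup>2) / (4*d) \<le> (a\<^sup>2 - (a+s)\<^sup>2) / (4*d)" using d by (intro divide_right_mono) auto
      then show ?thesis unfolding gauss_quot[symmetric] by simp
    qed
    then show "indicator {0..} s *\<^sub>R (gauss d (b + s) / gauss d b) \<le> indicator {0..} s *\<^sub>R (gauss d (a + s) / gauss d a)"
      by (auto simp: indicator_def)
  qed
qed

lemma gauss_antimono: assumes "d > 0" "0 \<le> a" "a \<le> b" shows "gauss d b \<le> gauss d a"
proof -
  have "a\<^sup>2 / (4*d) \<le> b\<^sup>2 / (4*d)" using assms by (intro divide_right_mono power_mono) auto
  then show ?thesis by (simp add: gauss_def)
qed

lemma gaussl_quot_mono:
  assumes d: "d > 0" and ab: "0 \<le> a" "a < b"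
  shows "gaussl d a / gauss d a < gaussl d b / gauss d b"
  using gaussl_strict_mono[OF ab, of d] gauss_antimono[OF d ab(1) less_imp_le[OF ab(2)]]
    gaussl_mono[of 0 a d] gauss_pos[of d a] gauss_pos[of d b] ab
  by (intro frac_less) (auto simp: gaussl_0)

text \<open>The integrand is smallest at the right end point. This linear growth supplies an
  explicit point at which the interface equation has changed sign.\<close>

lemma gaussl_quot_ge: assumes d: "d > 0" and a: "0 \<le> a" shows "a \<le> gaussl d a / gauss d a"
proof -
  have "integral {0..a} (\<lambda>x. gauss d a) \<le> integral {0..a} (gauss d)"
    by (rule integral_le) (use gauss_antimono[OF d] integrable_continuous_interval[OF gauss_cont] in auto)
  then show ?thesis using a gauss_pos[of d a] by (simp add: gaussl_def field_simps)
qed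

section \<open>The interface equation\<close>

lemma is_interface_iff: assumes "du > 0" "dv \<ge> 0"
  shows "is_interface du dv U0 V0 a \<longleftrightarrow> a > 0 \<and>
    (if dv > 0 then du * U0 * (gaussr dv a / gauss dv a) = dv * V0 * (gaussl du a / gauss du a)
     else U0 = V0 * a / (2 * du) * (gaussl du a / gauss du a))"
proof -
  have "(LINT s:{0..a}|lebesgue. gauss d s / gauss d a) = gaussl d a / gauss d a" for d
    using lint_gaussl[of a d] by (simp add: set_lebesgue_integral_def flip: integral_divide_zero)
  moreover have "(LINT s:{a..}|lebesgue. gauss d s / gauss d a) = gaussr d a / gauss d a" for d
    by (simp add: gaussr_def set_lebesgue_integral_def flip: integral_divide_zero)
  ultimately show ?thesis unfolding is_interface_def gauss_quot by (simp only:)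
qed

text \<open>Written as \<open>\<Phi> a = 0\<close>, both forms of the equation have a continuous,
  strictly increasing left side that is negative at 0. For \<open>dv > 0\<close> this combines the
  growth of \<open>gaussl_quot_mono\<close> with the decay of
  \<open>gaussr_quot_mono\<close>.\<close>

lemma ex1_interface:
  assumes du: "du > 0" and dv: "dv \<ge> 0" and U0: "U0 > 0" and V0: "V0 > 0"
  shows "\<exists>!a. is_interface du dv U0 V0 a"
proof -
  have key: "\<exists>!a. a > 0 \<and> \<Phi> a = 0" if c: "continuous_on {0..} \<Phi>" and m: "\<And>x y. 0 \<le> x \<Longrightarrow> x < y \<Longrightarrow> \<Phi> x < \<Phi> y"
    and 0: "\<Phi> 0 < 0" and b: "b \<ge> 0" "\<Phi> b \<ge> 0" for \<Phi> :: "real \<Rightarrow> real" and b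
  proof -
    obtain a where a: "0 \<le> a" "a \<le> b" "\<Phi> a = 0"
      using IVT'[of \<Phi> 0 0 b] 0 b continuous_on_subset[OF c, of "{0..b}"] by auto
    show ?thesis
    proof (rule ex1I[of _ a])
      show "a > 0 \<and> \<Phi> a = 0" using a 0 by (cases "a = 0") auto
      show "y = a" if "y > 0 \<and> \<Phi> y = 0" for y
        using m[of a y] m[of y a] that a by (cases y a rule: linorder_cases) auto
    qed
  qed
  have gc: "continuous_on {0..} (\<lambda>a. gaussl d a / gauss d a)" for d
    using gauss_pos[of d] by (intro continuous_intros gaussl_cont gauss_cont) (metis less_irrefl)
  show ?thesis
  proof (cases "dv > 0")
    case True
    let ?\<Phi> = "\<lambda>a. dv * V0 * (gaussl du a / gauss du a) - du * U0 * (gaussr dv a / gauss dv a)"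
    \<comment> \<open>The increasing part is at least \<open>dv * V0 * b\<close> by
      \<open>gaussl_quot_ge\<close>, and the decreasing part is at most its value at 0. This
      \<open>b\<close> equates the two bounds.\<close>
    define b where "b = du * U0 * (gaussr dv 0 / gauss dv 0) / (dv * V0)"
    have b0: "b \<ge> 0" unfolding b_def using du True U0 V0 gaussr_pos[OF True, of 0] gauss_pos[of dv 0] by simp
    have "\<exists>!a. a > 0 \<and> ?\<Phi> a = 0"
    proof (rule key)
      show "continuous_on {0..} ?\<Phi>" using gauss_pos[of dv]
        by (intro continuous_intros gc gaussr_cont gauss_cont True) (metis less_irrefl)
      show "?\<Phi> x < ?\<Phi> y" if "0 \<le> x" "x < y" for x y
        using mult_strict_left_mono[OF gaussl_quot_mono[OF du that], of "dv * V0"]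
          mult_left_mono[OF gaussr_quot_mono[OF True that(1) less_imp_le[OF that(2)]], of "du * U0"] True V0 du U0 by simp
      show "?\<Phi> 0 < 0" using gaussr_pos[OF True, of 0] gauss_pos[of dv 0] du U0 by (simp add: gaussl_0)
      show "b \<ge> 0" by fact
      have "dv * V0 * b \<le> dv * V0 * (gaussl du b / gauss du b)"
        using gaussl_quot_ge[OF du b0] True V0 by (intro mult_left_mono) auto
      moreover have "du * U0 * (gaussr dv b / gauss dv b) \<le> du * U0 * (gaussr dv 0 / gauss dv 0)"
        using gaussr_quot_mono[OF True _ b0] du U0 by (intro mult_left_mono) auto
      moreover have "dv * V0 * b = du * U0 * (gaussr dv 0 / gauss dv 0)" using True V0 by (simp add: b_def)
      ultimately show "?\<Phi> b \<ge> 0" by linarith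
    qed
    moreover have "is_interface du dv U0 V0 a \<longleftrightarrow> a > 0 \<and> ?\<Phi> a = 0" for a
      unfolding is_interface_iff[OF du dv] using True by auto
    ultimately show ?thesis by simp
  next
    case False
    let ?\<Phi> = "\<lambda>a. V0 * a / (2 * du) * (gaussl du a / gauss du a) - U0"
    \<comment> \<open>One entry makes \<open>V0 * b / (2 * du)\<close> at least \<open>U0\<close>;
      the other makes the Gaussian quotient, which is at least \<open>b\<close>, no smaller than
      1.\<close>
    define b where "b = max 1 (2 * du * U0 / V0)"
    have "\<exists>!a. a > 0 \<and> ?\<Phi> a = 0"
    proof (rule key)
      show "continuous_on {0..} ?\<Phi>" using du by (intro continuous_intros gc) auto
      show "?\<Phi> x < ?\<Phi> y" if "0 \<le> x" "x < y" for x y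
      proof -
        have "V0 * x / (2 * du) * (gaussl du x / gauss du x) \<le> V0 * y / (2 * du) * (gaussl du x / gauss du x)"
          using that V0 du gaussl_mono[of 0 x du] gauss_pos[of du x]
          by (intro mult_right_mono divide_right_mono mult_left_mono) (auto simp: gaussl_0)
        also have "\<dots> < V0 * y / (2 * du) * (gaussl du y / gauss du y)"
          using that V0 du by (intro mult_strict_left_mono gaussl_quot_mono) auto
        finally show ?thesis by simp
      qed
      show "?\<Phi> 0 < 0" using U0 by simp
      show "b \<ge> 0" by (simp add: b_def)
      have "2 * du * U0 / V0 \<le> b" by (simp add: b_def)
      then have "U0 \<le> V0 * b / (2 * du)" using V0 du by (simp add: field_simps)
      also have "\<dots> * 1 \<le> V0 * b / (2 * du) * (gaussl du b / gauss du b)"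
        using gaussl_quot_ge[OF du, of b] V0 du by (intro mult_left_mono) (auto simp: b_def)
      finally show "?\<Phi> b \<ge> 0" by simp
    qed
    moreover have "is_interface du dv U0 V0 a \<longleftrightarrow> a > 0 \<and> ?\<Phi> a = 0" for a
      unfolding is_interface_iff[OF du dv] using False by auto
    ultimately show ?thesis by simp
  qed
qed

lemma bm_If: assumes "bm {0..X} y" "bm {0..X} z" shows "bm {0..X} (\<lambda>x. if x \<le> (c::real) then y x else z x)"
proof -
  obtain C where C: "\<And>x. x \<in> {0..X} \<Longrightarrow> \<bar>y x\<bar> \<le> C" using bm_bound[OF assms(1)] by metis
  obtain D where D: "\<And>x. x \<in> {0..X} \<Longrightarrow> \<bar>z x\<bar> \<le> D" using bm_bound[OF assms(2)] by metis
  have "(\<lambda>x. if x \<in> {..c} then y x else z x) \<in> borel_measurable (lebesgue_on {0..X})"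
  proof (rule measurable_If_set)
    have "{0..X} \<inter> {..c} \<in> sets lebesgue" by (intro sets.Int) auto
    then show "{..c} \<inter> space (lebesgue_on {0..X}) \<in> sets (lebesgue_on {0..X})"
      by (auto simp: sets_restrict_space_iff Int_commute)
  qed (use assms in \<open>auto simp: bm_def\<close>)
  then show ?thesis by (intro bmI[where C="max C D"]) (use C D in \<open>auto simp: le_max_iff_disj\<close>)
qed

text \<open>By the fundamental theorem with one exceptional point, \<open>G\<close> is a constant
  plus the primitive of the continuous function \<open>g\<close>, and such a primitive is
  differentiable everywhere.\<close>

lemma piecewise_derivative_extends:
  fixes G g :: "real \<Rightarrow> real"
  assumes G: "continuous_on {0..} G" and g: "continuous_on {0..} g"
    and d: "\<And>x. x > 0 \<Longrightarrow> x \<noteq> a \<Longrightarrow> (G has_real_derivative g x) (at x)"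
    and x: "x \<ge> 0"
  shows "(G has_real_derivative g x) (at x within {0..})"
proof -
  have G0: "integral {0..y} g = G y - G 0" if "y \<ge> 0" for y
  proof (rule integral_unique, rule fundamental_theorem_of_calculus_interior_strong[where S="{a}"])
    show "(G has_vector_derivative g x) (at x)" if "x \<in> {0<..<y} - {a}" for x
      using d[of x] that by (simp add: has_real_derivative_iff_has_vector_derivative)
    show "continuous_on {0..y} G" by (rule continuous_on_subset[OF G]) auto
  qed (use that in auto)
  have "((\<lambda>y. integral {0..y} g) has_real_derivative g x) (at x within {0..x+1})"
    by (rule integral_has_real_derivative) (use x in \<open>auto intro: continuous_on_subset[OF g]\<close>)
  then have "((\<lambda>y. G 0 + integral {0..y} g) has_real_derivative 0 + g x) (at x within {0..x+1})"
    by (intro DERIV_add) auto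
  then have "(G has_real_derivative g x) (at x within {0..x+1})"
    using has_field_derivative_transform_within[where d=1 and g=G] x G0 by fastforce
  moreover have "at x within {0..x+1} = at x within {0..}"
    by (rule at_within_nhd[of _ "{..<x+1}"]) auto
  ultimately show ?thesis by simp
qed

section \<open>The self-similar solution and its potential\<close>

locale stefan =
  fixes du dv U0 V0 a :: real
  assumes du: "du > 0" and dv: "dv \<ge> 0" and U0: "U0 > 0" and V0: "V0 > 0"
    and iface: "is_interface du dv U0 V0 a"
begin

definition fl where "fl \<eta> = U0 * (1 - gaussl du \<eta> / gaussl du a)"
definition fr where "fr \<eta> = (if dv > 0 then - V0 * (1 - gaussr dv \<eta> / gaussr dv a) else - V0)"
definition f where "f \<eta> = (if \<eta> \<le> a then fl \<eta> else fr \<eta>)"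
definition Df where "Df \<eta> = du * max (f \<eta>) 0 + dv * min (f \<eta>) 0"
text \<open>The potential of the profile is sought in the form \<open>t * G (x / sqrt t)\<close>.
  Its time derivative is \<open>Df\<close> if \<open>G = Df + \<eta> * g / 2\<close> with
  \<open>g = G'\<close>, and its second space derivative is \<open>f + V0\<close> if
  \<open>g' = f + V0\<close>. Differentiating the first relation yields
  \<open>g = 2 * Df' + \<eta> * (f + V0)\<close>, which is the formula here on the left of the
  interface and that of \<open>gr\<close> on its right. For \<open>dv = 0\<close> the Gaussian term
  of \<open>gr\<close> vanishes through its factor \<open>dv\<close>.\<close>

definition gl where "gl \<eta> = - (2 * du * U0 / gaussl du a) * gauss du \<eta> + \<eta> * (fl \<eta> + V0)"
definition gr where "gr \<eta> = - (2 * dv * V0 / gaussr dv a) * gauss dv \<eta> + \<eta> * (fr \<eta> + V0)"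
definition g where "g \<eta> = (if \<eta> \<le> a then gl \<eta> else gr \<eta>)"
definition G where "G \<eta> = (if \<eta> \<le> a then du * fl \<eta> + \<eta> * gl \<eta> / 2 else dv * fr \<eta> + \<eta> * gr \<eta> / 2)"

lemma a_pos: "a > 0" using iface by (simp add: is_interface_def)

lemma gaussl_a_pos: "gaussl du a > 0" by (rule gaussl_pos[OF a_pos])

lemma gaussr_a_pos: "dv > 0 \<Longrightarrow> gaussr dv a > 0" using gaussr_pos a_pos by simp

lemma fl_a: "fl a = 0" using gaussl_a_pos by (simp add: fl_def)

lemma fr_a: "dv * fr a = 0" using gaussr_a_pos dv by (auto simp: fr_def)

text \<open>Both forms of the interface equation say that \<open>g\<close> is continuous at
  \<open>a\<close>. For \<open>dv > 0\<close> this is continuity of the flux. For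
  \<open>dv = 0\<close> the right side is 0, and the flux from the left balances the jump
  \<open>V0\<close> moving with the interface, the Stefan condition.\<close>

lemma flux: "gl a = gr a"
proof (cases "dv > 0")
  case True
  have "du * U0 * (gaussr dv a / gauss dv a) = dv * V0 * (gaussl du a / gauss du a)"
    using iface True is_interface_iff[OF du dv] by auto
  then have "du * U0 / gaussl du a * gauss du a = dv * V0 / gaussr dv a * gauss dv a"
    using gaussl_a_pos gaussr_a_pos[OF True] gauss_pos[of du a] gauss_pos[of dv a] by (simp add: field_simps)
  moreover have "fr a = 0" using fr_a True by simp
  ultimately show ?thesis by (simp add: gl_def gr_def fl_a)
next
  case False
  then have 0: "dv = 0" using dv by simp
  have "U0 = V0 * a / (2 * du) * (gaussl du a / gauss du a)"
    using iface 0 is_interface_iff[OF du dv] by auto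
  then have "2 * du * U0 / gaussl du a * gauss du a = a * V0"
    using gaussl_a_pos du gauss_pos[of du a] by (simp add: field_simps)
  then show ?thesis unfolding gl_def gr_def fl_a fr_def by (simp add: 0)
qed

lemma fl_cont: "continuous_on {0..} fl"
  unfolding fl_def[abs_def] using gaussl_a_pos by (intro continuous_intros gaussl_cont) auto

lemma fr_cont: "continuous_on {0..} fr"
proof (cases "dv > 0")
  case True
  have "continuous_on {0..} (\<lambda>x. - V0 * (1 - gaussr dv x / gaussr dv a))"
    using gaussr_a_pos[OF True] by (intro continuous_intros gaussr_cont True) auto
  then show ?thesis using True by (simp add: fr_def[abs_def])
qed (simp add: fr_def[abs_def])

lemma cont_glue:
  assumes "continuous_on {0..} y" "continuous_on {0..} z" "y a = z a"
  shows "continuous_on {0..} (\<lambda>x. if x \<le> a then y x else z x :: real)"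
proof -
  have "continuous_on ({0..a} \<union> {a..}) (\<lambda>x. if x \<le> a then y x else z x)"
    by (rule continuous_on_If) (use assms a_pos in \<open>auto intro: continuous_on_subset\<close>)
  moreover have "{0..a} \<union> {a..} = {0..}" using a_pos by auto
  ultimately show ?thesis by simp
qed

lemma glr_cont: "continuous_on {0..} gl" "continuous_on {0..} gr"
  unfolding gl_def[abs_def] gr_def[abs_def]
  by (intro continuous_intros gauss_cont fl_cont fr_cont)+

lemma g_cont: "continuous_on {0..} g"
  unfolding g_def[abs_def] by (rule cont_glue[OF glr_cont flux])

lemma G_cont: "continuous_on {0..} G"
  unfolding G_def[abs_def]
  by (rule cont_glue) (auto intro!: continuous_intros glr_cont fl_cont fr_cont simp: flux fl_a fr_a)

lemma fl_ge0: "0 \<le> \<eta> \<Longrightarrow> \<eta> \<le> a \<Longrightarrow> 0 \<le> fl \<eta>"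
  unfolding fl_def using gaussl_a_pos gaussl_mono[of \<eta> a du] U0 by auto

lemma fl_le: "0 \<le> \<eta> \<Longrightarrow> fl \<eta> \<le> U0"
  unfolding fl_def using gaussl_a_pos gaussl_mono[of 0 \<eta> du] U0 by (auto simp: gaussl_0 mult_le_cancel_left1)

lemma fr_le0: "a \<le> \<eta> \<Longrightarrow> fr \<eta> \<le> 0"
  unfolding fr_def using gaussr_a_pos gaussr_mono[of dv a \<eta>] V0 a_pos by (auto simp: field_simps)

lemma fr_ge: "a \<le> \<eta> \<Longrightarrow> - V0 \<le> fr \<eta>"
  unfolding fr_def using gaussr_a_pos gaussr_pos[of dv \<eta>] V0 a_pos by (auto simp: field_simps)

lemma f_bounds: "0 \<le> \<eta> \<Longrightarrow> - V0 \<le> f \<eta>" "0 \<le> \<eta> \<Longrightarrow> f \<eta> \<le> U0"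
  using fl_ge0[of \<eta>] fl_le[of \<eta>] fr_le0[of \<eta>] fr_ge[of \<eta>] U0 V0 by (auto simp: f_def)

text \<open>At a positive distance to the left of the interface the profile has a positive lower
  bound. This later turns smallness of the product of \<open>v\<close> and the profile into
  smallness of \<open>v\<close>.\<close>

lemma f_pos: assumes "0 \<le> \<eta>" "\<eta> \<le> b" "b < a" shows "f \<eta> \<ge> fl b" "fl b > 0"
proof -
  have "gaussl du \<eta> / gaussl du a \<le> gaussl du b / gaussl du a"
    using gaussl_mono[of \<eta> b du] assms gaussl_a_pos by (intro divide_right_mono) auto
  then show "f \<eta> \<ge> fl b" using assms U0 by (simp add: f_def fl_def)
  have "gaussl du b < gaussl du a" using assms by (intro gaussl_strict_mono) auto
  then show "fl b > 0" using gaussl_a_pos U0 by (simp add: fl_def)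
qed

lemma Df_eq: assumes "0 \<le> \<eta>" shows "Df \<eta> = (if \<eta> \<le> a then du * fl \<eta> else dv * fr \<eta>)"
  using assms fl_ge0[of \<eta>] fr_le0[of \<eta>] by (auto simp: Df_def f_def max_def min_def)

lemma Df_cont: "continuous_on {0..} Df"
proof -
  have "continuous_on {0..} (\<lambda>x. if x \<le> a then du * fl x else dv * fr x)"
    by (rule cont_glue) (auto intro!: continuous_intros fl_cont fr_cont simp: fl_a fr_a)
  then show ?thesis by (rule continuous_on_eq) (simp add: Df_eq)
qed

lemma G_eq: "0 \<le> \<eta> \<Longrightarrow> G \<eta> = Df \<eta> + \<eta> * g \<eta> / 2"
  by (simp add: Df_eq G_def g_def)

lemma f0: "f 0 = U0" "Df 0 = du * U0"
  using a_pos U0 by (auto simp: f_def fl_def gaussl_0 Df_def)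

lemma gaussl_deriv': "x > 0 \<Longrightarrow> (gaussl d has_real_derivative gauss d x) (at x)"
  using gaussl_deriv[of x d] at_within_interior[of x "{0..}"] by (simp add: interior_real_atLeast)

lemma fl_deriv: "x > 0 \<Longrightarrow> (fl has_real_derivative - U0 * gauss du x / gaussl du a) (at x)"
  unfolding fl_def[abs_def] using gaussl_a_pos
  by (auto intro!: derivative_eq_intros gaussl_deriv')

lemma fr_deriv: assumes "x > 0" shows "(fr has_real_derivative (if dv > 0 then - V0 * gauss dv x / gaussr dv a else 0)) (at x)"
proof (cases "dv > 0")
  case True
  have "((\<lambda>x. - V0 * (1 - gaussr dv x / gaussr dv a)) has_real_derivative - V0 * gauss dv x / gaussr dv a) (at x)"
    using gaussr_a_pos[OF True] True assms by (auto intro!: derivative_eq_intros gaussr_deriv)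
  then show ?thesis using True by (simp add: fr_def[abs_def])
qed (simp add: fr_def[abs_def])

text \<open>The Gaussian satisfies \<open>2 * du * gauss' = - x * gauss\<close>, so the derivative
  of the first term cancels the contribution of \<open>fl'\<close> in the second. This is the
  ordinary differential equation of the profile.\<close>

lemma gl_deriv: assumes "x > 0" shows "(gl has_real_derivative fl x + V0) (at x)"
proof -
  have "(gl has_real_derivative - (2 * du * U0 / gaussl du a) * (- (x / (2 * du)) * gauss du x) +
     (1 * (fl x + V0) + (- U0 * gauss du x / gaussl du a + 0) * x)) (at x)"
    unfolding gl_def[abs_def]
    by (intro DERIV_add DERIV_cmult DERIV_mult DERIV_ident DERIV_const fl_deriv assms gauss_deriv) (use du in auto)
  moreover have "- (2 * du * U0 / gaussl du a) * (- (x / (2 * du)) * gauss du x) +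
     (1 * (fl x + V0) + (- U0 * gauss du x / gaussl du a + 0) * x) = fl x + V0"
    using du gaussl_a_pos by (simp add: field_simps)
  ultimately show ?thesis by simp
qed

lemma gr_deriv: assumes "x > 0" shows "(gr has_real_derivative fr x + V0) (at x)"
proof (cases "dv > 0")
  case True
  have "(gr has_real_derivative - (2 * dv * V0 / gaussr dv a) * (- (x / (2 * dv)) * gauss dv x) +
     (1 * (fr x + V0) + ((if dv > 0 then - V0 * gauss dv x / gaussr dv a else 0) + 0) * x)) (at x)"
    unfolding gr_def[abs_def]
    by (intro DERIV_add DERIV_cmult DERIV_mult DERIV_ident DERIV_const fr_deriv assms gauss_deriv) (use True in auto)
  moreover have "- (2 * dv * V0 / gaussr dv a) * (- (x / (2 * dv)) * gauss dv x) +
     (1 * (fr x + V0) + ((if dv > 0 then - V0 * gauss dv x / gaussr dv a else 0) + 0) * x) = fr x + V0"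
    using True gaussr_a_pos by (simp add: field_simps)
  ultimately show ?thesis by (simp only:)
next
  case False
  then have "dv = 0" using dv by simp
  then show ?thesis unfolding gr_def[abs_def] fr_def by simp
qed

lemma glue_deriv:
  assumes "\<And>x. x > 0 \<Longrightarrow> (y has_real_derivative y' x) (at x)" "\<And>x. x > 0 \<Longrightarrow> (z has_real_derivative z' x) (at x)"
    and x: "x > 0" "x \<noteq> a"
  shows "((\<lambda>x. if x \<le> a then y x else z x) has_real_derivative (if x \<le> a then y' x else z' x)) (at x)"
proof (cases "x < a")
  case True
  have "((\<lambda>x. if x \<le> a then y x else z x) has_real_derivative y' x) (at x)"
    by (rule has_field_derivative_transform_within_open[OF assms(1)[OF x(1)], of "{..<a}"]) (use True in auto)
  then show ?thesis using True by simp
next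
  case False
  have "((\<lambda>x. if x \<le> a then y x else z x) has_real_derivative z' x) (at x)"
    by (rule has_field_derivative_transform_within_open[OF assms(2)[OF x(1)], of "{a<..}"]) (use False x in auto)
  moreover have "\<not> x \<le> a" using False x by simp
  ultimately show ?thesis by simp
qed

lemma g_deriv: "x > 0 \<Longrightarrow> x \<noteq> a \<Longrightarrow> (g has_real_derivative f x + V0) (at x)"
  using glue_deriv[OF gl_deriv gr_deriv, of x] by (auto simp: g_def[abs_def] f_def split: if_splits)

lemma G_deriv': assumes "x > 0" "x \<noteq> a" shows "(G has_real_derivative g x) (at x)"
proof -
  have l: "((\<lambda>x. du * fl x + x * gl x / 2) has_real_derivative gl x) (at x)" if x: "x > 0" for x
  proof -
    have "((\<lambda>x. du * fl x + x * gl x / 2) has_real_derivative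
      du * (- U0 * gauss du x / gaussl du a) + (1 * gl x + (fl x + V0) * x) / 2) (at x)"
      by (intro DERIV_add DERIV_cmult DERIV_cdivide DERIV_mult DERIV_ident fl_deriv gl_deriv x)
    moreover have "du * (- U0 * gauss du x / gaussl du a) + (1 * gl x + (fl x + V0) * x) / 2 = gl x"
      by (simp add: gl_def field_simps)
    ultimately show ?thesis by simp
  qed
  have r: "((\<lambda>x. dv * fr x + x * gr x / 2) has_real_derivative gr x) (at x)" if x: "x > 0" for x
  proof -
    have "((\<lambda>x. dv * fr x + x * gr x / 2) has_real_derivative
      dv * (if dv > 0 then - V0 * gauss dv x / gaussr dv a else 0) + (1 * gr x + (fr x + V0) * x) / 2) (at x)"
      by (intro DERIV_add DERIV_cmult DERIV_cdivide DERIV_mult DERIV_ident fr_deriv gr_deriv x)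
    moreover have "dv * (if dv > 0 then - V0 * gauss dv x / gaussr dv a else 0) + (1 * gr x + (fr x + V0) * x) / 2 = gr x"
      using dv by (simp add: gr_def field_simps)
    ultimately show ?thesis by simp
  qed
  show ?thesis using glue_deriv[OF l r assms] by (simp add: G_def[abs_def] g_def)
qed

text \<open>Differentiability across the interface rests on \<open>g_cont\<close>, hence on the
  interface equation.\<close>

lemma G_deriv: "x \<ge> 0 \<Longrightarrow> (G has_real_derivative g x) (at x within {0..})"
  by (rule piecewise_derivative_extends[OF G_cont g_cont G_deriv'])

text \<open>The time integral from 0 of \<open>Df (x / sqrt s)\<close>, in closed form. Thanks to
  the closed form no integral whose integrand is singular at \<open>s = 0\<close> has to be
  differentiated.\<close>

definition Qf where "Qf x t = t * G (x / sqrt t)"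
definition pf where "pf x t = sqrt t * g (x / sqrt t)"

lemma Qf_deriv_x: assumes t: "t > 0" and x: "x \<ge> 0"
  shows "((\<lambda>x. Qf x t) has_real_derivative pf x t) (at x within {0..})"
proof -
  have "(G \<circ> (\<lambda>x. x / sqrt t) has_real_derivative g (x / sqrt t) * (1 / sqrt t)) (at x within {0..})"
  proof (rule DERIV_image_chain)
    show "((\<lambda>x. x / sqrt t) has_real_derivative 1 / sqrt t) (at x within {0..})"
      by (rule DERIV_cdivide[OF DERIV_ident])
    show "(G has_real_derivative g (x / sqrt t)) (at (x / sqrt t) within (\<lambda>x. x / sqrt t) ` {0..})"
      by (rule DERIV_subset[OF G_deriv]) (use t x in auto)
  qed
  then have "((\<lambda>x. Qf x t) has_real_derivative t * (g (x / sqrt t) * (1 / sqrt t))) (at x within {0..})"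
    unfolding Qf_def o_def by (rule DERIV_cmult)
  moreover have "t * (g (x / sqrt t) * (1 / sqrt t)) = pf x t"
  proof -
    have "t / sqrt t = sqrt t" using t by (simp add: real_div_sqrt)
    then show ?thesis by (metis (no_types, opaque_lifting) mult.commute mult.right_neutral pf_def times_divide_eq_right)
  qed
  ultimately show ?thesis by simp
qed

lemma pf_integral: assumes t: "t > 0" and x: "x \<ge> 0"
  shows "pf x t = pf 0 t + integral {0..x} (\<lambda>y. f (y / sqrt t) + V0)"
proof -
  have "((\<lambda>y. f (y / sqrt t) + V0) has_integral pf x t - pf 0 t) {0..x}"
  proof (rule fundamental_theorem_of_calculus_interior_strong[where S="{a * sqrt t}"])
    show "continuous_on {0..x} (\<lambda>y. pf y t)"
      unfolding pf_def by (intro continuous_intros continuous_on_compose2[OF g_cont]) (use t in auto)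
    fix y assume y: "y \<in> {0<..<x} - {a * sqrt t}"
    have "((\<lambda>y. g (y / sqrt t)) has_real_derivative (f (y / sqrt t) + V0) * (1 / sqrt t)) (at y)"
    proof (rule DERIV_chain2[where g="\<lambda>y. y / sqrt t"])
      show "(g has_real_derivative f (y / sqrt t) + V0) (at (y / sqrt t))"
        by (rule g_deriv) (use y t in \<open>auto simp: field_simps\<close>)
    qed (rule DERIV_cdivide[OF DERIV_ident])
    then have "((\<lambda>y. pf y t) has_real_derivative sqrt t * ((f (y / sqrt t) + V0) * (1 / sqrt t))) (at y)"
      unfolding pf_def by (rule DERIV_cmult)
    then show "((\<lambda>y. pf y t) has_vector_derivative f (y / sqrt t) + V0) (at y)"
      using t by (simp add: has_real_derivative_iff_has_vector_derivative)
  qed (use x in auto)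
  then show ?thesis by (simp add: integral_unique)
qed

lemma Qf_deriv_t: assumes t: "t > 0" and x: "x \<ge> 0"
  shows "((\<lambda>t. Qf x t) has_real_derivative Df (x / sqrt t)) (at t)"
proof (cases "x = 0")
  case True
  have "G 0 = Df 0" by (simp add: G_eq)
  then show ?thesis using True by (auto simp: Qf_def intro!: derivative_eq_intros)
next
  case False
  let ?e = "x / sqrt t"
  have e: "?e > 0" using False x t by simp
  have "at ?e within {0..} = at ?e" using e by (intro at_within_interior) (simp add: interior_real_atLeast)
  then have G: "(G has_real_derivative g ?e) (at ?e)" using G_deriv[of ?e] e by simp
  have s: "((\<lambda>t. x / sqrt t) has_real_derivative - ?e / (2 * t)) (at t)"
  proof -
    have "((\<lambda>t. x / sqrt t) has_real_derivative (0 * sqrt t - x * (inverse (sqrt t) / 2)) / (sqrt t * sqrt t)) (at t)"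
      using t by (intro DERIV_divide DERIV_const DERIV_real_sqrt) auto
    moreover have "(0 * sqrt t - x * (inverse (sqrt t) / 2)) / (sqrt t * sqrt t) = - ?e / (2 * t)"
      using t by (simp add: divide_simps)
    ultimately show ?thesis by (simp only:)
  qed
  have "((\<lambda>t. Qf x t) has_real_derivative 1 * G ?e + (g ?e * (- ?e / (2 * t))) * t) (at t)"
    unfolding Qf_def by (intro DERIV_mult DERIV_ident DERIV_chain2[OF G s])
  moreover have "1 * G ?e + (g ?e * (- ?e / (2 * t))) * t = Df ?e"
    using t e by (simp add: G_eq)
  ultimately show ?thesis by simp
qed

lemma f_tendsto: "(f \<longlongrightarrow> - V0) at_top"
proof -
  have "(fr \<longlongrightarrow> - V0) at_top"
  proof (cases "dv > 0")
    case True
    have "((\<lambda>x. - V0 * (1 - gaussr dv x / gaussr dv a)) \<longlongrightarrow> - V0 * (1 - 0 / gaussr dv a)) at_top"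
      using gaussr_a_pos[OF True] by (intro tendsto_intros gaussr_tendsto_0 True) auto
    then show ?thesis using True by (simp add: fr_def[abs_def])
  qed (simp add: fr_def[abs_def])
  moreover have "\<forall>\<^sub>F x in at_top. fr x = f x"
    using eventually_gt_at_top[of a] by eventually_elim (auto simp: f_def)
  ultimately show ?thesis by (rule Lim_transform_eventually)
qed

lemma Df_bound: "0 \<le> \<eta> \<Longrightarrow> \<bar>Df \<eta>\<bar> \<le> (du + dv) * max U0 V0"
proof -
  assume e: "0 \<le> \<eta>"
  have "\<bar>Df \<eta>\<bar> \<le> du * \<bar>max (f \<eta>) 0\<bar> + dv * \<bar>min (f \<eta>) 0\<bar>"
    unfolding Df_def using abs_triangle_ineq[of "du * max (f \<eta>) 0" "dv * min (f \<eta>) 0"] du dv by (simp add: abs_mult)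
  also have "\<dots> \<le> du * max U0 V0 + dv * max U0 V0"
    using f_bounds[OF e] du dv U0 V0 by (intro add_mono mult_left_mono) auto
  finally show ?thesis by (simp add: algebra_simps)
qed

text \<open>Expanding \<open>t * G (x / sqrt t)\<close>, all terms carry a positive power of
  \<open>t\<close> except \<open>x^2 * (f (x / sqrt t) + V0) / 2\<close>. That one vanishes because
  \<open>x / sqrt t\<close> tends to infinity and \<open>f\<close> tends to \<open>- V0\<close>
  there.\<close>

lemma Qf_tendsto_0: assumes x: "x \<ge> 0" shows "((\<lambda>t. Qf x t) \<longlongrightarrow> 0) (at_right 0)"
proof (cases "x = 0")
  case True
  have "((\<lambda>t. t * G 0) \<longlongrightarrow> 0 * G 0) (at_right 0)" by (intro tendsto_intros)
  then show ?thesis using True by (simp add: Qf_def)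
next
  case False
  then have x0: "x > 0" using x by simp
  let ?C = "(du + dv) * max U0 V0" and ?c = "2 * dv * V0 / gaussr dv a"
  have lim: "filterlim (\<lambda>t. x / sqrt t) at_top (at_right 0)" using x0 by real_asymp
  have c0: "?c \<ge> 0" using dv V0 gaussr_a_pos by (cases "dv > 0") (auto intro!: divide_nonneg_nonneg less_imp_le)
  have "((\<lambda>t. t * ?C + x * sqrt t * ?c / 2 + x\<^sup>2 * (f (x / sqrt t) + V0) / 2) \<longlongrightarrow>
      0 * ?C + x * sqrt 0 * ?c / 2 + x\<^sup>2 * (- V0 + V0) / 2) (at_right 0)"
    by (intro tendsto_intros filterlim_compose[OF f_tendsto lim]) auto
  then have L: "((\<lambda>t. t * ?C + x * sqrt t * ?c / 2 + x\<^sup>2 * (f (x / sqrt t) + V0) / 2) \<longlongrightarrow> 0) (at_right 0)" by simp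
  show ?thesis
  proof (rule Lim_null_comparison[OF _ L])
    have "\<forall>\<^sub>F t in at_right 0. x / sqrt t > a" using lim by (simp add: filterlim_at_top_dense)
    moreover have "\<forall>\<^sub>F t in at_right (0::real). t > 0" by (simp add: eventually_at_right_less)
    ultimately show "\<forall>\<^sub>F t in at_right 0. norm (Qf x t) \<le> t * ?C + x * sqrt t * ?c / 2 + x\<^sup>2 * (f (x / sqrt t) + V0) / 2"
    proof eventually_elim
      case (elim t)
      let ?e = "x / sqrt t"
      have e: "?e \<ge> 0" "?e > a" using elim x0 by auto
      have te: "t * ?e = x * sqrt t" "t * ?e * ?e = x\<^sup>2"
        using elim by (simp_all add: field_simps power2_eq_square)
      have "Qf x t = t * Df ?e - x * sqrt t * (?c * gauss dv ?e) / 2 + x\<^sup>2 * (f ?e + V0) / 2"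
      proof -
        have "g ?e = - ?c * gauss dv ?e + ?e * (f ?e + V0)" using e by (simp add: g_def gr_def f_def)
        moreover have "t * (D + e * (- c * \<gamma> + e * F) / 2) = t * D - (t * e) * (c * \<gamma>) / 2 + (t * e * e) * F / 2"
          for D e c \<gamma> F :: real by (simp add: field_simps)
        ultimately show ?thesis unfolding Qf_def G_eq[OF e(1)] using te by metis
      qed
      moreover have "\<bar>t * Df ?e\<bar> \<le> t * ?C" using Df_bound[OF e(1)] elim by (simp add: abs_mult)
      moreover have "\<bar>x * sqrt t * (?c * gauss dv ?e) / 2\<bar> \<le> x * sqrt t * ?c / 2"
      proof -
        have "gauss dv ?e \<le> 1" using dv by (simp add: gauss_def)
        then have "?c * gauss dv ?e \<le> ?c * 1" using c0 by (intro mult_left_mono) auto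
        then have "x * sqrt t * (?c * gauss dv ?e) \<le> x * sqrt t * ?c" using x0 elim by (intro mult_left_mono) auto
        moreover have "0 \<le> x * sqrt t * (?c * gauss dv ?e)" using x0 elim c0 gauss_pos[of dv ?e] by (intro mult_nonneg_nonneg) auto
        moreover have "0 \<le> A \<Longrightarrow> A \<le> B \<Longrightarrow> \<bar>A / 2\<bar> \<le> B / 2" for A B :: real by simp
        ultimately show ?thesis by blast
      qed
      moreover have "0 \<le> x\<^sup>2 * (f ?e + V0) / 2" using f_bounds(1)[OF e(1)] by simp
      ultimately show ?case unfolding real_norm_def by linarith
    qed
  qed
qed

text \<open>The mean value theorem on {s..t} bounds the increment by the supremum of
  \<open>Df\<close> times \<open>t\<close>. Letting \<open>s\<close> tend to 0 removes the value at
  the lower end.\<close>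

lemma Qf_bound: assumes t: "t > 0" and x: "x \<ge> 0" shows "\<bar>Qf x t\<bar> \<le> (du + dv) * max U0 V0 * t"
proof (rule tendsto_upperbound)
  let ?C = "(du + dv) * max U0 V0"
  have C0: "?C \<ge> 0" using du dv U0 by simp
  have "((\<lambda>s. \<bar>Qf x t - Qf x s\<bar>) \<longlongrightarrow> \<bar>Qf x t - 0\<bar>) (at_right 0)"
    by (intro tendsto_intros Qf_tendsto_0 x)
  then show "((\<lambda>s. \<bar>Qf x t - Qf x s\<bar>) \<longlongrightarrow> \<bar>Qf x t\<bar>) (at_right 0)" by simp
  have "\<forall>\<^sub>F s in at_right 0. s < t" using t by (intro eventually_at_rightI[of 0 t]) auto
  moreover have "\<forall>\<^sub>F t in at_right (0::real). t > 0" by (simp add: eventually_at_right_less)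
  ultimately show "\<forall>\<^sub>F s in at_right 0. \<bar>Qf x t - Qf x s\<bar> \<le> ?C * t"
  proof eventually_elim
    case (elim s)
    have "\<exists>z>s. z < t \<and> Qf x t - Qf x s = (t - s) * Df (x / sqrt z)"
      by (rule MVT2) (use elim x in \<open>auto intro!: Qf_deriv_t\<close>)
    then obtain z where z: "z > s" "z < t" "Qf x t - Qf x s = (t - s) * Df (x / sqrt z)" by blast
    have "\<bar>Qf x t - Qf x s\<bar> = (t - s) * \<bar>Df (x / sqrt z)\<bar>" using z elim by (simp add: abs_mult)
    also have "\<dots> \<le> t * ?C" using z elim x by (intro mult_mono Df_bound) auto
    finally show ?case by (simp add: mult.commute)
  qed
qed simp

lemma f_bm: assumes t: "t > 0" shows "bm {0..X} (\<lambda>x. f (x / sqrt t))"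
proof -
  have l: "bm {0..X} (\<lambda>x. fl (x / sqrt t))" and r: "bm {0..X} (\<lambda>x. fr (x / sqrt t))"
    by (rule bm_cont, rule continuous_on_compose2[OF fl_cont] continuous_on_compose2[OF fr_cont],
        use t in \<open>auto intro!: continuous_intros\<close>)+
  have "f (x / sqrt t) = (if x \<le> a * sqrt t then fl (x / sqrt t) else fr (x / sqrt t))" for x
    using t by (simp add: f_def field_simps)
  then show ?thesis using bm_If[OF l r, of "a * sqrt t"] by simp
qed

lemma f_L1lim: assumes t: "t > 0" shows "L1lim X (at t) (\<lambda>s x. f (x / sqrt s)) (\<lambda>x. f (x / sqrt t))"
proof (rule L1lim_pointwise[where N="{a * sqrt t}" and C="max U0 V0"])
  show "\<bar>f (x / sqrt s)\<bar> \<le> max U0 V0" if "s > 0" "x \<in> {0..X}" for s x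
    using f_bounds[of "x / sqrt s"] that U0 V0 by (auto simp: abs_le_iff)
  fix x assume x: "x \<in> {0..X} - {a * sqrt t}"
  let ?e = "x / sqrt t"
  have s: "((\<lambda>s. x / sqrt s) \<longlongrightarrow> ?e) (at t)" using t by (intro tendsto_intros) auto
  have ev0: "\<forall>\<^sub>F s in at t. s > 0" using t
    by (metis eventually_at_topological greaterThan_iff open_greaterThan)
  have ne: "?e \<noteq> a" "?e \<ge> 0" using x t by (auto simp: field_simps)
  have "filterlim (\<lambda>s. x / sqrt s) (at ?e within {0..}) (at t) \<or> True" by simp
  have c: "((\<lambda>s. h (x / sqrt s)) \<longlongrightarrow> h ?e) (at t)" if "continuous_on {0..} h" for h :: "real \<Rightarrow> real"
    by (rule continuous_on_tendsto_compose[OF that s]) (use ne x ev0 in \<open>auto elim!: eventually_mono\<close>)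
  show "((\<lambda>s. f (x / sqrt s)) \<longlongrightarrow> f ?e) (at t)"
  proof (cases "?e < a")
    case True
    have "\<forall>\<^sub>F s in at t. fl (x / sqrt s) = f (x / sqrt s)"
      using order_tendstoD(2)[OF s True] by eventually_elim (simp add: f_def)
    then show ?thesis using Lim_transform_eventually[OF c[OF fl_cont]] True by (simp add: f_def)
  next
    case False
    then have "?e > a" using ne by simp
    have "\<forall>\<^sub>F s in at t. fr (x / sqrt s) = f (x / sqrt s)"
      using order_tendstoD(1)[OF s \<open>?e > a\<close>] by eventually_elim (simp add: f_def)
    then show ?thesis using Lim_transform_eventually[OF c[OF fr_cont]] \<open>?e > a\<close> by (simp add: f_def)
  qed
qed (use t f_bm in auto)

lemma profile_eq: assumes "0 \<le> \<eta>" shows "profile du dv U0 V0 \<eta> = f \<eta>"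
proof -
  have "interface du dv U0 V0 = a"
    unfolding interface_def using ex1_interface[OF du dv U0 V0] iface by (rule the1_equality)
  then show ?thesis
    by (simp only: profile_def Let_def f_def fl_def fr_def gauss_def[symmetric] lint_gaussl gaussr_def)
qed

end

section \<open>Self-similar large-time behaviour\<close>

lemma isCont_integral_L1lim:
  assumes "L1lim X (at t) (\<lambda>s x. h x s) (\<lambda>x. h x t)"
  shows "isCont (\<lambda>t. integral {0..X} (\<lambda>x. h x t)) t"
  using L1lim_integral[OF assms] by (simp add: isCont_def)

text \<open>The gauge integral of a derivative exists without any continuity of \<open>e'\<close>,
  so \<open>e'\<close> can be compared directly with its integrable majorant.\<close>

lemma derivative_le_integral:
  fixes e :: "real \<Rightarrow> real"
  assumes e: "\<And>t. t \<in> {a..b} \<Longrightarrow> (e has_real_derivative e' t) (at t)" and ab: "a \<le> b"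
    and le: "\<And>t. t \<in> {a..b} \<Longrightarrow> e' t \<le> h t" and h: "h integrable_on {a..b}"
  shows "e b - e a \<le> integral {a..b} h"
proof -
  have i: "(e' has_integral e b - e a) {a..b}"
    by (rule fundamental_theorem_of_calculus[OF ab])
      (use e in \<open>auto simp flip: has_real_derivative_iff_has_vector_derivative intro: DERIV_subset\<close>)
  show ?thesis by (rule has_integral_le[OF i integrable_integral[OF h]]) (use le in auto)
qed

text \<open>What classical and weak solutions have in common: \<open>rep\<close> is the equation
  \<open>\<partial>\<^sub>x\<^sup>2 \<integral>\<^sub>0\<^sup>\<tau> (d\<^sub>u u - d\<^sub>v v) ds = (u - v)(\<tau>) - (u\<^sub>0 - v\<^sub>0)\<close>, integrated twice in \<open>x\<close>; \<open>bdry\<close> replaces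
  the Neumann condition on \<open>v\<close>, since \<open>A = - d\<^sub>v v\<close> at \<open>x = 0\<close>.\<close>

locale rd_flow = stefan +
  fixes M :: real and u v :: "real \<Rightarrow> real \<Rightarrow> real" and u0 v0 :: "real \<Rightarrow> real"
  assumes M: "U0 \<le> M" "V0 \<le> M"
    and ub: "x \<ge> 0 \<Longrightarrow> t \<ge> 0 \<Longrightarrow> 0 \<le> u x t \<and> u x t \<le> M"
    and vb: "x \<ge> 0 \<Longrightarrow> t \<ge> 0 \<Longrightarrow> 0 \<le> v x t \<and> v x t \<le> M"
    and u_cont: "continuous_on ({0..} \<times> {0..}) (\<lambda>(x, t). u x t)"
    and dv_cont: "continuous_on ({0..} \<times> {0..}) (\<lambda>(x, t). dv * v x t)"
    and v_L1: "t > 0 \<Longrightarrow> L1lim X (at t) (\<lambda>s x. v x s) (\<lambda>x. v x t)"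
    and u0_bm: "bm {0..X} u0" and v0_bm: "bm {0..X} v0"
    and u0b: "x \<ge> 0 \<Longrightarrow> 0 \<le> u0 x \<and> u0 x \<le> M" and v0b: "x \<ge> 0 \<Longrightarrow> 0 \<le> v0 x \<and> v0 x \<le> M"
    and u0_int: "u0 absolutely_integrable_on {0..}"
    and v0_int: "(\<lambda>x. v0 x - V0) absolutely_integrable_on {0..}"
    and rep: "\<tau> > 0 \<Longrightarrow> \<exists>c. \<forall>x\<ge>0. integral {0..\<tau>} (\<lambda>s. du * u x s - dv * v x s) =
      integral {0..\<tau>} (\<lambda>s. du * u 0 s - dv * v 0 s) + c * x +
      integral {0..x} (\<lambda>y. (x - y) * ((u y \<tau> - v y \<tau>) - (u0 y - v0 y)))"
    and u_bdry: "t > 0 \<Longrightarrow> u 0 t = U0"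
    and seg: "((\<lambda>L. (1 / L^3) * integral {1..L\<^sup>2} (\<lambda>t. integral {0..X*L} (\<lambda>x. u x t * v x t))) \<longlongrightarrow> 0) at_top"
    and bdry: "((\<lambda>L. (1 / L\<^sup>2) * integral {1..L\<^sup>2} (\<lambda>t. dv * v 0 t)) \<longlongrightarrow> 0) at_top"
    and v_mono: "dv = 0 \<Longrightarrow> t > 0 \<Longrightarrow> AE x in lebesgue. x \<ge> 0 \<longrightarrow> v x t \<le> v0 x"
begin

section \<open>Error functions and their potential\<close>

definition B where "B x t = du * u x t - dv * v x t"
definition fp where "fp x t = max (f (x / sqrt t)) 0"
definition fm where "fm x t = min (f (x / sqrt t)) 0"
definition A where "A x t = B x t - Df (x / sqrt t)"
definition Z where "Z x t = (u x t - v x t) - f (x / sqrt t)"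
text \<open>The shift by \<open>V0\<close> matches the \<open>f + V0\<close> of
  \<open>pf_integral\<close>. It also makes the function integrable on the half-line, being
  \<open>u0 - (v0 - V0)\<close>.\<close>

definition Z0 where "Z0 x = u0 x - v0 x + V0"
text \<open>The coefficient of \<open>x\<close> in \<open>rep\<close>: the slope at
  \<open>x = 0\<close> of the time integral of \<open>B\<close>. No boundary condition determines
  it; its size is controlled afterwards through \<open>pot.p_bound\<close>.\<close>

definition cc where "cc \<tau> = (SOME c. \<forall>x\<ge>0. integral {0..\<tau>} (B x) =
      integral {0..\<tau>} (B 0) + c * x +
      integral {0..x} (\<lambda>y. (x - y) * ((u y \<tau> - v y \<tau>) - (u0 y - v0 y))))"
definition q where "q x \<tau> = integral {0..\<tau>} (B x) - Qf x \<tau>"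
definition p where "p x \<tau> = cc \<tau> + integral {0..x} (\<lambda>y. (u y \<tau> - v y \<tau>) - (u0 y - v0 y)) - pf x \<tau>"
definition Y where "Y x t = du * (u x t - fp x t)\<^sup>2 + dv * (v x t + fm x t)\<^sup>2 + (du + dv) * (u x t * (- fm x t) + v x t * fp x t)"

lemma B_rep: assumes "\<tau> > 0" "x \<ge> 0"
  shows "integral {0..\<tau>} (B x) = integral {0..\<tau>} (B 0) + cc \<tau> * x +
      integral {0..x} (\<lambda>y. (x - y) * ((u y \<tau> - v y \<tau>) - (u0 y - v0 y)))"
  using someI_ex[OF rep[OF assms(1)]] assms(2) unfolding cc_def B_def[abs_def] by blast

lemma M_pos: "M > 0" using M U0 by simp

lemma u_L1: "t > 0 \<Longrightarrow> L1lim X (at t) (\<lambda>s x. u x s) (\<lambda>x. u x t)"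
  by (rule L1lim_cont) (auto intro: continuous_on_subset[OF u_cont])

lemma u_bm: "t > 0 \<Longrightarrow> bm {0..X} (\<lambda>x. u x t)" and v_bm: "t > 0 \<Longrightarrow> bm {0..X} (\<lambda>x. v x t)"
  using L1lim_bm u_L1 v_L1 by blast+

lemma w_bm: "t > 0 \<Longrightarrow> bm {0..X} (\<lambda>y. (u y t - v y t) - (u0 y - v0 y))"
  by (intro bm_diff u_bm v_bm u0_bm v0_bm)

lemma B_cont: "continuous_on ({0..} \<times> {0..}) (\<lambda>(x, t). B x t)"
  unfolding B_def using u_cont dv_cont by (auto intro!: continuous_intros simp: case_prod_beta)

lemma B_cont_t: "x \<ge> 0 \<Longrightarrow> continuous_on {0..} (B x)"
  by (rule continuous_on_compose2[OF B_cont, of _ "\<lambda>t. (x, t)", simplified]) (auto intro!: continuous_intros)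

lemma B_bound: assumes "x \<ge> 0" "t \<ge> 0" shows "\<bar>B x t\<bar> \<le> (du + dv) * M"
proof -
  have "0 \<le> du * u x t" "du * u x t \<le> du * M" "0 \<le> dv * v x t" "dv * v x t \<le> dv * M"
    using ub[OF assms] vb[OF assms] du dv by (auto intro!: mult_left_mono)
  moreover have "0 \<le> du * M" "0 \<le> dv * M" using du dv M_pos by auto
  ultimately show ?thesis by (simp add: B_def algebra_simps)
qed

lemma diffusion_bound_le: "(du + dv) * max U0 V0 \<le> (du + dv) * M"
  using M du dv by (intro mult_left_mono) auto

lemma f_abs: "x \<ge> 0 \<Longrightarrow> t > 0 \<Longrightarrow> \<bar>f (x / sqrt t)\<bar> \<le> M"
  using f_bounds[of "x / sqrt t"] M U0 V0 by auto

text \<open>The bounds are sums of two halves: \<open>B\<close> and \<open>Df\<close> are each at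
  most \<open>(du + dv) * M\<close>, while \<open>u - v\<close> and \<open>f\<close> are each at
  most \<open>M\<close>. The potential itself is the difference of one obtained from
  \<open>rep\<close> and the explicit \<open>Qf\<close>.\<close>

sublocale pot: potential q p Z A Z0 "2 * (du + dv) * M" "2 * M"
proof
  fix t X :: real assume t: "t > 0"
  show "bm {0..X} (\<lambda>x. Z x t)" unfolding Z_def by (intro bm_diff u_bm v_bm f_bm t)
  show "L1lim X (at t) (\<lambda>s x. Z x s) (\<lambda>x. Z x t)" unfolding Z_def by (intro L1lim_diff u_L1 v_L1 f_L1lim t)
  fix x :: real assume x: "x \<ge> 0"
  show "\<bar>Z x t\<bar> \<le> 2 * M" using ub[of x t] vb[of x t] f_abs[of x t] t x by (auto simp: Z_def)
  show "\<bar>A x t\<bar> \<le> 2 * (du + dv) * M"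
  proof -
    have "\<bar>B x t\<bar> \<le> (du + dv) * M" "\<bar>Df (x / sqrt t)\<bar> \<le> (du + dv) * M"
      using B_bound[of x t] Df_bound[of "x / sqrt t"] diffusion_bound_le t x by auto
    moreover have "2 * (du + dv) * M = (du + dv) * M + (du + dv) * M" by simp
    ultimately show ?thesis unfolding A_def by linarith
  qed
  show "((\<lambda>x. q x t) has_real_derivative p x t) (at x within {0..})"
    unfolding q_def p_def
    by (intro DERIV_diff Qf_deriv_x t x has_derivative_second_primitive[where ?q0.0="integral {0..t} (B 0)", OF w_bm[OF t] _ x] B_rep)
  have i: "integral {0..x} (\<lambda>y. Z y t - Z0 y) =
      integral {0..x} (\<lambda>y. (u y t - v y t) - (u0 y - v0 y)) - integral {0..x} (\<lambda>y. f (y / sqrt t) + V0)"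
  proof -
    have "Z y t - Z0 y = ((u y t - v y t) - (u0 y - v0 y)) - (f (y / sqrt t) + V0)" for y
      by (simp add: Z_def Z0_def)
    then show ?thesis
      by (simp only:) (intro Henstock_Kurzweil_Integration.integral_diff bm_int w_bm bm_add f_bm bm_const t)
  qed
  show "p x t = p 0 t + integral {0..x} (\<lambda>y. Z y t - Z0 y)"
    unfolding i p_def using pf_integral[OF t x] by simp
  have "((\<lambda>s. integral {0..s} (B x)) has_real_derivative B x t) (at t within {0..t+1})"
    by (rule integral_has_real_derivative) (use t in \<open>auto intro: continuous_on_subset[OF B_cont_t[OF x]]\<close>)
  moreover have "at t within {0..t+1} = at t" by (rule at_within_interior) (use t in \<open>simp add: interior_atLeastAtMost_real\<close>)
  ultimately show "((\<lambda>s. q x s) has_real_derivative A x t) (at t)"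
    unfolding q_def A_def by (intro DERIV_diff Qf_deriv_t t x) simp
  have "\<bar>integral {0..t} (B x)\<bar> \<le> (du + dv) * M * (t - 0)"
    by (rule abs_integral_le) (use t x B_bound in \<open>auto intro!: integrable_continuous_interval continuous_on_subset[OF B_cont_t[OF x]]\<close>)
  moreover have "(du + dv) * max U0 V0 * t \<le> (du + dv) * M * t" using diffusion_bound_le t by (intro mult_right_mono) auto
  ultimately show "\<bar>q x t\<bar> \<le> 2 * (du + dv) * M * t"
    using Qf_bound[OF t x] unfolding q_def diff_zero by (simp only: mult.assoc mult_2 distrib_right)
next
  show "bm {0..X} Z0" for X unfolding Z0_def by (intro bm_add bm_diff bm_const u0_bm v0_bm)
  show "\<bar>Z0 x\<bar> \<le> 2 * M" if "x \<ge> 0" for x using u0b[OF that] v0b[OF that] M V0 by (auto simp: Z0_def)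
  have "continuous_on ({0..} \<times> {0<..}) (\<lambda>z. Df (fst z / sqrt (snd z)))"
    by (rule continuous_on_compose2[OF Df_cont]) (auto intro!: continuous_intros)
  moreover have "continuous_on ({0..} \<times> {0<..}) (\<lambda>z. B (fst z) (snd z))"
    by (rule continuous_on_subset[OF B_cont[unfolded case_prod_beta]]) auto
  ultimately show "continuous_on ({0..} \<times> {0<..}) (\<lambda>(x, t). A x t)"
    unfolding A_def case_prod_beta by (intro continuous_on_diff)
qed

lemma fp_fm_simps: "f (x / sqrt t) = fp x t + fm x t" "fp x t * fm x t = 0" "fp x t \<ge> 0" "fm x t \<le> 0"
  "Df (x / sqrt t) = du * fp x t + dv * fm x t"
  by (auto simp: fp_def fm_def Df_def max_def min_def)

lemma fp_le: "x \<ge> 0 \<Longrightarrow> t > 0 \<Longrightarrow> fp x t \<le> M" "x \<ge> 0 \<Longrightarrow> t > 0 \<Longrightarrow> - fm x t \<le> M"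
  using f_abs[of x t] M_pos by (auto simp: fp_def fm_def)

text \<open>Put \<open>\<alpha> = u - fp\<close> and \<open>\<beta> = v + fm\<close>. Then
  \<open>Z = \<alpha> - \<beta>\<close> and \<open>A = du * \<alpha> - dv * \<beta>\<close>. The
  product contains \<open>- (du + dv) * \<alpha> * \<beta>\<close>, and since
  \<open>fp * fm = 0\<close> the only part of this with a bad sign is the one with
  \<open>u * v\<close>. The rest is collected in \<open>Y\<close>.\<close>

lemma Z_times_A: "Z x t * A x t = Y x t - (du + dv) * (u x t * v x t)"
proof -
  have "Z x t * A x t - Y x t + (du + dv) * (u x t * v x t) = (du + dv) * (fp x t * fm x t)"
    unfolding Z_def A_def B_def Y_def fp_fm_simps(5) fp_fm_simps(1)[of x t] by (simp add: algebra_simps power2_eq_square)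
  then show ?thesis using fp_fm_simps(2)[of x t] by simp
qed

text \<open>All terms of \<open>Y\<close> are nonnegative because
  \<open>fm \<le> 0 \<le> fp\<close>. The last inequality, which follows from the two squares in
  \<open>Y\<close>, is the one that absorbs the error of the cutoff.\<close>

lemma Y_ge: assumes "x \<ge> 0" "t > 0"
  shows "du * (u x t - fp x t)\<^sup>2 \<le> Y x t" "dv * (v x t + fm x t)\<^sup>2 \<le> Y x t" "(du + dv) * (v x t * fp x t) \<le> Y x t" "0 \<le> Y x t"
    "(A x t)\<^sup>2 \<le> 2 * (du + dv) * Y x t"
proof -
  have 1: "0 \<le> du * (u x t - fp x t)\<^sup>2" "0 \<le> dv * (v x t + fm x t)\<^sup>2" using du dv by auto
  have 2: "0 \<le> u x t * (- fm x t)" "0 \<le> v x t * fp x t"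
    using ub[of x t] vb[of x t] fp_fm_simps(3,4)[of x t] assms by (auto intro!: mult_nonneg_nonneg mult_nonneg_nonpos)
  then have 3: "0 \<le> (du + dv) * (u x t * (- fm x t))" "0 \<le> (du + dv) * (v x t * fp x t)"
    using du dv mult_nonneg_nonneg[OF _ 2(1), of "du + dv"] mult_nonneg_nonneg[OF _ 2(2), of "du + dv"] by auto
  have e: "Y x t = du * (u x t - fp x t)\<^sup>2 + dv * (v x t + fm x t)\<^sup>2 + (du + dv) * (u x t * (- fm x t)) + (du + dv) * (v x t * fp x t)"
    by (simp add: Y_def algebra_simps)
  show "du * (u x t - fp x t)\<^sup>2 \<le> Y x t" "dv * (v x t + fm x t)\<^sup>2 \<le> Y x t" "(du + dv) * (v x t * fp x t) \<le> Y x t" "0 \<le> Y x t"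
    unfolding e using 1 3 by linarith+
  define \<alpha> \<beta> where ab: "\<alpha> = u x t - fp x t" "\<beta> = v x t + fm x t"
  have A: "A x t = du * \<alpha> - dv * \<beta>" unfolding A_def B_def fp_fm_simps(5) ab by (simp add: algebra_simps)
  have "(A x t)\<^sup>2 \<le> 2 * (du * \<alpha>)\<^sup>2 + 2 * (dv * \<beta>)\<^sup>2"
    unfolding A using zero_le_power2[of "du * \<alpha> + dv * \<beta>"] by (simp add: power2_eq_square algebra_simps)
  also have "\<dots> \<le> 2 * (du + dv) * (du * \<alpha>\<^sup>2 + dv * \<beta>\<^sup>2)"
  proof -
    have "0 \<le> 2 * (du * dv) * (\<alpha>\<^sup>2 + \<beta>\<^sup>2)" using du dv by simp
    then show ?thesis by (simp add: power2_eq_square algebra_simps)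
  qed
  also have "\<dots> \<le> 2 * (du + dv) * Y x t"
  proof (rule mult_left_mono)
    show "du * \<alpha>\<^sup>2 + dv * \<beta>\<^sup>2 \<le> Y x t" unfolding e ab[symmetric] using 3 by linarith
  qed (use du dv in simp)
  finally show "(A x t)\<^sup>2 \<le> 2 * (du + dv) * Y x t" .
qed

lemma fp_L1: "t > 0 \<Longrightarrow> L1lim X (at t) (\<lambda>s x. fp x s) (\<lambda>x. fp x t)"
  and fm_L1: "t > 0 \<Longrightarrow> L1lim X (at t) (\<lambda>s x. fm x s) (\<lambda>x. fm x t)"
  unfolding fp_def fm_def by (intro L1lim_max0 L1lim_min0 f_L1lim; assumption)+

lemma u_err_L1: "t > 0 \<Longrightarrow> L1lim X (at t) (\<lambda>s x. (u x s - fp x s)\<^sup>2) (\<lambda>x. (u x t - fp x t)\<^sup>2)"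
  by (intro L1lim_power2 L1lim_diff u_L1 fp_L1)

lemma v_err_L1: "t > 0 \<Longrightarrow> L1lim X (at t) (\<lambda>s x. (v x s + fm x s)\<^sup>2) (\<lambda>x. (v x t + fm x t)\<^sup>2)"
  by (intro L1lim_power2 L1lim_add v_L1 fm_L1)

lemma vfp_L1: "t > 0 \<Longrightarrow> L1lim X (at t) (\<lambda>s x. v x s * fp x s) (\<lambda>x. v x t * fp x t)"
  by (intro L1lim_mult v_L1 fp_L1)

lemma Y_L1: "t > 0 \<Longrightarrow> L1lim X (at t) (\<lambda>s x. Y x s) (\<lambda>x. Y x t)"
proof -
  assume t: "t > 0"
  have "L1lim X (at t) (\<lambda>s x. u x s * (- 1 * fm x s)) (\<lambda>x. u x t * (- 1 * fm x t))"
    by (intro L1lim_mult[OF u_L1[OF t]] L1lim_cmult fm_L1 t)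
  then have "L1lim X (at t) (\<lambda>s x. u x s * (- fm x s)) (\<lambda>x. u x t * (- fm x t))" by simp
  then show ?thesis unfolding Y_def
    by (intro L1lim_add L1lim_cmult u_err_L1 v_err_L1 vfp_L1 t)
qed

section \<open>Energy inequality on parabolic boxes\<close>

lemma L1_integrable:
  assumes "\<And>t. t > 0 \<Longrightarrow> L1lim X (at t) (\<lambda>s x. h x s) (\<lambda>x. h x t)" "c > 0"
  shows "(\<lambda>t. integral {0..X} (\<lambda>x. h x t)) integrable_on {c..d}"
  by (rule integrable_continuous_interval, rule continuous_at_imp_continuous_on)
    (use assms isCont_integral_L1lim in auto)

text \<open>The constant of \<open>pot.p_bound\<close> for the bounds of \<open>A\<close> and
  \<open>Z\<close> used in the sublocale.\<close>

abbreviation "K2 \<equiv> 2 * (2 * (du + dv) * M) + 2 * (2 * M)"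
definition S0 where "S0 = integral {0..} (\<lambda>x. \<bar>Z0 x\<bar>)"

lemma Z0_int: "(\<lambda>x. \<bar>Z0 x\<bar>) integrable_on {0..}"
proof -
  have "(\<lambda>x. u0 x - (v0 x - V0)) absolutely_integrable_on {0..}"
    by (rule set_integral_diff(1)[OF u0_int v0_int])
  then have "Z0 absolutely_integrable_on {0..}" by (simp add: Z0_def[abs_def] algebra_simps)
  from absolutely_integrable_norm[OF this] show ?thesis
    by (auto simp: o_def dest: set_lebesgue_integral_eq_integral(1))
qed

lemma Z0_le: "integral {0..X} (\<lambda>x. \<bar>Z0 x\<bar>) \<le> S0" and S0_nonneg: "S0 \<ge> 0"
  unfolding S0_def using Z0_int
  by (auto intro!: integral_subset_le bm_int bm_abs pot.Z0bm Henstock_Kurzweil_Integration.integral_nonneg)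

text \<open>Each term of the derivative has its own remedy: \<open>Z A\<close> is dissipation up to
  \<open>u v\<close>; the \<open>Z0\<close> part is bounded by the supremum of \<open>A\<close>
  times the norm of \<open>Z0\<close>; the boundary term is bounded through \<open>v 0 t\<close>;
  the cutoff term is split by Young's inequality and half of the dissipation is given up for
  it.\<close>

lemma energy_deriv_le:
  assumes X: "X > 0" and t: "t > 0"
  defines "e' \<equiv> - p 0 t * A 0 t - integral {0..X} (\<lambda>x. (Z x t - Z0 x) * (pot.rho X x * A x t))
    - integral {0..X} (\<lambda>x. p x t * (pot.rho' X x * A x t))"
  shows "e' \<le> - (1/2) * integral {0..X} (\<lambda>x. Y x t * pot.rho X x) + (du + dv) * integral {0..X} (\<lambda>x. u x t * v x t)
    + 2 * (du + dv) * M * S0 + 4 * (du + dv) * K2\<^sup>2 * t / X + K2 * sqrt t * (dv * v 0 t)"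
proof -
  let ?K = "2 * (du + dv) * M"
  let ?r = "pot.rho X"
  have D: "du + dv > 0" using du dv by simp
  have K0: "?K \<ge> 0" using D M_pos by simp
  have K2: "K2 \<ge> 0" using K0 M_pos by simp
  have Abm: "bm {0..X} (\<lambda>x. A x t)"
    by (rule L1lim_bm[OF L1lim_cont[OF _ t]]) (rule continuous_on_subset[OF pot.Acont], auto)
  have Ybm: "bm {0..X} (\<lambda>x. Y x t)" by (rule L1lim_bm[OF Y_L1[OF t]])
  have pbm: "bm {0..X} (\<lambda>x. p x t)" by (rule bm_cont[OF pot.p_cont[OF t]])
  note rbm = pot.rho_bm[OF X]
  note bms = Abm Ybm pbm rbm u_bm[OF t] v_bm[OF t] pot.Zbm[OF t] pot.Z0bm bm_mult bm_diff bm_add bm_const bm_power2 bm_divide bm_abs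
  \<comment> \<open>At \<open>x = 0\<close> both \<open>u\<close> and the profile equal
    \<open>U0\<close>, so only the contribution of \<open>v\<close> remains.\<close>
  have A0: "A 0 t = - dv * v 0 t" using u_bdry[OF t] by (simp add: A_def B_def f0)
  have 1: "- p 0 t * A 0 t \<le> K2 * sqrt t * (dv * v 0 t)"
  proof -
    have "p 0 t * (dv * v 0 t) \<le> (K2 * sqrt t) * (dv * v 0 t)"
      using pot.p_bound[OF t, of 0] vb[of 0 t] dv t by (intro mult_right_mono) auto
    then show ?thesis by (simp add: A0)
  qed
  have pt: "- ((Z x t - Z0 x) * (?r x * A x t)) - p x t * (pot.rho' X x * A x t) \<le>
     - (1/2) * (Y x t * ?r x) + (du + dv) * (u x t * v x t) + ?K * \<bar>Z0 x\<bar> + 4 * (du + dv) * K2\<^sup>2 * t / X\<^sup>2"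
    if x: "x \<in> {0..X}" for x
  proof -
    have x0: "x \<ge> 0" using x by simp
    have r: "0 \<le> ?r x" "?r x \<le> 1" using pot.rho_simps(3)[OF X] pot.rho_le[OF X x] by auto
    have "Z x t * A x t * ?r x = Y x t * ?r x - (du + dv) * (u x t * v x t) * ?r x"
      unfolding Z_times_A by (simp add: algebra_simps)
    moreover have "(du + dv) * (u x t * v x t) * ?r x \<le> (du + dv) * (u x t * v x t) * 1"
      using D r ub[of x t] vb[of x t] x0 t by (intro mult_left_mono) auto
    ultimately have a: "- (Z x t * A x t * ?r x) \<le> - (Y x t * ?r x) + (du + dv) * (u x t * v x t)" by simp
    have "\<bar>Z0 x * A x t * ?r x\<bar> \<le> \<bar>Z0 x\<bar> * ?K * 1"
      unfolding abs_mult using r pot.Ab[OF t x0] K0 by (intro mult_mono) auto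
    then have b: "Z0 x * A x t * ?r x \<le> ?K * \<bar>Z0 x\<bar>" by (simp add: abs_le_iff mult.commute)
    have c: "- (p x t * (pot.rho' X x * A x t)) \<le> (1/2) * (Y x t * ?r x) + 4 * (du + dv) * K2\<^sup>2 * t / X\<^sup>2"
    proof -
      \<comment> \<open>The cutoff term is \<open>2 * w * s\<close>. The weight
        \<open>4 * (du + dv)\<close> in Young's inequality is chosen so that the part with
        \<open>s^2\<close> is at most half of \<open>Y\<close> times the cutoff, by the last bound
        of \<open>Y_ge\<close>.\<close>
      define s where "s = A x t * (1 - x / X)"
      define w where "w = p x t / X"
      have "- (p x t * (pot.rho' X x * A x t)) = 2 * w * s"
        unfolding pot.rho'_def[OF X] s_def w_def by simp
      also have "\<dots> \<le> s\<^sup>2 / (4 * (du + dv)) + 4 * (du + dv) * w\<^sup>2"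
      proof -
        have "0 \<le> (s - 4 * (du + dv) * w)\<^sup>2 / (4 * (du + dv))" using D by simp
        also have "\<dots> = s\<^sup>2 / (4 * (du + dv)) - 2 * w * s + 4 * (du + dv) * w\<^sup>2"
          using D by (simp add: power2_eq_square divide_simps) (simp add: algebra_simps)
        finally show ?thesis by simp
      qed
      also have "s\<^sup>2 / (4 * (du + dv)) \<le> (1/2) * (Y x t * ?r x)"
      proof -
        have "s\<^sup>2 = (A x t)\<^sup>2 * ?r x" by (simp add: s_def pot.rho_def[OF X] power_mult_distrib)
        also have "\<dots> \<le> 2 * (du + dv) * Y x t * ?r x" using Y_ge(5)[OF x0 t] r by (intro mult_right_mono) auto
        finally show ?thesis using D by (simp add: field_simps)
      qed
      also have "4 * (du + dv) * w\<^sup>2 \<le> 4 * (du + dv) * K2\<^sup>2 * t / X\<^sup>2"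
      proof -
        have "(p x t)\<^sup>2 \<le> (K2 * sqrt t)\<^sup>2" using pot.p_bound[OF t x0] by (metis abs_ge_zero power2_abs power_mono)
        also have "\<dots> = K2\<^sup>2 * t" using t by (simp add: power_mult_distrib)
        finally have "w\<^sup>2 \<le> K2\<^sup>2 * t / X\<^sup>2" unfolding w_def power_divide by (intro divide_right_mono) auto
        then have "4 * (du + dv) * w\<^sup>2 \<le> 4 * (du + dv) * (K2\<^sup>2 * t / X\<^sup>2)" using D by (intro mult_left_mono) auto
        then show ?thesis by simp
      qed
      finally show ?thesis by simp
    qed
    have "- ((Z x t - Z0 x) * (?r x * A x t)) = - (Z x t * A x t * ?r x) + Z0 x * A x t * ?r x" by (simp add: algebra_simps)
    then show ?thesis using a b c by linarith
  qed
  have "- integral {0..X} (\<lambda>x. (Z x t - Z0 x) * (?r x * A x t)) - integral {0..X} (\<lambda>x. p x t * (pot.rho' X x * A x t))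
      = integral {0..X} (\<lambda>x. - ((Z x t - Z0 x) * (?r x * A x t)) - p x t * (pot.rho' X x * A x t))"
    by (subst Henstock_Kurzweil_Integration.integral_diff) (auto intro!: bm_int bm_uminus bms)
  also have "\<dots> \<le> integral {0..X} (\<lambda>x. - (1/2) * (Y x t * ?r x) + (du + dv) * (u x t * v x t) + ?K * \<bar>Z0 x\<bar> + 4 * (du + dv) * K2\<^sup>2 * t / X\<^sup>2)"
    by (intro integral_le bm_int bm_uminus bms pt)
  also have "\<dots> = - (1/2) * integral {0..X} (\<lambda>x. Y x t * ?r x) + (du + dv) * integral {0..X} (\<lambda>x. u x t * v x t) + ?K * integral {0..X} (\<lambda>x. \<bar>Z0 x\<bar>) + 4 * (du + dv) * K2\<^sup>2 * t / X\<^sup>2 * X"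
  proof -
    have i: "bm {0..X} (\<lambda>x. - (1/2) * (Y x t * ?r x))" "bm {0..X} (\<lambda>x. (du + dv) * (u x t * v x t))" "bm {0..X} (\<lambda>x. ?K * \<bar>Z0 x\<bar>)"
      by (intro bms)+
    show ?thesis
      using X by (simp only: Henstock_Kurzweil_Integration.integral_add bm_int[OF i(1)] bm_int[OF i(2)] bm_int[OF i(3)] bm_int[OF bm_const]
          integrable_add integral_mult_right integral_const_real) simp
  qed
  also have "4 * (du + dv) * K2\<^sup>2 * t / X\<^sup>2 * X = 4 * (du + dv) * K2\<^sup>2 * t / X" using X by (simp add: power2_eq_square)
  also have "?K * integral {0..X} (\<lambda>x. \<bar>Z0 x\<bar>) \<le> ?K * S0" using K0 Z0_le by (intro mult_left_mono) auto
  finally show ?thesis unfolding e'_def using 1 by simp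
qed

lemma energy_nonneg: "X > 0 \<Longrightarrow> t > 0 \<Longrightarrow> 0 \<le> pot.energy X t"
  unfolding pot.energy_def
  by (intro mult_nonneg_nonneg Henstock_Kurzweil_Integration.integral_nonneg bm_int bm_mult bm_power2 bm_cont[OF pot.p_cont] pot.rho_bm)
    (auto simp: pot.rho_simps(3))

lemma energy_1: assumes X: "X > 0" shows "pot.energy X 1 \<le> K2\<^sup>2 * X"
proof -
  have "(p x 1)\<^sup>2 * pot.rho X x \<le> K2\<^sup>2 * 1" if x: "x \<in> {0..X}" for x
  proof (rule mult_mono)
    show "(p x 1)\<^sup>2 \<le> K2\<^sup>2" using pot.p_bound[of 1 x] x by (metis abs_ge_zero atLeastAtMost_iff mult.right_neutral power2_abs power_mono real_sqrt_one zero_less_one)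
  qed (use pot.rho_le[OF X x] pot.rho_simps(3)[OF X] in auto)
  then have "integral {0..X} (\<lambda>x. (p x 1)\<^sup>2 * pot.rho X x) \<le> integral {0..X} (\<lambda>x. K2\<^sup>2)"
    by (intro integral_le bm_int bm_mult bm_power2 bm_cont[OF pot.p_cont] pot.rho_bm bm_const X) auto
  also have "\<dots> = K2\<^sup>2 * X" using X by simp
  finally have i: "integral {0..X} (\<lambda>x. (p x 1)\<^sup>2 * pot.rho X x) \<le> K2\<^sup>2 * X" .
  have "0 \<le> K2\<^sup>2 * X" using X by simp
  with i show ?thesis unfolding pot.energy_def[OF X] by linarith
qed

text \<open>Integration from time 1, where the energy is only of the order of the length
  \<open>X\<close>. The right side involves the final time \<open>T\<close> alone, so it bounds the
  energy and the dissipation for all \<open>\<tau>\<close> up to \<open>T\<close> at once.\<close>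

lemma energy_ineq:
  assumes X: "X > 0" and \<tau>: "1 \<le> \<tau>" "\<tau> \<le> T"
  shows "pot.energy X \<tau> + (1/2) * integral {1..\<tau>} (\<lambda>t. integral {0..X} (\<lambda>x. Y x t * pot.rho X x))
    \<le> K2\<^sup>2 * X + (du + dv) * integral {1..T} (\<lambda>t. integral {0..X} (\<lambda>x. u x t * v x t))
      + 2 * (du + dv) * M * S0 * T + 4 * (du + dv) * K2\<^sup>2 * T\<^sup>2 / X + K2 * sqrt T * integral {1..T} (\<lambda>t. dv * v 0 t)"
proof -
  have D: "du + dv > 0" using du dv by simp
  have K2: "K2 \<ge> 0" using D M_pos by simp
  define y where "y t = integral {0..X} (\<lambda>x. Y x t * pot.rho X x)" for t
  define m where "m t = integral {0..X} (\<lambda>x. u x t * v x t)" for t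
  have yi: "y integrable_on {1..b}" for b unfolding y_def
    by (rule L1_integrable) (auto intro!: L1lim_mult Y_L1 L1lim_const pot.rho_bm X)
  have mi: "m integrable_on {1..b}" for b unfolding m_def
    by (rule L1_integrable) (auto intro!: L1lim_mult u_L1 v_L1)
  have vi: "(\<lambda>t. dv * v 0 t) integrable_on {1..b}" for b
    by (rule integrable_continuous_interval, rule continuous_on_compose2[OF dv_cont, of _ "\<lambda>t. (0, t)", simplified])
      (auto intro!: continuous_intros)
  have m0: "m t \<ge> 0" if "t \<in> {1..T}" for t unfolding m_def
    by (rule Henstock_Kurzweil_Integration.integral_nonneg) (use that ub vb in \<open>auto intro!: bm_int bm_mult u_bm v_bm\<close>)
  define c where "c = 2 * (du + dv) * M * S0 + 4 * (du + dv) * K2\<^sup>2 * T / X"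
  have c0: "c \<ge> 0" unfolding c_def using D M_pos S0_nonneg X \<tau> by simp
  define h where "h t = - (1/2) * y t + (du + dv) * m t + c + K2 * sqrt T * (dv * v 0 t)" for t
  have "pot.energy X \<tau> - pot.energy X 1 \<le> integral {1..\<tau>} h"
  proof (rule derivative_le_integral[OF pot.energy_deriv[OF X]])
    fix t assume t: "t \<in> {1..\<tau>}"
    have "4 * (du + dv) * K2\<^sup>2 * t / X \<le> 4 * (du + dv) * K2\<^sup>2 * T / X"
      using t \<tau> D X by (intro divide_right_mono mult_left_mono) auto
    moreover have "K2 * sqrt t * (dv * v 0 t) \<le> K2 * sqrt T * (dv * v 0 t)"
      using t \<tau> K2 dv vb[of 0 t] by (intro mult_right_mono mult_left_mono) auto
    ultimately show "- p 0 t * A 0 t - integral {0..X} (\<lambda>x. (Z x t - Z0 x) * (pot.rho X x * A x t))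
      - integral {0..X} (\<lambda>x. p x t * (pot.rho' X x * A x t)) \<le> h t"
      using energy_deriv_le[OF X, of t] t unfolding h_def y_def m_def c_def by simp
    show "t > 0" using t by simp
  next
    show "h integrable_on {1..\<tau>}" unfolding h_def
      by (intro integrable_add integrable_on_mult_right yi mi vi integrable_const_ivl)
  qed (use \<tau> in auto)
  also have "integral {1..\<tau>} h = - (1/2) * integral {1..\<tau>} y + (du + dv) * integral {1..\<tau>} m + c * (\<tau> - 1) + K2 * sqrt T * integral {1..\<tau>} (\<lambda>t. dv * v 0 t)"
    unfolding h_def[abs_def] using \<tau>
    by (simp only: Henstock_Kurzweil_Integration.integral_add integrable_add integrable_on_mult_right yi mi vi
        integrable_const_ivl integral_mult_right integral_const_real) simp
  also have "\<dots> \<le> - (1/2) * integral {1..\<tau>} y + (du + dv) * integral {1..T} m + c * T + K2 * sqrt T * integral {1..T} (\<lambda>t. dv * v 0 t)"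
  proof -
    have "integral {1..\<tau>} m \<le> integral {1..T} m"
      by (rule integral_subset_le) (use \<tau> mi m0 in auto)
    then have 1: "(du + dv) * integral {1..\<tau>} m \<le> (du + dv) * integral {1..T} m"
      using D by (intro mult_left_mono) auto
    have "integral {1..\<tau>} (\<lambda>t. dv * v 0 t) \<le> integral {1..T} (\<lambda>t. dv * v 0 t)"
      by (rule integral_subset_le) (use \<tau> vi dv vb in auto)
    then have 2: "K2 * sqrt T * integral {1..\<tau>} (\<lambda>t. dv * v 0 t) \<le> K2 * sqrt T * integral {1..T} (\<lambda>t. dv * v 0 t)"
      using K2 \<tau> by (intro mult_left_mono) auto
    have 3: "c * (\<tau> - 1) \<le> c * T" using c0 \<tau> by (intro mult_left_mono) auto
    show ?thesis by (intro add_mono[OF add_mono[OF add_mono[OF order_refl 1] 3] 2])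
  qed
  finally have "pot.energy X \<tau> + (1/2) * integral {1..\<tau>} y \<le> K2\<^sup>2 * X + (du + dv) * integral {1..T} m + c * T + K2 * sqrt T * integral {1..T} (\<lambda>t. dv * v 0 t)"
    using energy_1[OF X] by linarith
  moreover have "c * T = 2 * (du + dv) * M * S0 * T + 4 * (du + dv) * K2\<^sup>2 * T\<^sup>2 / X"
    unfolding c_def by (simp add: algebra_simps power2_eq_square)
  ultimately show ?thesis unfolding y_def[abs_def] m_def[abs_def] by linarith
qed

lemma Yrho_nonneg: "X > 0 \<Longrightarrow> t > 0 \<Longrightarrow> 0 \<le> integral {0..X} (\<lambda>x. Y x t * pot.rho X x)"
  by (rule Henstock_Kurzweil_Integration.integral_nonneg)
    (auto intro!: bm_int bm_mult L1lim_bm[OF Y_L1] pot.rho_bm mult_nonneg_nonneg Y_ge pot.rho_simps)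

text \<open>For \<open>X = N * L\<close> and \<open>T = L^2\<close>, divide
  \<open>energy_ineq\<close> by \<open>L^3\<close>. All terms tend to 0 with growing
  \<open>L\<close> except the cutoff error \<open>k / N\<close>, which explains the order of the
  quantifiers. Besides the dissipation, the energy itself is recorded, since the case
  \<open>dv = 0\<close> needs it.\<close>

lemma energy_small:
  assumes e: "e > 0"
  shows "\<exists>N0>0. \<forall>N\<ge>N0. \<forall>\<^sub>F L in at_top. \<forall>\<tau>\<in>{1..L\<^sup>2}.
    pot.energy (N * L) \<tau> \<le> e * L^3 \<and>
    integral {1..\<tau>} (\<lambda>t. integral {0..N*L} (\<lambda>x. Y x t * pot.rho (N*L) x)) \<le> e * L^3"
proof -
  have D: "du + dv > 0" using du dv by simp
  define k where "k = 4 * (du + dv) * K2\<^sup>2"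
  have k0: "k \<ge> 0" unfolding k_def using D by simp
  \<comment> \<open>Beyond this threshold \<open>k / N\<close> is at most \<open>e / 4\<close>, half
    of what the limit argument below allows.\<close>
  define N0 where "N0 = 1 + 4 * k / e"
  have N0: "N0 > 0" unfolding N0_def using k0 e by (simp add: add_pos_nonneg)
  show ?thesis
  proof (intro exI[of _ N0] conjI allI impI N0)
    fix N assume N: "N \<ge> N0"
    then have Npos: "N > 0" using N0 by simp
    have kN: "k / N \<le> e / 4"
    proof -
      have "4 * k / e \<le> N" using N by (simp add: N0_def)
      then show ?thesis using e Npos by (simp add: field_simps)
    qed
    define s where "s L = (1 / L^3) * integral {1..L\<^sup>2} (\<lambda>t. integral {0..N*L} (\<lambda>x. u x t * v x t))" for L
    define b where "b L = (1 / L\<^sup>2) * integral {1..L\<^sup>2} (\<lambda>t. dv * v 0 t)" for L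
    define c where "c = 2 * (du + dv) * M * S0"
    have "((\<lambda>L. K2\<^sup>2 * N / L\<^sup>2 + (du + dv) * s L + c / L + k / N + K2 * b L) \<longlongrightarrow> K2\<^sup>2 * N * 0 + (du + dv) * 0 + c * 0 + k / N + K2 * 0) at_top"
    proof (intro tendsto_add tendsto_mult tendsto_const)
      show "((\<lambda>L. K2\<^sup>2 * N / L\<^sup>2) \<longlongrightarrow> K2\<^sup>2 * N * 0) at_top" by (simp, real_asymp)
      show "((\<lambda>L. c / L) \<longlongrightarrow> c * 0) at_top" by (simp, real_asymp)
      show "(s \<longlongrightarrow> 0) at_top" unfolding s_def[abs_def] by (rule seg)
      show "(b \<longlongrightarrow> 0) at_top" unfolding b_def[abs_def] by (rule bdry)
    qed
    then have "\<forall>\<^sub>F L in at_top. K2\<^sup>2 * N / L\<^sup>2 + (du + dv) * s L + c / L + k / N + K2 * b L < e / 2"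
      by (rule order_tendstoD(2)) (use kN e in linarith)
    then show "\<forall>\<^sub>F L in at_top. \<forall>\<tau>\<in>{1..L\<^sup>2}. pot.energy (N * L) \<tau> \<le> e * L^3 \<and>
      integral {1..\<tau>} (\<lambda>t. integral {0..N*L} (\<lambda>x. Y x t * pot.rho (N*L) x)) \<le> e * L^3"
      using eventually_gt_at_top[of 0]
    proof eventually_elim
      case (elim L)
      show ?case
      proof
        fix \<tau> assume \<tau>: "\<tau> \<in> {1..L\<^sup>2}"
        have X: "N * L > 0" using Npos elim by simp
        let ?y = "integral {1..\<tau>} (\<lambda>t. integral {0..N*L} (\<lambda>x. Y x t * pot.rho (N*L) x))"
        have "pot.energy (N*L) \<tau> + (1/2) * ?y \<le> K2\<^sup>2 * (N*L) + (du + dv) * integral {1..L\<^sup>2} (\<lambda>t. integral {0..N*L} (\<lambda>x. u x t * v x t))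
            + c * L\<^sup>2 + k * (L\<^sup>2)\<^sup>2 / (N*L) + K2 * sqrt (L\<^sup>2) * integral {1..L\<^sup>2} (\<lambda>t. dv * v 0 t)"
          unfolding c_def k_def by (rule energy_ineq[OF X]) (use \<tau> in auto)
        also have "\<dots> = L^3 * (K2\<^sup>2 * N / L\<^sup>2 + (du + dv) * s L + c / L + k / N + K2 * b L)"
          unfolding s_def b_def using elim Npos by (simp add: field_simps power2_eq_square power3_eq_cube)
        also have "\<dots> \<le> L^3 * (e / 2)" using elim by (intro mult_left_mono) auto
        finally have le: "pot.energy (N*L) \<tau> + (1/2) * ?y \<le> e * L^3 / 2" by (simp add: algebra_simps)
        have "0 \<le> pot.energy (N*L) \<tau>" by (rule energy_nonneg[OF X]) (use \<tau> in auto)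
        moreover have "0 \<le> ?y"
          by (rule Henstock_Kurzweil_Integration.integral_nonneg)
            (use Yrho_nonneg[OF X] in \<open>auto intro!: L1_integrable L1lim_mult Y_L1 L1lim_const pot.rho_bm X\<close>)
        moreover have "0 \<le> e * L^3" using e elim by simp
        ultimately show "pot.energy (N * L) \<tau> \<le> e * L^3 \<and> ?y \<le> e * L^3" using le by linarith
      qed
    qed
  qed
qed

text \<open>On the first half of the box the cutoff is at least 1/4, so a quantity dominated by
  \<open>Y\<close> there is controlled by four times the weighted dissipation.\<close>

lemma dominated_small:
  assumes h: "\<And>X t. t > 0 \<Longrightarrow> L1lim X (at t) (\<lambda>s x. h x s) (\<lambda>x. h x t)"
    and b: "\<And>x t. x \<ge> 0 \<Longrightarrow> t > 0 \<Longrightarrow> 0 \<le> h x t" "\<And>x t. x \<ge> 0 \<Longrightarrow> t > 0 \<Longrightarrow> c * h x t \<le> Y x t"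
    and c: "c > 0" and J: "J > 0"
  shows "((\<lambda>L. (1 / L^3) * integral {1..L\<^sup>2} (\<lambda>t. integral {0..J*L} (\<lambda>x. h x t))) \<longlongrightarrow> 0) at_top"
  unfolding tendsto_iff
proof (intro allI impI)
  fix e :: real assume e: "e > 0"
  define e' where "e' = e * c / 8"
  have "e' > 0" using e c by (simp add: e'_def)
  from energy_small[OF this] obtain N0 where N0: "\<And>N. N \<ge> N0 \<Longrightarrow> \<forall>\<^sub>F L in at_top. \<forall>\<tau>\<in>{1..L\<^sup>2}.
    pot.energy (N * L) \<tau> \<le> e' * L^3 \<and> integral {1..\<tau>} (\<lambda>t. integral {0..N*L} (\<lambda>x. Y x t * pot.rho (N*L) x)) \<le> e' * L^3" by blast
  \<comment> \<open>The bound \<open>N \<ge> 2 * J\<close> places {0..J*L} in the first half of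
    {0..N*L}.\<close>
  define N where "N = max N0 (2 * J)"
  have N: "N \<ge> 2 * J" "N \<ge> N0" "N > 0" using J by (auto simp: N_def)
  show "\<forall>\<^sub>F L in at_top. dist ((1 / L^3) * integral {1..L\<^sup>2} (\<lambda>t. integral {0..J*L} (\<lambda>x. h x t))) 0 < e"
    using N0[OF N(2)] eventually_ge_at_top[of 1]
  proof eventually_elim
    case (elim L)
    have X: "N * L > 0" "J * L > 0" using N elim J by auto
    have JN: "J * L \<le> N * L" using N J elim by (intro mult_right_mono) auto
    have L1: "1 \<le> L\<^sup>2" using elim by simp
    have le: "integral {0..J*L} (\<lambda>x. h x t) \<le> (4 / c) * integral {0..N*L} (\<lambda>x. Y x t * pot.rho (N*L) x)" if t: "t > 0" for t
    proof -
      have Yb: "bm {0..N*L} (\<lambda>x. Y x t * pot.rho (N*L) x)" by (intro bm_mult L1lim_bm[OF Y_L1] pot.rho_bm X t)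
      have "integral {0..J*L} (\<lambda>x. h x t) \<le> integral {0..J*L} (\<lambda>x. (4 / c) * (Y x t * pot.rho (N*L) x))"
      proof (intro integral_le)
        show "(\<lambda>x. h x t) integrable_on {0..J*L}" by (rule bm_int[OF L1lim_bm[OF h[OF t]]])
        show "(\<lambda>x. 4 / c * (Y x t * pot.rho (N * L) x)) integrable_on {0..J * L}"
          by (rule bm_int[OF bm_mult[OF bm_const bm_subset[OF Yb]]]) (use JN in auto)
        fix x assume x: "x \<in> {0..J*L}"
        have "x / (N*L) \<le> (J*L) / (2*J*L)" using x X N J elim by (intro frac_le) (auto intro!: mult_right_mono)
        also have "\<dots> = 1/2" using J elim by simp
        finally have "(1/2)\<^sup>2 \<le> pot.rho (N*L) x" unfolding pot.rho_def[OF X(1)] by (intro power_mono) auto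
        then have r: "1 \<le> 4 * pot.rho (N*L) x" by (simp add: power2_eq_square)
        have "c * h x t * 1 \<le> Y x t * (4 * pot.rho (N*L) x)"
          using b(1)[of x t] b(2)[of x t] c x t r by (intro mult_mono) (auto intro!: Y_ge)
        then show "h x t \<le> 4 / c * (Y x t * pot.rho (N * L) x)" using c by (simp add: field_simps)
      qed
      also have "\<dots> = (4 / c) * integral {0..J*L} (\<lambda>x. Y x t * pot.rho (N*L) x)" by simp
      also have "\<dots> \<le> (4 / c) * integral {0..N*L} (\<lambda>x. Y x t * pot.rho (N*L) x)"
        using c JN t by (intro mult_left_mono integral_subset_le bm_int Yb bm_subset[OF Yb])
          (auto intro!: mult_nonneg_nonneg Y_ge pot.rho_simps X)
      finally show ?thesis .
    qed
    let ?I = "integral {1..L\<^sup>2} (\<lambda>t. integral {0..J*L} (\<lambda>x. h x t))"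
    have "?I \<le> integral {1..L\<^sup>2} (\<lambda>t. (4 / c) * integral {0..N*L} (\<lambda>x. Y x t * pot.rho (N*L) x))"
      by (intro integral_le integrable_on_mult_right L1_integrable h L1lim_mult Y_L1 L1lim_const pot.rho_bm X le) auto
    also have "\<dots> = (4 / c) * integral {1..L\<^sup>2} (\<lambda>t. integral {0..N*L} (\<lambda>x. Y x t * pot.rho (N*L) x))" by simp
    also have "\<dots> \<le> (4 / c) * (e' * L^3)" using elim(1) L1 c by (intro mult_left_mono) auto
    also have "\<dots> = (e / 2) * L^3" using c by (simp add: e'_def)
    also have "\<dots> < e * L^3" using e elim by simp
    finally have "?I < e * L^3" .
    moreover have "0 \<le> ?I"
      by (intro Henstock_Kurzweil_Integration.integral_nonneg L1_integrable h bm_int[OF L1lim_bm[OF h]]) (auto intro: b)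
    ultimately show ?case using elim by (simp add: field_simps)
  qed
qed

end

lemma integral_le_negligible:
  fixes f g :: "real \<Rightarrow> real"
  assumes f: "f integrable_on S" and g: "g integrable_on S" and N: "negligible N"
    and le: "\<And>x. x \<in> S - N \<Longrightarrow> f x \<le> g x"
  shows "integral S f \<le> integral S g"
proof -
  let ?f = "\<lambda>x. if x \<in> N then 0 else f x" and ?g = "\<lambda>x. if x \<in> N then 0 else g x"
  have "integral S f = integral S ?f" "integral S g = integral S ?g"
    by (rule integral_spike[OF N]; simp)+
  moreover have "integral S ?f \<le> integral S ?g"
    by (rule integral_le) (use le in \<open>auto intro: integrable_spike[OF f N] integrable_spike[OF g N]\<close>)
  ultimately show ?thesis by simp
qed

lemma integral_indicator_le:
  fixes c d X :: real assumes "c \<le> d" "0 \<le> K"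
  shows "integral {0..X} (\<lambda>x. if x \<in> {c..d} then K else 0) \<le> K * (d - c)"
proof -
  have "integral {0..X} (\<lambda>x. if x \<in> {c..d} then K else 0) = integral ({0..X} \<inter> {c..d}) (\<lambda>x. K)"
    using Henstock_Kurzweil_Integration.integral_restrict_Int[of "{0..X}" "{c..d}" "\<lambda>x. K"] by (simp only: Int_commute)
  also have "\<dots> = integral {max 0 c..min X d} (\<lambda>x. K)" by (simp add: Int_atLeastAtMost)
  also have "\<dots> \<le> K * (d - c)"
  proof (cases "max 0 c \<le> min X d")
    case True
    then have "integral {max 0 c..min X d} (\<lambda>x. K) = K * (min X d - max 0 c)" by (simp add: mult.commute)
    also have "\<dots> \<le> K * (d - c)" using assms by (intro mult_left_mono) auto
    finally show ?thesis .
  qed (use assms in simp)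
  finally show ?thesis .
qed

text \<open>Replaces the Cauchy-Schwarz inequality: a first power is traded for a square whose
  integral is small, at the price of a parameter that is chosen at the end.\<close>

lemma abs_le_young: fixes s :: real assumes "k > 0" shows "\<bar>s\<bar> \<le> k / 2 + s\<^sup>2 / (2 * k)"
proof -
  have "0 \<le> (\<bar>s\<bar> - k)\<^sup>2 / (2 * k)" using assms by simp
  also have "\<dots> = s\<^sup>2 / (2 * k) + k / 2 - \<bar>s\<bar>"
    using assms by (simp add: power2_diff divide_simps) (simp add: power2_eq_square algebra_simps)
  finally show ?thesis by simp
qed

text \<open>The slack \<open>e\<close> turns the argument into a contradiction between weak
  inequalities of integrals, so no strict monotonicity of the integral is involved.\<close>

lemma exists_le_average:
  fixes h :: "real \<Rightarrow> real"
  assumes h: "h integrable_on {a..b}" and ab: "a < b" and I: "integral {a..b} h \<le> c * (b - a)" and e: "e > 0"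
  shows "\<exists>t\<in>{a..b}. h t \<le> c + e"
proof (rule ccontr)
  assume "\<not> ?thesis"
  then have "\<And>t. t \<in> {a..b} \<Longrightarrow> c + e \<le> h t" by force
  then have "integral {a..b} (\<lambda>t. c + e) \<le> integral {a..b} h"
    by (intro integral_le) (use h in auto)
  moreover have "integral {a..b} (\<lambda>t. c + e) = (c + e) * (b - a)" using ab by (simp add: mult.commute)
  ultimately have "(c + e) * (b - a) \<le> c * (b - a)" using I by linarith
  then show False using ab e by (simp add: mult_le_cancel_right)
qed

lemma const_over_tendsto_0: "((\<lambda>L::real. c / L) \<longlongrightarrow> 0) at_top"
  by real_asymp

section \<open>Averaged convergence of both components\<close>

context rd_flow
begin

lemma u_small:
  assumes J: "J > 0"
  shows "((\<lambda>L. (1 / L^3) * integral {1..L\<^sup>2} (\<lambda>t. integral {0..J*L} (\<lambda>x. (u x t - fp x t)\<^sup>2))) \<longlongrightarrow> 0) at_top"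
  by (rule dominated_small[where c=du]) (use du J u_err_L1 Y_ge in auto)

lemma vfp_small:
  assumes J: "J > 0"
  shows "((\<lambda>L. (1 / L^3) * integral {1..L\<^sup>2} (\<lambda>t. integral {0..J*L} (\<lambda>x. v x t * fp x t))) \<longlongrightarrow> 0) at_top"
  by (rule dominated_small[where c="du + dv"]) (use du dv J vfp_L1 Y_ge vb fp_fm_simps in auto)

text \<open>A weight that vanishes at both ends, unlike \<open>rho\<close>. With a weight equal to 1
  at 0, integration by parts would leave \<open>p 0 t\<close>, of order \<open>L\<close>, whereas an
  arbitrarily small multiple of \<open>L\<close> is required.\<close>

definition chi :: "real \<Rightarrow> real \<Rightarrow> real" where "chi X x = x * (X - x)\<^sup>2 / X^3"
definition chi' :: "real \<Rightarrow> real \<Rightarrow> real" where "chi' X x = ((X - x)\<^sup>2 - 2 * x * (X - x)) / X^3"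

lemma chi_deriv: "X > 0 \<Longrightarrow> (chi X has_real_derivative chi' X x) (at x within S)"
  unfolding chi_def[abs_def] chi'_def
  by (auto intro!: derivative_eq_intros simp: field_simps)

lemma chi_cont: "X > 0 \<Longrightarrow> continuous_on S (chi X)" "X > 0 \<Longrightarrow> continuous_on S (chi' X)"
  unfolding chi_def[abs_def] chi'_def[abs_def] by (auto intro!: continuous_intros)

lemma chi_bounds: assumes X: "X > 0" and x: "x \<in> {0..X}"
  shows "0 \<le> chi X x" "chi X x \<le> 1" "\<bar>chi' X x\<bar> \<le> 2 / X"
proof -
  show "0 \<le> chi X x" using X x by (simp add: chi_def)
  have "x * (X - x)\<^sup>2 \<le> X * X\<^sup>2" using X x by (intro mult_mono power_mono) auto
  then show "chi X x \<le> 1" using X by (simp add: chi_def power2_eq_square power3_eq_cube)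
  have "(X - x)\<^sup>2 - 2 * x * (X - x) = (X - x) * (X - 3 * x)" by (simp add: power2_eq_square algebra_simps)
  moreover have "\<bar>(X - x) * (X - 3 * x)\<bar> \<le> X * (2 * X)" unfolding abs_mult using x X by (intro mult_mono) auto
  ultimately have "\<bar>(X - x)\<^sup>2 - 2 * x * (X - x)\<bar> / X^3 \<le> X * (2 * X) / X^3"
    using X by (intro divide_right_mono) auto
  then show "\<bar>chi' X x\<bar> \<le> 2 / X" using X by (simp add: chi'_def power3_eq_cube field_simps)
qed

text \<open>\<open>Z\<close> is the derivative of \<open>p\<close> plus \<open>Z0\<close>. Moving
  the derivative to the weight, whose slope is at most \<open>2 / X\<close>, bounds the integral by
  that of \<open>p^2\<close>, which is an energy.\<close>

lemma Z_chi:
  assumes X: "X > 0" and t: "t > 0" and k: "k > 0"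
  shows "\<bar>integral {0..X} (\<lambda>x. Z x t * chi X x)\<bar> \<le> S0 + k + (1 / (k * X)) * integral {0..X} (\<lambda>x. (p x t)\<^sup>2)"
proof -
  note bms = bm_cont[OF chi_cont(1)[OF X]] bm_cont[OF chi_cont(2)[OF X]] pot.Zbm[OF t] pot.Z0bm bm_cont[OF pot.p_cont[OF t]]
    bm_mult bm_diff bm_add bm_const bm_power2 bm_abs
  have "integral {0..X} (\<lambda>x. p x t * chi' X x) = p X t * chi X X - p 0 t * chi X 0 - integral {0..X} (\<lambda>x. (Z x t - Z0 x) * chi X x)"
    by (rule integral_by_parts_indefinite)
      (use X in \<open>auto intro!: bms chi_deriv chi_cont pot.px[OF t]\<close>)
  then have a: "integral {0..X} (\<lambda>x. (Z x t - Z0 x) * chi X x) = - integral {0..X} (\<lambda>x. p x t * chi' X x)"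
    by (simp add: chi_def)
  have "\<bar>integral {0..X} (\<lambda>x. p x t * chi' X x)\<bar> \<le> integral {0..X} (\<lambda>x. (2 / X) * (k / 2 + (1 / (2 * k)) * (p x t)\<^sup>2))"
  proof (rule abs_integral_le_integral)
    fix x assume x: "x \<in> {0..X}"
    have "\<bar>p x t * chi' X x\<bar> \<le> (k / 2 + (p x t)\<^sup>2 / (2 * k)) * (2 / X)"
      unfolding abs_mult by (intro mult_mono abs_le_young k chi_bounds X x) (use k in auto)
    then show "\<bar>p x t * chi' X x\<bar> \<le> (2 / X) * (k / 2 + (1 / (2 * k)) * (p x t)\<^sup>2)" by (simp add: mult.commute)
  qed (intro bm_int bms)+
  also have "\<dots> = (2 / X) * (k / 2 * X + (1 / (2 * k)) * integral {0..X} (\<lambda>x. (p x t)\<^sup>2))"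
  proof -
    have i: "(\<lambda>x. (1 / (2 * k)) * (p x t)\<^sup>2) integrable_on {0..X}" by (intro bm_int bms)
    show ?thesis using X by (simp only: integral_mult_right Henstock_Kurzweil_Integration.integral_add[OF integrable_const_ivl i] integral_const_real) simp
  qed
  also have "\<dots> = k + (1 / (k * X)) * integral {0..X} (\<lambda>x. (p x t)\<^sup>2)" using X k by (simp add: field_simps)
  finally have b: "\<bar>integral {0..X} (\<lambda>x. (Z x t - Z0 x) * chi X x)\<bar> \<le> k + (1 / (k * X)) * integral {0..X} (\<lambda>x. (p x t)\<^sup>2)"
    unfolding a by simp
  have "\<bar>integral {0..X} (\<lambda>x. Z0 x * chi X x)\<bar> \<le> integral {0..X} (\<lambda>x. \<bar>Z0 x\<bar>)"
  proof (rule abs_integral_le_integral)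
    fix x assume x: "x \<in> {0..X}"
    show "\<bar>Z0 x * chi X x\<bar> \<le> \<bar>Z0 x\<bar>" unfolding abs_mult using chi_bounds[OF X x] by (simp add: mult_left_le)
  qed (intro bm_int bms)+
  then have c: "\<bar>integral {0..X} (\<lambda>x. Z0 x * chi X x)\<bar> \<le> S0" using Z0_le[of X] by simp
  have "integral {0..X} (\<lambda>x. Z x t * chi X x) = integral {0..X} (\<lambda>x. (Z x t - Z0 x) * chi X x + Z0 x * chi X x)"
    by (simp add: algebra_simps)
  also have "\<dots> = integral {0..X} (\<lambda>x. (Z x t - Z0 x) * chi X x) + integral {0..X} (\<lambda>x. Z0 x * chi X x)"
    by (intro Henstock_Kurzweil_Integration.integral_add bm_int bms)
  finally show ?thesis using b c by linarith
qed

definition V1 where "V1 = integral {0..} (\<lambda>x. \<bar>v0 x - V0\<bar>)"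

lemma V1_le: "integral {0..X} (\<lambda>x. \<bar>v0 x - V0\<bar>) \<le> V1"
proof -
  have "(\<lambda>x. \<bar>v0 x - V0\<bar>) integrable_on {0..}"
    using absolutely_integrable_norm[OF v0_int] by (auto simp: o_def dest: set_lebesgue_integral_eq_integral(1))
  then show ?thesis unfolding V1_def
    by (auto intro!: integral_subset_le bm_int bm_abs bm_diff v0_bm bm_const)
qed

lemma fp_bm: "t > 0 \<Longrightarrow> bm {0..X} (\<lambda>x. fp x t)" and fm_bm: "t > 0 \<Longrightarrow> bm {0..X} (\<lambda>x. fm x t)"
  using L1lim_bm fp_L1 fm_L1 by blast+

text \<open>Three zones. For \<open>x / sqrt t \<le> b\<close> the profile is at least
  \<open>fl b\<close>, so \<open>v\<close> is bounded by \<open>v * fp\<close>. Between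
  \<open>b\<close> and \<open>a\<close> there is a layer of length \<open>(a - b) * sqrt t\<close>,
  on which \<open>M\<close> is used. Beyond the interface \<open>fm = - V0\<close> as
  \<open>dv = 0\<close>, and \<open>v \<le> v0\<close> leaves at most
  \<open>\<bar>v0 - V0\<bar>\<close>.\<close>

lemma v_excess:
  assumes d0: "dv = 0" and t: "t > 0" and b: "0 < b" "b < a"
  shows "integral {0..X} (\<lambda>x. max (v x t + fm x t) 0) \<le>
    (1 / fl b) * integral {0..X} (\<lambda>x. v x t * fp x t) + V1 + M * (a - b) * sqrt t"
proof -
  define N where "N = {x. \<not> (x \<ge> 0 \<longrightarrow> v x t \<le> v0 x)}"
  have N: "negligible N"
    using v_mono[OF d0 t] by (simp add: AE_iff_null_sets completion.AE_iff_null_sets eventually_ae_filter negligible_iff_null_sets N_def)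
      (metis (mono_tags, lifting) completion.null_sets_outer mem_Collect_eq null_sets_completion_subset subsetI)
  let ?i = "\<lambda>x. if x \<in> {b * sqrt t..a * sqrt t} then M else 0"
  have fb: "fl b > 0" using f_pos[of b b] b by auto
  have ibm: "bm {0..X} ?i"
  proof -
    have "?i \<in> borel_measurable (lebesgue_on {0..X})"
      by (intro measurable_If measurable_const) (auto simp: sets_restrict_space_iff)
    then show ?thesis by (rule bmI[where C=M]) (use M_pos in auto)
  qed
  note bms = u_bm[OF t] v_bm[OF t] fp_bm[OF t] fm_bm[OF t] v0_bm ibm bm_mult bm_add bm_diff bm_const bm_max bm_abs
  have "integral {0..X} (\<lambda>x. max (v x t + fm x t) 0) \<le> integral {0..X} (\<lambda>x. (1 / fl b) * (v x t * fp x t) + \<bar>v0 x - V0\<bar> + ?i x)"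
  proof (rule integral_le_negligible[OF _ _ N])
    fix x assume x: "x \<in> {0..X} - N"
    then have x0: "x \<ge> 0" "v x t \<le> v0 x" by (auto simp: N_def)
    have vx: "0 \<le> v x t" "v x t \<le> M" using vb[of x t] x0 t by auto
    have s: "0 \<le> (1 / fl b) * (v x t * fp x t)" using fb vx fp_fm_simps(3) by simp
    consider "x / sqrt t \<le> b" | "b < x / sqrt t" "x / sqrt t \<le> a" | "a < x / sqrt t" by linarith
    then show "max (v x t + fm x t) 0 \<le> (1 / fl b) * (v x t * fp x t) + \<bar>v0 x - V0\<bar> + ?i x"
    proof cases
      case 1
      have "fl b \<le> f (x / sqrt t)" using f_pos[of "x / sqrt t" b] 1 x0 t b by auto
      then have "fl b \<le> fp x t" by (simp add: fp_def)
      then have "v x t * fl b \<le> v x t * fp x t" using vx by (intro mult_left_mono) auto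
      then have "v x t \<le> (1 / fl b) * (v x t * fp x t)" using fb by (simp add: field_simps)
      moreover have "fm x t \<le> 0" by (rule fp_fm_simps)
      moreover have "?i x \<ge> 0" using M_pos by auto
      ultimately show ?thesis using s by auto
    next
      case 2
      then have "?i x = M" using t by (simp add: field_simps)
      moreover have "fm x t \<le> 0" by (rule fp_fm_simps)
      ultimately show ?thesis using s vx by auto
    next
      case 3
      then have "fm x t = - V0" unfolding fm_def f_def fr_def using d0 V0 by simp
      moreover have "?i x \<ge> 0" using M_pos by auto
      ultimately show ?thesis using s x0 by simp
    qed
  qed (intro bm_int bms)+
  also have "\<dots> = (1 / fl b) * integral {0..X} (\<lambda>x. v x t * fp x t) + integral {0..X} (\<lambda>x. \<bar>v0 x - V0\<bar>) + integral {0..X} ?i"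
  proof -
    have i: "bm {0..X} (\<lambda>x. (1 / fl b) * (v x t * fp x t))" "bm {0..X} (\<lambda>x. \<bar>v0 x - V0\<bar>)" by (intro bms)+
    show ?thesis by (simp only: Henstock_Kurzweil_Integration.integral_add bm_int[OF i(1)] bm_int[OF i(2)] bm_int[OF ibm]
          integrable_add integral_mult_right)
  qed
  also have "integral {0..X} ?i \<le> M * (a * sqrt t - b * sqrt t)"
    by (rule integral_indicator_le) (use b t M_pos in \<open>auto intro!: mult_right_mono\<close>)
  also have "M * (a * sqrt t - b * sqrt t) = M * (a - b) * sqrt t" by (simp add: algebra_simps)
  finally show ?thesis using V1_le[of X] by linarith
qed

text \<open>The absolute value of \<open>\<beta> = v + fm\<close> is \<open>- \<beta>\<close> plus
  twice its positive part, and \<open>- \<beta>\<close> is \<open>Z\<close> minus the error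
  \<open>\<alpha> = u - fp\<close>. Each of the three pieces is already controlled: by
  \<open>Z_chi\<close>, by the dissipation and by \<open>v_excess\<close>.\<close>

lemma v_weighted:
  assumes d0: "dv = 0" and t: "t > 0" and b: "0 < b" "b < a" and X: "X > 0" and k: "k > 0"
  shows "integral {0..X} (\<lambda>x. \<bar>v x t + fm x t\<bar> * chi X x) \<le>
    \<bar>integral {0..X} (\<lambda>x. Z x t * chi X x)\<bar> + (k / 2 * X + 1 / (2 * k) * integral {0..X} (\<lambda>x. (u x t - fp x t)\<^sup>2)) +
    2 * ((1 / fl b) * integral {0..X} (\<lambda>x. v x t * fp x t) + V1 + M * (a - b) * sqrt t)"
proof -
  note bms = bm_cont[OF chi_cont(1)[OF X]] pot.Zbm[OF t] u_bm[OF t] v_bm[OF t] fp_bm[OF t] fm_bm[OF t]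
    bm_mult bm_add bm_diff bm_const bm_max bm_abs bm_power2
  have i: "bm {0..X} (\<lambda>x. Z x t * chi X x)" "bm {0..X} (\<lambda>x. (1 / (2 * k)) * (u x t - fp x t)\<^sup>2)" "bm {0..X} (\<lambda>x. 2 * max (v x t + fm x t) 0)"
    by (intro bms)+
  have "integral {0..X} (\<lambda>x. \<bar>v x t + fm x t\<bar> * chi X x) \<le>
    integral {0..X} (\<lambda>x. Z x t * chi X x + (k / 2 + (1 / (2 * k)) * (u x t - fp x t)\<^sup>2) + 2 * max (v x t + fm x t) 0)"
  proof (intro integral_le bm_int bms)
    fix x assume x: "x \<in> {0..X}"
    define \<alpha> \<beta> where ab: "\<alpha> = u x t - fp x t" "\<beta> = v x t + fm x t"
    have Z: "Z x t = \<alpha> - \<beta>" unfolding Z_def ab fp_fm_simps(1)[of x t] by simp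
    note c = chi_bounds[OF X x]
    have "\<bar>\<beta>\<bar> * chi X x = (\<alpha> - \<beta>) * chi X x - \<alpha> * chi X x + 2 * (max \<beta> 0 * chi X x)"
      by (auto simp: max_def abs_if algebra_simps)
    also have "- (\<alpha> * chi X x) \<le> \<bar>\<alpha>\<bar> * 1"
    proof -
      have "- (\<alpha> * chi X x) \<le> \<bar>\<alpha> * chi X x\<bar>" by simp
      also have "\<dots> \<le> \<bar>\<alpha>\<bar> * 1" unfolding abs_mult using c by (intro mult_left_mono) auto
      finally show ?thesis .
    qed
    then have "(\<alpha> - \<beta>) * chi X x - \<alpha> * chi X x + 2 * (max \<beta> 0 * chi X x) \<le> (\<alpha> - \<beta>) * chi X x + \<bar>\<alpha>\<bar> + 2 * (max \<beta> 0 * chi X x)" by simp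
    also have "max \<beta> 0 * chi X x \<le> max \<beta> 0 * 1" using c by (intro mult_left_mono) auto
    finally have "\<bar>\<beta>\<bar> * chi X x \<le> (\<alpha> - \<beta>) * chi X x + \<bar>\<alpha>\<bar> + 2 * max \<beta> 0" by simp
    moreover have "\<bar>\<alpha>\<bar> \<le> k / 2 + (1 / (2 * k)) * \<alpha>\<^sup>2" using abs_le_young[OF k, of \<alpha>] by simp
    ultimately show "\<bar>v x t + fm x t\<bar> * chi X x \<le> Z x t * chi X x + (k / 2 + (1 / (2 * k)) * (u x t - fp x t)\<^sup>2) + 2 * max (v x t + fm x t) 0"
      unfolding Z ab by linarith
  qed
  also have "\<dots> = integral {0..X} (\<lambda>x. Z x t * chi X x) + (k / 2 * X + 1 / (2 * k) * integral {0..X} (\<lambda>x. (u x t - fp x t)\<^sup>2)) + 2 * integral {0..X} (\<lambda>x. max (v x t + fm x t) 0)"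
    using X by (simp only: Henstock_Kurzweil_Integration.integral_add bm_int[OF i(1)] bm_int[OF i(2)] bm_int[OF i(3)] bm_int[OF bm_const]
          integrable_add integral_mult_right integral_const_real) simp
  also have "\<dots> \<le> \<bar>integral {0..X} (\<lambda>x. Z x t * chi X x)\<bar> + (k / 2 * X + 1 / (2 * k) * integral {0..X} (\<lambda>x. (u x t - fp x t)\<^sup>2)) +
    2 * ((1 / fl b) * integral {0..X} (\<lambda>x. v x t * fp x t) + V1 + M * (a - b) * sqrt t)"
    by (intro add_mono abs_ge_self order_refl mult_left_mono v_excess d0 t b) simp
  finally show ?thesis .
qed

text \<open>Without diffusion the dissipation does not see \<open>v + w\<^sup>-\<close>. Its positive part is small by
  \<open>v \<le> v\<^sub>0\<close> and since \<open>v w\<^sup>+\<close> is small; its integral against \<open>chi\<close> is small because \<open>\<integral> p\<^sup>2\<close> is.\<close>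

lemma v_small_degenerate:
  assumes d0: "dv = 0" and J: "J > 0"
  shows "((\<lambda>L. (1 / L^3) * integral {1..L\<^sup>2} (\<lambda>t. integral {0..J*L} (\<lambda>x. (v x t + fm x t)\<^sup>2))) \<longlongrightarrow> 0) at_top"
  unfolding tendsto_iff
proof (intro allI impI)
  fix e :: real assume e: "e > 0"
  \<comment> \<open>Near \<open>x = 0\<close> the weight \<open>chi\<close> is too small to be
    useful. The interval {0..\<eta>*L} is estimated by \<open>M^2\<close> and consumes a quarter of
    \<open>e\<close>.\<close>
  define \<eta> where "\<eta> = min J (e / (4 * M\<^sup>2))"
  have \<eta>: "\<eta> > 0" "\<eta> \<le> J" "M\<^sup>2 * \<eta> \<le> e / 4"
  proof -
    show "\<eta> > 0" "\<eta> \<le> J" using J e M_pos by (auto simp: \<eta>_def)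
    have "M\<^sup>2 * \<eta> \<le> M\<^sup>2 * (e / (4 * M\<^sup>2))" by (intro mult_left_mono) (auto simp: \<eta>_def)
    also have "\<dots> = e / 4" using M_pos by simp
    finally show "M\<^sup>2 * \<eta> \<le> e / 4" .
  qed
  \<comment> \<open>On {\<eta>*L..J*L} with \<open>X = 2 * J * L\<close> the weight
    \<open>chi X\<close> is at least \<open>\<eta> / (8 * J)\<close>, so \<open>Q * chi X\<close> is
    at least \<open>M\<close> and one factor of the square can be replaced by it.\<close>
  define Q where "Q = 8 * J * M / \<eta>"
  have Q: "Q > 0" using J M_pos \<eta> by (simp add: Q_def)
  \<comment> \<open>\<open>R\<close> collects what is proportional to \<open>\<delta> * L\<close>:
    \<open>1 + 4 / J\<close> from \<open>Z_chi\<close>, \<open>J\<close> from Young's inequality for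
    the error of \<open>u\<close> on length \<open>X = 2 * J * L\<close>, and \<open>2 * M\<close>
    from the layer of relative width \<open>a - b = \<delta>\<close>.\<close>
  define R where "R = (1 + 4 / J) + J + 2 * M"
  have R: "R > 0" unfolding R_def using J M_pos by (simp add: add_pos_pos)
  define \<delta> where "\<delta> = min (a / 2) (e / (4 * Q * R))"
  have \<delta>: "\<delta> > 0" "\<delta> < a" "Q * R * \<delta> \<le> e / 4"
  proof -
    show "\<delta> > 0" "\<delta> < a" using e Q R a_pos by (auto simp: \<delta>_def min_less_iff_disj)
    have "Q * R * \<delta> \<le> Q * R * (e / (4 * Q * R))" using Q R by (intro mult_left_mono) (auto simp: \<delta>_def)
    also have "\<dots> = e / 4" using Q R by simp
    finally show "Q * R * \<delta> \<le> e / 4" .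
  qed
  define b where "b = a - \<delta>"
  have b: "0 < b" "b < a" using \<delta> by (auto simp: b_def)
  define s1 where "s1 L = (1 / L^3) * integral {1..L\<^sup>2} (\<lambda>t. integral {0..(2*J)*L} (\<lambda>x. (u x t - fp x t)\<^sup>2))" for L
  define s2 where "s2 L = (1 / L^3) * integral {1..L\<^sup>2} (\<lambda>t. integral {0..(2*J)*L} (\<lambda>x. v x t * fp x t))" for L
  have J2: "2 * J > 0" using J by simp
  have "((\<lambda>L. Q * (S0 / L + 1 / (2 * \<delta>) * s1 L + 2 * (1 / fl b) * s2 L + 2 * V1 / L)) \<longlongrightarrow>
      Q * (S0 * 0 + 1 / (2 * \<delta>) * 0 + 2 * (1 / fl b) * 0 + 2 * V1 * 0)) at_top"
  proof (intro tendsto_add tendsto_mult tendsto_const)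
    show "((\<lambda>L. S0 / L) \<longlongrightarrow> S0 * 0) at_top" "((\<lambda>L. 2 * V1 / L) \<longlongrightarrow> 2 * V1 * 0) at_top"
      using const_over_tendsto_0[of S0] const_over_tendsto_0[of "2 * V1"] by simp_all
    show "(s1 \<longlongrightarrow> 0) at_top" unfolding s1_def[abs_def] by (rule u_small[OF J2])
    show "(s2 \<longlongrightarrow> 0) at_top" unfolding s2_def[abs_def] by (rule vfp_small[OF J2])
  qed
  then have small: "\<forall>\<^sub>F L in at_top. Q * (S0 / L + 1 / (2 * \<delta>) * s1 L + 2 * (1 / fl b) * s2 L + 2 * V1 / L) < e / 4"
    by (rule order_tendstoD(2)) (use e in simp)
  \<comment> \<open>The energy is required to be below \<open>\<delta>^2 * L^3\<close> so that
    \<open>Z_chi\<close> with parameter \<open>\<delta> * L\<close> yields a multiple of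
    \<open>\<delta> * L\<close>.\<close>
  have "\<delta>\<^sup>2 > 0" using \<delta> by simp
  from energy_small[OF this] obtain N0 where N0: "\<And>N. N \<ge> N0 \<Longrightarrow> \<forall>\<^sub>F L in at_top. \<forall>\<tau>\<in>{1..L\<^sup>2}.
    pot.energy (N * L) \<tau> \<le> \<delta>\<^sup>2 * L^3 \<and> integral {1..\<tau>} (\<lambda>t. integral {0..N*L} (\<lambda>x. Y x t * pot.rho (N*L) x)) \<le> \<delta>\<^sup>2 * L^3" by blast
  define N where "N = max N0 (4 * J)"
  have N: "N \<ge> 4 * J" "N \<ge> N0" "N > 0" using J by (auto simp: N_def)
  show "\<forall>\<^sub>F L in at_top. dist ((1 / L^3) * integral {1..L\<^sup>2} (\<lambda>t. integral {0..J*L} (\<lambda>x. (v x t + fm x t)\<^sup>2))) 0 < e"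
    using N0[OF N(2)] eventually_ge_at_top[of 1] small
  proof eventually_elim
    case (elim L)
    define X where "X = (2 * J) * L"
    have X: "X > 0" and NL: "N * L > 0" using N elim J by (auto simp: X_def)
    have L0: "L > 0" using elim by simp
    have XN: "X \<le> N * L" using N J elim by (auto simp: X_def intro!: mult_right_mono)
    have psq: "integral {0..X} (\<lambda>x. (p x t)\<^sup>2) \<le> 8 * (\<delta>\<^sup>2 * L^3)" if t: "t \<in> {1..L\<^sup>2}" for t
    proof -
      have t0: "t > 0" using t by simp
      have pb: "bm {0..Y} (\<lambda>x. (p x t)\<^sup>2)" for Y by (intro bm_power2 bm_cont pot.p_cont t0)
      have prb: "bm {0..N*L} (\<lambda>x. (p x t)\<^sup>2 * pot.rho (N*L) x)" by (intro bm_mult pb pot.rho_bm NL)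
      have "integral {0..X} (\<lambda>x. (p x t)\<^sup>2) \<le> integral {0..X} (\<lambda>x. 4 * ((p x t)\<^sup>2 * pot.rho (N*L) x))"
      proof (intro integral_le bm_int pb)
        show "bm {0..X} (\<lambda>x. 4 * ((p x t)\<^sup>2 * pot.rho (N * L) x))"
          by (intro bm_mult bm_const bm_subset[OF prb]) (use XN in auto)
        fix x assume x: "x \<in> {0..X}"
        have "x / (N*L) \<le> X / (2 * X)" using x X N J elim by (intro frac_le) (auto simp: X_def intro!: mult_right_mono)
        also have "\<dots> = 1/2" using X by simp
        finally have "(1/2)\<^sup>2 \<le> pot.rho (N*L) x" unfolding pot.rho_def[OF NL] by (intro power_mono) auto
        then have r: "1 \<le> 4 * pot.rho (N*L) x" by (simp add: power2_eq_square)
        have "(p x t)\<^sup>2 * 1 \<le> (p x t)\<^sup>2 * (4 * pot.rho (N*L) x)" using r by (intro mult_left_mono) auto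
        then show "(p x t)\<^sup>2 \<le> 4 * ((p x t)\<^sup>2 * pot.rho (N*L) x)" by (simp add: algebra_simps)
      qed
      also have "\<dots> = 4 * integral {0..X} (\<lambda>x. (p x t)\<^sup>2 * pot.rho (N*L) x)" by simp
      also have "\<dots> \<le> 4 * integral {0..N*L} (\<lambda>x. (p x t)\<^sup>2 * pot.rho (N*L) x)"
        using XN by (intro mult_left_mono integral_subset_le bm_int prb bm_subset[OF prb])
          (auto intro!: mult_nonneg_nonneg pot.rho_simps NL)
      also have "\<dots> = 8 * pot.energy (N*L) t" by (simp add: pot.energy_def[OF NL])
      also have "\<dots> \<le> 8 * (\<delta>\<^sup>2 * L^3)" using elim(1) t by auto
      finally show ?thesis .
    qed
    have Zc: "\<bar>integral {0..X} (\<lambda>x. Z x t * chi X x)\<bar> \<le> S0 + (1 + 4 / J) * \<delta> * L" if t: "t \<in> {1..L\<^sup>2}" for t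
    proof -
      have "\<bar>integral {0..X} (\<lambda>x. Z x t * chi X x)\<bar> \<le> S0 + (\<delta> * L) + (1 / ((\<delta> * L) * X)) * integral {0..X} (\<lambda>x. (p x t)\<^sup>2)"
        by (rule Z_chi) (use X t \<delta> L0 in auto)
      also have "(1 / ((\<delta> * L) * X)) * integral {0..X} (\<lambda>x. (p x t)\<^sup>2) \<le> (1 / ((\<delta> * L) * X)) * (8 * (\<delta>\<^sup>2 * L^3))"
        using \<delta> L0 X by (intro mult_left_mono psq t) auto
      also have "\<dots> = 4 / J * \<delta> * L" using \<delta> L0 J unfolding X_def by (simp add: field_simps power2_eq_square power3_eq_cube)
      finally show ?thesis by (simp add: algebra_simps)
    qed
    define i1 where "i1 t = integral {0..X} (\<lambda>x. (u x t - fp x t)\<^sup>2)" for t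
    define i2 where "i2 t = integral {0..X} (\<lambda>x. v x t * fp x t)" for t
    have ii: "i1 integrable_on {1..L\<^sup>2}" "i2 integrable_on {1..L\<^sup>2}" unfolding i1_def i2_def
      by (rule L1_integrable; auto intro!: u_err_L1 vfp_L1)+
    define C where "C = S0 + (1 + 4 / J) * \<delta> * L + \<delta> / 2 * X + 2 * V1 + 2 * M * (a - b) * L"
    have pt: "integral {0..J*L} (\<lambda>x. (v x t + fm x t)\<^sup>2) \<le> M\<^sup>2 * (\<eta> * L) + Q * (C + 1 / (2 * \<delta>) * i1 t + 2 * (1 / fl b) * i2 t)"
      if t: "t \<in> {1..L\<^sup>2}" for t
    proof -
      have t0: "t > 0" using t by simp
      let ?b = "\<lambda>x. v x t + fm x t"
      have "sqrt t \<le> L" using t L0 by (metis atLeastAtMost_iff abs_of_pos real_sqrt_abs real_sqrt_le_mono)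
      then have "M * (a - b) * sqrt t \<le> M * (a - b) * L" using M_pos b by (intro mult_left_mono) auto
      then have w: "integral {0..X} (\<lambda>x. \<bar>?b x\<bar> * chi X x) \<le> C + 1 / (2 * \<delta>) * i1 t + 2 * (1 / fl b) * i2 t"
        using v_weighted[OF d0 t0 b X \<delta>(1)] Zc[OF t] unfolding C_def i1_def i2_def by (simp add: algebra_simps)
      have bbm: "bm {0..Y} ?b" for Y by (intro bm_add v_bm fm_bm t0)
      have bM: "\<bar>?b x\<bar> \<le> M" if "x \<ge> 0" for x using vb[of x t] fp_le(2)[of x t] fp_fm_simps(4)[of x t] that t0 by auto
      have wbm: "bm {0..X} (\<lambda>x. \<bar>?b x\<bar> * chi X x)" by (intro bm_mult bm_abs bbm bm_cont chi_cont X)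
      have s1: "{\<eta>*L..J*L} \<subseteq> {0..J*L}" "{\<eta>*L..J*L} \<subseteq> {0..X}"
        using \<eta> L0 J by (auto simp: X_def intro: order_trans[OF mult_nonneg_nonneg[of \<eta> L]])
      have "integral {0..J*L} (\<lambda>x. (?b x)\<^sup>2) = integral {0..\<eta>*L} (\<lambda>x. (?b x)\<^sup>2) + integral {\<eta>*L..J*L} (\<lambda>x. (?b x)\<^sup>2)"
        using \<eta> L0 by (intro Henstock_Kurzweil_Integration.integral_combine[symmetric] bm_int bm_power2 bbm) auto
      also have "integral {0..\<eta>*L} (\<lambda>x. (?b x)\<^sup>2) \<le> integral {0..\<eta>*L} (\<lambda>x. M\<^sup>2)"
      proof (intro integral_le bm_int bm_power2 bbm bm_const)
        fix x assume "x \<in> {0..\<eta>*L}" then show "(?b x)\<^sup>2 \<le> M\<^sup>2" using bM[of x] by (metis abs_ge_zero atLeastAtMost_iff power2_abs power_mono)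
      qed
      also have "\<dots> = M\<^sup>2 * (\<eta> * L)" using \<eta> L0 by simp
      also have "integral {\<eta>*L..J*L} (\<lambda>x. (?b x)\<^sup>2) \<le> integral {\<eta>*L..J*L} (\<lambda>x. Q * (\<bar>?b x\<bar> * chi X x))"
      proof (intro integral_le bm_int)
        show "bm {\<eta>*L..J*L} (\<lambda>x. (?b x)\<^sup>2)" by (rule bm_subset[OF bm_power2[OF bbm] s1(1)])
        show "bm {\<eta>*L..J*L} (\<lambda>x. Q * (\<bar>?b x\<bar> * chi X x))" by (rule bm_mult[OF bm_const bm_subset[OF wbm s1(2)]])
        fix x assume x: "x \<in> {\<eta>*L..J*L}"
        then have x0: "x \<ge> 0" using s1 by auto
        have "(\<eta> * L) * (J * L)\<^sup>2 \<le> x * (X - x)\<^sup>2"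
          using x x0 J L0 by (intro mult_mono power_mono) (auto simp: X_def)
        then have "(\<eta> * L) * (J * L)\<^sup>2 / X^3 \<le> chi X x" unfolding chi_def using X by (intro divide_right_mono) auto
        moreover have "(\<eta> * L) * (J * L)\<^sup>2 / X^3 = \<eta> / (8 * J)" using J L0 unfolding X_def by (simp add: field_simps power2_eq_square power3_eq_cube)
        ultimately have "Q * (\<eta> / (8 * J)) \<le> Q * chi X x" using Q by (intro mult_left_mono) auto
        moreover have "Q * (\<eta> / (8 * J)) = M" using J \<eta> unfolding Q_def by simp
        ultimately have c: "M \<le> Q * chi X x" by simp
        have "(?b x)\<^sup>2 = \<bar>?b x\<bar> * \<bar>?b x\<bar>" by (simp add: power2_eq_square)
        also have "\<dots> \<le> \<bar>?b x\<bar> * (Q * chi X x)" using bM[OF x0] c by (intro mult_left_mono) auto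
        finally show "(?b x)\<^sup>2 \<le> Q * (\<bar>?b x\<bar> * chi X x)" by (simp add: algebra_simps)
      qed
      also have "\<dots> = Q * integral {\<eta>*L..J*L} (\<lambda>x. \<bar>?b x\<bar> * chi X x)" by simp
      also have "\<dots> \<le> Q * integral {0..X} (\<lambda>x. \<bar>?b x\<bar> * chi X x)"
        using Q by (intro mult_left_mono integral_subset_le bm_int wbm bm_subset[OF wbm s1(2)] s1(2)) (auto intro!: mult_nonneg_nonneg chi_bounds X)
      also have "\<dots> \<le> Q * (C + 1 / (2 * \<delta>) * i1 t + 2 * (1 / fl b) * i2 t)" using Q w by (intro mult_left_mono) auto
      finally show ?thesis by simp
    qed
    let ?I = "integral {1..L\<^sup>2} (\<lambda>t. integral {0..J*L} (\<lambda>x. (v x t + fm x t)\<^sup>2))"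
    have L1: "1 \<le> L\<^sup>2" using elim by simp
    have "?I \<le> integral {1..L\<^sup>2} (\<lambda>t. M\<^sup>2 * (\<eta> * L) + Q * (C + 1 / (2 * \<delta>) * i1 t + 2 * (1 / fl b) * i2 t))"
      by (intro integral_le integrable_add integrable_on_mult_right integrable_const_ivl ii pt L1_integrable v_err_L1) auto
    also have "\<dots> = M\<^sup>2 * (\<eta> * L) * (L\<^sup>2 - 1) + Q * (C * (L\<^sup>2 - 1) + 1 / (2 * \<delta>) * integral {1..L\<^sup>2} i1 + 2 * (1 / fl b) * integral {1..L\<^sup>2} i2)"
      using L1 by (simp only: Henstock_Kurzweil_Integration.integral_add integrable_add integrable_on_mult_right integrable_const_ivl ii
        integral_mult_right integral_const_real) simp
    also have "\<dots> \<le> M\<^sup>2 * (\<eta> * L) * L\<^sup>2 + Q * (C * L\<^sup>2 + 1 / (2 * \<delta>) * integral {1..L\<^sup>2} i1 + 2 * (1 / fl b) * integral {1..L\<^sup>2} i2)"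
    proof -
      have "integral {0..1} (\<lambda>x. \<bar>v0 x - V0\<bar>) \<ge> 0"
        by (intro Henstock_Kurzweil_Integration.integral_nonneg bm_int bm_abs bm_diff v0_bm bm_const) auto
      then have "V1 \<ge> 0" using V1_le[of 1] by linarith
      then have C0: "C \<ge> 0" unfolding C_def using S0_nonneg J \<delta> X L0 M_pos b by (intro add_nonneg_nonneg mult_nonneg_nonneg) auto
      have "M\<^sup>2 * (\<eta> * L) * (L\<^sup>2 - 1) \<le> M\<^sup>2 * (\<eta> * L) * L\<^sup>2" using \<eta> L0 by (intro mult_left_mono) auto
      moreover have "C * (L\<^sup>2 - 1) \<le> C * L\<^sup>2" using C0 by (intro mult_left_mono) auto
      note c1 = this
      have "Q * (C * (L\<^sup>2 - 1) + 1 / (2 * \<delta>) * integral {1..L\<^sup>2} i1 + 2 * (1 / fl b) * integral {1..L\<^sup>2} i2)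
        \<le> Q * (C * L\<^sup>2 + 1 / (2 * \<delta>) * integral {1..L\<^sup>2} i1 + 2 * (1 / fl b) * integral {1..L\<^sup>2} i2)"
        by (rule mult_left_mono[OF add_right_mono[OF add_right_mono[OF c1]] less_imp_le[OF Q]])
      ultimately show ?thesis by (intro add_mono)
    qed
    also have "\<dots> = L^3 * (M\<^sup>2 * \<eta> + Q * R * \<delta> + Q * (S0 / L + 1 / (2 * \<delta>) * s1 L + 2 * (1 / fl b) * s2 L + 2 * V1 / L))"
      unfolding C_def R_def s1_def s2_def i1_def[abs_def] i2_def[abs_def] X_def b_def
      using L0 by (simp add: power2_eq_square power3_eq_cube) (simp add: algebra_simps)
    also have "\<dots> < L^3 * e"
    proof (rule mult_strict_left_mono)
      have "A \<le> e / 4 \<Longrightarrow> B \<le> e / 4 \<Longrightarrow> C < e / 4 \<Longrightarrow> A + B + C < e" for A B C using e by linarith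
      from this[OF \<eta>(3) \<delta>(3) elim(3)]
      show "M\<^sup>2 * \<eta> + Q * R * \<delta> + Q * (S0 / L + 1 / (2 * \<delta>) * s1 L + 2 * (1 / fl b) * s2 L + 2 * V1 / L) < e" .
    qed (use L0 in simp)
    finally have "?I < e * L^3" by (simp add: mult.commute)
    moreover have "0 \<le> ?I"
      by (intro Henstock_Kurzweil_Integration.integral_nonneg L1_integrable v_err_L1 bm_int[OF L1lim_bm[OF v_err_L1]]) auto
    ultimately show ?case using L0 by (simp add: field_simps)
  qed
qed

lemma v_small:
  assumes J: "J > 0"
  shows "((\<lambda>L. (1 / L^3) * integral {1..L\<^sup>2} (\<lambda>t. integral {0..J*L} (\<lambda>x. (v x t + fm x t)\<^sup>2))) \<longlongrightarrow> 0) at_top"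
proof (cases "dv = 0")
  case False
  then show ?thesis
    by (intro dominated_small[where c=dv]) (use dv J v_err_L1 Y_ge in auto)
qed (use v_small_degenerate J in blast)

text \<open>The errors of \<open>u\<close> and \<open>v\<close> are added before a good time is
  selected, so a single sequence serves both.\<close>

lemma times_exist:
  assumes J: "J > 0"
  shows "\<exists>t :: nat \<Rightarrow> real. (\<forall>n. t n > 0) \<and> filterlim t at_top sequentially \<and>
    (\<lambda>n. 1 / sqrt (t n) * integral {0..J * sqrt (t n)} (\<lambda>x. (u x (t n) - fp x (t n))\<^sup>2)) \<longlonglongrightarrow> 0 \<and>
    (\<lambda>n. 1 / sqrt (t n) * integral {0..J * sqrt (t n)} (\<lambda>x. (v x (t n) + fm x (t n))\<^sup>2)) \<longlonglongrightarrow> 0"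
proof -
  define hu where "hu L t = integral {0..J*L} (\<lambda>x. (u x t - fp x t)\<^sup>2)" for L t
  define hv where "hv L t = integral {0..J*L} (\<lambda>x. (v x t + fm x t)\<^sup>2)" for L t
  have hi: "hu L integrable_on {c..d}" "hv L integrable_on {c..d}" if "c > 0" for L c d
    unfolding hu_def hv_def by (rule L1_integrable; use that in \<open>auto intro!: u_err_L1 v_err_L1\<close>)+
  have hmono: "0 \<le> hu K t" "0 \<le> hv K t" "hu K t \<le> hu L t" "hv K t \<le> hv L t" if "K \<le> L" "t > 0" for K L t
  proof -
    have "J * K \<le> J * L" using that J by simp
    then show "hu K t \<le> hu L t" "hv K t \<le> hv L t" unfolding hu_def hv_def
      by (auto intro!: integral_subset_le bm_int L1lim_bm[OF u_err_L1] L1lim_bm[OF v_err_L1] that)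
    show "0 \<le> hu K t" "0 \<le> hv K t" unfolding hu_def hv_def
      by (auto intro!: Henstock_Kurzweil_Integration.integral_nonneg bm_int L1lim_bm[OF u_err_L1] L1lim_bm[OF v_err_L1] that)
  qed
  have "\<exists>t\<ge>real n. t > 0 \<and> 1 / sqrt t * (hu (sqrt t) t + hv (sqrt t) t) \<le> 6 / (real n + 1)" for n
  proof -
    define \<epsilon> where "\<epsilon> = 1 / (real n + 1)"
    have \<epsilon>: "\<epsilon> > 0" by (simp add: \<epsilon>_def)
    have "((\<lambda>L. (1 / L^3) * integral {1..L\<^sup>2} (hu L) + (1 / L^3) * integral {1..L\<^sup>2} (hv L)) \<longlongrightarrow> 0 + 0) at_top"
      unfolding hu_def[abs_def] hv_def[abs_def] by (intro tendsto_add u_small v_small J)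
    then have "\<forall>\<^sub>F L in at_top. (1 / L^3) * integral {1..L\<^sup>2} (hu L) + (1 / L^3) * integral {1..L\<^sup>2} (hv L) < \<epsilon>"
      by (rule order_tendstoD(2)) (use \<epsilon> in simp)
    \<comment> \<open>The lower bound on \<open>L\<close> gives
      \<open>L^2 / 2 \<ge> L \<ge> n\<close>, so the selected times tend to infinity.\<close>
    then have "\<forall>\<^sub>F L in at_top. (1 / L^3) * integral {1..L\<^sup>2} (hu L) + (1 / L^3) * integral {1..L\<^sup>2} (hv L) < \<epsilon> \<and> L \<ge> 2 + 2 * real n"
      using eventually_ge_at_top by (rule eventually_conj)
    then obtain L where L: "(1 / L^3) * integral {1..L\<^sup>2} (hu L) + (1 / L^3) * integral {1..L\<^sup>2} (hv L) < \<epsilon>" "L \<ge> 2 + 2 * real n"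
      by (metis (mono_tags, lifting) eventually_at_top_linorder order_refl)
    have L2: "L \<ge> 2" using L by simp
    then have LL: "2 * L \<le> L\<^sup>2" by (simp add: power2_eq_square)
    define h where "h t = hu L t + hv L t" for t
    have hin: "h integrable_on {c..d}" if "c > 0" for c d unfolding h_def by (intro integrable_add hi that)
    \<comment> \<open>On the later half of the time interval \<open>sqrt t\<close> lies between
      \<open>L / 2\<close> and \<open>L\<close>, so the box of time \<open>t\<close> is contained in
      that of \<open>L\<close> and the normalisations are comparable. The mean
      \<open>2 * \<epsilon> * L\<close>, the slack \<open>\<epsilon> * L\<close> and the factor
      \<open>2 / L\<close> account for the 6.\<close>
    have "integral {L\<^sup>2/2..L\<^sup>2} h \<le> integral {1..L\<^sup>2} h"
      by (rule integral_subset_le) (use LL L2 hmono[OF order_refl] in \<open>auto intro!: hin simp: h_def\<close>)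
    also have "\<dots> = integral {1..L\<^sup>2} (hu L) + integral {1..L\<^sup>2} (hv L)"
      unfolding h_def by (intro Henstock_Kurzweil_Integration.integral_add hi) auto
    also have "\<dots> \<le> \<epsilon> * L^3" using L(1) L2 by (simp add: field_simps)
    also have "\<dots> = 2 * \<epsilon> * L * (L\<^sup>2 - L\<^sup>2/2)" by (simp add: power2_eq_square power3_eq_cube)
    finally obtain t where t: "t \<in> {L\<^sup>2/2..L\<^sup>2}" "h t \<le> 2 * \<epsilon> * L + \<epsilon> * L"
      using exists_le_average[of h "L\<^sup>2/2" "L\<^sup>2" "2 * \<epsilon> * L" "\<epsilon> * L"] hin[of "L\<^sup>2/2"] L2 \<epsilon> by auto
    have tn: "t \<ge> real n" "t > 0" using t LL L(2) by auto
    have s1: "sqrt t \<le> L" using t L2 real_sqrt_le_mono[of t "L\<^sup>2"] by simp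
    have s2: "L / 2 \<le> sqrt t"
    proof -
      have "(L/2)\<^sup>2 \<le> L\<^sup>2 / 2" by (simp add: power2_eq_square)
      then have "(L/2)\<^sup>2 \<le> t" using t by simp
      then show ?thesis using real_le_rsqrt by blast
    qed
    have "hu (sqrt t) t + hv (sqrt t) t \<le> h t" unfolding h_def using hmono(3,4)[OF s1 tn(2)] by simp
    also have "\<dots> \<le> 3 * \<epsilon> * L" using t by (simp add: mult_ac)
    finally have "1 / sqrt t * (hu (sqrt t) t + hv (sqrt t) t) \<le> 1 / (L / 2) * (3 * \<epsilon> * L)"
      using s2 L2 hmono(1,2)[OF order_refl tn(2)] by (intro mult_mono frac_le) (auto intro: add_nonneg_nonneg)
    also have "\<dots> = 6 / (real n + 1)" using L2 by (simp add: \<epsilon>_def)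
    finally show ?thesis using tn by blast
  qed
  then obtain t where t: "\<And>n. t n \<ge> real n" "\<And>n. t n > 0" "\<And>n. 1 / sqrt (t n) * (hu (sqrt (t n)) (t n) + hv (sqrt (t n)) (t n)) \<le> 6 / (real n + 1)"
    by metis
  have lim: "(\<lambda>n. 6 / (real n + 1)) \<longlonglongrightarrow> 0" by real_asymp
  show ?thesis
  proof (intro exI[of _ t] conjI allI t)
    show "filterlim t at_top sequentially"
      by (rule filterlim_at_top_mono[OF filterlim_real_sequentially]) (use t in auto)
    have b: "1 / sqrt (t n) * hu (sqrt (t n)) (t n) \<le> 6 / (real n + 1)" "1 / sqrt (t n) * hv (sqrt (t n)) (t n) \<le> 6 / (real n + 1)"
      "0 \<le> 1 / sqrt (t n) * hu (sqrt (t n)) (t n)" "0 \<le> 1 / sqrt (t n) * hv (sqrt (t n)) (t n)" for n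
      using t(3)[of n] hmono(1,2)[OF order_refl t(2)[of n], of "sqrt (t n)"] t(2)[of n]
      by (simp_all add: ring_distribs add_divide_distrib) (smt (verit) divide_nonneg_nonneg real_sqrt_ge_zero)+
    have "(\<lambda>n. 1 / sqrt (t n) * hu (sqrt (t n)) (t n)) \<longlonglongrightarrow> 0"
      by (rule tendsto_sandwich[OF _ _ tendsto_const lim]) (use b in auto)
    then show "(\<lambda>n. 1 / sqrt (t n) * integral {0..J * sqrt (t n)} (\<lambda>x. (u x (t n) - fp x (t n))\<^sup>2)) \<longlonglongrightarrow> 0" unfolding hu_def .
    have "(\<lambda>n. 1 / sqrt (t n) * hv (sqrt (t n)) (t n)) \<longlonglongrightarrow> 0"
      by (rule tendsto_sandwich[OF _ _ tendsto_const lim]) (use b in auto)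
    then show "(\<lambda>n. 1 / sqrt (t n) * integral {0..J * sqrt (t n)} (\<lambda>x. (v x (t n) + fm x (t n))\<^sup>2)) \<longlonglongrightarrow> 0" unfolding hv_def .
  qed
qed

end

section \<open>Classical solutions\<close>

lemma continuous_on_halfline_times:
  fixes g :: "real \<times> real \<Rightarrow> real"
  assumes "\<And>T. T > 0 \<Longrightarrow> continuous_on ({0..} \<times> {0..T}) g"
  shows "continuous_on ({0..} \<times> {0..}) g"
  unfolding continuous_on_eq_continuous_within
proof
  fix z :: "real \<times> real" assume z: "z \<in> {0..} \<times> {0..}"
  define T where "T = snd z + 1"
  have T: "T > 0" "z \<in> {0..} \<times> {0..T}" using z by (auto simp: T_def)
  have "continuous (at z within {0..} \<times> {0..T}) g"
    using assms[OF T(1)] T(2) unfolding continuous_on_eq_continuous_within by blast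
  moreover have "at z within {0..} \<times> {0..T} = at z within {0..} \<times> {0..}"
    by (rule at_within_nhd[of _ "UNIV \<times> {..<T}"]) (use z in \<open>auto simp: T_def open_Times\<close>)
  ultimately show "continuous (at z within {0..} \<times> {0..}) g" by simp
qed

lemma C21_partials_cont:
  assumes "C21_partials X I w wx wxx wt"
  shows "continuous_on (X \<times> I) (\<lambda>(x, t). w x t)" "continuous_on (X \<times> I) (\<lambda>(x, t). wx x t)"
    "continuous_on (X \<times> I) (\<lambda>(x, t). wxx x t)" "continuous_on (X \<times> I) (\<lambda>(x, t). wt x t)"
  using assms by (simp_all add: C21_partials_def)

lemma C21_partials_deriv:
  assumes "C21_partials X I w wx wxx wt" "x \<in> X" "t \<in> I"
  shows "((\<lambda>y. w y t) has_real_derivative wx x t) (at x within X)"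
    "((\<lambda>y. wx y t) has_real_derivative wxx x t) (at x within X)"
    "((\<lambda>s. w x s) has_real_derivative wt x t) (at t within I)"
  using assms by (simp_all add: C21_partials_def)

text \<open>Gradient bounds come from the equation of a squared deviation. It is used with
  \<open>c = 0\<close> for \<open>v\<close> and \<open>c = U0\<close> for \<open>u\<close>; in both
  cases the \<open>x\<close>-derivative of the square vanishes at \<open>x = 0\<close>.\<close>

lemma C21_partials_sq:
  assumes w: "C21_partials X I w wx wxx wt"
  shows "C21_partials X I (\<lambda>x t. (w x t - c)\<^sup>2) (\<lambda>x t. 2 * (w x t - c) * wx x t)
    (\<lambda>x t. 2 * (wx x t)\<^sup>2 + 2 * (w x t - c) * wxx x t) (\<lambda>x t. 2 * (w x t - c) * wt x t)"
  unfolding C21_partials_def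
proof (intro conjI ballI)
  fix x t assume xt: "x \<in> X" "t \<in> I"
  note d = C21_partials_deriv[OF w xt]
  show "((\<lambda>y. (w y t - c)\<^sup>2) has_real_derivative 2 * (w x t - c) * wx x t) (at x within X)"
    using d(1) by (auto intro!: derivative_eq_intros)
  show "((\<lambda>y. 2 * (w y t - c) * wx y t) has_real_derivative 2 * (wx x t)\<^sup>2 + 2 * (w x t - c) * wxx x t) (at x within X)"
    using d(1,2) by (auto intro!: derivative_eq_intros simp: power2_eq_square)
  show "((\<lambda>s. (w x s - c)\<^sup>2) has_real_derivative 2 * (w x t - c) * wt x t) (at t within I)"
    using d(3) by (auto intro!: derivative_eq_intros)
next
  note [continuous_intros] = C21_partials_cont[OF w, unfolded case_prod_beta]
  show "continuous_on (X \<times> I) (\<lambda>(x, t). (w x t - c)\<^sup>2)" "continuous_on (X \<times> I) (\<lambda>(x, t). 2 * (w x t - c) * wx x t)"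
    "continuous_on (X \<times> I) (\<lambda>(x, t). 2 * (wx x t)\<^sup>2 + 2 * (w x t - c) * wxx x t)"
    "continuous_on (X \<times> I) (\<lambda>(x, t). 2 * (w x t - c) * wt x t)"
    unfolding case_prod_beta by (intro continuous_intros)+
qed

lemma continuous_slice:
  assumes "continuous_on (X \<times> I) (\<lambda>(x, t). g x t)"
  shows "x \<in> X \<Longrightarrow> continuous_on I (g x)" "t \<in> I \<Longrightarrow> continuous_on X (\<lambda>x. g x t)"
  by (rule continuous_on_compose2[OF assms, of _ "\<lambda>t. (x, t)", simplified], auto intro!: continuous_intros)
     (rule continuous_on_compose2[OF assms, of _ "\<lambda>x. (x, t)", simplified], auto intro!: continuous_intros)

lemma continuous_time_integral:
  fixes g :: "real \<Rightarrow> real \<Rightarrow> real"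
  assumes "continuous_on (X \<times> {a..b}) (\<lambda>(x, t). g x t)"
  shows "continuous_on X (\<lambda>x. integral {a..b} (g x))"
  using integral_continuous_on_param[of X a b g] assms by simp

text \<open>Taylor's formula in \<open>x\<close> for a time integral. Because the weight of the
  remainder vanishes at \<open>X\<close>, only the value of \<open>z\<close> enters at
  \<open>X\<close>, not its slope.\<close>

lemma C21_taylor:
  assumes z: "C21_partials {0..} {\<delta>..T} z zx zxx zt" and X: "X \<ge> 0" and T: "\<delta> \<le> T"
  shows "integral {\<delta>..T} (z X) = integral {\<delta>..T} (z 0) + integral {\<delta>..T} (zx 0) * X +
    integral {0..X} (\<lambda>y. (X - y) * integral {\<delta>..T} (zxx y))"
proof -
  note c = C21_partials_cont[OF z]
  define r where "r x = integral {\<delta>..T} (z x)" for x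
  define r1 where "r1 x = integral {\<delta>..T} (zx x)" for x
  define r2 where "r2 x = integral {\<delta>..T} (zxx x)" for x
  have 1: "(r has_real_derivative r1 x) (at x within {0..})" if "x \<ge> 0" for x
    unfolding r_def r1_def
    using leibniz_rule_field_derivative[of "{0..}" \<delta> T z zx x] C21_partials_deriv(1)[OF z] c(2) that
    by (auto intro!: integrable_continuous_interval continuous_slice[OF c(1)])
  have 2: "(r1 has_real_derivative r2 x) (at x within {0..})" if "x \<ge> 0" for x
    unfolding r2_def r1_def
    using leibniz_rule_field_derivative[of "{0..}" \<delta> T zx zxx x] C21_partials_deriv(2)[OF z] c(3) that
    by (auto intro!: integrable_continuous_interval continuous_slice[OF c(2)])
  have ftc: "integral {0..x} h' = h x - h 0" if "x \<ge> 0" "\<And>x. x \<ge> 0 \<Longrightarrow> (h has_real_derivative h' x) (at x within {0..})" for h h' :: "real \<Rightarrow> real" and x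
    by (rule integral_unique, rule fundamental_theorem_of_calculus)
      (use that in \<open>auto simp flip: has_real_derivative_iff_has_vector_derivative intro!: DERIV_subset[OF that(2)]\<close>)
  have r2c: "continuous_on {0..} r2" unfolding r2_def by (rule continuous_time_integral[OF c(3)])
  have r2b: "bm {0..X} r2" by (rule bm_cont[OF continuous_on_subset[OF r2c]]) auto
  have "r X - r 0 = integral {0..X} r1" using ftc[OF X 1] by simp
  also have "\<dots> = integral {0..X} (\<lambda>y. r1 0 + integral {0..y} r2)"
    by (rule Henstock_Kurzweil_Integration.integral_cong) (use ftc[OF _ 2] in auto)
  also have "\<dots> = r1 0 * X + integral {0..X} (\<lambda>y. integral {0..y} r2)"
    using X by (subst Henstock_Kurzweil_Integration.integral_add[OF integrable_const_ivl
        integrable_continuous_interval[OF indefinite_integral_continuous_1[OF bm_int[OF r2b]]]]) (simp add: mult.commute)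
  also have "integral {0..X} (\<lambda>y. integral {0..y} r2) = integral {0..X} (\<lambda>y. (X - y) * r2 y)"
    by (rule integral_iterated_indefinite[OF r2b X, symmetric])
  finally show ?thesis unfolding r_def r1_def r2_def by simp
qed

lemma C21_time_ftc:
  assumes z: "C21_partials {0..} {\<delta>..T} z zx zxx zt" and x: "x \<ge> 0" and T: "\<delta> \<le> T"
  shows "integral {\<delta>..T} (zt x) = z x T - z x \<delta>"
  by (rule integral_unique, rule fundamental_theorem_of_calculus[OF T])
    (use C21_partials_deriv(3)[OF z, of x] x in \<open>auto simp flip: has_real_derivative_iff_has_vector_derivative\<close>)

lemma integral_linear_weight_bound:
  fixes h :: "real \<Rightarrow> real"
  assumes h: "bm {0..X} h" and C: "\<And>y. y \<in> {0..X} \<Longrightarrow> \<bar>h y\<bar> \<le> C" and X: "X \<ge> 0"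
  shows "\<bar>integral {0..X} (\<lambda>y. (X - y) * h y)\<bar> \<le> C * X\<^sup>2"
proof -
  have "\<bar>integral {0..X} (\<lambda>y. (X - y) * h y)\<bar> \<le> (X * C) * (X - 0)"
  proof (rule abs_integral_le[OF _ _ X])
    show "(\<lambda>y. (X - y) * h y) integrable_on {0..X}"
      by (intro bm_int bm_mult h bm_cont continuous_intros)
    show "\<bar>(X - y) * h y\<bar> \<le> X * C" if "y \<in> {0..X}" for y
      unfolding abs_mult using C[OF that] that by (intro mult_mono) auto
  qed
  then show ?thesis by (simp add: power2_eq_square mult_ac)
qed

text \<open>The weight \<open>X - y\<close> turns \<open>zxx\<close> into boundary values of
  \<open>z\<close>, and the vanishing slope at 0 removes the linear term; the time derivative
  integrates to values of \<open>z\<close> as well. A bound on \<open>z\<close> alone therefore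
  controls the total source.\<close>

lemma C21_source_bound:
  assumes z: "C21_partials {0..} {\<delta>..T} z zx zxx zt" and X: "X \<ge> 0" and T: "\<delta> \<le> T" and d: "d \<ge> 0"
    and C: "\<And>x t. x \<ge> 0 \<Longrightarrow> t \<in> {\<delta>..T} \<Longrightarrow> \<bar>z x t\<bar> \<le> C"
    and b: "\<And>t. t \<in> {\<delta>..T} \<Longrightarrow> zx 0 t = 0"
  shows "integral {0..X} (\<lambda>y. (X - y) * integral {\<delta>..T} (\<lambda>t. d * zxx y t - zt y t)) \<le> 2 * d * C * (T - \<delta>) + 2 * C * X\<^sup>2"
proof -
  note c = C21_partials_cont[OF z]
  have e: "integral {\<delta>..T} (\<lambda>t. d * zxx y t - zt y t) = d * integral {\<delta>..T} (zxx y) - (z y T - z y \<delta>)" if "y \<ge> 0" for y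
    using that T
    by (subst Henstock_Kurzweil_Integration.integral_diff)
      (auto intro!: integrable_continuous_interval continuous_slice[OF c(3)] continuous_slice[OF c(4)] continuous_intros simp: C21_time_ftc[OF z])
  have b1: "bm {0..X} (\<lambda>y. integral {\<delta>..T} (zxx y))"
    by (rule bm_cont[OF continuous_on_subset[OF continuous_time_integral[OF c(3)]]]) auto
  have b2: "bm {0..X} (\<lambda>y. z y T - z y \<delta>)"
    using T by (intro bm_cont continuous_intros; auto intro!: continuous_on_subset[OF continuous_slice(2)[OF c(1)]])
  have bX: "bm {0..X} (\<lambda>y. X - y)" by (intro bm_cont continuous_intros)
  have "integral {0..X} (\<lambda>y. (X - y) * integral {\<delta>..T} (\<lambda>t. d * zxx y t - zt y t)) =
      integral {0..X} (\<lambda>y. d * ((X - y) * integral {\<delta>..T} (zxx y)) - (X - y) * (z y T - z y \<delta>))"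
    by (rule Henstock_Kurzweil_Integration.integral_cong) (simp add: e algebra_simps)
  also have "\<dots> = integral {0..X} (\<lambda>y. d * ((X - y) * integral {\<delta>..T} (zxx y))) - integral {0..X} (\<lambda>y. (X - y) * (z y T - z y \<delta>))"
    by (intro Henstock_Kurzweil_Integration.integral_diff bm_int bm_mult bm_const b1 b2 bX)
  finally have 1: "integral {0..X} (\<lambda>y. (X - y) * integral {\<delta>..T} (\<lambda>t. d * zxx y t - zt y t)) =
    integral {0..X} (\<lambda>y. d * ((X - y) * integral {\<delta>..T} (zxx y))) - integral {0..X} (\<lambda>y. (X - y) * (z y T - z y \<delta>))" .
  have 2: "integral {0..X} (\<lambda>y. d * ((X - y) * integral {\<delta>..T} (zxx y))) = d * (integral {\<delta>..T} (z X) - integral {\<delta>..T} (z 0))"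
  proof -
    have "integral {\<delta>..T} (zx 0) = integral {\<delta>..T} (\<lambda>t. 0)"
      by (rule Henstock_Kurzweil_Integration.integral_cong) (rule b)
    then show ?thesis using C21_taylor[OF z X T] by simp
  qed
  have 3: "d * (integral {\<delta>..T} (z X) - integral {\<delta>..T} (z 0)) \<le> d * (2 * C * (T - \<delta>))"
  proof (intro mult_left_mono d)
    have "\<bar>integral {\<delta>..T} (z x)\<bar> \<le> C * (T - \<delta>)" if "x \<ge> 0" for x
      by (rule abs_integral_le) (use that T C in \<open>auto intro!: integrable_continuous_interval continuous_slice[OF c(1)]\<close>)
    from this[of X] this[of 0] X show "integral {\<delta>..T} (z X) - integral {\<delta>..T} (z 0) \<le> 2 * C * (T - \<delta>)" by simp
  qed
  have 4: "- integral {0..X} (\<lambda>y. (X - y) * (z y T - z y \<delta>)) \<le> 2 * C * X\<^sup>2"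
  proof -
    have "\<bar>z y T - z y \<delta>\<bar> \<le> 2 * C" if "y \<in> {0..X}" for y
      using C[of y T] C[of y \<delta>] that T by auto
    from integral_linear_weight_bound[OF b2 this X] show ?thesis by auto
  qed
  have "d * (2 * C * (T - \<delta>)) = 2 * d * C * (T - \<delta>)" by simp
  then show ?thesis using 1 2 3 4 by linarith
qed

lemma integral_half_weight:
  fixes G :: "real \<Rightarrow> real"
  assumes G: "continuous_on {0..X} G" and nn: "\<And>y. y \<in> {0..X} \<Longrightarrow> 0 \<le> G y" and X: "X > 0"
  shows "(X / 2) * integral {0..X/2} G \<le> integral {0..X} (\<lambda>y. (X - y) * G y)"
proof -
  have b: "bm {0..X} (\<lambda>y. (X - y) * G y)" by (intro bm_mult bm_cont G continuous_intros)
  have "(X / 2) * integral {0..X/2} G = integral {0..X/2} (\<lambda>y. (X / 2) * G y)" by simp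
  also have "\<dots> \<le> integral {0..X/2} (\<lambda>y. (X - y) * G y)"
  proof (rule integral_le)
    show "(\<lambda>y. X / 2 * G y) integrable_on {0..X / 2}"
      by (rule bm_int_sub[OF bm_mult[OF bm_const bm_cont[OF G]]]) (use X in auto)
    show "(\<lambda>y. (X - y) * G y) integrable_on {0..X / 2}" by (rule bm_int_sub[OF b]) (use X in auto)
    fix y assume "y \<in> {0..X/2}"
    then have "0 \<le> G y" "X / 2 \<le> X - y" using nn[of y] X by auto
    then show "X / 2 * G y \<le> (X - y) * G y" by (intro mult_right_mono)
  qed
  also have "\<dots> \<le> integral {0..X} (\<lambda>y. (X - y) * G y)"
    by (rule integral_subset_le) (use X nn in \<open>auto intro!: bm_int_sub[OF b]\<close>)
  finally show ?thesis .
qed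

lemma reaction_continuous:
  assumes "reaction_function F"
  shows "continuous_on ({0..} \<times> {0..}) (\<lambda>(a, b). F a b)"
proof -
  obtain \<alpha> where \<alpha>: "\<alpha> > 0" "\<And>R. R > 0 \<Longrightarrow> \<exists>C. \<forall>u\<in>{0..R}. \<forall>v\<in>{0..R}. \<forall>u'\<in>{0..R}. \<forall>v'\<in>{0..R}.
        \<bar>F u v - F u' v'\<bar> \<le> C * dist (u, v) (u', v') powr \<alpha>"
    using assms unfolding reaction_function_def by metis
  have R: "continuous_on ({0..R} \<times> {0..R}) (\<lambda>(a, b). F a b)" if R0: "R > 0" for R
  proof -
    obtain C where C0: "\<forall>u\<in>{0..R}. \<forall>v\<in>{0..R}. \<forall>u'\<in>{0..R}. \<forall>v'\<in>{0..R}.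
        \<bar>F u v - F u' v'\<bar> \<le> C * dist (u, v) (u', v') powr \<alpha>" using \<alpha>(2)[OF R0] by blast
    have C: "\<bar>(\<lambda>(a, b). F a b) z - (\<lambda>(a, b). F a b) w\<bar> \<le> C * dist z w powr \<alpha>"
      if "z \<in> {0..R} \<times> {0..R}" "w \<in> {0..R} \<times> {0..R}" for z w
      using C0[rule_format, of "fst z" "snd z" "fst w" "snd w"] that
      by (simp only: case_prod_beta mem_Times_iff prod.collapse)
    show ?thesis unfolding continuous_on_def
    proof
      fix z :: "real \<times> real" assume z: "z \<in> {0..R} \<times> {0..R}"
      show "((\<lambda>(a, b). F a b) \<longlongrightarrow> (\<lambda>(a, b). F a b) z) (at z within {0..R} \<times> {0..R})"
      proof (rule LIM_zero_cancel, rule Lim_null_comparison)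
        show "\<forall>\<^sub>F w in at z within {0..R} \<times> {0..R}. norm ((\<lambda>(a, b). F a b) w - (\<lambda>(a, b). F a b) z) \<le> C * dist w z powr \<alpha>"
          unfolding eventually_at_filter using C[OF _ z] by auto
        have "((\<lambda>w. C * dist w z powr \<alpha>) \<longlongrightarrow> C * dist z z powr \<alpha>) (at z within {0..R} \<times> {0..R})"
          using \<alpha>(1) by (intro tendsto_intros tendsto_powr2) auto
        then show "((\<lambda>w. C * dist w z powr \<alpha>) \<longlongrightarrow> 0) (at z within {0..R} \<times> {0..R})" using \<alpha>(1) by simp
      qed
    qed
  qed
  show ?thesis unfolding continuous_on_eq_continuous_within
  proof
    fix z :: "real \<times> real" assume z: "z \<in> {0..} \<times> {0..}"
    define R where "R = fst z + snd z + 1"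
    have R': "R > 0" "z \<in> {0..R} \<times> {0..R}" using z by (auto simp: R_def)
    have "continuous (at z within {0..R} \<times> {0..R}) (\<lambda>(a, b). F a b)"
      using R[OF R'(1)] R'(2) unfolding continuous_on_eq_continuous_within by blast
    moreover have "at z within {0..R} \<times> {0..R} = at z within {0..} \<times> {0..}"
      by (rule at_within_nhd[of _ "{..<R} \<times> {..<R}"]) (use z in \<open>auto simp: R_def open_Times\<close>)
    ultimately show "continuous (at z within {0..} \<times> {0..}) (\<lambda>(a, b). F a b)" by simp
  qed
qed

section \<open>Data and reaction\<close>

locale rd_data = stefan +
  fixes k M :: real and F u v :: "real \<Rightarrow> real \<Rightarrow> real" and u0 v0 :: "real \<Rightarrow> real"
  assumes k: "k > 0" and M: "U0 \<le> M" "V0 \<le> M" and F: "reaction_function F"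
    and u0_cont: "continuous_on {0..} u0" and v0_cont: "continuous_on {0..} v0"
    and data_bounds: "x \<ge> 0 \<Longrightarrow> 0 \<le> u0 x \<and> u0 x \<le> M \<and> 0 \<le> v0 x \<and> v0 x \<le> M"
    and u0_int: "u0 absolutely_integrable_on {0..}"
    and v0_int: "(\<lambda>x. v0 x - V0) absolutely_integrable_on {0..}"
begin

lemma M_pos: "M > 0" using M U0 by simp

lemma F_nonneg: "r \<ge> 0 \<Longrightarrow> s \<ge> 0 \<Longrightarrow> F r s \<ge> 0"
  using F by (simp add: reaction_function_def)

text \<open>Once the reaction term is known to be small in \<open>L\<^sup>1\<close>, this makes the product \<open>uv\<close> small:
  \<open>F\<close> is bounded below by \<open>F \<epsilon> \<epsilon>\<close> where both arguments exceed \<open>\<epsilon>\<close>.\<close>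

lemma product_le_reaction:
  assumes e: "e > 0"
  shows "\<exists>C\<ge>0. \<forall>a\<in>{0..M}. \<forall>b\<in>{0..M}. a * b \<le> M * e + C * (k * F a b)"
proof -
  have Fe: "F e e > 0" using F e by (simp add: reaction_function_def)
  define C where "C = M\<^sup>2 / (k * F e e)"
  have C0: "C \<ge> 0" using k Fe by (simp add: C_def)
  show ?thesis
  proof (intro exI[of _ C] conjI C0 ballI)
    fix a b assume a: "a \<in> {0..M}" and b: "b \<in> {0..M}"
    have nn: "0 \<le> C * (k * F a b)" using C0 k F_nonneg[of a b] a b by simp
    consider "a \<le> e" | "b \<le> e" | "a > e" "b > e" by linarith
    then show "a * b \<le> M * e + C * (k * F a b)"
    proof cases
      case 1
      then have "b * a \<le> M * e" using a b e by (intro mult_mono) auto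
      then show ?thesis using nn by (simp add: mult.commute)
    next
      case 2
      then have "a * b \<le> M * e" using a b e by (intro mult_mono) auto
      then show ?thesis using nn by simp
    next
      case 3
      have "F e e \<le> F a e" "F a e \<le> F a b"
        using F 3 a b e unfolding reaction_function_def mono_on_def by auto
      then have "C * (k * F e e) \<le> C * (k * F a b)" using C0 k by (intro mult_left_mono) auto
      moreover have "C * (k * F e e) = M\<^sup>2" using k Fe by (simp add: C_def)
      moreover have "a * b \<le> M\<^sup>2" unfolding power2_eq_square using a b by (intro mult_mono) auto
      moreover have "0 \<le> M * e" using M_pos e by simp
      ultimately show ?thesis by linarith
    qed
  qed
qed

end

section \<open>Classical equation up to the boundary and its integrated form\<close>

locale rd_classical = rd_data +
  assumes dv_pos: "dv > 0"
    and sol: "T > 0 \<Longrightarrow> classical_solution du dv k F U0 M u0 v0 T u v"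
begin

lemma bounds: assumes "x \<ge> 0" "t \<ge> 0" shows "0 \<le> u x t" "u x t \<le> M" "0 \<le> v x t" "v x t \<le> M"
  using sol[of "t+1"] assms unfolding classical_solution_def by auto

lemma uv_cont: "continuous_on ({0..} \<times> {0..}) (\<lambda>(x, t). u x t)" "continuous_on ({0..} \<times> {0..}) (\<lambda>(x, t). v x t)"
  by (rule continuous_on_halfline_times; use sol in \<open>simp add: classical_solution_def\<close>)+

lemma u_bdry: "t > 0 \<Longrightarrow> u 0 t = U0"
  using sol[of "t+1"] unfolding classical_solution_def by auto

lemma initial: "x \<ge> 0 \<Longrightarrow> u x 0 = u0 x \<and> v x 0 = v0 x"
  using sol[of 1] unfolding classical_solution_def by auto

lemma F_cont: "continuous_on ({0..} \<times> {0..}) (\<lambda>(x, t). F (u x t) (v x t))"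
proof -
  have "continuous_on ({0..} \<times> {0..}) (\<lambda>z. (\<lambda>(a, b). F a b) ((\<lambda>(x, t). u x t) z, (\<lambda>(x, t). v x t) z))"
    by (rule continuous_on_compose2[OF reaction_continuous[OF F]])
      (auto intro!: continuous_intros uv_cont simp: bounds)
  then show ?thesis by (simp add: case_prod_beta)
qed

text \<open>The equation is stated with \<open>deriv\<close>. At interior points one-sided
  derivatives are two-sided, so it becomes an equation for the partials of the \<open>C^2,1\<close>
  structure.\<close>

lemma interior_pde:
  assumes w: "C21_partials {0..} {\<delta>..T} w wx wxx wt" and x: "x > 0" and t: "t \<in> {\<delta><..<T}"
  shows "deriv (\<lambda>s. w x s) t = wt x t" "deriv (deriv (\<lambda>y. w y t)) x = wxx x t"
proof -
  have "at t within {\<delta>..T} = at t" by (rule at_within_interior) (use t in \<open>simp add: interior_atLeastAtMost_real\<close>)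
  then show "deriv (\<lambda>s. w x s) t = wt x t"
    using C21_partials_deriv(3)[OF w, of x t] x t by (auto intro!: DERIV_imp_deriv)
  have a: "at y within {0..} = at y" if "y > 0" for y :: real
    by (rule at_within_interior) (use that in \<open>simp add: interior_real_atLeast\<close>)
  have "deriv (\<lambda>y. w y t) y = wx y t" if "y > 0" for y
    using C21_partials_deriv(1)[OF w, of y t] that t a[OF that] by (auto intro!: DERIV_imp_deriv)
  then have e: "\<And>y. y \<in> {0<..} \<Longrightarrow> wx y t = deriv (\<lambda>y. w y t) y" by simp
  have "((\<lambda>y. wx y t) has_real_derivative wxx x t) (at x)"
    using C21_partials_deriv(2)[OF w, of x t] x t a[OF x] by auto
  then have "(deriv (\<lambda>y. w y t) has_real_derivative wxx x t) (at x)"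
    by (rule has_field_derivative_transform_within_open[where S="{0<..}"]) (use x e in auto)
  then show "deriv (deriv (\<lambda>y. w y t)) x = wxx x t" by (rule DERIV_imp_deriv)
qed

text \<open>The equation and the boundary condition are given on open sets only. Both sides are
  continuous up to the boundary of the strip, so they extend to \<open>x = 0\<close> and to the end
  points of the time interval. The boundary condition gives slope 0 because
  \<open>dv > 0\<close>.\<close>

lemma partials:
  assumes d: "0 < \<delta>" "\<delta> < T"
  obtains ux uxx ut vx vxx vt where
    "C21_partials {0..} {\<delta>..T} u ux uxx ut" "C21_partials {0..} {\<delta>..T} v vx vxx vt"
    "\<And>x t. x \<ge> 0 \<Longrightarrow> t \<in> {\<delta>..T} \<Longrightarrow> ut x t = du * uxx x t - k * F (u x t) (v x t)"
    "\<And>x t. x \<ge> 0 \<Longrightarrow> t \<in> {\<delta>..T} \<Longrightarrow> vt x t = dv * vxx x t - k * F (u x t) (v x t)"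
    "\<And>t. t \<in> {\<delta>..T} \<Longrightarrow> vx 0 t = 0"
proof -
  have "C21_on {0..} {\<delta>..T} u" "C21_on {0..} {\<delta>..T} v"
    using sol[of T] d by (auto simp: classical_solution_def)
  then obtain ux uxx ut vx vxx vt where U: "C21_partials {0..} {\<delta>..T} u ux uxx ut" and V: "C21_partials {0..} {\<delta>..T} v vx vxx vt"
    unfolding C21_on_def by blast
  have cl: "closure ({0::real<..} \<times> {\<delta><..<T}) = {0..} \<times> {\<delta>..T}"
    using d by (simp add: closure_Times)
  have Fc: "continuous_on ({0..} \<times> {\<delta>..T}) (\<lambda>(x, t). F (u x t) (v x t))"
    by (rule continuous_on_subset[OF F_cont]) (use d in auto)
  note [continuous_intros] = C21_partials_cont[OF U, unfolded case_prod_beta] C21_partials_cont[OF V, unfolded case_prod_beta] Fc[unfolded case_prod_beta]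
  have pde: "du * uxx x t - k * F (u x t) (v x t) = ut x t" "dv * vxx x t - k * F (u x t) (v x t) = vt x t"
    if "x > 0" "t \<in> {\<delta><..<T}" for x t
    using sol[of T] d that interior_pde[OF U that] interior_pde[OF V that] by (auto simp: classical_solution_def)
  have 1: "ut x t - (du * uxx x t - k * F (u x t) (v x t)) = 0" if "x \<ge> 0" "t \<in> {\<delta>..T}" for x t
  proof -
    have c: "continuous_on (closure ({0::real<..} \<times> {\<delta><..<T})) (\<lambda>z. ut (fst z) (snd z) - (du * uxx (fst z) (snd z) - k * F (u (fst z) (snd z)) (v (fst z) (snd z))))"
      unfolding cl by (intro continuous_intros)
    show ?thesis using continuous_constant_on_closure[OF c, of 0 "(x, t)"] that unfolding cl using pde(1) by (auto simp: mem_Times_iff)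
  qed
  have 2: "vt x t - (dv * vxx x t - k * F (u x t) (v x t)) = 0" if "x \<ge> 0" "t \<in> {\<delta>..T}" for x t
  proof -
    have c: "continuous_on (closure ({0::real<..} \<times> {\<delta><..<T})) (\<lambda>z. vt (fst z) (snd z) - (dv * vxx (fst z) (snd z) - k * F (u (fst z) (snd z)) (v (fst z) (snd z))))"
      unfolding cl by (intro continuous_intros)
    show ?thesis using continuous_constant_on_closure[OF c, of 0 "(x, t)"] that unfolding cl using pde(2) by (auto simp: mem_Times_iff)
  qed
  have "vx 0 t = 0" if t: "t \<in> {\<delta><..<T}" for t
  proof -
    obtain l where l: "((\<lambda>y. v y t) has_real_derivative l) (at 0 within {0..})" "dv * l = 0"
      using sol[of T] d t unfolding classical_solution_def by (metis greaterThanLessThan_iff order_less_trans)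
    have "((\<lambda>y. v y t) has_vector_derivative l) (at 0 within {0..1})" "((\<lambda>y. v y t) has_vector_derivative vx 0 t) (at 0 within {0..1})"
      unfolding has_real_derivative_iff_has_vector_derivative[symmetric]
      by (rule DERIV_subset[OF l(1)], simp, rule DERIV_subset[OF C21_partials_deriv(1)[OF V]]) (use t in auto)
    then have "vx 0 t = l"
      using vector_derivative_unique_within_closed_interval[of 0 1 0] by force
    then show ?thesis using l(2) dv_pos by simp
  qed
  then have 3: "vx 0 t = 0" if "t \<in> {\<delta>..T}" for t
    using continuous_constant_on_closure[of "{\<delta><..<T}" "vx 0" 0 t] that d
      continuous_slice(1)[OF C21_partials_cont(2)[OF V], of 0] by simp
  show ?thesis by (rule that[OF U V]) (use 1 2 3 in auto)
qed

text \<open>On {\<delta>..\<tau>} the difference of the two equations, from which the reaction drops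
  out, and \<open>C21_taylor\<close> show that the defect \<open>\<Phi> \<delta>\<close> is linear
  in \<open>X\<close>. Linearity is preserved in the limit \<open>\<delta> \<rightarrow> 0\<close>,
  because \<open>u\<close> and \<open>v\<close> are continuous down to the initial time.\<close>

lemma representation:
  assumes \<tau>: "\<tau> > 0"
  shows "\<exists>c. \<forall>x\<ge>0. integral {0..\<tau>} (\<lambda>s. du * u x s - dv * v x s) =
      integral {0..\<tau>} (\<lambda>s. du * u 0 s - dv * v 0 s) + c * x +
      integral {0..x} (\<lambda>y. (x - y) * ((u y \<tau> - v y \<tau>) - (u0 y - v0 y)))"
proof -
  define B where "B x s = du * u x s - dv * v x s" for x s
  define w where "w y s = u y s - v y s" for y s
  have Bc: "continuous_on ({0..} \<times> {0..}) (\<lambda>(x, t). B x t)" and wc: "continuous_on ({0..} \<times> {0..}) (\<lambda>(x, t). w x t)"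
    unfolding B_def w_def case_prod_beta by (intro continuous_intros uv_cont[unfolded case_prod_beta])+
  define \<Phi> where "\<Phi> \<delta> X = integral {\<delta>..\<tau>} (B X) - integral {\<delta>..\<tau>} (B 0) - integral {0..X} (\<lambda>y. (X - y) * (w y \<tau> - w y \<delta>))" for \<delta> X
  have lin: "\<Phi> \<delta> X = \<Phi> \<delta> 1 * X" if d: "0 < \<delta>" "\<delta> < \<tau>" and X: "X \<ge> 0" for \<delta> X
  proof -
    obtain ux uxx ut vx vxx vt where
      U: "C21_partials {0..} {\<delta>..\<tau>} u ux uxx ut" and V: "C21_partials {0..} {\<delta>..\<tau>} v vx vxx vt"
      and pu: "\<And>x t. x \<ge> 0 \<Longrightarrow> t \<in> {\<delta>..\<tau>} \<Longrightarrow> ut x t = du * uxx x t - k * F (u x t) (v x t)"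
      and pv: "\<And>x t. x \<ge> 0 \<Longrightarrow> t \<in> {\<delta>..\<tau>} \<Longrightarrow> vt x t = dv * vxx x t - k * F (u x t) (v x t)"
      using partials[OF d] by metis
    note cu = C21_partials_cont[OF U] and cv = C21_partials_cont[OF V]
    have T: "\<delta> \<le> \<tau>" using d by simp
    have "\<exists>c. \<forall>X\<ge>0. \<Phi> \<delta> X = c * X"
    proof (intro exI[of _ "du * integral {\<delta>..\<tau>} (ux 0) - dv * integral {\<delta>..\<tau>} (vx 0)"] allI impI)
      fix X :: real assume X: "X \<ge> 0"
      have iB: "integral {\<delta>..\<tau>} (B x) = du * integral {\<delta>..\<tau>} (u x) - dv * integral {\<delta>..\<tau>} (v x)" if "x \<ge> 0" for x
        unfolding B_def[abs_def] using that
        by (subst Henstock_Kurzweil_Integration.integral_diff)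
          (auto intro!: integrable_continuous_interval continuous_intros continuous_slice[OF cu(1)] continuous_slice[OF cv(1)])
      have r2: "du * integral {\<delta>..\<tau>} (uxx y) - dv * integral {\<delta>..\<tau>} (vxx y) = w y \<tau> - w y \<delta>" if y: "y \<ge> 0" for y
      proof -
        have "du * integral {\<delta>..\<tau>} (uxx y) - dv * integral {\<delta>..\<tau>} (vxx y) = integral {\<delta>..\<tau>} (\<lambda>t. du * uxx y t - dv * vxx y t)"
          using y by (subst Henstock_Kurzweil_Integration.integral_diff)
            (auto intro!: integrable_continuous_interval continuous_intros continuous_slice[OF cu(3)] continuous_slice[OF cv(3)])
        also have "\<dots> = integral {\<delta>..\<tau>} (\<lambda>t. ut y t - vt y t)"
          by (rule Henstock_Kurzweil_Integration.integral_cong) (use pu pv y in auto)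
        also have "\<dots> = w y \<tau> - w y \<delta>"
          using y T by (subst Henstock_Kurzweil_Integration.integral_diff)
            (auto intro!: integrable_continuous_interval continuous_slice[OF cu(4)] continuous_slice[OF cv(4)]
              simp: C21_time_ftc[OF U] C21_time_ftc[OF V] w_def)
        finally show ?thesis .
      qed
      have bX: "bm {0..X} (\<lambda>y. X - y)" by (intro bm_cont continuous_intros)
      have b: "bm {0..X} (\<lambda>y. integral {\<delta>..\<tau>} (uxx y))" "bm {0..X} (\<lambda>y. integral {\<delta>..\<tau>} (vxx y))"
        by (rule bm_cont[OF continuous_on_subset[OF continuous_time_integral[OF cu(3)]]], force,
            rule bm_cont[OF continuous_on_subset[OF continuous_time_integral[OF cv(3)]]], force)
      have "integral {0..X} (\<lambda>y. (X - y) * (w y \<tau> - w y \<delta>)) =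
          integral {0..X} (\<lambda>y. du * ((X - y) * integral {\<delta>..\<tau>} (uxx y)) - dv * ((X - y) * integral {\<delta>..\<tau>} (vxx y)))"
        by (rule Henstock_Kurzweil_Integration.integral_cong) (simp flip: r2 add: algebra_simps)
      also have "\<dots> = integral {0..X} (\<lambda>y. du * ((X - y) * integral {\<delta>..\<tau>} (uxx y))) - integral {0..X} (\<lambda>y. dv * ((X - y) * integral {\<delta>..\<tau>} (vxx y)))"
        by (intro Henstock_Kurzweil_Integration.integral_diff bm_int bm_mult bm_const b bX)
      finally have e: "integral {0..X} (\<lambda>y. (X - y) * (w y \<tau> - w y \<delta>)) =
        du * integral {0..X} (\<lambda>y. (X - y) * integral {\<delta>..\<tau>} (uxx y)) - dv * integral {0..X} (\<lambda>y. (X - y) * integral {\<delta>..\<tau>} (vxx y))"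
        by (simp only: integral_mult_right)
      show "\<Phi> \<delta> X = (du * integral {\<delta>..\<tau>} (ux 0) - dv * integral {\<delta>..\<tau>} (vx 0)) * X"
        unfolding \<Phi>_def e iB[OF X] iB[OF order_refl] C21_taylor[OF U X T] C21_taylor[OF V X T]
        by (simp only: ring_distribs)
    qed
    then obtain c where "\<And>X. X \<ge> 0 \<Longrightarrow> \<Phi> \<delta> X = c * X" by blast
    then show ?thesis using X by simp
  qed
  have ev: "\<forall>\<^sub>F \<delta> in at_right 0. 0 < \<delta> \<and> \<delta> < \<tau>"
    using \<tau> by (intro eventually_at_rightI[of 0 \<tau>]) auto
  have lim: "((\<lambda>\<delta>. \<Phi> \<delta> X) \<longlongrightarrow> \<Phi> 0 X) (at_right 0)" if X: "X \<ge> 0" for X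
  proof -
    have Bx: "continuous_on {0..\<tau>} (B x)" if "x \<ge> 0" for x
      by (rule continuous_on_subset[OF continuous_slice(1)[OF Bc]]) (use that in auto)
    have i: "continuous_on {0..\<tau>} (\<lambda>\<delta>. integral {\<delta>..\<tau>} (B x))" if "x \<ge> 0" for x
      by (rule indefinite_integral_continuous_1'[OF integrable_continuous_interval[OF Bx[OF that]]])
    have "continuous_on {0..\<tau>} (\<lambda>\<delta>. integral {0..X} (\<lambda>y. (X - y) * (w y \<tau> - w y \<delta>)))"
    proof (rule continuous_time_integral)
      have w1: "continuous_on ({0..\<tau>} \<times> {0..X}) (\<lambda>z. w (snd z) (fst z))"
        by (rule continuous_on_compose2[OF wc, of _ "\<lambda>z. (snd z, fst z)", simplified]) (auto intro!: continuous_intros)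
      have w2: "continuous_on ({0..\<tau>} \<times> {0..X}) (\<lambda>z. w (snd z) \<tau>)"
        by (rule continuous_on_compose2[OF wc, of _ "\<lambda>z. (snd z, \<tau>)", simplified]) (use \<tau> in \<open>auto intro!: continuous_intros\<close>)
      show "continuous_on ({0..\<tau>} \<times> {0..X}) (\<lambda>(\<delta>, y). (X - y) * (w y \<tau> - w y \<delta>))"
        unfolding case_prod_beta by (intro continuous_intros w1 w2)
    qed
    then have "continuous_on {0..\<tau>} (\<lambda>\<delta>. \<Phi> \<delta> X)" unfolding \<Phi>_def by (intro continuous_intros i X) auto
    then have "((\<lambda>\<delta>. \<Phi> \<delta> X) \<longlongrightarrow> \<Phi> 0 X) (at 0 within {0..\<tau>})" using \<tau> by (simp add: continuous_on_def)
    then show ?thesis using \<tau> by (simp add: at_within_Icc_at_right)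
  qed
  have lin0: "\<Phi> 0 X = \<Phi> 0 1 * X" if X: "X \<ge> 0" for X
  proof (rule tendsto_unique[OF _ lim[OF X]])
    have "((\<lambda>\<delta>. \<Phi> \<delta> 1 * X) \<longlongrightarrow> \<Phi> 0 1 * X) (at_right 0)" by (intro tendsto_intros lim) simp
    moreover have "\<forall>\<^sub>F \<delta> in at_right 0. \<Phi> \<delta> 1 * X = \<Phi> \<delta> X"
      using ev by eventually_elim (metis lin X)
    ultimately show "((\<lambda>\<delta>. \<Phi> \<delta> X) \<longlongrightarrow> \<Phi> 0 1 * X) (at_right 0)" by (rule Lim_transform_eventually)
  qed simp
  have w0: "integral {0..x} (\<lambda>y. (x - y) * (w y \<tau> - w y 0)) = integral {0..x} (\<lambda>y. (x - y) * ((u y \<tau> - v y \<tau>) - (u0 y - v0 y)))" for x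
    by (rule Henstock_Kurzweil_Integration.integral_cong) (simp add: w_def initial)
  have "integral {0..\<tau>} (B X) = integral {0..\<tau>} (B 0) + \<Phi> 0 1 * X +
      integral {0..X} (\<lambda>y. (X - y) * ((u y \<tau> - v y \<tau>) - (u0 y - v0 y)))" if "X \<ge> 0" for X
    using lin0[OF that] unfolding \<Phi>_def[of 0 X] w0 by linarith
  then show ?thesis unfolding B_def[abs_def] by blast
qed

end

section \<open>Weighted space-time estimates\<close>

definition weighted :: "real \<Rightarrow> real \<Rightarrow> real \<Rightarrow> (real \<Rightarrow> real \<Rightarrow> real) \<Rightarrow> real" where
  "weighted X \<delta> T g = integral {0..X} (\<lambda>y. (X - y) * integral {\<delta>..T} (g y))"

context
  fixes X \<delta> T :: real
  assumes X: "X > 0"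
begin

lemma weighted_bm: "continuous_on ({0..} \<times> {\<delta>..T}) (\<lambda>(x, t). g x t) \<Longrightarrow> bm {0..X} (\<lambda>y. (X - y) * integral {\<delta>..T} (g y))"
  by (intro bm_mult bm_cont continuous_intros continuous_on_subset[OF continuous_time_integral]) auto

lemma weighted_mono:
  assumes "continuous_on ({0..} \<times> {\<delta>..T}) (\<lambda>(x, t). g x t)" "continuous_on ({0..} \<times> {\<delta>..T}) (\<lambda>(x, t). h x t)"
    "\<And>x t. x \<ge> 0 \<Longrightarrow> t \<in> {\<delta>..T} \<Longrightarrow> g x t \<le> h x t"
  shows "weighted X \<delta> T g \<le> weighted X \<delta> T h"
  unfolding weighted_def
proof (intro integral_le bm_int weighted_bm assms(1,2))
  fix y assume y: "y \<in> {0..X}"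
  have "integral {\<delta>..T} (g y) \<le> integral {\<delta>..T} (h y)"
    by (rule integral_le) (use y assms in \<open>auto intro!: integrable_continuous_interval continuous_slice(1)[OF assms(1)] continuous_slice(1)[OF assms(2)]\<close>)
  then show "(X - y) * integral {\<delta>..T} (g y) \<le> (X - y) * integral {\<delta>..T} (h y)"
    using y by (intro mult_left_mono) auto
qed

lemma weighted_add:
  assumes "continuous_on ({0..} \<times> {\<delta>..T}) (\<lambda>(x, t). g x t)" "continuous_on ({0..} \<times> {\<delta>..T}) (\<lambda>(x, t). h x t)"
  shows "weighted X \<delta> T (\<lambda>x t. g x t + h x t) = weighted X \<delta> T g + weighted X \<delta> T h"
proof -
  have "weighted X \<delta> T (\<lambda>x t. g x t + h x t) = integral {0..X} (\<lambda>y. (X - y) * integral {\<delta>..T} (g y) + (X - y) * integral {\<delta>..T} (h y))"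
    unfolding weighted_def
  proof (rule Henstock_Kurzweil_Integration.integral_cong)
    fix y assume y: "y \<in> {0..X}"
    have "integral {\<delta>..T} (\<lambda>t. g y t + h y t) = integral {\<delta>..T} (g y) + integral {\<delta>..T} (h y)"
      by (rule Henstock_Kurzweil_Integration.integral_add)
        (use y in \<open>auto intro!: integrable_continuous_interval continuous_slice(1)[OF assms(1)] continuous_slice(1)[OF assms(2)]\<close>)
    then show "(X - y) * integral {\<delta>..T} (\<lambda>t. g y t + h y t) = (X - y) * integral {\<delta>..T} (g y) + (X - y) * integral {\<delta>..T} (h y)"
      by (simp add: distrib_left)
  qed
  also have "\<dots> = weighted X \<delta> T g + weighted X \<delta> T h"
    unfolding weighted_def by (intro Henstock_Kurzweil_Integration.integral_add bm_int weighted_bm assms)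
  finally show ?thesis .
qed

lemma weighted_cmult: "weighted X \<delta> T (\<lambda>x t. c * g x t) = c * weighted X \<delta> T g"
  unfolding weighted_def by (simp add: mult.left_commute)

lemma weighted_half:
  assumes g: "continuous_on ({0..} \<times> {\<delta>..T}) (\<lambda>(x, t). g x t)" and nn: "\<And>x t. x \<ge> 0 \<Longrightarrow> t \<in> {\<delta>..T} \<Longrightarrow> 0 \<le> g x t"
  shows "(X / 2) * integral {0..X/2} (\<lambda>y. integral {\<delta>..T} (g y)) \<le> weighted X \<delta> T g"
  unfolding weighted_def
proof (rule integral_half_weight[OF _ _ X])
  show "continuous_on {0..X} (\<lambda>y. integral {\<delta>..T} (g y))"
    by (rule continuous_on_subset[OF continuous_time_integral[OF g]]) auto
  show "0 \<le> integral {\<delta>..T} (g y)" if "y \<in> {0..X}" for y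
    by (rule Henstock_Kurzweil_Integration.integral_nonneg)
      (use that nn in \<open>auto intro!: integrable_continuous_interval continuous_slice(1)[OF g]\<close>)
qed

end

lemma integral_swap_rect:
  fixes g :: "real \<Rightarrow> real \<Rightarrow> real"
  assumes "continuous_on ({0..} \<times> {c..d}) (\<lambda>(x, t). g x t)"
  shows "integral {0..X} (\<lambda>x. integral {c..d} (g x)) = integral {c..d} (\<lambda>t. integral {0..X} (\<lambda>x. g x t))"
proof -
  have "continuous_on (cbox (0, c) (X, d)) (\<lambda>(x, t). g x t)"
    by (rule continuous_on_subset[OF assms]) (auto simp: cbox_Pair_eq)
  from integral_swap_continuous[OF this] show ?thesis by simp
qed

lemma continuous_space_integral:
  fixes g :: "real \<Rightarrow> real \<Rightarrow> real"
  assumes "continuous_on ({0..} \<times> I) (\<lambda>(x, t). g x t)"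
  shows "continuous_on I (\<lambda>t. integral {0..X} (\<lambda>x. g x t))"
proof -
  have "continuous_on (I \<times> {0..X}) (\<lambda>(t, x). g x t)"
    unfolding case_prod_beta
    by (rule continuous_on_compose2[OF assms, of _ "\<lambda>z. (snd z, fst z)", simplified]) (auto intro!: continuous_intros)
  then show ?thesis by (rule continuous_time_integral)
qed

context rd_classical
begin

text \<open>The three sources are fed into \<open>C21_source_bound\<close>. The reaction is the
  source in the equation of \<open>v\<close>. For the square of \<open>v\<close> the reaction enters
  with the favourable sign and is dropped. For the square of \<open>u - U0\<close> it may have the
  wrong sign, but \<open>u - U0 \<ge> - M\<close>, so \<open>2 * M\<close> times the first estimate
  compensates.\<close>

lemma weighted_estimates:
  assumes T: "1 < T" and X: "X > 0"
    and U: "C21_partials {0..} {1..T} u ux uxx ut" and V: "C21_partials {0..} {1..T} v vx vxx vt"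
    and pu: "\<And>x t. x \<ge> 0 \<Longrightarrow> t \<in> {1..T} \<Longrightarrow> ut x t = du * uxx x t - k * F (u x t) (v x t)"
    and pv: "\<And>x t. x \<ge> 0 \<Longrightarrow> t \<in> {1..T} \<Longrightarrow> vt x t = dv * vxx x t - k * F (u x t) (v x t)"
    and v0: "\<And>t. t \<in> {1..T} \<Longrightarrow> vx 0 t = 0"
  shows "weighted X 1 T (\<lambda>x t. k * F (u x t) (v x t)) \<le> 2 * dv * M * T + 2 * M * X\<^sup>2"
    "2 * dv * weighted X 1 T (\<lambda>x t. (vx x t)\<^sup>2) \<le> 2 * dv * M\<^sup>2 * T + 2 * M\<^sup>2 * X\<^sup>2"
    "2 * du * weighted X 1 T (\<lambda>x t. (ux x t)\<^sup>2) \<le> 2 * du * M\<^sup>2 * T + 2 * M\<^sup>2 * X\<^sup>2 + 2 * M * (2 * dv * M * T + 2 * M * X\<^sup>2)"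
proof -
  note cu = C21_partials_cont[OF U] and cv = C21_partials_cont[OF V]
  have Fc: "continuous_on ({0..} \<times> {1..T}) (\<lambda>(x, t). F (u x t) (v x t))"
    by (rule continuous_on_subset[OF F_cont]) auto
  note [continuous_intros] = cu[unfolded case_prod_beta] cv[unfolded case_prod_beta] Fc[unfolded case_prod_beta]
  note b = bounds
  have X0: "X \<ge> 0" and T1: "1 \<le> T" using X T by auto
  have F0: "0 \<le> k * F (u x t) (v x t)" if "x \<ge> 0" "t \<in> {1..T}" for x t
    using b[of x t] that k by (intro mult_nonneg_nonneg F_nonneg) auto
  have mono: "2 * d * C * (T - 1) \<le> 2 * d * C * T" if "d \<ge> 0" "C \<ge> 0" for d C :: real
    using that by (intro mult_left_mono) auto
  have dd: "du \<ge> 0" "dv \<ge> 0" using du dv by auto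
  have "weighted X 1 T (\<lambda>x t. k * F (u x t) (v x t)) \<le> weighted X 1 T (\<lambda>x t. dv * vxx x t - vt x t)"
    by (rule weighted_mono[OF X]) (auto simp: pv case_prod_beta intro!: continuous_intros)
  also have "\<dots> \<le> 2 * dv * M * (T - 1) + 2 * M * X\<^sup>2"
    unfolding weighted_def
    by (rule C21_source_bound[OF V X0 T1 dd(2)]) (use b v0 in auto)
  finally show 1: "weighted X 1 T (\<lambda>x t. k * F (u x t) (v x t)) \<le> 2 * dv * M * T + 2 * M * X\<^sup>2"
    using mono[of dv M] dv M_pos by linarith
  have "2 * dv * weighted X 1 T (\<lambda>x t. (vx x t)\<^sup>2) = weighted X 1 T (\<lambda>x t. 2 * dv * (vx x t)\<^sup>2)"
    by (rule weighted_cmult[OF X, symmetric])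
  also have "\<dots> \<le> weighted X 1 T (\<lambda>x t. dv * (2 * (vx x t)\<^sup>2 + 2 * (v x t - 0) * vxx x t) - 2 * (v x t - 0) * vt x t)"
  proof (rule weighted_mono[OF X])
    fix x t :: real assume xt: "x \<ge> 0" "t \<in> {1..T}"
    have "0 \<le> v x t * (k * F (u x t) (v x t))" using F0[OF xt] b(3)[of x t] xt by auto
    then show "2 * dv * (vx x t)\<^sup>2 \<le> dv * (2 * (vx x t)\<^sup>2 + 2 * (v x t - 0) * vxx x t) - 2 * (v x t - 0) * vt x t"
      unfolding pv[OF xt] by (simp add: algebra_simps)
  qed (auto simp: case_prod_beta intro!: continuous_intros)
  also have "\<dots> \<le> 2 * dv * M\<^sup>2 * (T - 1) + 2 * M\<^sup>2 * X\<^sup>2"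
    unfolding weighted_def
  proof (rule C21_source_bound[OF C21_partials_sq[OF V] X0 T1 dd(2)])
    fix x t :: real assume "x \<ge> 0" "t \<in> {1..T}"
    then have "(v x t)\<^sup>2 \<le> M\<^sup>2" using b[of x t] by (intro power_mono) auto
    then show "\<bar>(v x t - 0)\<^sup>2\<bar> \<le> M\<^sup>2" by simp
  qed (simp add: v0)
  finally show "2 * dv * weighted X 1 T (\<lambda>x t. (vx x t)\<^sup>2) \<le> 2 * dv * M\<^sup>2 * T + 2 * M\<^sup>2 * X\<^sup>2"
    using mono[of dv "M\<^sup>2"] dv by simp
  have "2 * du * weighted X 1 T (\<lambda>x t. (ux x t)\<^sup>2) = weighted X 1 T (\<lambda>x t. 2 * du * (ux x t)\<^sup>2)"
    by (rule weighted_cmult[OF X, symmetric])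
  also have "\<dots> \<le> weighted X 1 T (\<lambda>x t. (du * (2 * (ux x t)\<^sup>2 + 2 * (u x t - U0) * uxx x t) - 2 * (u x t - U0) * ut x t) + (2 * M) * (k * F (u x t) (v x t)))"
  proof (rule weighted_mono[OF X])
    fix x t :: real assume xt: "x \<ge> 0" "t \<in> {1..T}"
    have "0 \<le> (u x t - U0 + M) * (k * F (u x t) (v x t))" using b(1)[of x t] xt M by (intro mult_nonneg_nonneg[OF _ F0[OF xt]]) auto
    then show "2 * du * (ux x t)\<^sup>2 \<le> (du * (2 * (ux x t)\<^sup>2 + 2 * (u x t - U0) * uxx x t) - 2 * (u x t - U0) * ut x t) + (2 * M) * (k * F (u x t) (v x t))"
      unfolding pu[OF xt] by (simp add: algebra_simps)
  qed (auto simp: case_prod_beta intro!: continuous_intros)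
  also have "\<dots> = weighted X 1 T (\<lambda>x t. du * (2 * (ux x t)\<^sup>2 + 2 * (u x t - U0) * uxx x t) - 2 * (u x t - U0) * ut x t) + (2 * M) * weighted X 1 T (\<lambda>x t. k * F (u x t) (v x t))"
    unfolding weighted_cmult[OF X, symmetric] by (rule weighted_add[OF X]) (auto simp: case_prod_beta intro!: continuous_intros)
  also have "weighted X 1 T (\<lambda>x t. du * (2 * (ux x t)\<^sup>2 + 2 * (u x t - U0) * uxx x t) - 2 * (u x t - U0) * ut x t) \<le> 2 * du * M\<^sup>2 * (T - 1) + 2 * M\<^sup>2 * X\<^sup>2"
    unfolding weighted_def
  proof (rule C21_source_bound[OF C21_partials_sq[OF U] X0 T1 dd(1)])
    fix x t :: real assume "x \<ge> 0" "t \<in> {1..T}"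
    then have "\<bar>u x t - U0\<bar>\<^sup>2 \<le> M\<^sup>2" using b[of x t] M U0 by (intro power_mono) auto
    then show "\<bar>(u x t - U0)\<^sup>2\<bar> \<le> M\<^sup>2" by simp
  qed (simp add: u_bdry)
  also have "2 * M * weighted X 1 T (\<lambda>x t. k * F (u x t) (v x t)) \<le> 2 * M * (2 * dv * M * T + 2 * M * X\<^sup>2)"
    using 1 M_pos by (intro mult_left_mono) auto
  finally show "2 * du * weighted X 1 T (\<lambda>x t. (ux x t)\<^sup>2) \<le> 2 * du * M\<^sup>2 * T + 2 * M\<^sup>2 * X\<^sup>2 + 2 * M * (2 * dv * M * T + 2 * M * X\<^sup>2)"
    using mono[OF dd(1) zero_le_power2[of M]] by linarith
qed

text \<open>With \<open>X = 2 * X0 * L\<close> the weighted integrals are of order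
  \<open>L^2\<close> while the weight is at least \<open>X0 * L\<close> on {0..X0*L}, so the plain
  integrals are of order \<open>L\<close>. The constant does not depend on \<open>L\<close>,
  although the partial derivatives are obtained separately for each strip.\<close>

lemma estimates:
  assumes X0: "X0 > 0"
  shows "\<exists>C>0. \<forall>L\<ge>2. \<exists>ux vx.
    (\<forall>x\<ge>0. \<forall>t\<in>{1..L\<^sup>2}. ((\<lambda>y. u y t) has_real_derivative ux x t) (at x within {0..}) \<and> ((\<lambda>y. v y t) has_real_derivative vx x t) (at x within {0..})) \<and>
    continuous_on ({0..} \<times> {1..L\<^sup>2}) (\<lambda>(x, t). ux x t) \<and> continuous_on ({0..} \<times> {1..L\<^sup>2}) (\<lambda>(x, t). vx x t) \<and>
    integral {0..X0*L} (\<lambda>x. integral {1..L\<^sup>2} (\<lambda>t. k * F (u x t) (v x t))) \<le> C * L \<and>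
    integral {0..X0*L} (\<lambda>x. integral {1..L\<^sup>2} (\<lambda>t. (ux x t)\<^sup>2)) \<le> C * L \<and>
    integral {0..X0*L} (\<lambda>x. integral {1..L\<^sup>2} (\<lambda>t. (vx x t)\<^sup>2)) \<le> C * L"
proof -
  \<comment> \<open>The coefficients of \<open>L^2\<close> in \<open>weighted_estimates\<close> for
    \<open>T = L^2\<close> and \<open>X^2 = 4 * X0^2 * L^2\<close>, divided by the diffusion factor
    for the gradients.\<close>
  define c1 where "c1 = 2 * dv * M + 8 * M * X0\<^sup>2"
  define c2 where "c2 = (2 * dv * M\<^sup>2 + 8 * M\<^sup>2 * X0\<^sup>2) / (2 * dv)"
  define c3 where "c3 = (2 * du * M\<^sup>2 + 8 * M\<^sup>2 * X0\<^sup>2 + 2 * M * c1) / (2 * du)"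
  have c: "c1 > 0" "c2 > 0" "c3 > 0"
    unfolding c1_def c2_def c3_def using dv_pos du M_pos X0 by (auto intro!: add_pos_pos divide_pos_pos mult_pos_pos)
  define C where "C = (c1 + c2 + c3) / X0"
  show ?thesis
  proof (intro exI[of _ C] conjI allI impI)
    show "C > 0" using c X0 by (simp add: C_def)
    fix L :: real assume L: "L \<ge> 2"
    have "2 * 2 \<le> L * L" using L by (intro mult_mono) auto
    then have T: "1 < L\<^sup>2" by (simp add: power2_eq_square)
    define X where "X = 2 * X0 * L"
    have X: "X > 0" "X / 2 = X0 * L" using X0 L by (auto simp: X_def)
    have X2: "X\<^sup>2 = 4 * X0\<^sup>2 * L\<^sup>2" by (simp add: X_def power_mult_distrib)
    obtain ux uxx ut vx vxx vt where P: "C21_partials {0..} {1..L\<^sup>2} u ux uxx ut" "C21_partials {0..} {1..L\<^sup>2} v vx vxx vt"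
      "\<And>x t. x \<ge> 0 \<Longrightarrow> t \<in> {1..L\<^sup>2} \<Longrightarrow> ut x t = du * uxx x t - k * F (u x t) (v x t)"
      "\<And>x t. x \<ge> 0 \<Longrightarrow> t \<in> {1..L\<^sup>2} \<Longrightarrow> vt x t = dv * vxx x t - k * F (u x t) (v x t)"
      "\<And>t. t \<in> {1..L\<^sup>2} \<Longrightarrow> vx 0 t = 0"
      using partials[OF zero_less_one T] by metis
    note cu = C21_partials_cont[OF P(1)] and cv = C21_partials_cont[OF P(2)]
    have Fc: "continuous_on ({0..} \<times> {1..L\<^sup>2}) (\<lambda>(x, t). F (u x t) (v x t))"
      by (rule continuous_on_subset[OF F_cont]) auto
    note [continuous_intros] = cu[unfolded case_prod_beta] cv[unfolded case_prod_beta] Fc[unfolded case_prod_beta]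
    note W = weighted_estimates[OF T X(1) P]
    have fin: "integral {0..X0*L} (\<lambda>x. integral {1..L\<^sup>2} (g x)) \<le> C * L"
      if g: "continuous_on ({0..} \<times> {1..L\<^sup>2}) (\<lambda>(x, t). g x t)" "\<And>x t. x \<ge> 0 \<Longrightarrow> t \<in> {1..L\<^sup>2} \<Longrightarrow> 0 \<le> g x t"
        and w: "weighted X 1 (L\<^sup>2) g \<le> c * L\<^sup>2" and cC: "c \<le> c1 + c2 + c3" for g c
    proof -
      have "(X0 * L) * integral {0..X0*L} (\<lambda>x. integral {1..L\<^sup>2} (g x)) \<le> c * L\<^sup>2"
        using weighted_half[OF X(1) g] w unfolding X(2) by linarith
      also have "\<dots> \<le> (c1 + c2 + c3) * L\<^sup>2" using cC by (intro mult_right_mono) auto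
      also have "\<dots> = (X0 * L) * (C * L)" using X0 by (simp add: C_def power2_eq_square)
      finally show ?thesis using X0 L by simp
    qed
    have w1: "weighted X 1 (L\<^sup>2) (\<lambda>x t. k * F (u x t) (v x t)) \<le> c1 * L\<^sup>2"
      using W(1) unfolding X2 c1_def by (simp add: algebra_simps)
    have w2: "weighted X 1 (L\<^sup>2) (\<lambda>x t. (vx x t)\<^sup>2) \<le> c2 * L\<^sup>2"
    proof -
      have "2 * dv * weighted X 1 (L\<^sup>2) (\<lambda>x t. (vx x t)\<^sup>2) \<le> (2 * dv * M\<^sup>2 + 8 * M\<^sup>2 * X0\<^sup>2) * L\<^sup>2"
        using W(2) unfolding X2 by (simp add: algebra_simps)
      then show ?thesis unfolding c2_def using dv_pos by (simp add: field_simps)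
    qed
    have w3: "weighted X 1 (L\<^sup>2) (\<lambda>x t. (ux x t)\<^sup>2) \<le> c3 * L\<^sup>2"
    proof -
      have "2 * du * weighted X 1 (L\<^sup>2) (\<lambda>x t. (ux x t)\<^sup>2) \<le> (2 * du * M\<^sup>2 + 8 * M\<^sup>2 * X0\<^sup>2 + 2 * M * c1) * L\<^sup>2"
        using W(3) unfolding X2 c1_def by (simp add: algebra_simps)
      then show ?thesis unfolding c3_def using du by (simp add: field_simps)
    qed
    show "\<exists>ux vx.
    (\<forall>x\<ge>0. \<forall>t\<in>{1..L\<^sup>2}. ((\<lambda>y. u y t) has_real_derivative ux x t) (at x within {0..}) \<and> ((\<lambda>y. v y t) has_real_derivative vx x t) (at x within {0..})) \<and>
    continuous_on ({0..} \<times> {1..L\<^sup>2}) (\<lambda>(x, t). ux x t) \<and> continuous_on ({0..} \<times> {1..L\<^sup>2}) (\<lambda>(x, t). vx x t) \<and>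
    integral {0..X0*L} (\<lambda>x. integral {1..L\<^sup>2} (\<lambda>t. k * F (u x t) (v x t))) \<le> C * L \<and>
    integral {0..X0*L} (\<lambda>x. integral {1..L\<^sup>2} (\<lambda>t. (ux x t)\<^sup>2)) \<le> C * L \<and>
    integral {0..X0*L} (\<lambda>x. integral {1..L\<^sup>2} (\<lambda>t. (vx x t)\<^sup>2)) \<le> C * L"
    proof (rule exI[of _ ux], rule exI[of _ vx], intro conjI)
      show "integral {0..X0*L} (\<lambda>x. integral {1..L\<^sup>2} (\<lambda>t. k * F (u x t) (v x t))) \<le> C * L"
        by (rule fin[OF _ _ w1])
          (use c k bounds in \<open>auto simp: case_prod_beta intro!: continuous_intros mult_nonneg_nonneg F_nonneg\<close>)
      show "integral {0..X0*L} (\<lambda>x. integral {1..L\<^sup>2} (\<lambda>t. (ux x t)\<^sup>2)) \<le> C * L"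
        by (rule fin[OF _ _ w3]) (use c in \<open>auto simp: case_prod_beta intro!: continuous_intros\<close>)
      show "integral {0..X0*L} (\<lambda>x. integral {1..L\<^sup>2} (\<lambda>t. (vx x t)\<^sup>2)) \<le> C * L"
        by (rule fin[OF _ _ w2]) (use c in \<open>auto simp: case_prod_beta intro!: continuous_intros\<close>)
    qed (use C21_partials_deriv[OF P(1)] C21_partials_deriv[OF P(2)] cu cv in auto)
  qed
qed

text \<open>By \<open>product_le_reaction\<close> the product is at most a small constant plus a
  multiple of the reaction. The constant contributes proportionally to the volume
  \<open>L^3\<close>; the reaction contributes only order \<open>L\<close>.\<close>

lemma segregation:
  "((\<lambda>L. (1 / L^3) * integral {1..L\<^sup>2} (\<lambda>t. integral {0..X*L} (\<lambda>x. u x t * v x t))) \<longlongrightarrow> 0) at_top"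
proof (cases "X > 0")
  case False
  have "\<forall>\<^sub>F L in at_top. 0 = (1 / L^3) * integral {1..L\<^sup>2} (\<lambda>t. integral {0..X*L} (\<lambda>x. u x t * v x t))"
    using eventually_ge_at_top[of 0]
  proof eventually_elim
    case (elim L)
    then have "X * L \<le> 0" using False by (simp add: mult_nonpos_nonneg)
    then have "integral {0..X*L} h = 0" for h :: "real \<Rightarrow> real" by (cases "X * L = 0") auto
    then show ?case by simp
  qed
  then show ?thesis by (rule Lim_transform_eventually[OF tendsto_const])
next
  case X: True
  obtain C where C: "C > 0" "\<And>L. L \<ge> 2 \<Longrightarrow> integral {0..X*L} (\<lambda>x. integral {1..L\<^sup>2} (\<lambda>t. k * F (u x t) (v x t))) \<le> C * L"
    using estimates[OF X] by (elim exE conjE) (rule that, assumption, blast)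
  show ?thesis unfolding tendsto_iff
  proof (intro allI impI)
    fix e :: real assume e: "e > 0"
    \<comment> \<open>Makes the contribution \<open>M * \<epsilon> * X\<close> of the constant equal
      to \<open>e / 2\<close>.\<close>
    define \<epsilon> where "\<epsilon> = e / (2 * M * X)"
    have \<epsilon>: "\<epsilon> > 0" using e M_pos X by (simp add: \<epsilon>_def)
    obtain D where D: "D \<ge> 0" "\<And>r s. r \<in> {0..M} \<Longrightarrow> s \<in> {0..M} \<Longrightarrow> r * s \<le> M * \<epsilon> + D * (k * F r s)"
      using product_le_reaction[OF \<epsilon>] by metis
    have "((\<lambda>L. M * \<epsilon> * X + D * C / L\<^sup>2) \<longlongrightarrow> M * \<epsilon> * X) at_top" by real_asymp
    then have "\<forall>\<^sub>F L in at_top. M * \<epsilon> * X + D * C / L\<^sup>2 < e"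
      by (rule order_tendstoD(2)) (use e M_pos X in \<open>simp add: \<epsilon>_def\<close>)
    then show "\<forall>\<^sub>F L in at_top. dist ((1 / L^3) * integral {1..L\<^sup>2} (\<lambda>t. integral {0..X*L} (\<lambda>x. u x t * v x t))) 0 < e"
      using eventually_ge_at_top[of 2]
    proof eventually_elim
      case (elim L)
      have L0: "L > 0" using elim by simp
      have L1: "1 \<le> L\<^sup>2" using elim by (intro one_le_power) simp
      have sub: "{0..} \<times> {1..L\<^sup>2} \<subseteq> {0..} \<times> {0::real..}" by auto
      note [continuous_intros] = continuous_on_subset[OF uv_cont(1) sub, unfolded case_prod_beta]
        continuous_on_subset[OF uv_cont(2) sub, unfolded case_prod_beta] continuous_on_subset[OF F_cont sub, unfolded case_prod_beta]
      have gc: "continuous_on ({0..} \<times> {1..L\<^sup>2}) (\<lambda>(x, t). u x t * v x t)"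
        and hc: "continuous_on ({0..} \<times> {1..L\<^sup>2}) (\<lambda>(x, t). k * F (u x t) (v x t))"
        and hc': "continuous_on ({0..} \<times> {1..L\<^sup>2}) (\<lambda>(x, t). M * \<epsilon> + D * (k * F (u x t) (v x t)))"
        unfolding case_prod_beta by (intro continuous_intros)+
      let ?I = "integral {1..L\<^sup>2} (\<lambda>t. integral {0..X*L} (\<lambda>x. u x t * v x t))"
      have "?I \<le> integral {1..L\<^sup>2} (\<lambda>t. integral {0..X*L} (\<lambda>x. M * \<epsilon> + D * (k * F (u x t) (v x t))))"
      proof (intro integral_le integrable_continuous_interval continuous_space_integral[OF gc] continuous_space_integral[OF hc'])
        fix t assume t: "t \<in> {1..L\<^sup>2}"
        show "continuous_on {0..X*L} (\<lambda>x. u x t * v x t)" "continuous_on {0..X*L} (\<lambda>x. M * \<epsilon> + D * (k * F (u x t) (v x t)))"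
          by (rule continuous_on_subset[OF continuous_slice(2)[OF gc t]], force, rule continuous_on_subset[OF continuous_slice(2)[OF hc' t]], force)
        show "u x t * v x t \<le> M * \<epsilon> + D * (k * F (u x t) (v x t))" if "x \<in> {0..X*L}" for x
          using D(2)[of "u x t" "v x t"] bounds[of x t] that t by auto
      qed
      also have "\<dots> = integral {1..L\<^sup>2} (\<lambda>t. M * \<epsilon> * (X * L) + D * integral {0..X*L} (\<lambda>x. k * F (u x t) (v x t)))"
      proof (rule Henstock_Kurzweil_Integration.integral_cong)
        fix t assume t: "t \<in> {1..L\<^sup>2}"
        have i: "(\<lambda>x. D * (k * F (u x t) (v x t))) integrable_on {0..X*L}"
          by (intro integrable_on_mult_right integrable_continuous_interval continuous_on_subset[OF continuous_slice(2)[OF hc t]]) auto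
        show "integral {0..X*L} (\<lambda>x. M * \<epsilon> + D * (k * F (u x t) (v x t))) = M * \<epsilon> * (X * L) + D * integral {0..X*L} (\<lambda>x. k * F (u x t) (v x t))"
          using X L0 by (simp only: Henstock_Kurzweil_Integration.integral_add[OF integrable_const_ivl i] integral_mult_right[symmetric] integral_const_real)
            (simp add: mult.commute)
      qed
      also have "\<dots> = M * \<epsilon> * (X * L) * (L\<^sup>2 - 1) + D * integral {1..L\<^sup>2} (\<lambda>t. integral {0..X*L} (\<lambda>x. k * F (u x t) (v x t)))"
      proof -
        have i: "(\<lambda>t. D * integral {0..X*L} (\<lambda>x. k * F (u x t) (v x t))) integrable_on {1..L\<^sup>2}"
          by (intro integrable_on_mult_right integrable_continuous_interval continuous_space_integral[OF hc])
        show ?thesis using L1 by (simp only: Henstock_Kurzweil_Integration.integral_add[OF integrable_const_ivl i] integral_mult_right[of _ D] integral_const_real)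
            (simp add: mult.commute)
      qed
      also have "\<dots> \<le> M * \<epsilon> * (X * L) * L\<^sup>2 + D * (C * L)"
      proof (intro add_mono)
        show "D * integral {1..L\<^sup>2} (\<lambda>t. integral {0..X*L} (\<lambda>x. k * F (u x t) (v x t))) \<le> D * (C * L)"
          using C(2)[OF elim(2)] D(1) unfolding integral_swap_rect[OF hc] by (intro mult_left_mono)
        show "M * \<epsilon> * (X * L) * (L\<^sup>2 - 1) \<le> M * \<epsilon> * (X * L) * L\<^sup>2"
          using M_pos \<epsilon> X L0 by (intro mult_left_mono) auto
      qed
      also have "\<dots> = L^3 * (M * \<epsilon> * X + D * C / L\<^sup>2)" using L0 by (simp add: field_simps power2_eq_square power3_eq_cube)
      also have "\<dots> < L^3 * e" using elim(1) L0 by (intro mult_strict_left_mono) auto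
      finally have "?I < L^3 * e" .
      moreover have "0 \<le> ?I"
      proof (intro Henstock_Kurzweil_Integration.integral_nonneg integrable_continuous_interval continuous_space_integral[OF gc])
        fix t assume t: "t \<in> {1..L\<^sup>2}"
        show "continuous_on {0..X*L} (\<lambda>x. u x t * v x t)"
          by (rule continuous_on_subset[OF continuous_slice(2)[OF gc t]]) force
        show "0 \<le> u x t * v x t" if "x \<in> {0..X*L}" for x using bounds[of x t] that t by auto
      qed
      ultimately show ?case using L0 by (simp add: field_simps)
    qed
  qed
qed

text \<open>Fundamental theorem of calculus and Young's inequality with parameter \<open>s\<close>,
  so that only the integral of the squared slope is needed.\<close>

lemma increment_le:
  assumes d: "\<And>y. y \<ge> 0 \<Longrightarrow> (h has_real_derivative h' y) (at y within {0..})" and c: "continuous_on {0..} h'"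
    and x: "0 \<le> x" "x \<le> X" and s: "s > 0"
  shows "\<bar>h x - h 0\<bar> \<le> s / 2 * X + 1 / (2 * s) * integral {0..X} (\<lambda>y. (h' y)\<^sup>2)"
proof -
  have c': "continuous_on {0..y} h'" for y by (rule continuous_on_subset[OF c]) auto
  have "h x - h 0 = integral {0..x} h'"
    by (rule integral_unique[symmetric], rule fundamental_theorem_of_calculus[OF x(1)])
      (use d in \<open>auto simp flip: has_real_derivative_iff_has_vector_derivative intro!: DERIV_subset[OF d]\<close>)
  also have "\<bar>\<dots>\<bar> \<le> integral {0..x} (\<lambda>y. s / 2 + (1 / (2 * s)) * (h' y)\<^sup>2)"
  proof (rule abs_integral_le_integral)
    show "\<bar>h' y\<bar> \<le> s / 2 + (1 / (2 * s)) * (h' y)\<^sup>2" for y using abs_le_young[OF s, of "h' y"] by simp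
  qed (intro integrable_continuous_interval continuous_intros c')+
  also have "\<dots> \<le> integral {0..X} (\<lambda>y. s / 2 + (1 / (2 * s)) * (h' y)\<^sup>2)"
    by (rule integral_subset_le) (use x s in \<open>auto intro!: integrable_continuous_interval continuous_intros c'\<close>)
  also have "\<dots> = s / 2 * X + 1 / (2 * s) * integral {0..X} (\<lambda>y. (h' y)\<^sup>2)"
  proof -
    have i: "(\<lambda>y. (1 / (2 * s)) * (h' y)\<^sup>2) integrable_on {0..X}"
      by (intro integrable_continuous_interval continuous_intros c')
    show ?thesis using x by (simp only: Henstock_Kurzweil_Integration.integral_add[OF integrable_const_ivl i] integral_mult_right integral_const_real) simp
  qed
  finally show ?thesis .
qed

text \<open>Near the boundary \<open>u x t * v x t\<close> stays close to \<open>U0 * v 0 t\<close>,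
  with an error controlled by the gradients. Averaging over {0..X} bounds the boundary value of
  \<open>v\<close> by the mean of the product, which segregation makes small.\<close>

lemma boundary_pointwise:
  assumes u: "\<And>y. y \<ge> 0 \<Longrightarrow> ((\<lambda>y. u y t) has_real_derivative p y) (at y within {0..})" and pc: "continuous_on {0..} p"
    and v: "\<And>y. y \<ge> 0 \<Longrightarrow> ((\<lambda>y. v y t) has_real_derivative r y) (at y within {0..})" and rc: "continuous_on {0..} r"
    and X: "X > 0" and s: "s > 0" and t: "t > 0"
  shows "U0 * v 0 t \<le> (1 / X) * integral {0..X} (\<lambda>x. u x t * v x t) +
    (M * s * X + M / (2 * s) * (integral {0..X} (\<lambda>y. (p y)\<^sup>2) + integral {0..X} (\<lambda>y. (r y)\<^sup>2)))"
proof -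
  define E where "E = M * s * X + M / (2 * s) * (integral {0..X} (\<lambda>y. (p y)\<^sup>2) + integral {0..X} (\<lambda>y. (r y)\<^sup>2))"
  have uvc: "continuous_on {0..X} (\<lambda>x. u x t * v x t)"
    using t by (intro continuous_intros continuous_on_subset[OF continuous_slice(2)[OF uv_cont(1)]] continuous_on_subset[OF continuous_slice(2)[OF uv_cont(2)]]) auto
  have pt: "U0 * v 0 t - E \<le> u x t * v x t" if x: "x \<in> {0..X}" for x
  proof -
    have x0: "0 \<le> x" "x \<le> X" using x by auto
    have t0: "t \<ge> 0" using t by simp
    note du = increment_le[OF u pc x0 s, unfolded u_bdry[OF t]] and dv = increment_le[OF v rc x0 s]
    have "U0 * v 0 t = u x t * v x t - v 0 t * (u x t - U0) - u x t * (v x t - v 0 t)" by (simp add: algebra_simps)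
    also have "\<dots> \<le> u x t * v x t + v 0 t * \<bar>u x t - U0\<bar> + u x t * \<bar>v x t - v 0 t\<bar>"
    proof -
      have "- (v 0 t * (u x t - U0)) \<le> v 0 t * \<bar>u x t - U0\<bar>" "- (u x t * (v x t - v 0 t)) \<le> u x t * \<bar>v x t - v 0 t\<bar>"
        using bounds(3)[of 0 t] bounds(1)[OF x0(1) t0] t0
        by (metis abs_ge_minus_self mult_left_mono mult_minus_right order_refl)+
      then show ?thesis by linarith
    qed
    also have "\<dots> \<le> u x t * v x t + M * (s / 2 * X + 1 / (2 * s) * integral {0..X} (\<lambda>y. (p y)\<^sup>2)) + M * (s / 2 * X + 1 / (2 * s) * integral {0..X} (\<lambda>y. (r y)\<^sup>2))"
      using bounds[OF x0(1) t0] bounds[OF order_refl t0] du dv M_pos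
      by (intro add_mono order_refl mult_mono) auto
    also have "\<dots> = u x t * v x t + E" unfolding E_def by (simp add: algebra_simps add_divide_distrib)
    finally show ?thesis by simp
  qed
  have "integral {0..X} (\<lambda>x. U0 * v 0 t - E) \<le> integral {0..X} (\<lambda>x. u x t * v x t)"
    by (intro integral_le pt integrable_continuous_interval[OF uvc]) auto
  then have "X * (U0 * v 0 t - E) \<le> integral {0..X} (\<lambda>x. u x t * v x t)" using X by simp
  then have "U0 * v 0 t - E \<le> (1 / X) * integral {0..X} (\<lambda>x. u x t * v x t)" using X by (simp add: field_simps)
  then show ?thesis unfolding E_def by linarith
qed

text \<open>The gradient bounds on {0..L} serve all widths \<open>\<epsilon> * L\<close> with
  \<open>\<epsilon> \<le> 1\<close>, so \<open>C\<close> is independent of \<open>\<epsilon>\<close>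
  and \<open>s\<close>, which are still to be chosen.\<close>

lemma boundary_estimate:
  obtains C where "C > 0" "\<And>L \<epsilon> s. L \<ge> 2 \<Longrightarrow> 0 < \<epsilon> \<Longrightarrow> \<epsilon> \<le> 1 \<Longrightarrow> s > 0 \<Longrightarrow> U0 * integral {1..L\<^sup>2} (\<lambda>t. v 0 t) \<le>
    (1 / (\<epsilon> * L)) * integral {1..L\<^sup>2} (\<lambda>t. integral {0..\<epsilon>*L} (\<lambda>x. u x t * v x t)) + M * s * \<epsilon> * L\<^sup>2 + C / s * L\<^sup>2"
proof -
  obtain C where C: "C > 0" and E: "\<And>L. L \<ge> 2 \<Longrightarrow> \<exists>ux vx.
    (\<forall>x\<ge>0. \<forall>t\<in>{1..L\<^sup>2}. ((\<lambda>y. u y t) has_real_derivative ux x t) (at x within {0..}) \<and> ((\<lambda>y. v y t) has_real_derivative vx x t) (at x within {0..})) \<and>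
    continuous_on ({0..} \<times> {1..L\<^sup>2}) (\<lambda>(x, t). ux x t) \<and> continuous_on ({0..} \<times> {1..L\<^sup>2}) (\<lambda>(x, t). vx x t) \<and>
    integral {0..1*L} (\<lambda>x. integral {1..L\<^sup>2} (\<lambda>t. k * F (u x t) (v x t))) \<le> C * L \<and>
    integral {0..1*L} (\<lambda>x. integral {1..L\<^sup>2} (\<lambda>t. (ux x t)\<^sup>2)) \<le> C * L \<and>
    integral {0..1*L} (\<lambda>x. integral {1..L\<^sup>2} (\<lambda>t. (vx x t)\<^sup>2)) \<le> C * L"
    using estimates[OF zero_less_one] by (elim exE conjE) (rule that, assumption, blast)
  show ?thesis
  proof (rule that[of "M * C"])
    show "M * C > 0" using M_pos C by simp
    fix L \<epsilon> s :: real assume L: "L \<ge> 2" and \<epsilon>: "0 < \<epsilon>" "\<epsilon> \<le> 1" and s: "s > 0"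
    obtain ux vx where d: "\<And>x t. x \<ge> 0 \<Longrightarrow> t \<in> {1..L\<^sup>2} \<Longrightarrow> ((\<lambda>y. u y t) has_real_derivative ux x t) (at x within {0..})"
        "\<And>x t. x \<ge> 0 \<Longrightarrow> t \<in> {1..L\<^sup>2} \<Longrightarrow> ((\<lambda>y. v y t) has_real_derivative vx x t) (at x within {0..})"
      and cu: "continuous_on ({0..} \<times> {1..L\<^sup>2}) (\<lambda>(x, t). ux x t)" and cv: "continuous_on ({0..} \<times> {1..L\<^sup>2}) (\<lambda>(x, t). vx x t)"
      and iu: "integral {0..1*L} (\<lambda>x. integral {1..L\<^sup>2} (\<lambda>t. (ux x t)\<^sup>2)) \<le> C * L"
      and iv: "integral {0..1*L} (\<lambda>x. integral {1..L\<^sup>2} (\<lambda>t. (vx x t)\<^sup>2)) \<le> C * L"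
      using E[OF L] by (elim exE conjE) (rule that, blast+)
    have L0: "L > 0" using L by simp
    have L1: "1 \<le> L\<^sup>2" using L by (intro one_le_power) simp
    define X where "X = \<epsilon> * L"
    have X: "X > 0" "X \<le> L" using \<epsilon> L0 by (auto simp: X_def mult_le_cancel_right1)
    have sub: "{0..} \<times> {1..L\<^sup>2} \<subseteq> {0..} \<times> {0::real..}" by auto
    note [continuous_intros] = continuous_on_subset[OF uv_cont(1) sub, unfolded case_prod_beta]
      continuous_on_subset[OF uv_cont(2) sub, unfolded case_prod_beta] cu[unfolded case_prod_beta] cv[unfolded case_prod_beta]
    have gc: "continuous_on ({0..} \<times> {1..L\<^sup>2}) (\<lambda>(x, t). u x t * v x t)"
      and pc: "continuous_on ({0..} \<times> {1..L\<^sup>2}) (\<lambda>(x, t). (ux x t)\<^sup>2)"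
      and rc: "continuous_on ({0..} \<times> {1..L\<^sup>2}) (\<lambda>(x, t). (vx x t)\<^sup>2)"
      unfolding case_prod_beta by (intro continuous_intros)+
    define m where "m t = integral {0..X} (\<lambda>x. u x t * v x t)" for t
    define P where "P t = integral {0..X} (\<lambda>x. (ux x t)\<^sup>2)" for t
    define R where "R t = integral {0..X} (\<lambda>x. (vx x t)\<^sup>2)" for t
    have i: "m integrable_on {1..L\<^sup>2}" "P integrable_on {1..L\<^sup>2}" "R integrable_on {1..L\<^sup>2}"
      unfolding m_def P_def R_def
      by (intro integrable_continuous_interval continuous_space_integral gc pc rc)+
    have PR: "integral {1..L\<^sup>2} P \<le> C * L" "integral {1..L\<^sup>2} R \<le> C * L"
    proof -
      have *: "integral {1..L\<^sup>2} (\<lambda>t. integral {0..X} (\<lambda>x. g x t)) \<le> C * L"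
        if g: "continuous_on ({0..} \<times> {1..L\<^sup>2}) (\<lambda>(x, t). g x t)" "\<And>x t. 0 \<le> g x t"
          and le: "integral {0..1*L} (\<lambda>x. integral {1..L\<^sup>2} (g x)) \<le> C * L" for g
      proof -
        have tc: "continuous_on {0..y} (\<lambda>x. integral {1..L\<^sup>2} (g x))" for y
          by (rule continuous_on_subset[OF continuous_time_integral[OF g(1)]]) auto
        have "integral {0..X} (\<lambda>x. integral {1..L\<^sup>2} (g x)) \<le> integral {0..1*L} (\<lambda>x. integral {1..L\<^sup>2} (g x))"
          by (rule integral_subset_le)
            (use X g in \<open>auto intro!: integrable_continuous_interval tc Henstock_Kurzweil_Integration.integral_nonneg continuous_slice(1)[OF g(1)]\<close>)
        then show ?thesis using le unfolding integral_swap_rect[OF g(1)] by simp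
      qed
      show "integral {1..L\<^sup>2} P \<le> C * L" "integral {1..L\<^sup>2} R \<le> C * L"
        unfolding P_def R_def by (rule *[OF pc _ iu], simp, rule *[OF rc _ iv], simp)
    qed
    \<comment> \<open>With Young parameter \<open>s / L\<close> the length term and the gradient
      term are both of order \<open>L^2\<close>, the order to which the boundary integral is
      compared.\<close>
    have ss: "s / L > 0" using s L0 by simp
    have vc: "continuous_on {1..L\<^sup>2} (\<lambda>t. v 0 t)"
      by (rule continuous_on_subset[OF continuous_slice(1)[OF uv_cont(2)]]) auto
    have "U0 * integral {1..L\<^sup>2} (\<lambda>t. v 0 t) = integral {1..L\<^sup>2} (\<lambda>t. U0 * v 0 t)" by simp
    also have "\<dots> \<le> integral {1..L\<^sup>2} (\<lambda>t. (1 / X) * m t + (M * (s / L) * X + M / (2 * (s / L)) * (P t + R t)))"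
    proof (rule integral_le)
      show "(\<lambda>t. U0 * v 0 t) integrable_on {1..L\<^sup>2}" by (intro integrable_on_mult_right integrable_continuous_interval vc)
      show "(\<lambda>t. (1 / X) * m t + (M * (s / L) * X + M / (2 * (s / L)) * (P t + R t))) integrable_on {1..L\<^sup>2}"
        by (intro integrable_add integrable_on_mult_right i integrable_const_ivl)
      fix t assume t: "t \<in> {1..L\<^sup>2}"
      show "U0 * v 0 t \<le> (1 / X) * m t + (M * (s / L) * X + M / (2 * (s / L)) * (P t + R t))"
        unfolding m_def P_def R_def
        by (rule boundary_pointwise[where p="\<lambda>x. ux x t" and r="\<lambda>x. vx x t"])
          (use d[OF _ t] continuous_slice(2)[OF cu t] continuous_slice(2)[OF cv t] X ss t in auto)
    qed
    also have "\<dots> = (1 / X) * integral {1..L\<^sup>2} m + (M * (s / L) * X * (L\<^sup>2 - 1) + M / (2 * (s / L)) * (integral {1..L\<^sup>2} P + integral {1..L\<^sup>2} R))"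
      using L1 by (simp only: Henstock_Kurzweil_Integration.integral_add integrable_add integrable_on_mult_right i integrable_const_ivl
          integral_mult_right integral_const_real) simp
    also have "\<dots> \<le> (1 / X) * integral {1..L\<^sup>2} m + (M * (s / L) * X * L\<^sup>2 + M / (2 * (s / L)) * (C * L + C * L))"
      using PR M_pos s X L0 by (intro add_mono mult_left_mono order_refl) auto
    also have "\<dots> = (1 / (\<epsilon> * L)) * integral {1..L\<^sup>2} m + M * s * \<epsilon> * L\<^sup>2 + (M * C) / s * L\<^sup>2"
      using s L0 unfolding X_def by (simp add: field_simps power2_eq_square)
    finally show "U0 * integral {1..L\<^sup>2} (\<lambda>t. v 0 t) \<le>
      (1 / (\<epsilon> * L)) * integral {1..L\<^sup>2} (\<lambda>t. integral {0..\<epsilon>*L} (\<lambda>x. u x t * v x t)) + M * s * \<epsilon> * L\<^sup>2 + (M * C) / s * L\<^sup>2"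
      unfolding m_def[abs_def] X_def .
  qed
qed

lemma boundary_decay:
  "((\<lambda>L. (1 / L\<^sup>2) * integral {1..L\<^sup>2} (\<lambda>t. dv * v 0 t)) \<longlongrightarrow> 0) at_top"
proof -
  obtain C where C: "C > 0" "\<And>L \<epsilon> s. L \<ge> 2 \<Longrightarrow> 0 < \<epsilon> \<Longrightarrow> \<epsilon> \<le> 1 \<Longrightarrow> s > 0 \<Longrightarrow> U0 * integral {1..L\<^sup>2} (\<lambda>t. v 0 t) \<le>
    (1 / (\<epsilon> * L)) * integral {1..L\<^sup>2} (\<lambda>t. integral {0..\<epsilon>*L} (\<lambda>x. u x t * v x t)) + M * s * \<epsilon> * L\<^sup>2 + C / s * L\<^sup>2"
    using boundary_estimate by blast
  have "((\<lambda>L. (1 / L\<^sup>2) * integral {1..L\<^sup>2} (\<lambda>t. v 0 t)) \<longlongrightarrow> 0) at_top"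
    unfolding tendsto_iff
  proof (intro allI impI)
    fix e :: real assume e: "e > 0"
    \<comment> \<open>First \<open>s\<close> makes \<open>C / s\<close> a quarter of
      \<open>U0 * e\<close>, then \<open>\<epsilon>\<close> does the same for
      \<open>M * s * \<epsilon>\<close>. With both fixed, segregation on width
      \<open>\<epsilon> * L\<close> settles the remaining term as \<open>L\<close> grows.\<close>
    define s where "s = 4 * C / (U0 * e)"
    have s: "s > 0" "C / s = U0 * e / 4" using C U0 e by (auto simp: s_def)
    define \<epsilon> where "\<epsilon> = min 1 (U0 * e / (4 * M * s))"
    have \<epsilon>: "0 < \<epsilon>" "\<epsilon> \<le> 1" using U0 e M_pos s by (auto simp: \<epsilon>_def)
    have Ms: "M * s * \<epsilon> \<le> U0 * e / 4"
    proof -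
      have "M * s * \<epsilon> \<le> M * s * (U0 * e / (4 * M * s))" using M_pos s by (intro mult_left_mono) (auto simp: \<epsilon>_def)
      then show ?thesis using M_pos s by simp
    qed
    define g where "g L = (1 / L^3) * integral {1..L\<^sup>2} (\<lambda>t. integral {0..\<epsilon>*L} (\<lambda>x. u x t * v x t))" for L
    have "((\<lambda>L. (1 / \<epsilon>) * g L) \<longlongrightarrow> (1 / \<epsilon>) * 0) at_top"
      unfolding g_def by (intro tendsto_mult tendsto_const segregation)
    then have "\<forall>\<^sub>F L in at_top. (1 / \<epsilon>) * g L < U0 * e / 4"
      by (rule order_tendstoD(2)) (use U0 e in simp)
    then show "\<forall>\<^sub>F L in at_top. dist ((1 / L\<^sup>2) * integral {1..L\<^sup>2} (\<lambda>t. v 0 t)) 0 < e"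
      using eventually_ge_at_top[of 2]
    proof eventually_elim
      case (elim L)
      then have L0: "L > 0" by simp
      let ?I = "integral {1..L\<^sup>2} (\<lambda>t. v 0 t)"
      have "U0 * ?I \<le> (1 / (\<epsilon> * L)) * (L^3 * g L) + M * s * \<epsilon> * L\<^sup>2 + C / s * L\<^sup>2"
        using C(2)[OF elim(2) \<epsilon> s(1)] L0 by (simp add: g_def)
      also have "\<dots> = L\<^sup>2 * ((1 / \<epsilon>) * g L + M * s * \<epsilon> + C / s)"
        using L0 \<epsilon> by (simp add: field_simps power2_eq_square power3_eq_cube)
      also have "\<dots> < L\<^sup>2 * (U0 * e)"
      proof (rule mult_strict_left_mono)
        have "0 < U0 * e" using U0 e by simp
        then show "(1 / \<epsilon>) * g L + M * s * \<epsilon> + C / s < U0 * e" using elim(1) Ms s(2) by linarith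
      qed (use L0 in simp)
      finally have "U0 * ?I < U0 * (e * L\<^sup>2)" by (simp add: mult_ac)
      then have "?I < e * L\<^sup>2" using U0 by simp
      moreover have "0 \<le> ?I"
        by (rule Henstock_Kurzweil_Integration.integral_nonneg)
          (use bounds in \<open>auto intro!: integrable_continuous_interval continuous_on_subset[OF continuous_slice(1)[OF uv_cont(2)]]\<close>)
      ultimately show ?case using L0 by (simp add: field_simps)
    qed
  qed
  then have "((\<lambda>L. dv * ((1 / L\<^sup>2) * integral {1..L\<^sup>2} (\<lambda>t. v 0 t))) \<longlongrightarrow> dv * 0) at_top"
    by (intro tendsto_mult tendsto_const)
  then show ?thesis by (simp add: mult.left_commute)
qed

lemma is_rd_flow: "rd_flow du dv U0 V0 a M u v u0 v0"
proof unfold_locales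
  show "continuous_on ({0..} \<times> {0..}) (\<lambda>(x, t). dv * v x t)"
    using uv_cont(2) by (auto intro!: continuous_intros simp: case_prod_beta)
  show "L1lim X (at t) (\<lambda>s x. v x s) (\<lambda>x. v x t)" if "t > 0" for t X
    by (rule L1lim_cont[OF _ that]) (rule continuous_on_subset[OF uv_cont(2)], auto)
  show "bm {0..X} u0" "bm {0..X} v0" for X
    by (auto intro!: bm_cont continuous_on_subset[OF u0_cont] continuous_on_subset[OF v0_cont])
qed (use M bounds uv_cont(1) data_bounds u0_int v0_int representation u_bdry segregation boundary_decay dv_pos in auto)

end

section \<open>Weak solutions\<close>

lemma sets_lborel_pair: "sets (lborel \<Otimes>\<^sub>M lborel) = sets (borel :: (real \<times> real) measure)"
  by (metis lborel_prod sets_lborel)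

text \<open>Lebesgue measure of the plane is the completion of a product, not a product of
  completions. The exceptional set is therefore enclosed in a Borel null set, almost all of whose
  sections are null.\<close>

lemma AE_lebesgue_slices:
  fixes H :: "real \<times> real \<Rightarrow> real"
  assumes H: "AE z in lebesgue. H z = g z" and g: "g \<in> borel_measurable lborel"
  shows "AE t in lebesgue. AE x in lebesgue. H (x, t) = g (x, t)"
proof -
  have "AE z in lborel. H z = g z" using H by (simp add: AE_completion_iff)
  then obtain N where N: "{z \<in> space lborel. \<not> H z = g z} \<subseteq> N" "N \<in> sets lborel" "emeasure lborel N = 0"
    by (auto simp: eventually_ae_filter null_sets_def)
  have P: "{z\<in>space (lborel \<Otimes>\<^sub>M (lborel :: real measure)). (fst z, snd z) \<notin> N} \<in> sets (lborel \<Otimes>\<^sub>M lborel)"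
  proof -
    have "{z\<in>space (lborel \<Otimes>\<^sub>M (lborel :: real measure)). (fst z, snd z) \<notin> N} = - N"
      by (auto simp: space_pair_measure)
    moreover have "- N \<in> sets lborel" using N(2) by (simp add: borel_comp)
    ultimately show ?thesis unfolding sets_lborel_pair by simp
  qed
  have "AE z in lborel. z \<notin> N" using N by (intro AE_not_in) (simp add: null_sets_def)
  then have "AE z in lborel \<Otimes>\<^sub>M lborel. z \<notin> N" unfolding lborel_prod .
  from lborel_pair.AE_pair[OF this] have "AE x in lborel. AE t in lborel. (x, t) \<notin> N" .
  then have "AE t in lborel. AE x in lborel. (x, t) \<notin> N"
    using lborel_pair.AE_commute[of "\<lambda>x t. (x, t) \<notin> N"] P by simp
  then have "AE t in lborel. AE x in lborel. H (x, t) = g (x, t)"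
    by (auto elim!: eventually_mono) (use N(1) in auto)
  then show ?thesis by (simp add: AE_completion_iff)
qed

text \<open>A set with null sections is null only if it is measurable in the plane; hence the joint
  measurability assumption. The Borel representative inherits null sections for almost every
  \<open>t\<close>, and Fubini applies to it.\<close>

lemma lebesgue_null_of_slices:
  fixes H :: "real \<times> real \<Rightarrow> real"
  assumes H: "H \<in> borel_measurable lebesgue" and s: "\<And>t. AE x in lebesgue. H (x, t) = 0"
  shows "AE z in lebesgue. H z = 0"
proof -
  obtain g where g: "g \<in> borel_measurable lborel" "AE z in lborel. H z = g z"
    using completion_ex_borel_measurable_real[OF H] by auto
  have "AE z in lebesgue. H z = g z" using g(2) by (simp add: AE_completion_iff)
  from AE_lebesgue_slices[OF this g(1)] have "AE t in lebesgue. AE x in lebesgue. g (x, t) = 0"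
  proof (rule eventually_mono)
    fix t assume "AE x in lebesgue. H (x, t) = g (x, t)"
    with s[of t] show "AE x in lebesgue. g (x, t) = 0" by eventually_elim simp
  qed
  then have 1: "AE t in lborel. AE x in lborel. g (x, t) = 0" by (simp add: AE_completion_iff)
  have m: "{z\<in>space (lborel \<Otimes>\<^sub>M lborel). g (fst z, snd z) = 0} \<in> sets (lborel \<Otimes>\<^sub>M lborel)"
  proof -
    have "{z \<in> space lborel. g z = 0} \<in> sets lborel" using g(1) by measurable
    then show ?thesis unfolding sets_lborel_pair by (simp add: space_pair_measure)
  qed
  have "AE x in lborel. AE t in lborel. g (x, t) = 0"
    using lborel_pair.AE_commute[of "\<lambda>x t. g (x, t) = 0"] m 1 by simp
  then have "AE z in lborel \<Otimes>\<^sub>M lborel. g z = 0"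
    by (intro lborel_pair.AE_pair_measure) (use m in simp_all)
  then have "AE z in lborel. g z = 0" unfolding lborel_prod .
  with g(2) have "AE z in lborel. H z = 0" by eventually_elim simp
  then show ?thesis by (simp add: AE_completion_iff)
qed

text \<open>The identity holds for a Borel representative and is carried back slice by slice.
  Measurability of all slices and of the inner integral is assumed because a Lebesgue measurable
  function need not provide it for every \<open>t\<close>.\<close>

lemma lebesgue_fubini:
  fixes H :: "real \<times> real \<Rightarrow> real"
  assumes H: "integrable lebesgue H" and s: "\<And>t. (\<lambda>x. H (x, t)) \<in> borel_measurable lebesgue"
    and m: "(\<lambda>t. LINT x|lebesgue. H (x, t)) \<in> borel_measurable lebesgue"
  shows "(LINT z|lebesgue. H z) = (LINT t|lebesgue. LINT x|lebesgue. H (x, t))"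
proof -
  have Hm: "H \<in> borel_measurable lebesgue" using H by auto
  obtain g where g: "g \<in> borel_measurable lborel" "AE z in lborel. H z = g z"
    using completion_ex_borel_measurable_real[OF Hm] by auto
  have gm: "g \<in> borel_measurable lebesgue" using g(1) by (rule measurable_completion)
  have ae: "AE z in lebesgue. H z = g z" using g(2) by (simp add: AE_completion_iff)
  have "integrable lebesgue g" using integrable_cong_AE[OF Hm gm ae] H by simp
  then have gi: "integrable lborel g" using integrable_completion[OF g(1)] by simp
  then have gp: "integrable (lborel \<Otimes>\<^sub>M lborel) (\<lambda>(x, t). g (x, t))" by (simp add: lborel_prod)
  have slm: "(\<lambda>x. g (x, t)) \<in> borel_measurable lborel" for t
    using g(1) by (simp add: borel_prod[symmetric])
  have "(LINT z|lebesgue. H z) = (LINT z|lborel. g z)"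
    using integral_cong_AE[OF Hm gm ae] integral_completion[OF g(1)] by simp
  also have "\<dots> = (LINT t|lborel. LINT x|lborel. g (x, t))"
    using lborel_pair.integral_snd[of "\<lambda>x t. g (x, t)"] gp by (simp add: lborel_prod)
  also have "\<dots> = (LINT t|lebesgue. LINT x|lborel. g (x, t))"
    by (rule integral_completion[symmetric]) (use lborel_pair.integrable_snd[OF gp] in auto)
  also have "\<dots> = (LINT t|lebesgue. LINT x|lebesgue. H (x, t))"
  proof (rule integral_cong_AE)
    show "(\<lambda>t. LINT x|lborel. g (x, t)) \<in> borel_measurable lebesgue"
      by (rule measurable_completion) (use lborel_pair.integrable_snd[OF gp] in auto)
    show "AE t in lebesgue. (LINT x|lborel. g (x, t)) = (LINT x|lebesgue. H (x, t))"
      using AE_lebesgue_slices[OF ae g(1)]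
    proof (rule eventually_mono)
      fix t assume "AE x in lebesgue. H (x, t) = g (x, t)"
      then have "(LINT x|lebesgue. H (x, t)) = (LINT x|lebesgue. g (x, t))"
        by (intro integral_cong_AE s measurable_completion slm)
      also have "\<dots> = (LINT x|lborel. g (x, t))" by (rule integral_completion[OF slm])
      finally show "(LINT x|lborel. g (x, t)) = (LINT x|lebesgue. H (x, t))" by simp
    qed
  qed (rule m)
  finally show ?thesis .
qed

text \<open>The spatial factors of admissible test functions for the weak formulation. The slope
  \<open>\<phi>1 0\<close> is left free: through it the boundary value of \<open>u\<close>
  enters.\<close>

definition test_fun :: "real \<Rightarrow> (real \<Rightarrow> real) \<Rightarrow> (real \<Rightarrow> real) \<Rightarrow> (real \<Rightarrow> real) \<Rightarrow> bool" where
  "test_fun J \<phi> \<phi>1 \<phi>2 \<longleftrightarrow> J > 0 \<and> (\<forall>x\<ge>0. (\<phi> has_real_derivative \<phi>1 x) (at x within {0..}) \<and>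
     (\<phi>1 has_real_derivative \<phi>2 x) (at x within {0..})) \<and> continuous_on {0..} \<phi>2 \<and> \<phi> 0 = 0 \<and>
     (\<forall>x\<ge>J. \<phi> x = 0 \<and> \<phi>1 x = 0 \<and> \<phi>2 x = 0)"

section \<open>Second primitives and inequalities from weak identities\<close>

lemma test_fun_cont:
  assumes "test_fun J \<phi> \<phi>1 \<phi>2"
  shows "continuous_on {0..} \<phi>" "continuous_on {0..} \<phi>1" "continuous_on {0..} \<phi>2"
proof -
  show "continuous_on {0..} \<phi>" by (rule DERIV_continuous_on[of _ _ \<phi>1]) (use assms in \<open>auto simp: test_fun_def\<close>)
  show "continuous_on {0..} \<phi>1" by (rule DERIV_continuous_on[of _ _ \<phi>2]) (use assms in \<open>auto simp: test_fun_def\<close>)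
  show "continuous_on {0..} \<phi>2" using assms by (simp add: test_fun_def)
qed

lemma integral_ftc_halfline:
  assumes "\<And>x. x \<ge> 0 \<Longrightarrow> (h has_real_derivative h' x) (at x within {0..})" "0 \<le> (J::real)"
  shows "integral {0..J} h' = h J - h 0"
  by (rule integral_unique, rule fundamental_theorem_of_calculus[OF assms(2)])
    (use assms in \<open>auto simp flip: has_real_derivative_iff_has_vector_derivative intro!: DERIV_subset[OF assms(1)]\<close>)

lemma has_derivative_primitive_halfline:
  fixes g :: "real \<Rightarrow> real"
  assumes "continuous_on {0..} g" "x \<ge> 0"
  shows "((\<lambda>x. integral {0..x} g) has_real_derivative g x) (at x within {0..})"
proof -
  have "((\<lambda>x. integral {0..x} g) has_real_derivative g x) (at x within {0..x+1})"
    by (rule integral_has_real_derivative) (use assms in \<open>auto intro: continuous_on_subset\<close>)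
  moreover have "at x within {0..x+1} = at x within {0..}"
    by (rule at_within_nhd[of _ "{..<x+1}"]) auto
  ultimately show ?thesis by simp
qed

text \<open>The test function has \<open>\<phi>'' = (G - c x) (J - x)\<^sub>+\<close>, where \<open>c\<close> is chosen such that
  \<open>\<integral> x \<phi>'' = 0\<close>, so that \<open>\<phi>\<close> vanishes at \<open>0\<close> as well as beyond \<open>J\<close>.\<close>

lemma linear_if_weak_second_derivative_0:
  assumes G: "continuous_on {0..} G"
    and w: "\<And>J \<phi> \<phi>1 \<phi>2. test_fun J \<phi> \<phi>1 \<phi>2 \<Longrightarrow> integral {0..J} (\<lambda>x. G x * \<phi>2 x) = 0"
    and x: "x \<ge> 0"
  shows "G x = G 1 * x"
proof -
  \<comment> \<open>The weight \<open>J - y\<close> is positive both at \<open>x\<close> and at 1,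
    so the vanishing of the weighted square identifies \<open>G\<close> at both points.\<close>
  define J where "J = max x 1 + 1"
  have J: "J > 0" "x < J" "1 < J" by (auto simp: J_def)
  have lin: "\<exists>c. \<forall>y\<in>{0..J}. (G y - c * y)\<^sup>2 * (J - y) = 0"
  proof -
    define k where "k = integral {0..J} (\<lambda>y. y * (y * (J - y)))"
    have kpos: "k > 0"
    proof -
      have "k \<noteq> 0" unfolding k_def
      proof
        assume "integral {0..J} (\<lambda>y. y * (y * (J - y))) = 0"
        then have "\<forall>y\<in>{0..J}. y * (y * (J - y)) = 0"
          by (subst (asm) integral_eq_0_iff) (use J in \<open>auto intro!: continuous_intros\<close>)
        from this[rule_format, of 1] show False using J by simp
      qed
      moreover have "k \<ge> 0" unfolding k_def
        by (rule Henstock_Kurzweil_Integration.integral_nonneg) (auto intro!: integrable_continuous_interval continuous_intros)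
      ultimately show ?thesis by simp
    qed
    define c where "c = integral {0..J} (\<lambda>y. y * (G y * (J - y))) / k"
    define \<theta> where "\<theta> y = (G y - c * y) * max 0 (J - y)" for y
    have GJ: "continuous_on {0..J} G" by (rule continuous_on_subset[OF G]) auto
    have \<theta>c: "continuous_on {0..} \<theta>" unfolding \<theta>_def by (intro continuous_intros G)
    have \<theta>J: "\<theta> y = (G y - c * y) * (J - y)" if "y \<in> {0..J}" for y using that by (simp add: \<theta>_def)
    have mom: "integral {0..J} (\<lambda>y. y * \<theta> y) = 0"
    proof -
      have "integral {0..J} (\<lambda>y. y * \<theta> y) = integral {0..J} (\<lambda>y. y * (G y * (J - y)) - c * (y * (y * (J - y))))"
        by (rule Henstock_Kurzweil_Integration.integral_cong) (simp add: \<theta>J algebra_simps)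
      also have "\<dots> = integral {0..J} (\<lambda>y. y * (G y * (J - y))) - integral {0..J} (\<lambda>y. c * (y * (y * (J - y))))"
        by (intro Henstock_Kurzweil_Integration.integral_diff integrable_continuous_interval continuous_intros GJ)
      also have "\<dots> = 0" unfolding integral_mult_right k_def[symmetric] using kpos by (simp add: c_def)
      finally show ?thesis .
    qed
    define A where "A = integral {0..J} \<theta>"
    define \<phi>1 where "\<phi>1 x = integral {0..x} \<theta> - A" for x
    define \<phi> where "\<phi> x = integral {0..x} \<phi>1" for x
    have d1: "(\<phi>1 has_real_derivative \<theta> x) (at x within {0..})" if "x \<ge> 0" for x
      unfolding \<phi>1_def using DERIV_diff[OF has_derivative_primitive_halfline[OF \<theta>c that] DERIV_const[of A]] by simp
    have \<phi>1c: "continuous_on {0..} \<phi>1" by (rule DERIV_continuous_on[of _ _ \<theta>]) (use d1 in auto)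
    have d0: "(\<phi> has_real_derivative \<phi>1 x) (at x within {0..})" if "x \<ge> 0" for x
      unfolding \<phi>_def by (rule has_derivative_primitive_halfline[OF \<phi>1c that])
    have z1: "\<phi>1 x = 0" if "x \<ge> J" for x
    proof -
      have "integral {0..x} \<theta> = integral {0..J} \<theta> + integral {J..x} \<theta>"
        using that J by (intro Henstock_Kurzweil_Integration.integral_combine[symmetric] integrable_continuous_interval continuous_on_subset[OF \<theta>c]) auto
      moreover have "integral {J..x} \<theta> = integral {J..x} (\<lambda>y. 0)"
        by (rule Henstock_Kurzweil_Integration.integral_cong) (auto simp: \<theta>_def)
      ultimately show ?thesis by (simp add: \<phi>1_def A_def)
    qed
    have zJ: "\<phi> J = 0"
    proof -
      have "integral {0..J} (\<lambda>y. 1 * \<phi>1 y + \<theta> y * y) = J * \<phi>1 J - 0 * \<phi>1 0"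
        by (rule integral_ftc_halfline[where h="\<lambda>y. y * \<phi>1 y"]) (use J in \<open>auto intro!: derivative_eq_intros d1\<close>)
      moreover have "integral {0..J} (\<lambda>y. 1 * \<phi>1 y + \<theta> y * y) = integral {0..J} \<phi>1 + integral {0..J} (\<lambda>y. y * \<theta> y)"
        by (subst Henstock_Kurzweil_Integration.integral_add)
          (auto intro!: integrable_continuous_interval continuous_intros continuous_on_subset[OF \<phi>1c] continuous_on_subset[OF \<theta>c] simp: mult.commute)
      ultimately show ?thesis using mom z1[of J] by (simp add: \<phi>_def)
    qed
    have z0: "\<phi> x = 0" if "x \<ge> J" for x
    proof -
      have "\<phi> x = integral {0..J} \<phi>1 + integral {J..x} \<phi>1" unfolding \<phi>_def
        using that J by (intro Henstock_Kurzweil_Integration.integral_combine[symmetric] integrable_continuous_interval continuous_on_subset[OF \<phi>1c]) auto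
      moreover have "integral {J..x} \<phi>1 = integral {J..x} (\<lambda>y. 0)"
        by (rule Henstock_Kurzweil_Integration.integral_cong) (auto simp: z1)
      ultimately show ?thesis using zJ by (simp add: \<phi>_def)
    qed
    have "test_fun J \<phi> \<phi>1 \<theta>"
      unfolding test_fun_def using J d0 d1 \<theta>c z0 z1 by (auto simp: \<phi>_def \<theta>_def)
    from w[OF this] have "integral {0..J} (\<lambda>x. G x * \<theta> x) = 0" .
    moreover have "integral {0..J} (\<lambda>x. G x * \<theta> x) = integral {0..J} (\<lambda>x. (G x - c * x) * \<theta> x) + integral {0..J} (\<lambda>x. c * (x * \<theta> x))"
    proof -
      have "G x * \<theta> x = (G x - c * x) * \<theta> x + c * (x * \<theta> x)" for x by (simp add: algebra_simps)
      then show ?thesis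
        by (simp only:) (intro Henstock_Kurzweil_Integration.integral_add integrable_continuous_interval continuous_intros GJ continuous_on_subset[OF \<theta>c]; auto)
    qed
    ultimately have "integral {0..J} (\<lambda>x. (G x - c * x) * \<theta> x) = 0" by (simp add: mom)
    moreover have "integral {0..J} (\<lambda>x. (G x - c * x) * \<theta> x) = integral {0..J} (\<lambda>x. (G x - c * x)\<^sup>2 * (J - x))"
      by (rule Henstock_Kurzweil_Integration.integral_cong) (simp add: \<theta>J power2_eq_square)
    ultimately have "integral {0..J} (\<lambda>x. (G x - c * x)\<^sup>2 * (J - x)) = 0" by simp
    then have "\<forall>x\<in>{0..J}. (G x - c * x)\<^sup>2 * (J - x) = 0"
      by (subst (asm) integral_eq_0_iff) (use J GJ in \<open>auto intro!: continuous_intros\<close>)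
    then show ?thesis by blast
  qed
  then obtain c where c: "\<And>y. y \<in> {0..J} \<Longrightarrow> (G y - c * y)\<^sup>2 * (J - y) = 0" by blast
  have "G x = c * x" "G 1 = c * 1" using c[of x] c[of 1] J x by auto
  then show ?thesis by simp
qed

text \<open>Let \<open>H\<close> be the second primitive of \<open>h\<close> that starts from 0 with
  slope 0. Then \<open>q - b - H\<close> annihilates all \<open>\<phi>2\<close>, since the integral
  of \<open>\<phi>2\<close> is \<open>- \<phi>1 0\<close>, and is therefore linear through the
  origin. In particular \<open>q 0 = b\<close>: the boundary value is recovered as well.\<close>

lemma second_primitive_if_weak:
  assumes h: "\<And>X. bm {0..X} h" and q: "continuous_on {0..} q"
    and w: "\<And>J \<phi> \<phi>1 \<phi>2. test_fun J \<phi> \<phi>1 \<phi>2 \<Longrightarrow>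
      integral {0..J} (\<lambda>x. h x * \<phi> x) = integral {0..J} (\<lambda>x. q x * \<phi>2 x) + b * \<phi>1 0"
  shows "\<exists>c. \<forall>x\<ge>0. q x = b + c * x + integral {0..x} (\<lambda>y. (x - y) * h y)"
proof -
  define H where "H x = integral {0..x} (\<lambda>y. (x - y) * h y)" for x
  have Hd: "(H has_real_derivative 0 + integral {0..x} h) (at x within {0..})" if "x \<ge> 0" for x
    by (rule has_derivative_second_primitive[OF h _ that, of H 0 0]) (simp add: H_def)
  have Hc: "continuous_on {0..} H" by (rule DERIV_continuous_on[OF Hd]) auto
  define G where "G x = q x - b - H x" for x
  have Gc: "continuous_on {0..} G" unfolding G_def by (intro continuous_intros q Hc)
  have "G x = G 1 * x" if "x \<ge> 0" for x
  proof (rule linear_if_weak_second_derivative_0[OF Gc _ that])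
    fix J \<phi> \<phi>1 \<phi>2 assume T: "test_fun J \<phi> \<phi>1 \<phi>2"
    note tc = test_fun_cont[OF T]
    have J: "J > 0" and d: "\<And>x. x \<ge> 0 \<Longrightarrow> (\<phi> has_real_derivative \<phi>1 x) (at x within {0..})"
      "\<And>x. x \<ge> 0 \<Longrightarrow> (\<phi>1 has_real_derivative \<phi>2 x) (at x within {0..})"
      and z: "\<phi> J = 0" "\<phi>1 J = 0" using T by (auto simp: test_fun_def)
    have cJ: "continuous_on {0..J} \<phi>" "continuous_on {0..J} \<phi>1" "continuous_on {0..J} \<phi>2" "continuous_on {0..J} q" "continuous_on {0..J} H"
      using tc q Hc by (auto intro: continuous_on_subset)
    have iH: "continuous_on {0..J} (\<lambda>x. integral {0..x} h)" by (intro indefinite_integral_continuous_1 bm_int h)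
    have "integral {0..J} (\<lambda>x. integral {0..x} h * \<phi>1 x) = integral {0..J} h * \<phi> J - integral {0..0} h * \<phi> 0 - integral {0..J} (\<lambda>x. h x * \<phi> x)"
      by (rule integral_by_parts_indefinite[OF h, where P="\<lambda>x. integral {0..x} h"])
        (use J in \<open>auto intro!: DERIV_subset[OF d(1)] cJ\<close>)
    then have 1: "integral {0..J} (\<lambda>x. h x * \<phi> x) = - integral {0..J} (\<lambda>x. integral {0..x} h * \<phi>1 x)" by (simp add: z)
    have "integral {0..J} (\<lambda>x. (0 + integral {0..x} h) * \<phi>1 x + \<phi>2 x * H x) = H J * \<phi>1 J - H 0 * \<phi>1 0"
    proof (rule integral_ftc_halfline[where h="\<lambda>x. H x * \<phi>1 x"])
      show "0 \<le> J" using J by simp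
    qed (rule DERIV_mult[OF Hd d(2)])
    moreover have "integral {0..J} (\<lambda>x. (0 + integral {0..x} h) * \<phi>1 x + \<phi>2 x * H x) =
        integral {0..J} (\<lambda>x. integral {0..x} h * \<phi>1 x) + integral {0..J} (\<lambda>x. H x * \<phi>2 x)"
      by (subst Henstock_Kurzweil_Integration.integral_add)
        (auto intro!: integrable_continuous_interval continuous_intros cJ iH simp: mult.commute)
    ultimately have 2: "integral {0..J} (\<lambda>x. h x * \<phi> x) = integral {0..J} (\<lambda>x. H x * \<phi>2 x)"
      using 1 z by (simp add: H_def)
    have 3: "integral {0..J} \<phi>2 = - \<phi>1 0" using integral_ftc_halfline[of \<phi>1 \<phi>2 J] d(2) J z by simp
    have "integral {0..J} (\<lambda>x. G x * \<phi>2 x) = integral {0..J} (\<lambda>x. (q x * \<phi>2 x - b * \<phi>2 x) - H x * \<phi>2 x)"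
      by (simp add: G_def algebra_simps)
    also have "\<dots> = (integral {0..J} (\<lambda>x. q x * \<phi>2 x) - integral {0..J} (\<lambda>x. b * \<phi>2 x)) - integral {0..J} (\<lambda>x. H x * \<phi>2 x)"
      by (subst Henstock_Kurzweil_Integration.integral_diff, auto intro!: integrable_continuous_interval continuous_intros cJ)
         (subst Henstock_Kurzweil_Integration.integral_diff, auto intro!: integrable_continuous_interval continuous_intros cJ)
    also have "\<dots> = 0" using w[OF T] 2 3 by simp
    finally show "integral {0..J} (\<lambda>x. G x * \<phi>2 x) = 0" .
  qed
  then show ?thesis by (intro exI[of _ "G 1"]) (auto simp: G_def H_def algebra_simps)
qed

text \<open>The third power makes the truncation twice continuously differentiable at
  \<open>J\<close>, and the factor \<open>x\<close> gives the zero at 0. Polynomials are rich enough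
  by the Stone-Weierstrass theorem, and their derivatives are again polynomials.\<close>

lemma test_fun_poly:
  assumes p: "real_polynomial_function r" and J: "J > 0"
  shows "\<exists>\<phi>1 \<phi>2. test_fun J (\<lambda>x. x * r x * (max 0 (J - x))^3) \<phi>1 \<phi>2"
proof -
  define s where "s x = x * r x" for x
  have "real_polynomial_function s" unfolding s_def[abs_def] using polynomial_function_mult[of "\<lambda>x::real. x" r] p
    by (simp add: real_polynomial_function_eq)
  then obtain s1 where s1: "real_polynomial_function s1" "\<And>x. (s has_real_derivative s1 x) (at x)"
    using has_real_derivative_polynomial_function by blast
  then obtain s2 where s2: "real_polynomial_function s2" "\<And>x. (s1 has_real_derivative s2 x) (at x)"
    using has_real_derivative_polynomial_function by blast
  have s2c: "continuous_on {0..} s2"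
    using s2(1) by (auto intro!: continuous_on_polymonial_function simp: real_polynomial_function_eq)
  have m: "((\<lambda>x. (max 0 (J - x))^(Suc (Suc n))) has_real_derivative - (real (Suc (Suc n)) * (max 0 (J - x))^(Suc n))) (at x)" for n x
  proof (cases x J rule: linorder_cases)
    case less
    have "((\<lambda>x. (J - x)^(Suc (Suc n))) has_real_derivative - (real (Suc (Suc n)) * (max 0 (J - x))^(Suc n))) (at x)"
    proof -
      have "((\<lambda>x. J - x) has_real_derivative 0 - 1) (at x)" by (intro DERIV_diff DERIV_const DERIV_ident)
      from DERIV_power[OF this, of "Suc (Suc n)"] show ?thesis using less by simp
    qed
    then show ?thesis
      by (rule has_field_derivative_transform_within_open[where S="{..<J}"]) (use less in auto)
  next
    case greater
    have "((\<lambda>x. 0) has_real_derivative - (real (Suc (Suc n)) * (max 0 (J - x))^(Suc n))) (at x)"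
      using greater by simp
    then show ?thesis
      by (rule has_field_derivative_transform_within_open[where S="{J<..}"]) (use greater in auto)
  next
    case equal
    have "((\<lambda>y. (max 0 (J - y))^(Suc (Suc n)) / (y - J)) \<longlongrightarrow> 0) (at J)"
    proof (rule Lim_null_comparison)
      show "\<forall>\<^sub>F y in at J. norm ((max 0 (J - y))^(Suc (Suc n)) / (y - J)) \<le> (max 0 (J - y))^(Suc n)"
        unfolding eventually_at_filter
      proof (rule always_eventually, intro allI impI)
        fix y assume "y \<noteq> J" "y \<in> UNIV"
        then show "norm ((max 0 (J - y))^(Suc (Suc n)) / (y - J)) \<le> (max 0 (J - y))^(Suc n)"
        proof (cases "y < J")
          case True
          define P where "P = (J - y)^(Suc n)"
          have "(J - y) * P / (y - J) = - P" using True by (simp add: field_simps)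
          moreover have "P \<ge> 0" using True by (simp add: P_def)
          ultimately show ?thesis using True by (simp add: P_def)
        qed simp
      qed
      have "((\<lambda>y. (max 0 (J - y))^(Suc n)) \<longlongrightarrow> (max 0 (J - J))^(Suc n)) (at J)" by (intro tendsto_intros)
      then show "((\<lambda>y. (max 0 (J - y))^(Suc n)) \<longlongrightarrow> 0) (at J)" by simp
    qed
    then show ?thesis using equal by (simp add: has_field_derivative_iff)
  qed
  have m3: "((\<lambda>x. (max 0 (J - x))^3) has_real_derivative - 3 * (max 0 (J - x))^2) (at x)" for x
    using m[of 1 x] by (simp add: numeral_eq_Suc)
  have m2: "((\<lambda>x. (max 0 (J - x))^2) has_real_derivative - 2 * max 0 (J - x)) (at x)" for x
    using m[of 0 x] by (simp add: numeral_eq_Suc)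
  define \<phi>1 where "\<phi>1 x = s1 x * (max 0 (J - x))^3 + (- 3 * (max 0 (J - x))^2) * s x" for x
  define \<phi>2 where "\<phi>2 x = (s2 x * (max 0 (J - x))^3 + (- 3 * (max 0 (J - x))^2) * s1 x) +
     ((- 3 * (- 2 * max 0 (J - x))) * s x + s1 x * (- 3 * (max 0 (J - x))^2))" for x
  have "test_fun J (\<lambda>x. s x * (max 0 (J - x))^3) \<phi>1 \<phi>2"
    unfolding test_fun_def
  proof (intro conjI allI impI)
    fix x :: real assume "x \<ge> 0"
    show "((\<lambda>x. s x * (max 0 (J - x))^3) has_real_derivative \<phi>1 x) (at x within {0..})"
      unfolding \<phi>1_def by (intro DERIV_mult has_field_derivative_at_within[OF s1(2)] has_field_derivative_at_within[OF m3])
    show "(\<phi>1 has_real_derivative \<phi>2 x) (at x within {0..})"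
      unfolding \<phi>1_def \<phi>2_def
      by (intro DERIV_add DERIV_mult DERIV_cmult has_field_derivative_at_within[OF s1(2)] has_field_derivative_at_within[OF s2(2)]
          has_field_derivative_at_within[OF m3] has_field_derivative_at_within[OF m2])
  next
    have "continuous_on {0..} s" "continuous_on {0..} s1"
      by (rule DERIV_continuous_on[OF has_field_derivative_at_within[OF s1(2)]], rule DERIV_continuous_on[OF has_field_derivative_at_within[OF s2(2)]])
    then show "continuous_on {0..} \<phi>2" unfolding \<phi>2_def by (intro continuous_intros s2c)
  qed (use J in \<open>auto simp: s_def \<phi>1_def \<phi>2_def\<close>)
  then show ?thesis unfolding s_def by blast
qed

text \<open>Nonnegative polynomials approximate all nonnegative continuous functions, and these,
  almost everywhere, the indicator of \<open>z > 0\<close>. In the limit the integral of the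
  positive part of \<open>z\<close> against a positive weight is at most 0.\<close>

lemma AE_nonpos_if_weak:
  assumes z: "bm {0..J} z" and J: "J > 0"
    and w: "\<And>r. real_polynomial_function r \<Longrightarrow> (\<And>x. x \<in> {0..J} \<Longrightarrow> 0 \<le> r x) \<Longrightarrow>
      integral {0..J} (\<lambda>x. z x * (x * r x * (max 0 (J - x))^3)) \<le> 0"
  shows "AE x in lebesgue. x \<in> {0<..<J} \<longrightarrow> z x \<le> 0"
proof -
  define \<omega> where "\<omega> x = x * (max 0 (J - x))^3" for x
  have \<omega>c: "continuous_on {0..J} \<omega>" unfolding \<omega>_def by (intro continuous_intros)
  have \<omega>0: "0 \<le> \<omega> x" if "x \<in> {0..J}" for x using that by (simp add: \<omega>_def)
  have zw: "bm {0..J} (\<lambda>x. z x * \<omega> x)" by (intro bm_mult z bm_cont[OF \<omega>c])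
  obtain C where C: "C > 0" "\<And>x. x \<in> {0..J} \<Longrightarrow> \<bar>z x * \<omega> x\<bar> \<le> C" using bm_bound[OF zw] by metis
  have cont: "integral {0..J} (\<lambda>x. z x * \<omega> x * g x) \<le> 0" if g: "continuous_on {0..J} g" "\<And>x. x \<in> {0..J} \<Longrightarrow> 0 \<le> g x" for g
  proof (rule field_le_epsilon)
    fix e :: real assume e: "e > 0"
    define d where "d = e / (2 * C * J)"
    have d: "d > 0" using e C J by (simp add: d_def)
    \<comment> \<open>Approximating \<open>g + d\<close> instead of \<open>g\<close> to within
      \<open>d\<close> keeps the polynomial nonnegative.\<close>
    obtain r where r: "real_polynomial_function r" "\<And>x. x \<in> {0..J} \<Longrightarrow> \<bar>(g x + d) - r x\<bar> < d"
      using Stone_Weierstrass_real_polynomial_function[OF compact_Icc continuous_on_add[OF g(1) continuous_on_const] d] by blast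
    have rc: "continuous_on {0..J} r" using r(1) by (auto intro!: continuous_on_polymonial_function simp: real_polynomial_function_eq)
    have r0: "0 \<le> r x" if "x \<in> {0..J}" for x using r(2)[OF that] g(2)[OF that] by auto
    have "integral {0..J} (\<lambda>x. z x * \<omega> x * g x) = integral {0..J} (\<lambda>x. z x * \<omega> x * r x) + integral {0..J} (\<lambda>x. z x * \<omega> x * (g x - r x))"
    proof -
      have "z x * \<omega> x * g x = z x * \<omega> x * r x + z x * \<omega> x * (g x - r x)" for x by (simp add: algebra_simps)
      then show ?thesis by (simp only:) (intro Henstock_Kurzweil_Integration.integral_add bm_int bm_mult[OF zw] bm_diff bm_cont rc g(1))
    qed
    also have "integral {0..J} (\<lambda>x. z x * \<omega> x * r x) \<le> 0"
      using w[OF r(1) r0] by (simp add: \<omega>_def mult_ac)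
    also have "integral {0..J} (\<lambda>x. z x * \<omega> x * (g x - r x)) \<le> C * (2 * d) * (J - 0)"
    proof -
      have "\<bar>integral {0..J} (\<lambda>x. z x * \<omega> x * (g x - r x))\<bar> \<le> C * (2 * d) * (J - 0)"
      proof (rule abs_integral_le)
        show "(\<lambda>x. z x * \<omega> x * (g x - r x)) integrable_on {0..J}" by (intro bm_int bm_mult[OF zw] bm_diff bm_cont rc g(1))
        fix x assume x: "x \<in> {0..J}"
        have "\<bar>g x - r x\<bar> \<le> 2 * d" using r(2)[OF x] by linarith
        then show "\<bar>z x * \<omega> x * (g x - r x)\<bar> \<le> C * (2 * d)"
          unfolding abs_mult[of "z x * \<omega> x"] using C(2)[OF x] C(1) by (intro mult_mono) auto
      qed (use J in simp)
      then show ?thesis by linarith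
    qed
    also have "C * (2 * d) * (J - 0) = e" using C J by (simp add: d_def)
    finally show "integral {0..J} (\<lambda>x. z x * \<omega> x * g x) \<le> 0 + e" by simp
  qed
  define s where "s x = (if z x > 0 then 1 else (0::real))" for x
  have zm: "z \<in> borel_measurable (lebesgue_on {0..J})" using z by (simp add: bm_def)
  have sm: "(\<lambda>x. if x \<in> {0..J} then s x else 0) \<in> borel_measurable lebesgue"
  proof -
    have "s \<in> borel_measurable (lebesgue_on {0..J})"
      unfolding s_def[abs_def] using zm by measurable
    then show ?thesis using borel_measurable_if_I[of s "{0..J}"] by simp
  qed
  have sbm: "bm {0..J} s"
  proof (rule bmI[where C=1])
    show "s \<in> borel_measurable (lebesgue_on {0..J})"
      unfolding s_def[abs_def] using zm by measurable
  qed (auto simp: s_def)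
  obtain N g where N: "negligible N" and g: "\<And>n. continuous_on UNIV (g n)"
    "\<And>x. x \<notin> N \<Longrightarrow> (\<lambda>n. g n x) \<longlonglongrightarrow> (if x \<in> UNIV then (if x \<in> {0..J} then s x else 0) else 0 :: real)"
    using lebesgue_measurable_imp_measurable_on_real[OF sm, of UNIV] unfolding measurable_on_def by auto
  \<comment> \<open>Truncation to {0..1} provides domination and leaves the limits 0 and 1
    unchanged.\<close>
  define g' where "g' n x = max 0 (min 1 (g n x))" for n x
  have g'c: "continuous_on {0..J} (g' n)" for n
    unfolding g'_def by (intro continuous_intros continuous_on_subset[OF g(1)]) auto
  have spike: "integral ({0..J} - N) h = integral {0..J} h" for h :: "real \<Rightarrow> real"
    by (rule integral_spike_set) (rule negligible_subset[OF N]; auto)+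
  have spikei: "h integrable_on {0..J} \<Longrightarrow> h integrable_on ({0..J} - N)" for h :: "real \<Rightarrow> real"
    using integrable_spike_set_eq[of "{0..J}" "{0..J} - N" h] negligible_subset[OF N, of "sym_diff {0..J} ({0..J} - N)"] by auto
  have "(\<lambda>n. integral ({0..J} - N) (\<lambda>x. z x * \<omega> x * g' n x)) \<longlonglongrightarrow> integral ({0..J} - N) (\<lambda>x. z x * \<omega> x * s x)"
  proof (rule dominated_convergence(2)[where h="\<lambda>x. C"])
    show "(\<lambda>x. z x * \<omega> x * g' n x) integrable_on {0..J} - N" for n
      by (intro spikei bm_int bm_mult[OF zw] bm_cont g'c)
    show "(\<lambda>x. C) integrable_on {0..J} - N" by (intro spikei) auto
    show "norm (z x * \<omega> x * g' n x) \<le> C" if "x \<in> {0..J} - N" for n x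
    proof -
      have "\<bar>z x * \<omega> x\<bar> * \<bar>g' n x\<bar> \<le> C * 1" using C(2)[of x] C(1) that by (intro mult_mono) (auto simp: g'_def)
      then show ?thesis by (simp add: abs_mult)
    qed
    show "(\<lambda>n. z x * \<omega> x * g' n x) \<longlonglongrightarrow> z x * \<omega> x * s x" if x: "x \<in> {0..J} - N" for x
    proof -
      have "(\<lambda>n. g' n x) \<longlonglongrightarrow> max 0 (min 1 (s x))"
        unfolding g'_def using g(2)[of x] x by (intro tendsto_intros) auto
      then show ?thesis by (intro tendsto_intros) (auto simp: s_def split: if_splits)
    qed
  qed
  then have "(\<lambda>n. integral {0..J} (\<lambda>x. z x * \<omega> x * g' n x)) \<longlonglongrightarrow> integral {0..J} (\<lambda>x. z x * \<omega> x * s x)"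
    by (simp only: spike)
  then have le0: "integral {0..J} (\<lambda>x. z x * \<omega> x * s x) \<le> 0"
    by (rule LIMSEQ_le_const2) (use cont[OF g'c] in \<open>auto simp: g'_def\<close>)
  have b: "bm {0..J} (\<lambda>x. z x * \<omega> x * s x)" by (intro bm_mult[OF zw] sbm)
  have nn: "0 \<le> z x * \<omega> x * s x" if "x \<in> {0..J}" for x using \<omega>0[OF that] by (auto simp: s_def)
  have "integral {0..J} (\<lambda>x. z x * \<omega> x * s x) = 0"
    using le0 Henstock_Kurzweil_Integration.integral_nonneg[OF bm_int[OF b] nn] by simp
  then have i0: "(LINT x|lebesgue. indicator {0..J} x *\<^sub>R (z x * \<omega> x * s x)) = 0"
    using bm_lint[OF b] by (simp add: set_lebesgue_integral_def)
  have "integrable lebesgue (\<lambda>x. indicator {0..J} x *\<^sub>R (z x * \<omega> x * s x))"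
    using bm_absint[OF b] by (simp add: set_integrable_def)
  then have "AE x in lebesgue. indicator {0..J} x *\<^sub>R (z x * \<omega> x * s x) = 0"
    using i0 by (subst (asm) integral_nonneg_eq_0_iff_AE) (use nn in \<open>auto simp: indicator_def\<close>)
  then show ?thesis
  proof eventually_elim
    case (elim x)
    show ?case
    proof
      assume x: "x \<in> {0<..<J}"
      then have "\<omega> x > 0" by (simp add: \<omega>_def)
      then show "z x \<le> 0" using elim x by (auto simp: s_def split: if_splits)
    qed
  qed
qed

lemma AE_lebesgue_on_open_iff:
  fixes P :: "real \<Rightarrow> bool"
  shows "(AE x in lebesgue_on {0<..<J}. P x) \<longleftrightarrow> (AE x in lebesgue. x \<in> {0<..<J} \<longrightarrow> P x)"
  by (subst AE_restrict_space_iff) auto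

lemma tendsto_integral_uniform_AE:
  fixes a :: "real \<Rightarrow> real \<Rightarrow> real"
  assumes bm: "\<And>s. s \<in> I \<Longrightarrow> bm {0..J} (a s)" and t: "t \<in> I"
    and u: "\<And>e. e > 0 \<Longrightarrow> \<forall>\<^sub>F s in at t within I. AE x in lebesgue. x \<in> {0..J} \<longrightarrow> \<bar>a s x - a t x\<bar> \<le> e"
  shows "((\<lambda>s. integral {0..J} (\<lambda>x. \<bar>a s x - a t x\<bar>)) \<longlongrightarrow> 0) (at t within I)"
    "((\<lambda>s. integral {0..J} (a s)) \<longlongrightarrow> integral {0..J} (a t)) (at t within I)"
proof -
  have ev: "\<forall>\<^sub>F s in at t within I. s \<in> I" by (simp add: eventually_at_filter)
  show 1: "((\<lambda>s. integral {0..J} (\<lambda>x. \<bar>a s x - a t x\<bar>)) \<longlongrightarrow> 0) (at t within I)"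
    unfolding tendsto_iff
  proof (intro allI impI)
    fix e :: real assume e: "e > 0"
    define d where "d = e / (\<bar>J\<bar> + 1)"
    have d: "d > 0" using e by (simp add: d_def)
    show "\<forall>\<^sub>F s in at t within I. dist (integral {0..J} (\<lambda>x. \<bar>a s x - a t x\<bar>)) 0 < e"
      using u[OF d] ev
    proof eventually_elim
      case (elim s)
      have i: "(\<lambda>x. \<bar>a s x - a t x\<bar>) integrable_on {0..J}" by (intro bm_int bm_intros bm elim(2) t)
      obtain N where N: "negligible N" "\<And>x. x \<notin> N \<Longrightarrow> x \<in> {0..J} \<longrightarrow> \<bar>a s x - a t x\<bar> \<le> d"
        using elim(1) unfolding eventually_ae_filter negligible_iff_null_sets by auto
      have "integral {0..J} (\<lambda>x. \<bar>a s x - a t x\<bar>) \<le> integral {0..J} (\<lambda>x. d)"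
        by (rule integral_le_negligible[OF i _ N(1)]) (use N(2) in auto)
      also have "\<dots> \<le> d * \<bar>J\<bar>" using d by (cases "J \<ge> 0") (auto simp: mult_nonneg_nonpos)
      also have "\<dots> < d * (\<bar>J\<bar> + 1)" using d by simp
      also have "\<dots> = e" unfolding d_def by (simp add: field_simps)
      finally have "integral {0..J} (\<lambda>x. \<bar>a s x - a t x\<bar>) < e" .
      moreover have "0 \<le> integral {0..J} (\<lambda>x. \<bar>a s x - a t x\<bar>)"
        by (rule Henstock_Kurzweil_Integration.integral_nonneg[OF i]) simp
      ultimately show ?case by simp
    qed
  qed
  show "((\<lambda>s. integral {0..J} (a s)) \<longlongrightarrow> integral {0..J} (a t)) (at t within I)"
  proof (rule LIM_zero_cancel, rule Lim_null_comparison[OF _ 1])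
    show "\<forall>\<^sub>F s in at t within I. norm (integral {0..J} (a s) - integral {0..J} (a t)) \<le> integral {0..J} (\<lambda>x. \<bar>a s x - a t x\<bar>)"
      using ev
    proof eventually_elim
      case (elim s)
      have "\<bar>integral {0..J} (\<lambda>x. a s x - a t x)\<bar> \<le> integral {0..J} (\<lambda>x. \<bar>a s x - a t x\<bar>)"
        by (rule abs_integral_le_integral) (auto intro!: bm_int bm_intros bm elim t)
      then show ?case using bm_int[OF bm[OF elim]] bm_int[OF bm[OF t]] by (simp add: Henstock_Kurzweil_Integration.integral_diff)
    qed
  qed
qed

lemma lint_open_interval:
  assumes "bm {0..J} h"
  shows "(LINT x|lebesgue. (if x \<in> {0<..<J} then h x else 0)) = integral {0..J} h"
proof -
  have "h absolutely_integrable_on {0<..<J}"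
    by (rule set_integrable_subset[OF bm_absint[OF assms]]) auto
  then have "(LINT x:{0<..<J}|lebesgue. h x) = integral {0..J} h"
    using set_lebesgue_integral_eq_integral(2) by (simp add: integral_open_interval_real)
  moreover have "(LINT x:{0<..<J}|lebesgue. h x) = (LINT x|lebesgue. (if x \<in> {0<..<J} then h x else 0))"
    unfolding set_lebesgue_integral_def by (rule Bochner_Integration.integral_cong) auto
  ultimately show ?thesis by simp
qed

section \<open>Time slices of weak solutions\<close>

locale rd_weak = rd_data +
  assumes dv_zero: "dv = 0"
    and sol: "T > 0 \<Longrightarrow> weak_solution du k F U0 M u0 v0 T u v"
begin

text \<open>The values of \<open>v\<close> are only controlled almost everywhere.\<close>

definition vc where "vc x t = (if x > 0 then max 0 (min M (v x t)) else 0)"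

lemma vc_bounds: "0 \<le> vc x t" "vc x t \<le> M"
  using M_pos by (auto simp: vc_def)

lemma u_bounds: "x \<ge> 0 \<Longrightarrow> t \<ge> 0 \<Longrightarrow> 0 \<le> u x t \<and> u x t \<le> M"
  using sol[of "t + 1"] unfolding weak_solution_def by simp

lemma u_cont: "continuous_on ({0..} \<times> {0..}) (\<lambda>(x, t). u x t)"
  by (rule continuous_on_halfline_times) (use sol in \<open>simp add: weak_solution_def\<close>)

lemma v_AE_vc: assumes "t \<ge> 0" shows "AE x in lebesgue. x > 0 \<longrightarrow> v x t = vc x t"
proof -
  have "AE x in lebesgue_on {0..}. 0 \<le> v x t \<and> v x t \<le> M"
    using sol[of "t + 1"] assms unfolding weak_solution_def by auto
  then have "AE x in lebesgue. x \<in> {0..} \<longrightarrow> 0 \<le> v x t \<and> v x t \<le> M"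
    by (subst (asm) AE_restrict_space_iff) auto
  then show ?thesis by (rule eventually_mono) (auto simp: vc_def)
qed

lemma v_Linf: assumes "t \<ge> 0" "J > 0" shows "in_Linf {0<..<J} (\<lambda>x. v x t)"
  using sol[of "t + 1"] assms unfolding weak_solution_def by simp

lemma vc_meas: assumes "t \<ge> 0" shows "(\<lambda>x. vc x t) \<in> borel_measurable lebesgue"
proof -
  have "(\<lambda>x. if x \<in> {0<..<real n} then v x t else 0) \<in> borel_measurable lebesgue" for n
  proof (cases "n = 0")
    case False
    then have "(\<lambda>x. v x t) \<in> borel_measurable (lebesgue_on {0<..<real n})" using v_Linf[OF assms, of "real n"] by (simp add: in_Linf_def)
    then show ?thesis by (intro borel_measurable_if_I) auto
  qed auto
  then have m: "(\<lambda>x. if x \<in> {0<..<real n} then v x t else 0) \<in> borel_measurable lebesgue" for n .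
  have "(\<lambda>x. if x > 0 then v x t else 0) \<in> borel_measurable lebesgue"
  proof (rule borel_measurable_LIMSEQ_real[OF _ m])
    fix x :: real
    have "\<forall>\<^sub>F n in sequentially. (if x \<in> {0<..<real n} then v x t else 0) = (if x > 0 then v x t else 0)"
      using eventually_gt_at_top[of "nat \<lceil>x\<rceil>"] by eventually_elim (auto, linarith)
    then show "(\<lambda>n. if x \<in> {0<..<real n} then v x t else 0) \<longlonglongrightarrow> (if x > 0 then v x t else 0)"
      by (rule tendsto_eventually)
  qed
  then have "(\<lambda>x. max 0 (min M (if x > 0 then v x t else 0))) \<in> borel_measurable lebesgue" by simp
  also have "(\<lambda>x. max 0 (min M (if x > 0 then v x t else 0))) = (\<lambda>x. vc x t)" using M_pos by (auto simp: vc_def fun_eq_iff)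
  finally show ?thesis .
qed

lemma vc_bm: "t \<ge> 0 \<Longrightarrow> bm {0..X} (\<lambda>x. vc x t)"
  by (rule bmI[of _ _ M]) (use vc_meas vc_bounds in \<open>auto intro!: measurable_restrict_space1\<close>)

lemma vc_unif:
  assumes t: "t \<ge> 0" and e: "e > 0"
  shows "\<forall>\<^sub>F s in at t within {0..}. AE x in lebesgue. x \<in> {0..J} \<longrightarrow> \<bar>vc x s - vc x t\<bar> \<le> e"
proof -
  define K where "K = \<bar>J\<bar> + 1"
  have K: "K > 0" "J < K" by (auto simp: K_def)
  have "((\<lambda>s. Linf_norm {0<..<K} (\<lambda>x. v x s - v x t)) \<longlongrightarrow> 0) (at t within {0..t+1})"
    using sol[of "t + 1"] t K(1) unfolding weak_solution_def by simp
  moreover have "at t within {0..t+1} = at t within {0..}"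
    by (rule at_within_nhd[of _ "{..<t+1}"]) auto
  ultimately have "((\<lambda>s. Linf_norm {0<..<K} (\<lambda>x. v x s - v x t)) \<longlongrightarrow> 0) (at t within {0..})" by simp
  then have "\<forall>\<^sub>F s in at t within {0..}. Linf_norm {0<..<K} (\<lambda>x. v x s - v x t) < ereal e"
    by (rule order_tendstoD(2)) (use e in simp)
  moreover have "\<forall>\<^sub>F s in at t within {0..}. s \<in> {0..}" by (simp add: eventually_at_filter)
  ultimately show ?thesis
  proof eventually_elim
    case (elim s)
    have "AE x in lebesgue_on {0<..<K}. ereal \<bar>v x s - v x t\<bar> \<le> Linf_norm {0<..<K} (\<lambda>x. v x s - v x t)"
      unfolding Linf_norm_def by (rule esssup_AE)
    then have "AE x in lebesgue_on {0<..<K}. \<bar>v x s - v x t\<bar> \<le> e"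
    proof (rule eventually_mono)
      fix x assume "ereal \<bar>v x s - v x t\<bar> \<le> Linf_norm {0<..<K} (\<lambda>x. v x s - v x t)"
      then have "ereal \<bar>v x s - v x t\<bar> < ereal e" using elim(1) by (rule le_less_trans)
      then show "\<bar>v x s - v x t\<bar> \<le> e" by simp
    qed
    then have "AE x in lebesgue. x \<in> {0<..<K} \<longrightarrow> \<bar>v x s - v x t\<bar> \<le> e"
      by (simp only: AE_lebesgue_on_open_iff)
    then show ?case
    proof (rule eventually_mono, intro impI)
      fix x assume x: "x \<in> {0<..<K} \<longrightarrow> \<bar>v x s - v x t\<bar> \<le> e" "x \<in> {0..J}"
      show "\<bar>vc x s - vc x t\<bar> \<le> e"
        using x K(2) e by (cases "x > 0") (auto simp: vc_def)
    qed
  qed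
qed

text \<open>At each fixed time \<open>v\<close> and \<open>vc\<close> agree almost everywhere in
  \<open>x\<close>. Joint measurability, which is part of the Bochner space condition, upgrades this
  to almost everywhere in the box, where the weak formulation lives.\<close>

lemma v_joint:
  assumes T: "T > 0" and J: "J > 0"
  shows "(\<lambda>(x, t). vc x t) \<in> borel_measurable (lebesgue_on ({0<..<J} \<times> {0<..<T}))"
    "AE z in lebesgue. z \<in> {0<..<J} \<times> {0<..<T} \<longrightarrow> v (fst z) (snd z) = vc (fst z) (snd z)"
proof -
  let ?S = "{0<..<J} \<times> {0<..<T}"
  have S: "?S \<in> sets lebesgue" by (intro sets_completionI_sets) (simp add: borel_open open_Times)
  have vm: "(\<lambda>(x, t). v x t) \<in> borel_measurable (lebesgue_on ?S)"
    using sol[OF T] J unfolding weak_solution_def in_W1inf_Linf_def in_Linf_Linf_def by simp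
  have "(\<lambda>z. max 0 (min M (case z of (x, t) \<Rightarrow> v x t))) \<in> borel_measurable (lebesgue_on ?S)" using vm by simp
  also have "?this \<longleftrightarrow> (\<lambda>(x, t). vc x t) \<in> borel_measurable (lebesgue_on ?S)"
    by (rule measurable_cong) (auto simp: vc_def)
  finally show vcm: "(\<lambda>(x, t). vc x t) \<in> borel_measurable (lebesgue_on ?S)" .
  have "(\<lambda>z. (case z of (x, t) \<Rightarrow> v x t) - (case z of (x, t) \<Rightarrow> vc x t)) \<in> borel_measurable (lebesgue_on ?S)"
    by (rule borel_measurable_diff[OF vm vcm])
  then have "(\<lambda>z. if z \<in> ?S then (case z of (x, t) \<Rightarrow> v x t) - (case z of (x, t) \<Rightarrow> vc x t) else 0) \<in> borel_measurable lebesgue"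
    by (rule borel_measurable_if_I[OF _ S])
  then have "AE z in lebesgue. (if z \<in> ?S then (case z of (x, t) \<Rightarrow> v x t) - (case z of (x, t) \<Rightarrow> vc x t) else 0) = 0"
  proof (rule lebesgue_null_of_slices)
    fix t :: real
    show "AE x in lebesgue. (if (x, t) \<in> ?S then (case (x, t) of (x, t) \<Rightarrow> v x t) - (case (x, t) of (x, t) \<Rightarrow> vc x t) else 0) = 0"
    proof (cases "t \<in> {0<..<T}")
      case True
      then have "AE x in lebesgue. x > 0 \<longrightarrow> v x t = vc x t" by (intro v_AE_vc) simp
      then show ?thesis by (rule eventually_mono) auto
    next
      case False
      then show ?thesis by (intro AE_I2) auto
    qed
  qed
  then show "AE z in lebesgue. z \<in> ?S \<longrightarrow> v (fst z) (snd z) = vc (fst z) (snd z)"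
    by (rule eventually_mono) (auto simp: case_prod_beta)
qed

text \<open>Composition with Lebesgue measurable functions preserves measurability if the outer
  function is Borel on the whole space. Projection onto the box extends \<open>\<Phi>\<close>
  continuously and keeps it bounded.\<close>

lemma continuous_clamp:
  fixes \<Phi> :: "real \<times> real \<times> real \<Rightarrow> real"
  assumes c: "continuous_on ({0..J} \<times> {0..M} \<times> {0..M}) \<Phi>" and J: "J > 0"
  obtains \<Phi>' C where "continuous_on UNIV \<Phi>'" "\<And>z. \<bar>\<Phi>' z\<bar> \<le> C"
    "\<And>x r s. x \<in> {0..J} \<Longrightarrow> r \<in> {0..M} \<Longrightarrow> s \<in> {0..M} \<Longrightarrow> \<Phi>' (x, r, s) = \<Phi> (x, r, s)"
proof -
  define P :: "real \<times> real \<times> real \<Rightarrow> real \<times> real \<times> real"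
    where "P z = (max 0 (min J (fst z)), max 0 (min M (fst (snd z))), max 0 (min M (snd (snd z))))" for z
  have PK: "P z \<in> {0..J} \<times> {0..M} \<times> {0..M}" for z using J M_pos by (auto simp: P_def)
  have "bounded (\<Phi> ` ({0..J} \<times> {0..M} \<times> {0..M}))"
    by (intro compact_imp_bounded compact_continuous_image c compact_Times) auto
  then obtain C where C: "\<And>z. z \<in> {0..J} \<times> {0..M} \<times> {0..M} \<Longrightarrow> \<bar>\<Phi> z\<bar> \<le> C"
    unfolding bounded_iff by auto
  have "continuous_on UNIV (\<lambda>z. \<Phi> (P z))"
    by (rule continuous_on_compose2[OF c]) (use PK in \<open>auto simp: P_def[abs_def] intro!: continuous_intros\<close>)
  moreover have "\<Phi> (P (x, r, s)) = \<Phi> (x, r, s)" if "x \<in> {0..J}" "r \<in> {0..M}" "s \<in> {0..M}" for x r s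
    using that by (simp add: P_def)
  ultimately show ?thesis using that[of "\<lambda>z. \<Phi> (P z)" C] C[OF PK] by blast
qed

lemma slice_bm:
  assumes c: "continuous_on ({0..J} \<times> {0..M} \<times> {0..M}) \<Phi>" and J: "J > 0" and t: "t \<ge> 0"
  shows "bm {0..J} (\<lambda>x. \<Phi> (x, u x t, vc x t))"
proof -
  obtain \<Phi>' C where P: "continuous_on UNIV \<Phi>'" "\<And>z. \<bar>\<Phi>' z\<bar> \<le> C"
    "\<And>x r s. x \<in> {0..J} \<Longrightarrow> r \<in> {0..M} \<Longrightarrow> s \<in> {0..M} \<Longrightarrow> \<Phi>' (x, r, s) = \<Phi> (x, r, s)"
    using continuous_clamp[OF c J] by blast
  have eq: "\<Phi>' (x, u x t, vc x t) = \<Phi> (x, u x t, vc x t)" if "x \<in> {0..J}" for x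
    using that u_bounds[of x t] vc_bounds t by (intro P(3)) auto
  have um: "(\<lambda>x. u x t) \<in> borel_measurable (lebesgue_on {0..J})"
    using bm_cont[OF continuous_on_subset[OF continuous_slice(2)[OF u_cont]], of t 0 J] t by (auto simp: bm_def)
  have "(\<lambda>x. \<Phi>' (x, u x t, vc x t)) \<in> borel_measurable (lebesgue_on {0..J})"
    by (rule measurable_compose[OF _ borel_measurable_continuous_onI[OF P(1)]])
      (use um vc_bm[OF t, of J] bm_cont[OF continuous_on_id, of 0 J] in \<open>auto simp: bm_def intro!: borel_measurable_Pair\<close>)
  also have "?this \<longleftrightarrow> (\<lambda>x. \<Phi> (x, u x t, vc x t)) \<in> borel_measurable (lebesgue_on {0..J})"
    by (rule measurable_cong) (simp add: eq)
  finally show ?thesis by (rule bmI[of _ _ C]) (metis eq P(2))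
qed

lemma slice_unif:
  fixes \<Phi> :: "real \<times> real \<times> real \<Rightarrow> real"
  assumes c: "continuous_on ({0..J} \<times> {0..M} \<times> {0..M}) \<Phi>" and J: "J > 0" and t: "t \<ge> 0" and e: "e > 0"
  shows "\<forall>\<^sub>F s in at t within {0..}. AE x in lebesgue. x \<in> {0..J} \<longrightarrow>
    \<bar>\<Phi> (x, u x s, vc x s) - \<Phi> (x, u x t, vc x t)\<bar> \<le> e"
proof -
  have "uniformly_continuous_on ({0..J} \<times> {0..M} \<times> {0..M}) \<Phi>"
    by (intro compact_uniformly_continuous c compact_Times) auto
  then obtain d where d: "d > 0" "\<And>z w. z \<in> {0..J} \<times> {0..M} \<times> {0..M} \<Longrightarrow> w \<in> {0..J} \<times> {0..M} \<times> {0..M} \<Longrightarrow>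
      dist w z < d \<Longrightarrow> dist (\<Phi> w) (\<Phi> z) < e"
    unfolding uniformly_continuous_on_def using e by metis
  have "uniformly_continuous_on ({0..J} \<times> {0..t+1}) (\<lambda>(x, t). u x t)"
    by (intro compact_uniformly_continuous continuous_on_subset[OF u_cont] compact_Times) auto
  then obtain d' where d': "d' > 0" "\<And>z w. z \<in> {0..J} \<times> {0..t+1} \<Longrightarrow> w \<in> {0..J} \<times> {0..t+1} \<Longrightarrow>
      dist w z < d' \<Longrightarrow> dist ((\<lambda>(x, t). u x t) w) ((\<lambda>(x, t). u x t) z) < d/2"
    unfolding uniformly_continuous_on_def using half_gt_zero[OF d(1)] by metis
  have "\<forall>\<^sub>F s in at t within {0..}. dist s t < min 1 d'"
    using d'(1) by (auto simp: eventually_at intro!: exI[of _ "min 1 d'"])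
  moreover have "\<forall>\<^sub>F s in at t within {0..}. AE x in lebesgue. x \<in> {0..J} \<longrightarrow> \<bar>vc x s - vc x t\<bar> \<le> d/3"
    using d(1) by (intro vc_unif t) simp
  moreover have "\<forall>\<^sub>F s in at t within {0..}. s \<in> {0..}" by (simp add: eventually_at_filter)
  ultimately show ?thesis
  proof eventually_elim
    case (elim s)
    then have s: "s \<ge> 0" "s \<le> t + 1" "\<bar>s - t\<bar> < d'" by (auto simp: dist_real_def)
    show ?case using elim(2)
    proof (rule eventually_mono, intro impI)
      fix x assume x: "x \<in> {0..J} \<longrightarrow> \<bar>vc x s - vc x t\<bar> \<le> d/3" "x \<in> {0..J}"
      have "\<bar>u x s - u x t\<bar> < d/2"
        using d'(2)[of "(x, t)" "(x, s)"] x(2) s t by (simp add: dist_Pair_Pair dist_real_def)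
      then have "dist (x, u x s, vc x s) (x, u x t, vc x t) < d"
        using d(1) x sqrt_sum_squares_le_sum_abs[of "u x s - u x t" "vc x s - vc x t"]
        by (simp add: dist_Pair_Pair dist_real_def)
      then have "dist (\<Phi> (x, u x s, vc x s)) (\<Phi> (x, u x t, vc x t)) < e"
        using x(2) u_bounds[of x] vc_bounds s t by (intro d(2)) auto
      then show "\<bar>\<Phi> (x, u x s, vc x s) - \<Phi> (x, u x t, vc x t)\<bar> \<le> e" by (simp add: dist_real_def)
    qed
  qed
qed

text \<open>Continuity in time of all spatial averages of \<open>u\<close> and \<open>vc\<close>. It
  is what allows time-integrated identities to be differentiated and evaluated at a given
  time.\<close>

lemma slice_integral_cont:
  fixes \<Phi> :: "real \<times> real \<times> real \<Rightarrow> real"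
  assumes c: "continuous_on ({0..J} \<times> {0..M} \<times> {0..M}) \<Phi>" and J: "J > 0"
  shows "continuous_on {0..} (\<lambda>t. integral {0..J} (\<lambda>x. \<Phi> (x, u x t, vc x t)))"
  unfolding continuous_on_def
proof
  fix t :: real assume "t \<in> {0..}"
  then show "((\<lambda>t. integral {0..J} (\<lambda>x. \<Phi> (x, u x t, vc x t))) \<longlongrightarrow> integral {0..J} (\<lambda>x. \<Phi> (x, u x t, vc x t))) (at t within {0..})"
    by (intro tendsto_integral_uniform_AE(2)[where a="\<lambda>t x. \<Phi> (x, u x t, vc x t)"])
      (use slice_bm[OF c J] slice_unif[OF c J] in \<open>simp_all\<close>)
qed

text \<open>Translates the plane integrals of the weak formulation, with the given \<open>v\<close>,
  into iterated gauge integrals with \<open>vc\<close>. The integrand \<open>w\<close> is described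
  pointwise so that one lemma covers every term of the formulation.\<close>

lemma box_integral:
  fixes \<Phi> :: "real \<times> real \<times> real \<Rightarrow> real"
  assumes c: "continuous_on ({0..J} \<times> {0..M} \<times> {0..M}) \<Phi>" and J: "J > 0" and T: "T > 0"
    and \<theta>: "continuous_on {0..T} \<theta>"
    and w: "\<And>x t. x > 0 \<Longrightarrow> t \<in> {0<..<T} \<Longrightarrow> w x t = (if x < J then \<theta> t * \<Phi> (x, u x t, v x t) else 0)"
  shows "(LINT (x, t):{0<..} \<times> {0<..<T}|lebesgue. w x t) =
    integral {0..T} (\<lambda>t. \<theta> t * integral {0..J} (\<lambda>x. \<Phi> (x, u x t, vc x t)))"
proof -
  let ?S = "{0<..<J} \<times> {0<..<T}"
  have S: "?S \<in> sets lebesgue" by (intro sets_completionI_sets) (simp add: borel_open open_Times)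
  obtain \<Phi>' C where P: "continuous_on UNIV \<Phi>'" "\<And>z. \<bar>\<Phi>' z\<bar> \<le> C"
    "\<And>x r s. x \<in> {0..J} \<Longrightarrow> r \<in> {0..M} \<Longrightarrow> s \<in> {0..M} \<Longrightarrow> \<Phi>' (x, r, s) = \<Phi> (x, r, s)"
    using continuous_clamp[OF c J] by blast
  have eq: "\<Phi>' (x, u x t, vc x t) = \<Phi> (x, u x t, vc x t)" if "x \<in> {0..J}" "t \<ge> 0" for x t
    using that u_bounds[of x t] vc_bounds by (intro P(3)) auto
  obtain D where D: "\<And>t. t \<in> {0..T} \<Longrightarrow> \<bar>\<theta> t\<bar> \<le> D" using bm_bound[OF bm_cont[OF \<theta>]] by blast
  define h where "h z = \<theta> (snd z) * \<Phi>' (fst z, (\<lambda>(x, t). u x t) z, (\<lambda>(x, t). vc x t) z)" for z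
  define H where "H z = (if z \<in> ?S then h z else 0)" for z
  have hm: "h \<in> borel_measurable (lebesgue_on ?S)"
    unfolding h_def
  proof (intro borel_measurable_times)
    show "(\<lambda>z. \<theta> (snd z)) \<in> borel_measurable (lebesgue_on ?S)"
      by (intro continuous_imp_measurable_on_sets_lebesgue S continuous_on_compose2[OF \<theta>] continuous_intros) auto
    have 1: "(\<lambda>z::real\<times>real. fst z) \<in> borel_measurable (lebesgue_on ?S)"
      by (intro continuous_imp_measurable_on_sets_lebesgue S continuous_intros)
    have 2: "(\<lambda>z. (\<lambda>(x, t). u x t) z) \<in> borel_measurable (lebesgue_on ?S)"
      by (intro continuous_imp_measurable_on_sets_lebesgue S continuous_on_subset[OF u_cont]) auto
    show "(\<lambda>z. \<Phi>' (fst z, (\<lambda>(x, t). u x t) z, (\<lambda>(x, t). vc x t) z)) \<in> borel_measurable (lebesgue_on ?S)"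
      by (rule measurable_compose[OF _ borel_measurable_continuous_onI[OF P(1)]])
        (intro borel_measurable_Pair 1 2 v_joint(1)[OF T J])
  qed
  have Hm: "H \<in> borel_measurable lebesgue" unfolding H_def by (rule borel_measurable_if_I[OF hm S])
  have hb: "\<bar>h z\<bar> \<le> D * C" if "z \<in> ?S" for z
  proof -
    have "\<bar>\<theta> (snd z)\<bar> \<le> D" using that by (intro D) auto
    then show ?thesis unfolding h_def abs_mult using P(2) by (intro mult_mono) auto
  qed
  have Hi: "integrable lebesgue H"
  proof -
    have "h absolutely_integrable_on ?S"
    proof (rule measurable_bounded_by_integrable_imp_absolutely_integrable[OF hm S])
      have "?S \<in> lmeasurable" by (rule bounded_set_imp_lmeasurable[OF _ S]) (simp add: bounded_Times)
      then show "(\<lambda>z. D * C) integrable_on ?S" by (rule integrable_on_const)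
    qed (use hb in auto)
    then have "integrable lebesgue (\<lambda>z. indicator ?S z *\<^sub>R h z)" by (simp add: set_integrable_def)
    also have "(\<lambda>z. indicator ?S z *\<^sub>R h z) = H" by (auto simp: H_def fun_eq_iff)
    finally show ?thesis .
  qed
  have AEH: "AE z in lebesgue. H z = indicator ({0<..} \<times> {0<..<T}) z *\<^sub>R (case z of (x, t) \<Rightarrow> w x t)"
    using v_joint(2)[OF T J]
  proof (rule eventually_mono)
    fix z :: "real \<times> real" assume z: "z \<in> ?S \<longrightarrow> v (fst z) (snd z) = vc (fst z) (snd z)"
    show "H z = indicator ({0<..} \<times> {0<..<T}) z *\<^sub>R (case z of (x, t) \<Rightarrow> w x t)"
    proof (cases "z \<in> {0<..} \<times> {0<..<T}")
      case True
      then show ?thesis using z eq[of "fst z" "snd z"] w[of "fst z" "snd z"] J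
        by (cases z) (auto simp: H_def h_def)
    qed (auto simp: H_def)
  qed
  define m where "m t = \<theta> t * integral {0..J} (\<lambda>x. \<Phi> (x, u x t, vc x t))" for t
  have mc: "continuous_on {0..T} m" unfolding m_def
    by (intro continuous_intros \<theta> continuous_on_subset[OF slice_integral_cont[OF c J]]) auto
  have HS: "(\<lambda>x. H (x, t)) = (\<lambda>x. if x \<in> {0<..<J} then (if t \<in> {0<..<T} then \<theta> t * \<Phi> (x, u x t, vc x t) else 0) else 0)" for t
    by (auto simp: H_def h_def eq fun_eq_iff)
  have sb: "bm {0..J} (\<lambda>x. if t \<in> {0<..<T} then \<theta> t * \<Phi> (x, u x t, vc x t) else 0)" for t
  proof (cases "t \<in> {0<..<T}")
    case True
    show ?thesis unfolding if_P[OF True] by (rule bm_mult[OF bm_const slice_bm[OF c J]]) (use True in simp)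
  next
    case False
    show ?thesis unfolding if_not_P[OF False] by (rule bm_const)
  qed
  have HI: "(LINT x|lebesgue. H (x, t)) = (if t \<in> {0<..<T} then m t else 0)" for t
    unfolding HS lint_open_interval[OF sb]
    by (cases "t \<in> {0<..<T}") (simp_all only: if_True if_False simp_thms m_def integral_mult_right Henstock_Kurzweil_Integration.integral_0)
  have "(LINT (x, t):{0<..} \<times> {0<..<T}|lebesgue. w x t) = (LINT z|lebesgue. H z)"
    unfolding set_lebesgue_integral_def
  proof (rule integral_cong_AE[OF _ Hm])
    show "(\<lambda>z. indicator ({0<..} \<times> {0<..<T}) z *\<^sub>R (case z of (x, t) \<Rightarrow> w x t)) \<in> borel_measurable lebesgue"
      by (rule borel_measurable_AE[OF Hm AEH])
    show "AE z in lebesgue. indicator ({0<..} \<times> {0<..<T}) z *\<^sub>R (case z of (x, t) \<Rightarrow> w x t) = H z"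
      using AEH by (rule eventually_mono) simp
  qed
  also have "\<dots> = (LINT t|lebesgue. LINT x|lebesgue. H (x, t))"
  proof (rule lebesgue_fubini[OF Hi])
    fix t
    have "(\<lambda>x. if t \<in> {0<..<T} then \<theta> t * \<Phi> (x, u x t, vc x t) else 0) \<in> borel_measurable (lebesgue_on {0<..<J})"
      using sb[of t] unfolding bm_def by (auto intro: measurable_restrict_mono)
    then show "(\<lambda>x. H (x, t)) \<in> borel_measurable lebesgue"
      unfolding HS by (rule borel_measurable_if_I) auto
  next
    have "m \<in> borel_measurable (lebesgue_on {0<..<T})"
      by (intro continuous_imp_measurable_on_sets_lebesgue continuous_on_subset[OF mc]) auto
    then show "(\<lambda>t. LINT x|lebesgue. H (x, t)) \<in> borel_measurable lebesgue"
      unfolding HI by (rule borel_measurable_if_I) auto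
  qed
  also have "\<dots> = integral {0..T} m" unfolding HI by (rule lint_open_interval[OF bm_cont[OF mc]])
  finally show ?thesis unfolding m_def[abs_def] .
qed

end

section \<open>Weak balance laws at a fixed time\<close>

lemma zero_if_indefinite_integral_zero:
  fixes h :: "real \<Rightarrow> real"
  assumes h: "continuous_on {0..} h" and z: "\<And>T. T > 0 \<Longrightarrow> integral {0..T} h = 0" and T: "T > 0"
  shows "h T = 0"
proof -
  have w: "at T within {0..} = at T" using T by (intro at_within_interior) (simp add: interior_real_atLeast)
  have "((\<lambda>x. integral {0..x} h) has_real_derivative h T) (at T)"
    using has_derivative_primitive_halfline[OF h, of T] T unfolding w by simp
  moreover have "((\<lambda>x. integral {0..x} h) has_real_derivative 0) (at T)"
  proof (rule DERIV_cong_ev[THEN iffD1])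
    show "((\<lambda>x. 0) has_real_derivative 0) (at T)" by simp
    have "\<forall>\<^sub>F x in nhds T. x \<in> {0<..}" by (rule eventually_nhds_in_open) (use T in auto)
    then show "\<forall>\<^sub>F x in nhds T. 0 = integral {0..x} h" by eventually_elim (simp add: z)
  qed simp_all
  ultimately show ?thesis by (rule DERIV_unique)
qed

text \<open>By Cauchy's formula the integral with weight \<open>T - t\<close> is a primitive of the
  primitive of \<open>N\<close>. The hypothesis thus says that the primitives of both sides of the
  conclusion agree for all \<open>T\<close>, and both sides are continuous.\<close>

lemma differentiate_time_average:
  fixes m N :: "real \<Rightarrow> real"
  assumes m: "continuous_on {0..} m" and N: "continuous_on {0..} N"
    and id: "\<And>T. T > 0 \<Longrightarrow> integral {0..T} m = T * m0 + b * T\<^sup>2 / 2 + integral {0..T} (\<lambda>t. (T - t) * N t)"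
    and T: "T > 0"
  shows "m T = m0 + b * T + integral {0..T} N"
proof -
  define h where "h t = m t - (m0 + b * t + integral {0..t} N)" for t
  have N': "continuous_on {0..t} N" and m': "continuous_on {0..t} m" for t
    using N m by (auto intro: continuous_on_subset)
  have pc: "continuous_on {0..} (\<lambda>t. integral {0..t} N)"
    by (rule DERIV_continuous_on[OF has_derivative_primitive_halfline[OF N]]) auto
  have hc: "continuous_on {0..} h" unfolding h_def by (intro continuous_intros m pc)
  have "integral {0..t} h = 0" if t: "t > 0" for t
  proof -
    have p': "continuous_on {0..t} (\<lambda>t. integral {0..t} N)" using pc by (rule continuous_on_subset) auto
    have lin: "integral {0..t} (\<lambda>s. m0 + b * s) = t * m0 + b * t\<^sup>2 / 2"
    proof -
      have "((\<lambda>s. m0 + b * s) has_integral (m0 * t + b * t\<^sup>2 / 2) - (m0 * 0 + b * 0\<^sup>2 / 2)) {0..t}"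
        using t by (intro fundamental_theorem_of_calculus)
          (auto intro!: derivative_eq_intros simp flip: has_real_derivative_iff_has_vector_derivative)
      then show ?thesis by (simp add: integral_unique mult.commute)
    qed
    have "integral {0..t} h = integral {0..t} m - (integral {0..t} (\<lambda>s. m0 + b * s) + integral {0..t} (\<lambda>s. integral {0..s} N))"
      unfolding h_def
      by (subst Henstock_Kurzweil_Integration.integral_diff, simp_all add: Henstock_Kurzweil_Integration.integral_add
          integrable_add integrable_continuous_interval m' p' continuous_intros)
    also have "integral {0..t} (\<lambda>s. integral {0..s} N) = integral {0..t} (\<lambda>s. (t - s) * N s)"
      by (rule integral_iterated_indefinite[OF bm_cont[OF N'], symmetric]) (use t in simp)
    finally show ?thesis using id[OF t] lin by simp
  qed
  from zero_if_indefinite_integral_zero[OF hc this T] show ?thesis by (simp add: h_def)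
qed

context rd_weak
begin

lemma F_slab: "continuous_on ({0..J} \<times> {0..M} \<times> {0..M}) (\<lambda>z. F (fst (snd z)) (snd (snd z)))"
proof -
  have "continuous_on ({0..J} \<times> {0..M} \<times> {0..M}) (\<lambda>z. (\<lambda>(a, b). F a b) (fst (snd z), snd (snd z)))"
    by (rule continuous_on_compose2[OF reaction_continuous[OF F]]) (auto intro!: continuous_intros)
  then show ?thesis by (simp only: prod.case)
qed

text \<open>The test functions \<open>\<phi>(x) (T - t)\<close> vanish at \<open>t = T\<close>; differentiating the resulting identity in \<open>T\<close>
  removes the time average.\<close>

lemma weak_balance:
  assumes \<phi>: "test_fun J \<phi> \<phi>1 \<phi>2" and t: "t > 0"
  shows "integral {0..J} (\<lambda>x. u x t * \<phi> x) = integral {0..J} (\<lambda>x. u0 x * \<phi> x) + du * U0 * \<phi>1 0 * t +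
      integral {0..t} (\<lambda>s. integral {0..J} (\<lambda>x. du * u x s * \<phi>2 x - k * F (u x s) (vc x s) * \<phi> x))"
    and "integral {0..J} (\<lambda>x. vc x t * \<phi> x) = integral {0..J} (\<lambda>x. v0 x * \<phi> x) -
      integral {0..t} (\<lambda>s. integral {0..J} (\<lambda>x. k * F (u x s) (vc x s) * \<phi> x))"
proof -
  have J: "J > 0" and \<phi>0: "\<phi> 0 = 0" and \<phi>J: "\<And>x. x \<ge> J \<Longrightarrow> \<phi> x = 0 \<and> \<phi>1 x = 0 \<and> \<phi>2 x = 0"
    and d: "\<And>x. x \<ge> 0 \<Longrightarrow> (\<phi> has_real_derivative \<phi>1 x) (at x within {0..})"
      "\<And>x. x \<ge> 0 \<Longrightarrow> (\<phi>1 has_real_derivative \<phi>2 x) (at x within {0..})"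
    using \<phi> by (auto simp: test_fun_def)
  note c = test_fun_cont[OF \<phi>]
  have cK: "continuous_on ({0..J} \<times> {0..M} \<times> {0..M}) (\<lambda>z. \<phi> (fst z))"
    "continuous_on ({0..J} \<times> {0..M} \<times> {0..M}) (\<lambda>z. \<phi>2 (fst z))"
    by (rule continuous_on_compose2[OF c(1)] continuous_on_compose2[OF c(3)], auto intro!: continuous_intros)+
  define Pu where "Pu z = fst (snd z) * \<phi> (fst z)" for z :: "real \<times> real \<times> real"
  define Pv where "Pv z = snd (snd z) * \<phi> (fst z)" for z :: "real \<times> real \<times> real"
  define Pn where "Pn z = du * fst (snd z) * \<phi>2 (fst z) - k * F (fst (snd z)) (snd (snd z)) * \<phi> (fst z)" for z :: "real \<times> real \<times> real"
  define Pr where "Pr z = - (k * F (fst (snd z)) (snd (snd z)) * \<phi> (fst z))" for z :: "real \<times> real \<times> real"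
  have cP: "continuous_on ({0..J} \<times> {0..M} \<times> {0..M}) Pu" "continuous_on ({0..J} \<times> {0..M} \<times> {0..M}) Pv"
    "continuous_on ({0..J} \<times> {0..M} \<times> {0..M}) Pn" "continuous_on ({0..J} \<times> {0..M} \<times> {0..M}) Pr"
    unfolding Pu_def Pv_def Pn_def Pr_def by (intro continuous_intros cK F_slab)+
  \<comment> \<open>The factor \<open>T^2 / 2\<close> is the integral of \<open>T - t\<close>
    produced by the constant boundary datum. The identity for \<open>v\<close> carries it with
    coefficient 0, so that \<open>differentiate_time_average\<close> fits both.\<close>
  have weak: "integral {0..T} (\<lambda>t. integral {0..J} (\<lambda>x. Pu (x, u x t, vc x t))) =
      T * integral {0..J} (\<lambda>x. u0 x * \<phi> x) + (du * U0 * \<phi>1 0) * T\<^sup>2 / 2 +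
      integral {0..T} (\<lambda>t. (T - t) * integral {0..J} (\<lambda>x. Pn (x, u x t, vc x t)))" (is ?u)
    "integral {0..T} (\<lambda>t. integral {0..J} (\<lambda>x. Pv (x, u x t, vc x t))) =
      T * integral {0..J} (\<lambda>x. v0 x * \<phi> x) + 0 * T\<^sup>2 / 2 +
      integral {0..T} (\<lambda>t. (T - t) * integral {0..J} (\<lambda>x. Pr (x, u x t, vc x t)))" (is ?v)
    if T: "T > 0" for T
  proof -
    define \<psi> where "\<psi> x t = \<phi> x * (T - t)" for x t
    define \<psi>x where "\<psi>x x t = \<phi>1 x * (T - t)" for x t
    define \<psi>xx where "\<psi>xx x t = \<phi>2 x * (T - t)" for x t
    define \<psi>t where "\<psi>t x t = - \<phi> x" for x and t :: real
    have cc: "continuous_on ({0..} \<times> {0..T}) (\<lambda>z. \<phi> (fst z))" "continuous_on ({0..} \<times> {0..T}) (\<lambda>z. \<phi>1 (fst z))"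
      "continuous_on ({0..} \<times> {0..T}) (\<lambda>z. \<phi>2 (fst z))"
      by (rule continuous_on_compose2[OF c(1)] continuous_on_compose2[OF c(2)] continuous_on_compose2[OF c(3)],
          auto intro!: continuous_intros)+
    have "C21_partials {0..} {0..T} \<psi> \<psi>x \<psi>xx \<psi>t"
      unfolding C21_partials_def
    proof (intro conjI ballI)
      fix x t :: real assume x: "x \<in> {0..}"
      have x0: "x \<ge> 0" using x by simp
      show "((\<lambda>y. \<psi> y t) has_real_derivative \<psi>x x t) (at x within {0..})"
        unfolding \<psi>_def \<psi>x_def by (rule DERIV_cmult_right[OF d(1)[OF x0]])
      show "((\<lambda>y. \<psi>x y t) has_real_derivative \<psi>xx x t) (at x within {0..})"
        unfolding \<psi>x_def \<psi>xx_def by (rule DERIV_cmult_right[OF d(2)[OF x0]])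
      show "((\<lambda>s. \<psi> x s) has_real_derivative \<psi>t x t) (at t within {0..T})"
        unfolding \<psi>_def \<psi>t_def by (auto intro!: derivative_eq_intros)
    qed (auto simp: \<psi>_def \<psi>x_def \<psi>xx_def \<psi>t_def case_prod_beta intro!: continuous_intros cc)
    moreover have "\<forall>x\<ge>0. \<psi> x T = 0" "\<forall>t\<in>{0<..<T}. \<psi> 0 t = 0" "\<exists>J>0. \<forall>x>J. \<forall>t\<in>{0..T}. \<psi> x t = 0"
      using \<phi>0 \<phi>J J by (auto simp: \<psi>_def intro!: exI[of _ J])
    ultimately have
      W: "(LINT (x, t):{0<..} \<times> {0<..<T}|lebesgue. u x t * \<psi>t x t) +
        (LINT (x, t):{0<..} \<times> {0<..<T}|lebesgue. du * u x t * \<psi>xx x t - k * F (u x t) (v x t) * \<psi> x t) =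
        - (LINT x:{0<..}|lebesgue. u0 x * \<psi> x 0) - du * U0 * (LINT t:{0<..<T}|lebesgue. \<psi>x 0 t)"
        "(LINT (x, t):{0<..} \<times> {0<..<T}|lebesgue. v x t * \<psi>t x t) -
        (LINT (x, t):{0<..} \<times> {0<..<T}|lebesgue. k * F (u x t) (v x t) * \<psi> x t) =
        - (LINT x:{0<..}|lebesgue. v0 x * \<psi> x 0)"
      using sol[OF T] unfolding weak_solution_def by blast+
    have tc: "continuous_on {0..T} (\<lambda>t. T - t)" "continuous_on {0..T} (\<lambda>t. - 1 :: real)" by (intro continuous_intros)+
    have 1: "(LINT (x, t):{0<..} \<times> {0<..<T}|lebesgue. u x t * \<psi>t x t) =
        integral {0..T} (\<lambda>t. (- 1) * integral {0..J} (\<lambda>x. Pu (x, u x t, vc x t)))"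
      by (rule box_integral[OF cP(1) J T tc(2)]) (auto simp: \<psi>t_def Pu_def \<phi>J)
    have 2: "(LINT (x, t):{0<..} \<times> {0<..<T}|lebesgue. v x t * \<psi>t x t) =
        integral {0..T} (\<lambda>t. (- 1) * integral {0..J} (\<lambda>x. Pv (x, u x t, vc x t)))"
      by (rule box_integral[OF cP(2) J T tc(2)]) (auto simp: \<psi>t_def Pv_def \<phi>J)
    have 3: "(LINT (x, t):{0<..} \<times> {0<..<T}|lebesgue. du * u x t * \<psi>xx x t - k * F (u x t) (v x t) * \<psi> x t) =
        integral {0..T} (\<lambda>t. (T - t) * integral {0..J} (\<lambda>x. Pn (x, u x t, vc x t)))"
      by (rule box_integral[OF cP(3) J T tc(1)]) (auto simp: \<psi>_def \<psi>xx_def Pn_def \<phi>J algebra_simps)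
    have 4: "(LINT (x, t):{0<..} \<times> {0<..<T}|lebesgue. k * F (u x t) (v x t) * \<psi> x t) =
        integral {0..T} (\<lambda>t. - (T - t) * integral {0..J} (\<lambda>x. Pr (x, u x t, vc x t)))"
      by (rule box_integral[OF cP(4) J T continuous_on_minus[OF tc(1)]]) (auto simp: \<psi>_def Pr_def \<phi>J algebra_simps)
    have 5: "(LINT x:{0<..}|lebesgue. h x * \<psi> x 0) = T * integral {0..J} (\<lambda>x. h x * \<phi> x)" if h: "continuous_on {0..} h" for h
    proof -
      have "(LINT x:{0<..}|lebesgue. h x * \<psi> x 0) = (LINT x|lebesgue. (if x \<in> {0<..<J} then T * (h x * \<phi> x) else 0))"
        unfolding set_lebesgue_integral_def by (rule Bochner_Integration.integral_cong) (auto simp: \<psi>_def \<phi>J)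
      also have "\<dots> = integral {0..J} (\<lambda>x. T * (h x * \<phi> x))"
        by (rule lint_open_interval) (intro bm_cont continuous_intros continuous_on_subset[OF h] continuous_on_subset[OF c(1)]; simp)
      finally show ?thesis by simp
    qed
    have 6: "(LINT t:{0<..<T}|lebesgue. \<psi>x 0 t) = \<phi>1 0 * T\<^sup>2 / 2"
    proof -
      have "(LINT t:{0<..<T}|lebesgue. \<psi>x 0 t) = (LINT t|lebesgue. (if t \<in> {0<..<T} then \<phi>1 0 * (T - t) else 0))"
        unfolding set_lebesgue_integral_def by (rule Bochner_Integration.integral_cong) (auto simp: \<psi>x_def)
      also have "\<dots> = integral {0..T} (\<lambda>t. \<phi>1 0 * (T - t))"
        by (rule lint_open_interval) (intro bm_cont continuous_intros)
      also have "\<dots> = \<phi>1 0 * (T * T - T\<^sup>2 / 2) - \<phi>1 0 * (T * 0 - 0\<^sup>2 / 2)"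
        using T by (intro integral_unique fundamental_theorem_of_calculus)
          (auto intro!: derivative_eq_intros simp flip: has_real_derivative_iff_has_vector_derivative)
      finally show ?thesis by (simp add: power2_eq_square)
    qed
    show ?u using W(1) unfolding 1 3 5[OF u0_cont] 6 by simp
    have "integral {0..T} (\<lambda>t. - (T - t) * integral {0..J} (\<lambda>x. Pr (x, u x t, vc x t))) =
        - integral {0..T} (\<lambda>t. (T - t) * integral {0..J} (\<lambda>x. Pr (x, u x t, vc x t)))"
      unfolding Henstock_Kurzweil_Integration.integral_neg[symmetric] by (simp only: mult_minus_left)
    then show ?v using W(2) unfolding 2 4 5[OF v0_cont] by simp
  qed
  note sc = slice_integral_cont[OF _ J]
  show "integral {0..J} (\<lambda>x. u x t * \<phi> x) = integral {0..J} (\<lambda>x. u0 x * \<phi> x) + du * U0 * \<phi>1 0 * t +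
      integral {0..t} (\<lambda>s. integral {0..J} (\<lambda>x. du * u x s * \<phi>2 x - k * F (u x s) (vc x s) * \<phi> x))"
    using differentiate_time_average[OF sc[OF cP(1)] sc[OF cP(3)] weak(1) t] by (simp add: Pu_def Pn_def)
  have "integral {0..J} (\<lambda>x. vc x t * \<phi> x) = integral {0..J} (\<lambda>x. v0 x * \<phi> x) +
      integral {0..t} (\<lambda>s. integral {0..J} (\<lambda>x. - (k * F (u x s) (vc x s) * \<phi> x)))"
    using differentiate_time_average[OF sc[OF cP(2)] sc[OF cP(4)] weak(2) t] by (simp add: Pv_def Pr_def)
  then show "integral {0..J} (\<lambda>x. vc x t * \<phi> x) = integral {0..J} (\<lambda>x. v0 x * \<phi> x) -
      integral {0..t} (\<lambda>s. integral {0..J} (\<lambda>x. k * F (u x s) (vc x s) * \<phi> x))"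
    by (simp only: Henstock_Kurzweil_Integration.integral_neg)
qed

lemma bm_data: "bm {0..X} u0" "bm {0..X} v0"
  by (auto intro!: bm_cont continuous_on_subset[OF u0_cont] continuous_on_subset[OF v0_cont])

lemma u_bm: "t \<ge> 0 \<Longrightarrow> bm {0..X} (\<lambda>x. u x t)"
  by (rule bm_cont[OF continuous_on_subset[OF continuous_slice(2)[OF u_cont]]]) auto

text \<open>The difference of the two identities of \<open>weak_balance\<close> contains no
  reaction. Exchanging the integrals exhibits the time integral of \<open>du * u\<close> as a weak
  solution of a second-order equation, to which \<open>second_primitive_if_weak\<close> applies with
  \<open>b = du * U0 * t\<close>.\<close>

lemma weak_representation:
  assumes t: "t > 0"
  shows "\<exists>c. \<forall>x\<ge>0. integral {0..t} (\<lambda>s. du * u x s) = du * U0 * t + c * x +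
    integral {0..x} (\<lambda>y. (x - y) * ((u y t - vc y t) - (u0 y - v0 y)))"
proof (rule second_primitive_if_weak)
  have sub: "{0..} \<times> {0..t} \<subseteq> {0..} \<times> {0::real..}" by auto
  have uc: "continuous_on ({0..} \<times> {0..t}) (\<lambda>(x, s). du * u x s)"
    using continuous_on_subset[OF u_cont sub] by (auto intro!: continuous_intros simp: case_prod_beta)
  have t0: "t \<ge> 0" using t by simp
  show "bm {0..X} (\<lambda>y. u y t - vc y t - (u0 y - v0 y))" for X
    by (intro bm_diff u_bm vc_bm bm_data t0)
  show "continuous_on {0..} (\<lambda>x. integral {0..t} (\<lambda>s. du * u x s))"
    by (rule continuous_time_integral[OF uc])
  fix J \<phi> \<phi>1 \<phi>2 assume \<phi>: "test_fun J \<phi> \<phi>1 \<phi>2"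
  have J: "J > 0" using \<phi> by (simp add: test_fun_def)
  note c = test_fun_cont[OF \<phi>]
  have b\<phi>: "bm {0..J} \<phi>" "bm {0..J} \<phi>2"
    by (auto intro!: bm_cont continuous_on_subset[OF c(1)] continuous_on_subset[OF c(3)])
  let ?r = "\<lambda>s. integral {0..J} (\<lambda>x. k * F (u x s) (vc x s) * \<phi> x)"
  let ?n = "\<lambda>s. integral {0..J} (\<lambda>x. du * u x s * \<phi>2 x)"
  have \<phi>K: "continuous_on ({0..J} \<times> {0..M} \<times> {0..M}) (\<lambda>z. \<phi> (fst z))"
    "continuous_on ({0..J} \<times> {0..M} \<times> {0..M}) (\<lambda>z. \<phi>2 (fst z))"
    by (rule continuous_on_compose2[OF c(1)] continuous_on_compose2[OF c(3)], auto intro!: continuous_intros)+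
  have Kr: "continuous_on ({0..J} \<times> {0..M} \<times> {0..M}) (\<lambda>z. k * F (fst (snd z)) (snd (snd z)) * \<phi> (fst z))"
    and Kn: "continuous_on ({0..J} \<times> {0..M} \<times> {0..M}) (\<lambda>z. du * fst (snd z) * \<phi>2 (fst z))"
    by (intro continuous_intros F_slab \<phi>K)+
  have ri: "?r integrable_on {0..t}" and ni: "?n integrable_on {0..t}"
    using slice_integral_cont[OF Kr J] slice_integral_cont[OF Kn J]
    by (auto intro!: integrable_continuous_interval intro: continuous_on_subset)
  have split: "integral {0..t} (\<lambda>s. integral {0..J} (\<lambda>x. du * u x s * \<phi>2 x - k * F (u x s) (vc x s) * \<phi> x)) =
      integral {0..t} ?n - integral {0..t} ?r"
  proof -
    have "integral {0..J} (\<lambda>x. du * u x s * \<phi>2 x - k * F (u x s) (vc x s) * \<phi> x) = ?n s - ?r s" if "s \<in> {0..t}" for s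
      using slice_bm[OF Kr J, of s] slice_bm[OF Kn J, of s] that
      by (intro Henstock_Kurzweil_Integration.integral_diff bm_int) auto
    then have "integral {0..t} (\<lambda>s. integral {0..J} (\<lambda>x. du * u x s * \<phi>2 x - k * F (u x s) (vc x s) * \<phi> x)) =
      integral {0..t} (\<lambda>s. ?n s - ?r s)" by (rule Henstock_Kurzweil_Integration.integral_cong)
    then show ?thesis by (simp only: Henstock_Kurzweil_Integration.integral_diff[OF ni ri])
  qed
  have swap: "integral {0..t} ?n = integral {0..J} (\<lambda>x. integral {0..t} (\<lambda>s. du * u x s) * \<phi>2 x)"
  proof -
    have cn: "continuous_on ({0..} \<times> {0..t}) (\<lambda>z. \<phi>2 (fst z))"
      by (rule continuous_on_compose2[OF c(3)]) (auto intro!: continuous_intros)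
    have "continuous_on ({0..} \<times> {0..t}) (\<lambda>(x, s). du * u x s * \<phi>2 x)"
      using continuous_on_mult[OF uc cn] by (simp add: case_prod_beta)
    from integral_swap_rect[OF this, of J] show ?thesis by simp
  qed
  have parts: "integral {0..J} (\<lambda>x. (u x t - vc x t - (u0 x - v0 x)) * \<phi> x) =
      (integral {0..J} (\<lambda>x. u x t * \<phi> x) - integral {0..J} (\<lambda>x. vc x t * \<phi> x)) -
      (integral {0..J} (\<lambda>x. u0 x * \<phi> x) - integral {0..J} (\<lambda>x. v0 x * \<phi> x))"
  proof -
    have i: "(\<lambda>x. u x t * \<phi> x) integrable_on {0..J}" "(\<lambda>x. vc x t * \<phi> x) integrable_on {0..J}"
      "(\<lambda>x. u0 x * \<phi> x) integrable_on {0..J}" "(\<lambda>x. v0 x * \<phi> x) integrable_on {0..J}"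
      by (intro bm_int bm_mult b\<phi> u_bm vc_bm bm_data t0)+
    have "(\<lambda>x. (u x t - vc x t - (u0 x - v0 x)) * \<phi> x) = (\<lambda>x. (u x t * \<phi> x - vc x t * \<phi> x) - (u0 x * \<phi> x - v0 x * \<phi> x))"
      by (simp add: fun_eq_iff algebra_simps)
    then show ?thesis by (simp only: Henstock_Kurzweil_Integration.integral_diff integrable_diff i)
  qed
  show "integral {0..J} (\<lambda>x. (u x t - vc x t - (u0 x - v0 x)) * \<phi> x) =
      integral {0..J} (\<lambda>x. integral {0..t} (\<lambda>s. du * u x s) * \<phi>2 x) + du * U0 * t * \<phi>1 0"
    unfolding parts weak_balance[OF \<phi> t] split swap by simp
qed

text \<open>The weak formulation encodes the boundary value only through test functions. The
  representation at \<open>x = 0\<close> gives the time integral of \<open>u 0 s\<close> for every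
  end time, and continuity gives the value itself.\<close>

lemma weak_u_boundary: assumes "t > 0" shows "u 0 t = U0"
proof -
  have c: "continuous_on {0..} (\<lambda>s. u 0 s)" by (rule continuous_slice(1)[OF u_cont]) simp
  have "du * u 0 t - du * U0 = 0"
  proof (rule zero_if_indefinite_integral_zero[OF _ _ assms])
    show "continuous_on {0..} (\<lambda>s. du * u 0 s - du * U0)" by (intro continuous_intros c)
    fix T :: real assume T: "T > 0"
    have "integral {0..T} (\<lambda>s. du * u 0 s) = du * U0 * T" using weak_representation[OF T] by auto
    moreover have "(\<lambda>s. du * u 0 s) integrable_on {0..T}"
      by (intro integrable_continuous_interval continuous_intros continuous_on_subset[OF c]) auto
    ultimately show "integral {0..T} (\<lambda>s. du * u 0 s - du * U0) = 0"
      using T by (subst Henstock_Kurzweil_Integration.integral_diff) (simp_all only: integrable_const_ivl integral_const_real, simp)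
  qed
  then show ?thesis using du by simp
qed

lemma reaction_integral_bounds:
  assumes \<phi>: "test_fun J \<phi> \<phi>1 \<phi>2" and nn: "\<And>x. x \<in> {0..J} \<Longrightarrow> 0 \<le> \<phi> x"
  shows "continuous_on {0..} (\<lambda>s. integral {0..J} (\<lambda>x. k * F (u x s) (vc x s) * \<phi> x))"
    and "\<And>s. s \<ge> 0 \<Longrightarrow> bm {0..J} (\<lambda>x. k * F (u x s) (vc x s) * \<phi> x)"
    and "\<And>s. s \<ge> 0 \<Longrightarrow> 0 \<le> integral {0..J} (\<lambda>x. k * F (u x s) (vc x s) * \<phi> x)"
    and "\<And>t. 0 \<le> integral {0..t} (\<lambda>s. integral {0..J} (\<lambda>x. k * F (u x s) (vc x s) * \<phi> x))"
proof -
  have J: "J > 0" using \<phi> by (simp add: test_fun_def)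
  have "continuous_on ({0..J} \<times> {0..M} \<times> {0..M}) (\<lambda>z. \<phi> (fst z))"
    by (rule continuous_on_compose2[OF test_fun_cont(1)[OF \<phi>]]) (auto intro!: continuous_intros)
  then have Kr: "continuous_on ({0..J} \<times> {0..M} \<times> {0..M}) (\<lambda>z. k * F (fst (snd z)) (snd (snd z)) * \<phi> (fst z))"
    by (intro continuous_intros F_slab)
  show c: "continuous_on {0..} (\<lambda>s. integral {0..J} (\<lambda>x. k * F (u x s) (vc x s) * \<phi> x))"
    using slice_integral_cont[OF Kr J] by simp
  show b: "bm {0..J} (\<lambda>x. k * F (u x s) (vc x s) * \<phi> x)" if "s \<ge> 0" for s
    using slice_bm[OF Kr J that] by simp
  have *: "0 \<le> integral {0..J} (\<lambda>x. k * F (u x s) (vc x s) * \<phi> x)" if "s \<ge> 0" for s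
    by (rule Henstock_Kurzweil_Integration.integral_nonneg[OF bm_int[OF b[OF that]]])
      (use k nn u_bounds vc_bounds that in \<open>auto intro!: mult_nonneg_nonneg F_nonneg\<close>)
  then show "\<And>s. s \<ge> 0 \<Longrightarrow> 0 \<le> integral {0..J} (\<lambda>x. k * F (u x s) (vc x s) * \<phi> x)" .
  show "0 \<le> integral {0..t} (\<lambda>s. integral {0..J} (\<lambda>x. k * F (u x s) (vc x s) * \<phi> x))" for t
  proof (rule Henstock_Kurzweil_Integration.integral_nonneg)
    show "(\<lambda>s. integral {0..J} (\<lambda>x. k * F (u x s) (vc x s) * \<phi> x)) integrable_on {0..t}"
      by (rule integrable_continuous_interval, rule continuous_on_subset[OF c]) auto
    show "0 \<le> integral {0..J} (\<lambda>x. k * F (u x s) (vc x s) * \<phi> x)" if "s \<in> {0..t}" for s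
      by (rule *) (use that in simp)
  qed
qed

text \<open>Without diffusion \<open>v\<close> only loses mass to a nonnegative reaction, so
  \<open>vc - v0\<close> has nonpositive integral against every nonnegative test function.
  Exhausting the half-line by bounded intervals gives the pointwise statement.\<close>

lemma weak_v_le_initial:
  assumes t: "t > 0"
  shows "AE x in lebesgue. x \<ge> 0 \<longrightarrow> vc x t \<le> v0 x"
proof -
  have t0: "t \<ge> 0" using t by simp
  have "AE x in lebesgue. x \<in> {0<..<real (Suc n)} \<longrightarrow> vc x t - v0 x \<le> 0" for n
  proof (rule AE_nonpos_if_weak)
    let ?J = "real (Suc n)"
    show "bm {0..?J} (\<lambda>x. vc x t - v0 x)" by (intro bm_diff vc_bm bm_data t0)
    fix r :: "real \<Rightarrow> real" assume r: "real_polynomial_function r" "\<And>x. x \<in> {0..?J} \<Longrightarrow> 0 \<le> r x"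
    define \<phi> where "\<phi> x = x * r x * (max 0 (?J - x))^3" for x
    obtain \<phi>1 \<phi>2 where \<phi>: "test_fun ?J \<phi> \<phi>1 \<phi>2" using test_fun_poly[OF r(1), of ?J] unfolding \<phi>_def[abs_def] by auto
    have nn: "0 \<le> \<phi> x" if "x \<in> {0..?J}" for x using r(2)[OF that] that by (simp add: \<phi>_def)
    have b: "bm {0..?J} \<phi>" by (rule bm_cont[OF continuous_on_subset[OF test_fun_cont(1)[OF \<phi>]]]) auto
    have "integral {0..?J} (\<lambda>x. vc x t * \<phi> x) \<le> integral {0..?J} (\<lambda>x. v0 x * \<phi> x)"
      using weak_balance(2)[OF \<phi> t] reaction_integral_bounds(4)[OF \<phi> nn, of t] by linarith
    moreover have "integral {0..?J} (\<lambda>x. (vc x t - v0 x) * \<phi> x) =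
        integral {0..?J} (\<lambda>x. vc x t * \<phi> x) - integral {0..?J} (\<lambda>x. v0 x * \<phi> x)"
      unfolding left_diff_distrib by (intro Henstock_Kurzweil_Integration.integral_diff bm_int bm_mult b vc_bm bm_data t0)
    ultimately show "integral {0..?J} (\<lambda>x. (vc x t - v0 x) * (x * r x * (max 0 (?J - x))^3)) \<le> 0"
      unfolding \<phi>_def by linarith
  qed simp
  then have "AE x in lebesgue. \<forall>n. x \<in> {0<..<real (Suc n)} \<longrightarrow> vc x t - v0 x \<le> 0"
    unfolding AE_all_countable by blast
  then show ?thesis
  proof (rule eventually_mono, intro impI)
    fix x :: real assume x: "\<forall>n. x \<in> {0<..<real (Suc n)} \<longrightarrow> vc x t - v0 x \<le> 0" "x \<ge> 0"
    show "vc x t \<le> v0 x"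
    proof (cases "x = 0")
      case True then show ?thesis using data_bounds[of 0] by (simp add: vc_def)
    next
      case False
      have "x < real (Suc (nat \<lceil>x\<rceil>))" by linarith
      then have "x \<in> {0<..<real (Suc (nat \<lceil>x\<rceil>))}" using x(2) False by simp
      then have "vc x t - v0 x \<le> 0" using x(1) by blast
      then show ?thesis by simp
    qed
  qed
qed

text \<open>Testing the equation of \<open>v\<close> bounds the reaction against
  \<open>\<phi>\<close> by the initial mass of \<open>v\<close> in the box, of order
  \<open>L\<close>, with no gradient involved. Where \<open>\<phi>\<close> has a lower bound, the
  product \<open>u * vc\<close> is then handled through \<open>product_le_reaction\<close>.\<close>

lemma weak_segregation:
  "((\<lambda>L. (1 / L^3) * integral {1..L\<^sup>2} (\<lambda>t. integral {0..X*L} (\<lambda>x. u x t * vc x t))) \<longlongrightarrow> 0) at_top"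
proof (cases "X > 0")
  case False
  have "\<forall>\<^sub>F L in at_top. 0 = (1 / L^3) * integral {1..L\<^sup>2} (\<lambda>t. integral {0..X*L} (\<lambda>x. u x t * vc x t))"
    using eventually_ge_at_top[of 0]
  proof eventually_elim
    case (elim L)
    then have "X * L \<le> 0" using False by (simp add: mult_nonpos_nonneg)
    then have "integral {0..X*L} h = 0" for h :: "real \<Rightarrow> real" by (cases "X * L = 0") auto
    then show ?case by simp
  qed
  then show ?thesis by (rule Lim_transform_eventually[OF tendsto_const])
next
  case X: True
  show ?thesis unfolding tendsto_iff
  proof (intro allI impI)
    fix e :: real assume e: "e > 0"
    \<comment> \<open>The test function has to vanish at 0, so the strip {0..\<eta>*L} is estimated
      trivially by \<open>M^2\<close>, at the cost of a quarter of \<open>e\<close>.\<close>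
    define \<eta> where "\<eta> = e / (4 * M\<^sup>2)"
    have \<eta>: "\<eta> > 0" "M\<^sup>2 * \<eta> = e / 4" using e M_pos by (auto simp: \<eta>_def)
    \<comment> \<open>On {\<eta>*L..X*L}, in a box of width \<open>Y = 2 * X * L\<close>, the test
      function is at least \<open>\<eta> * L * (X * L)^3 / Y^4 = \<eta> / (16 * X)\<close>, so
      \<open>c\<close> times it is at least 1.\<close>
    define c where "c = 16 * X / \<eta>"
    have c: "c > 0" using X \<eta> by (simp add: c_def)
    \<comment> \<open>Gives the constant term of \<open>product_le_reaction\<close>, multiplied by
      \<open>c\<close> and spread over the width \<open>2 * X * L\<close>, another quarter of
      \<open>e\<close>.\<close>
    define \<epsilon> where "\<epsilon> = e / (8 * c * M * X)"
    have \<epsilon>: "\<epsilon> > 0" "c * (M * \<epsilon> * (2 * X)) = e / 4" using e M_pos X c by (auto simp: \<epsilon>_def)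
    obtain D where D: "D \<ge> 0" "\<And>r s. r \<in> {0..M} \<Longrightarrow> s \<in> {0..M} \<Longrightarrow> r * s \<le> M * \<epsilon> + D * (k * F r s)"
      using product_le_reaction[OF \<epsilon>(1)] by metis
    have "((\<lambda>L. e / 2 + c * (D * (M * (2 * X))) / L\<^sup>2) \<longlongrightarrow> e / 2) at_top" by real_asymp
    then have "\<forall>\<^sub>F L in at_top. e / 2 + c * (D * (M * (2 * X))) / L\<^sup>2 < e"
      by (rule order_tendstoD(2)) (use e in simp)
    then show "\<forall>\<^sub>F L in at_top. dist ((1 / L^3) * integral {1..L\<^sup>2} (\<lambda>t. integral {0..X*L} (\<lambda>x. u x t * vc x t))) 0 < e"
      using eventually_ge_at_top[of 2]
    proof eventually_elim
      case (elim L)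
      have L0: "L > 0" using elim by simp
      have L1: "1 \<le> L\<^sup>2" using elim by (intro one_le_power) simp
      define Y where "Y = 2 * (X * L)"
      have Y: "Y > 0" "X * L \<le> Y" using X L0 by (auto simp: Y_def)
      have XL: "X * L > 0" using X L0 by simp
      define \<phi> where "\<phi> x = x * (1 / Y^4) * (max 0 (Y - x))^3" for x
      obtain \<phi>1 \<phi>2 where \<phi>: "test_fun Y \<phi> \<phi>1 \<phi>2"
        using test_fun_poly[OF real_polynomial_function.intros(2)[of "1 / Y^4"] Y(1)] unfolding \<phi>_def[abs_def] by auto
      have nn: "0 \<le> \<phi> x" if "x \<in> {0..Y}" for x using that Y by (simp add: \<phi>_def)
      have le1: "\<phi> x \<le> 1" if x: "x \<in> {0..Y}" for x
      proof -
        have "x * (max 0 (Y - x))^3 \<le> Y * Y^3" using x Y by (intro mult_mono power_mono) auto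
        then show ?thesis using Y by (simp add: \<phi>_def field_simps power4_eq_xxxx power3_eq_cube)
      qed
      have lower: "1 \<le> c * \<phi> x" if x: "\<eta> * L \<le> x" "x \<le> X * L" for x
      proof -
        have "0 < \<eta> * L" using \<eta> L0 by simp
        then have "\<eta> * L * (X * L)^3 \<le> x * (max 0 (Y - x))^3"
          using x XL by (intro mult_mono power_mono) (auto simp: Y_def mult.commute)
        then have "c * (\<eta> * L * (X * L)^3 * (1 / Y^4)) \<le> c * \<phi> x"
          unfolding \<phi>_def using c Y by (intro mult_left_mono) (auto simp: field_simps)
        moreover have "c * (\<eta> * L * (X * L)^3 * (1 / Y^4)) = 1"
          unfolding c_def Y_def using X L0 \<eta>(1) by (simp add: field_simps power4_eq_xxxx power3_eq_cube)
        ultimately show ?thesis by linarith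
      qed
      define R where "R s = integral {0..Y} (\<lambda>x. k * F (u x s) (vc x s) * \<phi> x)" for s
      have Rc: "continuous_on {0..} R"
        and Rb: "\<And>s. s \<ge> 0 \<Longrightarrow> bm {0..Y} (\<lambda>x. k * F (u x s) (vc x s) * \<phi> x)"
        and R0: "\<And>s. s \<ge> 0 \<Longrightarrow> 0 \<le> R s"
        unfolding R_def[abs_def] by (rule reaction_integral_bounds(1-3)[OF \<phi> nn]; assumption)+
      have Ri: "R integrable_on {p..q}" if "p \<ge> 0" for p q
        by (intro integrable_continuous_interval continuous_on_subset[OF Rc]) (use that in auto)
      have b\<phi>: "bm {0..Y} \<phi>" by (rule bm_cont[OF continuous_on_subset[OF test_fun_cont(1)[OF \<phi>]]]) auto
      have RI: "integral {1..L\<^sup>2} R \<le> M * Y"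
      proof -
        have "integral {1..L\<^sup>2} R \<le> integral {0..L\<^sup>2} R"
          by (rule integral_subset_le) (use Ri R0 in auto)
        also have "\<dots> \<le> integral {0..Y} (\<lambda>x. v0 x * \<phi> x)"
        proof -
          have "0 \<le> integral {0..Y} (\<lambda>x. vc x (L\<^sup>2) * \<phi> x)"
            by (rule Henstock_Kurzweil_Integration.integral_nonneg)
              (use nn vc_bounds in \<open>auto intro!: bm_int bm_mult vc_bm b\<phi> mult_nonneg_nonneg\<close>)
          then show ?thesis using weak_balance(2)[OF \<phi>, of "L\<^sup>2"] L0 by (simp add: R_def[abs_def])
        qed
        also have "\<dots> \<le> integral {0..Y} (\<lambda>x. M)"
        proof (rule integral_le)
          show "(\<lambda>x. v0 x * \<phi> x) integrable_on {0..Y}"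
            by (intro bm_int bm_mult bm_data b\<phi>)
          show "v0 x * \<phi> x \<le> M" if "x \<in> {0..Y}" for x
            using mult_mono[of "v0 x" M "\<phi> x" 1] data_bounds[of x] le1[OF that] nn[OF that] M_pos that by auto
        qed (rule integrable_const_ivl)
        finally show ?thesis using Y by (simp add: mult.commute)
      qed
      have slice: "integral {0..X*L} (\<lambda>x. u x s * vc x s) \<le> M\<^sup>2 * \<eta> * L + c * (M * \<epsilon> * Y) + c * D * R s" if s: "s \<ge> 0" for s
      proof -
        let ?i = "\<lambda>x. if x \<in> {0..\<eta>*L} then M\<^sup>2 else 0"
        let ?w = "\<lambda>x. k * F (u x s) (vc x s) * \<phi> x"
        have ib: "bm {0..Y} ?i"
        proof (rule bmI[of _ _ "M\<^sup>2"])
          show "?i \<in> borel_measurable (lebesgue_on {0..Y})"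
            by (rule measurable_restrict_space1, rule borel_measurable_if_I) simp_all
        qed auto
        have wb: "bm {0..Y} ?w" by (rule Rb[OF s])
        have i: "?i integrable_on {0..Y}" "(\<lambda>x. c * D * ?w x) integrable_on {0..Y}" "(\<lambda>x. c * (M * \<epsilon>)) integrable_on {0..Y}"
          by (intro bm_int ib bm_mult bm_const wb)+
        have rb: "bm {0..Y} (\<lambda>x. ?i x + c * (M * \<epsilon>) + c * D * ?w x)"
          by (intro bm_add ib bm_mult bm_const wb)
        have wn: "0 \<le> c * D * ?w x" if "x \<in> {0..Y}" for x
          using that c D(1) k nn u_bounds[of x s] vc_bounds s by (auto intro!: mult_nonneg_nonneg F_nonneg)
        have cM: "0 \<le> c * (M * \<epsilon>)" using c M_pos \<epsilon> by simp
        have "integral {0..X*L} (\<lambda>x. u x s * vc x s) \<le> integral {0..X*L} (\<lambda>x. ?i x + c * (M * \<epsilon>) + c * D * ?w x)"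
        proof (rule integral_le)
          show "(\<lambda>x. u x s * vc x s) integrable_on {0..X*L}" by (intro bm_int bm_mult u_bm vc_bm s)
          show "(\<lambda>x. ?i x + c * (M * \<epsilon>) + c * D * ?w x) integrable_on {0..X*L}" by (rule bm_int_sub[OF rb]) (use Y in auto)
          fix x assume x: "x \<in> {0..X*L}"
          have xY: "x \<in> {0..Y}" using x Y by auto
          have ub: "0 \<le> u x s" "u x s \<le> M" using u_bounds[of x s] x s by auto
          show "u x s * vc x s \<le> ?i x + c * (M * \<epsilon>) + c * D * ?w x"
          proof (cases "x \<le> \<eta> * L")
            case True
            have "u x s * vc x s \<le> M\<^sup>2" unfolding power2_eq_square using ub vc_bounds M_pos by (intro mult_mono) auto
            then show ?thesis using True x wn[OF xY] cM by simp
          next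
            case False
            have p0: "0 \<le> u x s * vc x s" using ub vc_bounds by simp
            have "u x s * vc x s * 1 \<le> u x s * vc x s * (c * \<phi> x)"
              using lower[of x] False x p0 by (intro mult_left_mono) auto
            also have "\<dots> = c * (u x s * vc x s * \<phi> x)" by simp
            also have "\<dots> \<le> c * ((M * \<epsilon> + D * (k * F (u x s) (vc x s))) * \<phi> x)"
              using c nn[OF xY] D(2)[of "u x s" "vc x s"] ub vc_bounds by (intro mult_left_mono mult_right_mono) auto
            also have "\<dots> = c * (M * \<epsilon>) * \<phi> x + c * D * ?w x" by (simp add: algebra_simps)
            also have "\<dots> \<le> c * (M * \<epsilon>) * 1 + c * D * ?w x"
              using cM le1[OF xY] by (intro add_right_mono mult_left_mono) auto
            finally show ?thesis using False by simp
          qed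
        qed
        also have "\<dots> \<le> integral {0..Y} (\<lambda>x. ?i x + c * (M * \<epsilon>) + c * D * ?w x)"
        proof (rule integral_subset_le[OF _ bm_int_sub[OF rb] bm_int[OF rb]])
          show "\<forall>x\<in>{0..Y}. 0 \<le> ?i x + c * (M * \<epsilon>) + c * D * ?w x"
            by (intro ballI add_nonneg_nonneg wn cM) auto
        qed (use Y in auto)
        also have "\<dots> = integral {0..Y} ?i + c * (M * \<epsilon>) * Y + c * D * R s"
          unfolding R_def using Y(1)
          by (simp only: Henstock_Kurzweil_Integration.integral_add integrable_add i integral_mult_right integral_const_real) simp
        also have "\<dots> \<le> M\<^sup>2 * (\<eta> * L - 0) + c * (M * \<epsilon>) * Y + c * D * R s"
          using integral_indicator_le[of 0 "\<eta> * L" "M\<^sup>2" Y] \<eta>(1) L0 by (intro add_right_mono) auto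
        finally show ?thesis by (simp add: mult.assoc)
      qed
      let ?I = "integral {1..L\<^sup>2} (\<lambda>t. integral {0..X*L} (\<lambda>x. u x t * vc x t))"
      have ic: "continuous_on {1..L\<^sup>2} (\<lambda>t. integral {0..X*L} (\<lambda>x. u x t * vc x t))"
      proof -
        have "continuous_on ({0..X*L} \<times> {0..M} \<times> {0..M}) (\<lambda>z. fst (snd z) * snd (snd z))" by (intro continuous_intros)
        from slice_integral_cont[OF this XL] show ?thesis by (auto intro: continuous_on_subset)
      qed
      have "?I \<le> integral {1..L\<^sup>2} (\<lambda>s. (M\<^sup>2 * \<eta> * L + c * (M * \<epsilon> * Y)) + c * D * R s)"
        by (intro integral_le integrable_continuous_interval[OF ic] integrable_add integrable_on_mult_right Ri integrable_const_ivl)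
          (use slice in auto)
      also have "\<dots> = (M\<^sup>2 * \<eta> * L + c * (M * \<epsilon> * Y)) * (L\<^sup>2 - 1) + c * D * integral {1..L\<^sup>2} R"
        using L1 Ri[OF zero_le_one, of "L\<^sup>2"]
        by (simp only: Henstock_Kurzweil_Integration.integral_add integrable_on_mult_right integrable_const_ivl
            integral_mult_right integral_const_real) simp
      also have "\<dots> \<le> (M\<^sup>2 * \<eta> * L + c * (M * \<epsilon> * Y)) * L\<^sup>2 + c * D * (M * Y)"
        using RI c D(1) \<eta>(1) \<epsilon>(1) M_pos Y L0 by (intro add_mono mult_left_mono) auto
      also have "\<dots> = L^3 * (M\<^sup>2 * \<eta> + c * (M * \<epsilon> * (2 * X)) + c * (D * (M * (2 * X))) / L\<^sup>2)"
        unfolding Y_def using L0 by (simp add: field_simps power2_eq_square power3_eq_cube)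
      also have "\<dots> = L^3 * (e / 2 + c * (D * (M * (2 * X))) / L\<^sup>2)" unfolding \<eta>(2) \<epsilon>(2) by simp
      also have "\<dots> < L^3 * e" using elim(1) L0 by (intro mult_strict_left_mono) auto
      finally have "?I < L^3 * e" .
      moreover have "0 \<le> ?I"
        by (rule Henstock_Kurzweil_Integration.integral_nonneg[OF integrable_continuous_interval[OF ic]],
            rule Henstock_Kurzweil_Integration.integral_nonneg)
          (use u_bounds vc_bounds in \<open>auto intro!: bm_int bm_mult u_bm vc_bm mult_nonneg_nonneg\<close>)
      ultimately show ?case using L0 by (simp add: field_simps)
    qed
  qed
qed

lemma is_rd_flow: "rd_flow du dv U0 V0 a M u vc u0 v0"
proof unfold_locales
  show "L1lim X (at t) (\<lambda>s x. vc x s) (\<lambda>x. vc x t)" if t: "t > 0" for t X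
  proof -
    have w: "at t within {0..} = at t" using t by (intro at_within_interior) (simp add: interior_real_atLeast)
    have t0: "t \<ge> 0" using t by simp
    have ev: "\<forall>\<^sub>F s in at t. s \<ge> 0" using eventually_at_in_open'[of "{0<..}" t] t by (auto elim: eventually_mono)
    show ?thesis
    proof (rule L1limI[where C=M])
      show "((\<lambda>s. integral {0..X} (\<lambda>x. \<bar>vc x s - vc x t\<bar>)) \<longlongrightarrow> 0) (at t)"
        using tendsto_integral_uniform_AE(1)[of "{0..}" X "\<lambda>s x. vc x s" t] vc_bm vc_unif[OF t0] t0 unfolding w by simp
    qed (use ev vc_bm vc_bounds t0 in \<open>auto elim!: eventually_mono\<close>)
  qed
  show "\<exists>c. \<forall>x\<ge>0. integral {0..\<tau>} (\<lambda>s. du * u x s - dv * vc x s) =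
      integral {0..\<tau>} (\<lambda>s. du * u 0 s - dv * vc 0 s) + c * x +
      integral {0..x} (\<lambda>y. (x - y) * (u y \<tau> - vc y \<tau> - (u0 y - v0 y)))" if \<tau>: "\<tau> > 0" for \<tau>
  proof -
    obtain c where c: "\<And>x. x \<ge> 0 \<Longrightarrow> integral {0..\<tau>} (\<lambda>s. du * u x s) = du * U0 * \<tau> + c * x +
        integral {0..x} (\<lambda>y. (x - y) * (u y \<tau> - vc y \<tau> - (u0 y - v0 y)))"
      using weak_representation[OF \<tau>] by blast
    have "integral {0..\<tau>} (\<lambda>s. du * u 0 s) = du * U0 * \<tau>" using c[of 0] by simp
    then show ?thesis unfolding dv_zero mult_zero_left diff_0_right using c by (intro exI[of _ c]) auto
  qed
qed (use M u_bounds vc_bounds u_cont bm_data data_bounds u0_int v0_int weak_u_boundary weak_segregation weak_v_le_initial dv_zero in auto)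

end

section \<open>From the flow to the original pair of functions\<close>

lemma C2_on_continuous: "C2_on X h \<Longrightarrow> continuous_on X h"
  unfolding C2_on_def by (auto intro: DERIV_continuous_on)

lemma lint_eq_integral_AE:
  assumes h: "bm {a..b} h" and ae: "AE x in lebesgue. x \<in> {a..b} \<longrightarrow> w x = h x"
  shows "(LINT x:{a..b}|lebesgue. w x) = integral {a..b} h"
proof -
  have hm: "(\<lambda>x. indicator {a..b} x *\<^sub>R h x) \<in> borel_measurable lebesgue"
    using bm_absint[OF h] by (simp add: set_integrable_def)
  have e: "AE x in lebesgue. indicator {a..b} x *\<^sub>R h x = indicator {a..b} x *\<^sub>R w x"
    using ae by (rule eventually_mono) (simp add: indicator_def)
  have "(LINT x:{a..b}|lebesgue. w x) = (LINT x:{a..b}|lebesgue. h x)"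
    unfolding set_lebesgue_integral_def
    by (rule integral_cong_AE[OF borel_measurable_AE[OF hm e] hm]) (use e in \<open>auto elim: eventually_mono\<close>)
  then show ?thesis by (simp add: bm_lint[OF h])
qed

text \<open>Here \<open>w\<close> is the second component as originally given and \<open>v\<close>
  that of the flow. For weak solutions the two agree at each fixed time only almost everywhere on
  \<open>x > 0\<close>, which the integrals of the conclusion do not notice.\<close>

lemma (in rd_flow) profile_times_exist:
  assumes J: "J > 0" and w: "\<And>t. t > 0 \<Longrightarrow> AE x in lebesgue. x > 0 \<longrightarrow> w x t = v x t"
  shows "\<exists>t :: nat \<Rightarrow> real. (\<forall>n. t n > 0) \<and> filterlim t at_top sequentially \<and>
      (\<lambda>n. 1 / sqrt (t n) * (LINT y:{0..J * sqrt (t n)}|lebesgue.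
          \<bar>u y (t n) - max (profile du dv U0 V0 (y / sqrt (t n))) 0\<bar>\<^sup>2)) \<longlonglongrightarrow> 0 \<and>
      (\<lambda>n. 1 / sqrt (t n) * (LINT y:{0..J * sqrt (t n)}|lebesgue.
          \<bar>w y (t n) + min (profile du dv U0 V0 (y / sqrt (t n))) 0\<bar>\<^sup>2)) \<longlonglongrightarrow> 0"
proof -
  have 1: "(LINT y:{0..X}|lebesgue. \<bar>u y t - max (profile du dv U0 V0 (y / sqrt t)) 0\<bar>\<^sup>2) =
      integral {0..X} (\<lambda>x. (u x t - fp x t)\<^sup>2)" if t: "t > 0" for t X
  proof (rule lint_eq_integral_AE)
    show "bm {0..X} (\<lambda>x. (u x t - fp x t)\<^sup>2)" by (intro bm_power2 bm_diff u_bm fp_bm t)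
  qed (use t in \<open>auto simp: fp_def profile_eq\<close>)
  have 2: "(LINT y:{0..X}|lebesgue. \<bar>w y t + min (profile du dv U0 V0 (y / sqrt t)) 0\<bar>\<^sup>2) =
      integral {0..X} (\<lambda>x. (v x t + fm x t)\<^sup>2)" if t: "t > 0" for t X
  proof (rule lint_eq_integral_AE)
    show "bm {0..X} (\<lambda>x. (v x t + fm x t)\<^sup>2)" by (intro bm_power2 bm_add v_bm fm_bm t)
    have "AE x in lebesgue. x \<noteq> 0" by (rule AE_completion) (simp add: AE_lborel_singleton)
    then show "AE x in lebesgue. x \<in> {0..X} \<longrightarrow> \<bar>w x t + min (profile du dv U0 V0 (x / sqrt t)) 0\<bar>\<^sup>2 = (v x t + fm x t)\<^sup>2"
      using w[OF t] by eventually_elim (use t in \<open>auto simp: fm_def profile_eq\<close>)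
  qed
  obtain t :: "nat \<Rightarrow> real" where t: "\<And>n. t n > 0" "filterlim t at_top sequentially"
      "(\<lambda>n. 1 / sqrt (t n) * integral {0..J * sqrt (t n)} (\<lambda>x. (u x (t n) - fp x (t n))\<^sup>2)) \<longlonglongrightarrow> 0"
      "(\<lambda>n. 1 / sqrt (t n) * integral {0..J * sqrt (t n)} (\<lambda>x. (v x (t n) + fm x (t n))\<^sup>2)) \<longlonglongrightarrow> 0"
    using times_exist[OF J] by blast
  show ?thesis
    using t(2-4) by (intro exI[of _ t] conjI) (simp_all only: 1[OF t(1)] 2[OF t(1)] t(1) simp_thms)
qed

theorem theorem4p2:
  fixes du dv k U0 V0 M :: real
    and F u v :: "real \<Rightarrow> real \<Rightarrow> real"
    and u0 v0 :: "real \<Rightarrow> real"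
  assumes "k > 0" and "du > 0" and "dv \<ge> 0"
    and "U0 > 0" and "V0 > 0" and "M \<ge> max U0 V0"
    and "reaction_function F"
    and "C2_on {0..} u0" and "C2_on {0..} v0"
    and "\<forall>x\<ge>0. 0 \<le> u0 x \<and> u0 x \<le> M \<and> 0 \<le> v0 x \<and> v0 x \<le> M"
    and "set_integrable lebesgue {0..} u0"
    and "set_integrable lebesgue {0..} (\<lambda>x. v0 x - V0)"
    and "(u0 \<longlongrightarrow> 0) at_top" and "(v0 \<longlongrightarrow> V0) at_top"
    and "\<forall>T>0. is_solution du dv k F U0 M u0 v0 T u v"
  shows "(\<exists>!a. is_interface du dv U0 V0 a) \<and>
    (\<forall>J>0. \<exists>t :: nat \<Rightarrow> real. (\<forall>n. t n > 0) \<and> filterlim t at_top sequentially \<and>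
      (\<lambda>n. 1 / sqrt (t n) * (LINT y:{0..J * sqrt (t n)}|lebesgue.
          \<bar>u y (t n) - max (profile du dv U0 V0 (y / sqrt (t n))) 0\<bar>\<^sup>2)) \<longlonglongrightarrow> 0 \<and>
      (\<lambda>n. 1 / sqrt (t n) * (LINT y:{0..J * sqrt (t n)}|lebesgue.
          \<bar>v y (t n) + min (profile du dv U0 V0 (y / sqrt (t n))) 0\<bar>\<^sup>2)) \<longlonglongrightarrow> 0)"
proof (rule conjI)
  show ex1: "\<exists>!a. is_interface du dv U0 V0 a" by (rule ex1_interface[OF assms(2-5)])
  then obtain a where "is_interface du dv U0 V0 a" by blast
  then interpret rd_data du dv U0 V0 a k M F u v u0 v0
    by unfold_locales (use assms C2_on_continuous in auto)
  show "\<forall>J>0. \<exists>t :: nat \<Rightarrow> real. (\<forall>n. t n > 0) \<and> filterlim t at_top sequentially \<and>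
      (\<lambda>n. 1 / sqrt (t n) * (LINT y:{0..J * sqrt (t n)}|lebesgue.
          \<bar>u y (t n) - max (profile du dv U0 V0 (y / sqrt (t n))) 0\<bar>\<^sup>2)) \<longlonglongrightarrow> 0 \<and>
      (\<lambda>n. 1 / sqrt (t n) * (LINT y:{0..J * sqrt (t n)}|lebesgue.
          \<bar>v y (t n) + min (profile du dv U0 V0 (y / sqrt (t n))) 0\<bar>\<^sup>2)) \<longlonglongrightarrow> 0"
  proof (cases "dv > 0")
    case True
    interpret rd_classical du dv U0 V0 a k M F u v u0 v0
      by unfold_locales (use True assms(15) in \<open>auto simp: is_solution_def\<close>)
    interpret flow: rd_flow du dv U0 V0 a M u v u0 v0 by (rule is_rd_flow)
    show ?thesis by (intro allI impI flow.profile_times_exist) auto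
  next
    case False
    interpret rd_weak du dv U0 V0 a k M F u v u0 v0
      by unfold_locales (use False assms(3,15) in \<open>auto simp: is_solution_def\<close>)
    interpret flow: rd_flow du dv U0 V0 a M u vc u0 v0 by (rule is_rd_flow)
    show ?thesis by (intro allI impI flow.profile_times_exist v_AE_vc) auto
  qed
qed

end
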